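(* Suppose that $\mathbf S$ is a complete local noetherian commutative ring with maximal ideal $\mathfrak m$. If $\mathfrak C$ is a locally finite category over $\mathbf S$, then the categories $C(\mathfrak C)$ and $K(\mathfrak C)$ are $\omega$-local (in particular, Krull–Schmidt). Moreover, a morphism $f_\bullet:A_\bullet\to B_\bullet$ from one of these categories belongs to the radical if and only if all components $f_ng_n$ (or $g_nf_n$) are nilpotent modulo $\mathfrak m$ for any morphism $g_\bullet:B_\bullet\to A_\bullet$.
   Context: Let $\mathbf S$ be a commutative ring. All categories are $\mathbf S$-categories: morphism sets are $\mathbf S$-modules and composition is $\mathbf S$-bilinear. An additive category $\mathfrak C$ is called *$\omega$-local* if every object decomposes into a finite or countable direct sum of objects with local endomorphism rings; *fully additive* if any idempotent morphism splits, that is, defines a decomposition into a direct sum; *locally finite* over $\mathbf S$ if it is fully additive and all morphism spaces $\mathfrak C(A,B)$ are finitely generated $\mathbf S$-modules. A category is Krull–Schmidt here in the sense that decompositions into direct sums of objects with local endomorphism rings are unique. $C(\mathfrak C)$ is the category of chain complexes with entries from $\mathfrak C$, and $K(\mathfrak C)$ is the factor category of $C(\mathfrak C)$ modulo homotopy. The radical is the set of all morphisms $f:A\to B$ such that no component of the matrix presentation of $f$ with respect to some (hence any) decomposition of $A$ and $B$ into direct sums of indecomposable objects is invertible. An endomorphism $a$ of an object $X$ of $\mathfrak C$ is nilpotent modulo $\mathfrak m$ if its image in $\operatorname{End}X/\mathfrak m\operatorname{End}X$ is nilpotent.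
   Formalization: For K(C) the components f_n depend on the representative of the homotopy class; the criterion is stated as: some representative f of the class has all f_n g_n (or g_n f_n) nilpotent modulo m for every morphism g and every representative of g. *)

theory Defs
  imports "HOL-Algebra.Ring_Divisibility" "HOL-Algebra.Ideal_Product"
begin

section \<open>Rings and modules\<close>

text \<open>
  Separatedness together with convergence of the sequences that are compatible modulo the
  powers of \<open>\<mm>\<close> says that the canonical map from \<open>S\<close> to the inverse limit of the quotients
  \<open>S / \<mm>^n\<close> is bijective. Powers are taken in the monoid of ideals, so \<open>\<mm>^0 = carrier S\<close>.
\<close>

locale complete_local_cring = cring S for S (structure) +
  fixes \<mm> :: "'a set"
  assumes maximal: "maximalideal \<mm> S"
    and maximal_unique: "maximalideal J S \<Longrightarrow> J = \<mm>"
    and separated: "(\<Inter>n::nat. \<mm> [^]\<^bsub>ideals_set S\<^esub> n) = {\<zero>}"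
    and complete: "\<lbrakk>\<And>n. x n \<in> carrier S; \<And>n. x (Suc n) \<ominus> x n \<in> \<mm> [^]\<^bsub>ideals_set S\<^esub> n\<rbrakk>
      \<Longrightarrow> \<exists>y\<in>carrier S. \<forall>n::nat. y \<ominus> x n \<in> \<mm> [^]\<^bsub>ideals_set S\<^esub> n"

text \<open>Not necessarily commutative. The zero ring is excluded, as an ideal contains \<open>\<zero>\<close>.\<close>

definition local_ring :: "('a, 'b) ring_scheme \<Rightarrow> bool"
  where "local_ring R \<longleftrightarrow> ideal (carrier R - Units R) R"

definition span_module :: "('a, 'c) ring_scheme \<Rightarrow> ('a, 'b) module \<Rightarrow> 'b set \<Rightarrow> 'b set"
  where "span_module S M X = \<Inter>{N. submodule N S M \<and> X \<subseteq> N}"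

definition fin_gen_module :: "('a, 'c) ring_scheme \<Rightarrow> ('a, 'b) module \<Rightarrow> bool"
  where "fin_gen_module S M \<longleftrightarrow>
    (\<exists>X. finite X \<and> X \<subseteq> carrier M \<and> carrier M = span_module S M X)"

definition ideal_times_module ::
  "('a, 'c) ring_scheme \<Rightarrow> 'a set \<Rightarrow> ('a, 'b) module \<Rightarrow> 'b set"
  where "ideal_times_module S I M =
    span_module S M {s \<odot>\<^bsub>M\<^esub> x |s x. s \<in> I \<and> x \<in> carrier M}"

text \<open>
  Records of type \<^typ>\<open>('a, 'b) module\<close> extend those of rings; the fields \<open>mult\<close> and \<open>one\<close>
  play no role for modules and are left undefined.
\<close>

definition quot_module :: "('a, 'b) module \<Rightarrow> 'b set \<Rightarrow> ('a, 'b set) module"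
  where "quot_module M N = \<lparr>
    carrier = a_rcosets\<^bsub>M\<^esub> N,
    mult = undefined,
    one = undefined,
    zero = N,
    add = set_add M,
    smult = (\<lambda>s X. \<Union>x\<in>X. N +>\<^bsub>M\<^esub> (s \<odot>\<^bsub>M\<^esub> x))\<rparr>"


section \<open>Categories enriched in modules\<close>

text \<open>
  Morphism sets of different pairs of objects need not be disjoint, so composition carries the
  objects involved: \<open>Comp C X Y Z g f\<close> is the composite of \<open>f : X \<rightarrow> Y\<close> with \<open>g : Y \<rightarrow> Z\<close>.
\<close>

record ('o, 'a, 'm) linear_category =
  Obj :: "'o set"
  Hom :: "'o \<Rightarrow> 'o \<Rightarrow> ('a, 'm) module"
  Comp :: "'o \<Rightarrow> 'o \<Rightarrow> 'o \<Rightarrow> 'm \<Rightarrow> 'm \<Rightarrow> 'm"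
  Ident :: "'o \<Rightarrow> 'm"

abbreviation Mor :: "('o, 'a, 'm) linear_category \<Rightarrow> 'o \<Rightarrow> 'o \<Rightarrow> 'm set"
  where "Mor C X Y \<equiv> carrier (Hom C X Y)"

locale S_category = cring S for S (structure) +
  fixes C :: "('o, 'a, 'm) linear_category"
  assumes Hom_module: "\<lbrakk>X \<in> Obj C; Y \<in> Obj C\<rbrakk> \<Longrightarrow> module S (Hom C X Y)"
    and Ident_closed: "X \<in> Obj C \<Longrightarrow> Ident C X \<in> Mor C X X"
    and Comp_closed: "\<lbrakk>X \<in> Obj C; Y \<in> Obj C; Z \<in> Obj C; g \<in> Mor C Y Z; f \<in> Mor C X Y\<rbrakk>
      \<Longrightarrow> Comp C X Y Z g f \<in> Mor C X Z"
    and Comp_Ident_left: "\<lbrakk>X \<in> Obj C; Y \<in> Obj C; f \<in> Mor C X Y\<rbrakk>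
      \<Longrightarrow> Comp C X Y Y (Ident C Y) f = f"
    and Comp_Ident_right: "\<lbrakk>X \<in> Obj C; Y \<in> Obj C; f \<in> Mor C X Y\<rbrakk>
      \<Longrightarrow> Comp C X X Y f (Ident C X) = f"
    and Comp_assoc: "\<lbrakk>W \<in> Obj C; X \<in> Obj C; Y \<in> Obj C; Z \<in> Obj C;
        h \<in> Mor C Y Z; g \<in> Mor C X Y; f \<in> Mor C W X\<rbrakk>
      \<Longrightarrow> Comp C W X Z (Comp C X Y Z h g) f = Comp C W Y Z h (Comp C W X Y g f)"
    and Comp_add_left: "\<lbrakk>X \<in> Obj C; Y \<in> Obj C; Z \<in> Obj C;
        g \<in> Mor C Y Z; g' \<in> Mor C Y Z; f \<in> Mor C X Y\<rbrakk>
      \<Longrightarrow> Comp C X Y Z (g \<oplus>\<^bsub>Hom C Y Z\<^esub> g') f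
          = Comp C X Y Z g f \<oplus>\<^bsub>Hom C X Z\<^esub> Comp C X Y Z g' f"
    and Comp_add_right: "\<lbrakk>X \<in> Obj C; Y \<in> Obj C; Z \<in> Obj C;
        g \<in> Mor C Y Z; f \<in> Mor C X Y; f' \<in> Mor C X Y\<rbrakk>
      \<Longrightarrow> Comp C X Y Z g (f \<oplus>\<^bsub>Hom C X Y\<^esub> f')
          = Comp C X Y Z g f \<oplus>\<^bsub>Hom C X Z\<^esub> Comp C X Y Z g f'"
    and Comp_smult_left: "\<lbrakk>X \<in> Obj C; Y \<in> Obj C; Z \<in> Obj C;
        s \<in> carrier S; g \<in> Mor C Y Z; f \<in> Mor C X Y\<rbrakk>
      \<Longrightarrow> Comp C X Y Z (s \<odot>\<^bsub>Hom C Y Z\<^esub> g) f = s \<odot>\<^bsub>Hom C X Z\<^esub> Comp C X Y Z g f"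
    and Comp_smult_right: "\<lbrakk>X \<in> Obj C; Y \<in> Obj C; Z \<in> Obj C;
        s \<in> carrier S; g \<in> Mor C Y Z; f \<in> Mor C X Y\<rbrakk>
      \<Longrightarrow> Comp C X Y Z g (s \<odot>\<^bsub>Hom C X Y\<^esub> f) = s \<odot>\<^bsub>Hom C X Z\<^esub> Comp C X Y Z g f"

definition End :: "('o, 'a, 'm) linear_category \<Rightarrow> 'o \<Rightarrow> ('a, 'm) module"
  where "End C X = (Hom C X X)\<lparr>mult := Comp C X X X, one := Ident C X\<rparr>"

definition nilpotent_mod ::
  "('a, 'c) ring_scheme \<Rightarrow> 'a set \<Rightarrow> ('o, 'a, 'm) linear_category \<Rightarrow> 'o \<Rightarrow> 'm \<Rightarrow> bool"
  where "nilpotent_mod S \<mm> C X a \<longleftrightarrow>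
    (let N = ideal_times_module S \<mm> (End C X); Q = End C X Quot N
     in \<exists>k::nat. (N +>\<^bsub>End C X\<^esub> a) [^]\<^bsub>Q\<^esub> k = \<zero>\<^bsub>Q\<^esub>)"

definition invertible :: "('o, 'a, 'm) linear_category \<Rightarrow> 'o \<Rightarrow> 'o \<Rightarrow> 'm \<Rightarrow> bool"
  where "invertible C X Y f \<longleftrightarrow> f \<in> Mor C X Y \<and>
    (\<exists>g\<in>Mor C Y X. Comp C X Y X g f = Ident C X \<and> Comp C Y X Y f g = Ident C Y)"

definition isomorphic :: "('o, 'a, 'm) linear_category \<Rightarrow> 'o \<Rightarrow> 'o \<Rightarrow> bool"
  where "isomorphic C X Y \<longleftrightarrow> (\<exists>f. invertible C X Y f)"

definition zero_object :: "('o, 'a, 'm) linear_category \<Rightarrow> 'o \<Rightarrow> bool"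
  where "zero_object C X \<longleftrightarrow> X \<in> Obj C \<and> Ident C X = \<zero>\<^bsub>Hom C X X\<^esub>"


subsection \<open>Direct sums\<close>

definition biproduct ::
  "('o, 'a, 'm) linear_category \<Rightarrow> 'o \<Rightarrow> 'o \<Rightarrow> 'o \<Rightarrow> 'm \<Rightarrow> 'm \<Rightarrow> 'm \<Rightarrow> 'm \<Rightarrow> bool"
  where "biproduct C X Y A i j p q \<longleftrightarrow>
    X \<in> Obj C \<and> Y \<in> Obj C \<and> A \<in> Obj C \<and>
    i \<in> Mor C X A \<and> j \<in> Mor C Y A \<and> p \<in> Mor C A X \<and> q \<in> Mor C A Y \<and>
    Comp C X A X p i = Ident C X \<and> Comp C Y A Y q j = Ident C Y \<and>
    Comp C X A Y q i = \<zero>\<^bsub>Hom C X Y\<^esub> \<and> Comp C Y A X p j = \<zero>\<^bsub>Hom C Y X\<^esub> \<and>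
    Comp C A X A i p \<oplus>\<^bsub>Hom C A A\<^esub> Comp C A Y A j q = Ident C A"

text \<open>
  \<open>A\<close> is the coproduct of the family \<open>X\<close> with injections \<open>\<iota>\<close>. The projections \<open>\<pi>\<close> are no
  additional structure: by the universal property they exist and are uniquely determined by the
  injections.
\<close>

definition direct_sum :: "('o, 'a, 'm) linear_category \<Rightarrow> 'i set \<Rightarrow> ('i \<Rightarrow> 'o) \<Rightarrow> 'o
    \<Rightarrow> ('i \<Rightarrow> 'm) \<Rightarrow> ('i \<Rightarrow> 'm) \<Rightarrow> bool"
  where "direct_sum C I X A \<iota> \<pi> \<longleftrightarrow>
    A \<in> Obj C \<and>
    (\<forall>i\<in>I. X i \<in> Obj C \<and> \<iota> i \<in> Mor C (X i) A \<and> \<pi> i \<in> Mor C A (X i)) \<and>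
    (\<forall>i\<in>I. \<forall>j\<in>I. Comp C (X i) A (X j) (\<pi> j) (\<iota> i)
      = (if i = j then Ident C (X i) else \<zero>\<^bsub>Hom C (X i) (X j)\<^esub>)) \<and>
    (\<forall>B\<in>Obj C. \<forall>f. (\<forall>i\<in>I. f i \<in> Mor C (X i) B) \<longrightarrow>
      (\<exists>!h. h \<in> Mor C A B \<and> (\<forall>i\<in>I. Comp C (X i) A B h (\<iota> i) = f i)))"

definition indecomposable :: "('o, 'a, 'm) linear_category \<Rightarrow> 'o \<Rightarrow> bool"
  where "indecomposable C A \<longleftrightarrow> A \<in> Obj C \<and> \<not> zero_object C A \<and>
    (\<forall>X Y i j p q. biproduct C X Y A i j p q \<longrightarrow> zero_object C X \<or> zero_object C Y)"

locale additive_category = S_category +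
  assumes zero_object_ex: "\<exists>Z. zero_object C Z"
    and biproduct_ex: "\<lbrakk>X \<in> Obj C; Y \<in> Obj C\<rbrakk> \<Longrightarrow> \<exists>A i j p q. biproduct C X Y A i j p q"

locale fully_additive_category = additive_category +
  assumes idempotent_splits: "\<lbrakk>A \<in> Obj C; e \<in> Mor C A A; Comp C A A A e e = e\<rbrakk>
    \<Longrightarrow> \<exists>X Y i j p q. biproduct C X Y A i j p q \<and> Comp C A X A i p = e"

locale locally_finite_category = fully_additive_category +
  assumes Hom_fin_gen: "\<lbrakk>X \<in> Obj C; Y \<in> Obj C\<rbrakk> \<Longrightarrow> fin_gen_module S (Hom C X Y)"

locale omega_local_category = additive_category +
  assumes decomposition_ex: "A \<in> Obj C \<Longrightarrow>
    \<exists>(I::nat set) X \<iota> \<pi>. direct_sum C I X A \<iota> \<pi> \<and> (\<forall>i\<in>I. local_ring (End C (X i)))"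

text \<open>
  The type argument is the type from which the index sets of the decompositions are taken.
\<close>

definition krull_schmidt :: "'i itself \<Rightarrow> ('o, 'a, 'm) linear_category \<Rightarrow> bool"
  where "krull_schmidt T C \<longleftrightarrow>
    (\<forall>A (I::'i set) (J::'i set) X \<iota> \<pi> Y \<kappa> \<rho>.
      direct_sum C I X A \<iota> \<pi> \<and> (\<forall>i\<in>I. local_ring (End C (X i))) \<and>
      direct_sum C J Y A \<kappa> \<rho> \<and> (\<forall>j\<in>J. local_ring (End C (Y j))) \<longrightarrow>
      (\<exists>\<sigma>. bij_betw \<sigma> I J \<and> (\<forall>i\<in>I. isomorphic C (X i) (Y (\<sigma> i)))))"

definition radical :: "('o, 'a, 'm) linear_category \<Rightarrow> 'o \<Rightarrow> 'o \<Rightarrow> 'm set"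
  where "radical C A B = {f \<in> Mor C A B.
    \<exists>(I::nat set) X \<iota> \<pi> (J::nat set) Y \<kappa> \<rho>.
      direct_sum C I X A \<iota> \<pi> \<and> (\<forall>i\<in>I. indecomposable C (X i)) \<and>
      direct_sum C J Y B \<kappa> \<rho> \<and> (\<forall>j\<in>J. indecomposable C (Y j)) \<and>
      (\<forall>i\<in>I. \<forall>j\<in>J. \<not> invertible C (X i) (Y j)
        (Comp C (X i) A (Y j) (Comp C A B (Y j) (\<rho> j) f) (\<iota> i)))}"


section \<open>Complexes and the homotopy category\<close>

record ('o, 'm) chain_complex =
  ob :: "int \<Rightarrow> 'o"
  diff :: "int \<Rightarrow> 'm"

definition is_chain_complex ::
  "('o, 'a, 'm) linear_category \<Rightarrow> ('o, 'm) chain_complex \<Rightarrow> bool"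
  where "is_chain_complex C A \<longleftrightarrow>
    (\<forall>n. ob A n \<in> Obj C \<and> diff A n \<in> Mor C (ob A n) (ob A (n - 1)) \<and>
      Comp C (ob A n) (ob A (n - 1)) (ob A (n - 2)) (diff A (n - 1)) (diff A n)
        = \<zero>\<^bsub>Hom C (ob A n) (ob A (n - 2))\<^esub>)"

definition is_chain_map :: "('o, 'a, 'm) linear_category
    \<Rightarrow> ('o, 'm) chain_complex \<Rightarrow> ('o, 'm) chain_complex \<Rightarrow> (int \<Rightarrow> 'm) \<Rightarrow> bool"
  where "is_chain_map C A B f \<longleftrightarrow>
    (\<forall>n. f n \<in> Mor C (ob A n) (ob B n) \<and>
      Comp C (ob A n) (ob B n) (ob B (n - 1)) (diff B n) (f n)
        = Comp C (ob A n) (ob A (n - 1)) (ob B (n - 1)) (f (n - 1)) (diff A n))"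

definition Ch ::
  "('o, 'a, 'm) linear_category \<Rightarrow> (('o, 'm) chain_complex, 'a, int \<Rightarrow> 'm) linear_category"
  where "Ch C = \<lparr>
    Obj = Collect (is_chain_complex C),
    Hom = (\<lambda>A B. \<lparr>
      carrier = Collect (is_chain_map C A B),
      mult = undefined,
      one = undefined,
      zero = (\<lambda>n. \<zero>\<^bsub>Hom C (ob A n) (ob B n)\<^esub>),
      add = (\<lambda>f g n. f n \<oplus>\<^bsub>Hom C (ob A n) (ob B n)\<^esub> g n),
      smult = (\<lambda>s f n. s \<odot>\<^bsub>Hom C (ob A n) (ob B n)\<^esub> f n)\<rparr>),
    Comp = (\<lambda>A B D g f n. Comp C (ob A n) (ob B n) (ob D n) (g n) (f n)),
    Ident = (\<lambda>A n. Ident C (ob A n))\<rparr>"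

definition null_homotopic :: "('o, 'a, 'm) linear_category
    \<Rightarrow> ('o, 'm) chain_complex \<Rightarrow> ('o, 'm) chain_complex \<Rightarrow> (int \<Rightarrow> 'm) set"
  where "null_homotopic C A B = {f \<in> Mor (Ch C) A B.
    \<exists>h. (\<forall>n. h n \<in> Mor C (ob A n) (ob B (n + 1))) \<and>
      (\<forall>n. f n = Comp C (ob A n) (ob B (n + 1)) (ob B n) (diff B (n + 1)) (h n)
        \<oplus>\<^bsub>Hom C (ob A n) (ob B n)\<^esub>
          Comp C (ob A n) (ob A (n - 1)) (ob B n) (h (n - 1)) (diff A n))}"

text \<open>
  A morphism of the homotopy category is a homotopy class, that is, a nonempty set of chain maps.
\<close>

definition Ho ::
  "('o, 'a, 'm) linear_category \<Rightarrow> (('o, 'm) chain_complex, 'a, (int \<Rightarrow> 'm) set) linear_category"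
  where "Ho C = \<lparr>
    Obj = Obj (Ch C),
    Hom = (\<lambda>A B. quot_module (Hom (Ch C) A B) (null_homotopic C A B)),
    Comp = (\<lambda>A B D G F. \<Union>g\<in>G. \<Union>f\<in>F.
      null_homotopic C A D +>\<^bsub>Hom (Ch C) A D\<^esub> Comp (Ch C) A B D g f),
    Ident = (\<lambda>A. null_homotopic C A A +>\<^bsub>Hom (Ch C) A A\<^esub> Ident (Ch C) A)\<rparr>"

end

theory Submission
  imports Defs "HOL-Library.Countable_Set"
begin

text \<open>
  A finitely generated \<open>S\<close>-algebra \<open>E\<close> is \<open>\<mm>\<close>-adically complete and its quotient \<open>E / \<mm>E\<close> has
  finite length, so Fitting's lemma holds in \<open>E\<close>: every \<open>a\<close> determines an idempotent \<open>e\<close>, a limit of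
  polynomials in \<open>a\<close>, such that \<open>a\<close> is invertible in \<open>eEe\<close> and nilpotent modulo \<open>\<mm>\<close> in the
  complement. Being canonical, these idempotents can be formed degreewise in a complex and commute
  with the differential. Hence an endomorphism of a complex that is not degreewise nilpotent modulo
  \<open>\<mm>\<close> yields a nonzero idempotent; in particular a complex without proper idempotents has a local
  endomorphism ring. Zorn's lemma provides enough primitive idempotents, and a maximal orthogonal
  family of them decomposes a given complex, with finitely many nonzero summands in each degree.

  In such a decomposition, an endomorphism of a local object that factors through the sum is a unit
  only if some component is. Together with finite multiplicities this implies the theorem of
  Krull, Schmidt and Azumaya by an exchange argument, and shows that a morphism is outside the
  radical if and only if the identity of some local object factors through it. The homotopy category
  inherits the decompositions by discarding the contractible summands.
\<close>

section \<open>Modules over complete local noetherian rings\<close>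

lemma (in noetherian_ring) ideal_family_maximal:
  assumes "F \<noteq> {}" "\<And>I. I \<in> F \<Longrightarrow> ideal I R"
  obtains I where "I \<in> F" "\<And>J. J \<in> F \<Longrightarrow> I \<subseteq> J \<Longrightarrow> J = I"
proof -
  have "\<exists>M\<in>F. \<forall>X\<in>F. M \<subseteq> X \<longrightarrow> X = M"
  proof (rule subset_Zorn_nonempty[OF assms(1)])
    fix Ch assume C: "Ch \<noteq> {}" "subset.chain F Ch"
    then have sub: "Ch \<subseteq> F" and "subset.chain {I. ideal I R} Ch"
      using assms(2) unfolding pred_on.chain_def by (simp_all add: subset_iff)
    from ideal_chain_is_trivial[OF C(1) this(2)] show "\<Union>Ch \<in> F"
      using sub by (rule subsetD[rotated])
  qed
  then show ?thesis using that by blast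
qed

locale smodule = module R M for R :: "('a, 'r) ring_scheme" (structure) and M :: "('a, 'b) module" (structure)
begin

lemma submodule_subset: "submodule N R M \<Longrightarrow> N \<subseteq> carrier M"
  using submoduleE(1) .

lemma submodule_zero: "submodule N R M \<Longrightarrow> \<zero>\<^bsub>M\<^esub> \<in> N"
  using submodule.axioms(1) subgroup.one_closed by fastforce

lemma submodule_add: "submodule N R M \<Longrightarrow> x \<in> N \<Longrightarrow> y \<in> N \<Longrightarrow> x \<oplus>\<^bsub>M\<^esub> y \<in> N"
  using submoduleE(5) .

lemma submodule_minus: "submodule N R M \<Longrightarrow> x \<in> N \<Longrightarrow> \<ominus>\<^bsub>M\<^esub> x \<in> N"
  using submoduleE(3) .

lemma submodule_diff: "submodule N R M \<Longrightarrow> x \<in> N \<Longrightarrow> y \<in> N \<Longrightarrow> x \<ominus>\<^bsub>M\<^esub> y \<in> N"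
  by (simp add: a_minus_def submodule_add submodule_minus)

lemma submodule_smult: "submodule N R M \<Longrightarrow> a \<in> carrier R \<Longrightarrow> x \<in> N \<Longrightarrow> a \<odot>\<^bsub>M\<^esub> x \<in> N"
  using submoduleE(4) .

lemma submodule_add_cancel:
  assumes "submodule N R M" "x \<in> carrier M" "y \<in> N" "x \<oplus>\<^bsub>M\<^esub> y \<in> N"
  shows "x \<in> N"
proof -
  have "y \<in> carrier M" using assms submodule_subset by blast
  then have "x = (x \<oplus>\<^bsub>M\<^esub> y) \<ominus>\<^bsub>M\<^esub> y"
    using assms(2) by (simp add: a_minus_def M.a_assoc M.r_neg)
  then show ?thesis using submodule_diff[OF assms(1) assms(4) assms(3)] by simp
qed

lemma submodule_diff_cancel:
  assumes "submodule N R M" "x \<in> carrier M" "y \<in> N" "x \<ominus>\<^bsub>M\<^esub> y \<in> N"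
  shows "x \<in> N"
  using submodule_add_cancel[OF assms(1,2) submodule_minus[OF assms(1,3)]] assms(4)
  by (simp add: a_minus_def)

lemma smult_diff_l:
  "\<lbrakk>a \<in> carrier R; b \<in> carrier R; x \<in> carrier M\<rbrakk> \<Longrightarrow> (a \<ominus> b) \<odot>\<^bsub>M\<^esub> x = a \<odot>\<^bsub>M\<^esub> x \<ominus>\<^bsub>M\<^esub> b \<odot>\<^bsub>M\<^esub> x"
  by (simp add: a_minus_def smult_l_distr smult_l_minus)

lemma submodule_finsum:
  assumes "submodule N R M" "f \<in> A \<rightarrow> N"
  shows "finsum M f A \<in> N"
proof (cases "finite A")
  case True
  then show ?thesis using assms(2)
  proof (induction A)
    case empty
    then show ?case by (simp add: submodule_zero[OF assms(1)])
  next
    case (insert x A)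
    have "f \<in> insert x A \<rightarrow> carrier M"
      using insert.prems submodule_subset[OF assms(1)] by blast
    then have "finsum M f (insert x A) = f x \<oplus>\<^bsub>M\<^esub> finsum M f A"
      using insert.hyps by (subst M.finsum_insert) (auto simp: Pi_def)
    moreover have "finsum M f A \<in> N" "f x \<in> N"
      using insert.IH insert.prems by auto
    ultimately show ?case using submodule_add[OF assms(1)] by simp
  qed
next
  case False
  then show ?thesis by (simp add: submodule_zero[OF assms(1)] M.finsum_infinite)
qed

lemma span_submodule:
  assumes "X \<subseteq> carrier M"
  shows "submodule (span_module R M X) R M"
  unfolding span_module_def
proof (rule submoduleI)
  show "\<Inter>{N. submodule N R M \<and> X \<subseteq> N} \<subseteq> carrier M"
    using assms carrier_is_submodule by blast
qed (auto intro: submodule_zero submodule_minus submodule_add submodule_smult)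

lemma span_minimal: "submodule N R M \<Longrightarrow> X \<subseteq> N \<Longrightarrow> span_module R M X \<subseteq> N"
  by (auto simp: span_module_def)

lemma span_superset: "X \<subseteq> span_module R M X"
  by (auto simp: span_module_def)

definition lincomb :: "'a set \<Rightarrow> 'b set \<Rightarrow> 'b set"
  where "lincomb I X = {\<Oplus>\<^bsub>M\<^esub>v\<in>X. c v \<odot>\<^bsub>M\<^esub> v |c. c \<in> X \<rightarrow> I}"

lemma lincomb_submodule:
  assumes "finite X" "X \<subseteq> carrier M" "ideal I R"
  shows "submodule (lincomb I X) R M"
proof -
  interpret I: ideal I R by fact
  have ct: "(\<lambda>v. c v \<odot>\<^bsub>M\<^esub> v) \<in> X \<rightarrow> carrier M" if "c \<in> X \<rightarrow> I" for c
    using that assms(2) I.a_Hcarr by (auto simp: Pi_def subset_iff)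
  show ?thesis
  proof (rule submoduleI)
    show "lincomb I X \<subseteq> carrier M"
      using ct by (auto simp: lincomb_def)
    have "\<zero>\<^bsub>M\<^esub> = (\<Oplus>\<^bsub>M\<^esub>v\<in>X. \<zero> \<odot>\<^bsub>M\<^esub> v)"
      using assms by (auto intro!: M.add.finprod_one_eqI[symmetric])
    then show "\<zero>\<^bsub>M\<^esub> \<in> lincomb I X"
      unfolding lincomb_def by (auto intro!: exI[of _ "\<lambda>_. \<zero>"])
  next
    fix a b assume "a \<in> lincomb I X" "b \<in> lincomb I X"
    then obtain c d where c: "c \<in> X \<rightarrow> I" "a = (\<Oplus>\<^bsub>M\<^esub>v\<in>X. c v \<odot>\<^bsub>M\<^esub> v)"
      and d: "d \<in> X \<rightarrow> I" "b = (\<Oplus>\<^bsub>M\<^esub>v\<in>X. d v \<odot>\<^bsub>M\<^esub> v)"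
      by (auto simp: lincomb_def)
    have "a \<oplus>\<^bsub>M\<^esub> b = (\<Oplus>\<^bsub>M\<^esub>v\<in>X. c v \<odot>\<^bsub>M\<^esub> v \<oplus>\<^bsub>M\<^esub> d v \<odot>\<^bsub>M\<^esub> v)"
      using c d ct by (simp add: M.finsum_addf)
    also have "\<dots> = (\<Oplus>\<^bsub>M\<^esub>v\<in>X. (c v \<oplus> d v) \<odot>\<^bsub>M\<^esub> v)"
      using c d assms(2) ct by (intro M.finsum_cong') (auto simp: smult_l_distr Pi_def subset_iff)
    finally show "a \<oplus>\<^bsub>M\<^esub> b \<in> lincomb I X"
      using c d unfolding lincomb_def by (auto intro!: exI[of _ "\<lambda>v. c v \<oplus> d v"])
  next
    fix s a assume s: "s \<in> carrier R" and "a \<in> lincomb I X"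
    then obtain c where c: "c \<in> X \<rightarrow> I" "a = (\<Oplus>\<^bsub>M\<^esub>v\<in>X. c v \<odot>\<^bsub>M\<^esub> v)"
      by (auto simp: lincomb_def)
    have "s \<odot>\<^bsub>M\<^esub> a = (\<Oplus>\<^bsub>M\<^esub>v\<in>X. s \<odot>\<^bsub>M\<^esub> (c v \<odot>\<^bsub>M\<^esub> v))"
      using c(2) finsum_smult_ldistr[OF assms(1) s ct[OF c(1)]] by simp
    also have "\<dots> = (\<Oplus>\<^bsub>M\<^esub>v\<in>X. (s \<otimes> c v) \<odot>\<^bsub>M\<^esub> v)"
      using s c assms(2) by (intro M.finsum_cong') (auto simp: smult_assoc1 Pi_def subset_iff)
    finally show "s \<odot>\<^bsub>M\<^esub> a \<in> lincomb I X"
      using c s I.I_l_closed unfolding lincomb_def by (auto intro!: exI[of _ "\<lambda>v. s \<otimes> c v"])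
    next
    fix a assume "a \<in> lincomb I X"
    then obtain c where c: "c \<in> X \<rightarrow> I" "a = (\<Oplus>\<^bsub>M\<^esub>v\<in>X. c v \<odot>\<^bsub>M\<^esub> v)"
      by (auto simp: lincomb_def)
    have "\<ominus>\<^bsub>M\<^esub> a = (\<ominus>\<one>) \<odot>\<^bsub>M\<^esub> a"
      using c ct by (simp add: smult_l_minus)
    also have "\<dots> = (\<Oplus>\<^bsub>M\<^esub>v\<in>X. (\<ominus>\<one>) \<odot>\<^bsub>M\<^esub> (c v \<odot>\<^bsub>M\<^esub> v))"
      using c(2) finsum_smult_ldistr[OF assms(1) _ ct[OF c(1)]] by simp
    also have "\<dots> = (\<Oplus>\<^bsub>M\<^esub>v\<in>X. (\<ominus> c v) \<odot>\<^bsub>M\<^esub> v)"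
      using c assms(2) by (intro M.finsum_cong') (auto simp: smult_l_minus Pi_def subset_iff)
    finally show "\<ominus>\<^bsub>M\<^esub> a \<in> lincomb I X"
      using c unfolding lincomb_def by (auto intro!: exI[of _ "\<lambda>v. \<ominus> c v"])
  qed
qed

lemma lincomb_single:
  assumes "finite X" "X \<subseteq> carrier M" "ideal I R" "s \<in> I" "v \<in> X"
  shows "s \<odot>\<^bsub>M\<^esub> v \<in> lincomb I X"
proof -
  interpret I: ideal I R by fact
  have X: "X = insert v (X - {v})" using assms(5) by blast
  have "(\<Oplus>\<^bsub>M\<^esub>w\<in>X. (if w = v then s else \<zero>) \<odot>\<^bsub>M\<^esub> w)
      = s \<odot>\<^bsub>M\<^esub> v \<oplus>\<^bsub>M\<^esub> (\<Oplus>\<^bsub>M\<^esub>w\<in>X - {v}. (if w = v then s else \<zero>) \<odot>\<^bsub>M\<^esub> w)"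
    using assms by (subst X, subst M.finsum_insert) auto
  also have "(\<Oplus>\<^bsub>M\<^esub>w\<in>X - {v}. (if w = v then s else \<zero>) \<odot>\<^bsub>M\<^esub> w) = \<zero>\<^bsub>M\<^esub>"
    using assms by (intro M.add.finprod_one_eqI) auto
  also have "s \<odot>\<^bsub>M\<^esub> v \<oplus>\<^bsub>M\<^esub> \<zero>\<^bsub>M\<^esub> = s \<odot>\<^bsub>M\<^esub> v"
    using assms by auto
  finally show ?thesis
    using assms(4) unfolding lincomb_def by (auto intro!: exI[of _ "\<lambda>w. if w = v then s else \<zero>"])
qed

lemma lincomb_minimal:
  assumes "submodule N R M" "\<And>s v. s \<in> I \<Longrightarrow> v \<in> X \<Longrightarrow> s \<odot>\<^bsub>M\<^esub> v \<in> N"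
  shows "lincomb I X \<subseteq> N"
  unfolding lincomb_def using assms by (auto intro!: submodule_finsum)

lemma span_eq_lincomb:
  assumes "finite X" "X \<subseteq> carrier M"
  shows "span_module R M X = lincomb (carrier R) X"
proof
  show "span_module R M X \<subseteq> lincomb (carrier R) X"
    using lincomb_single[OF assms oneideal one_closed] assms
    by (intro span_minimal lincomb_submodule oneideal) (auto simp: subset_iff)
  show "lincomb (carrier R) X \<subseteq> span_module R M X"
    using span_submodule[OF assms(2)] span_superset
    by (intro lincomb_minimal) (auto intro: submodule_smult)
qed

lemma smult_lincomb_mem:
  assumes "finite X" "X \<subseteq> carrier M" "ideal I R" "s \<in> I" "x \<in> lincomb (carrier R) X"
  shows "s \<odot>\<^bsub>M\<^esub> x \<in> lincomb I X"
proof -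
  interpret I: ideal I R by fact
  obtain c where c: "c \<in> X \<rightarrow> carrier R" "x = (\<Oplus>\<^bsub>M\<^esub>v\<in>X. c v \<odot>\<^bsub>M\<^esub> v)"
    using assms(5) by (auto simp: lincomb_def)
  have "s \<odot>\<^bsub>M\<^esub> x = (\<Oplus>\<^bsub>M\<^esub>v\<in>X. s \<odot>\<^bsub>M\<^esub> (c v \<odot>\<^bsub>M\<^esub> v))"
    unfolding c(2) using assms c by (intro finsum_smult_ldistr) auto
  also have "\<dots> \<in> lincomb I X"
  proof (rule submodule_finsum[OF lincomb_submodule[OF assms(1-3)]], rule)
    fix v assume "v \<in> X"
    then have "s \<odot>\<^bsub>M\<^esub> (c v \<odot>\<^bsub>M\<^esub> v) = (s \<otimes> c v) \<odot>\<^bsub>M\<^esub> v"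
      using c assms by (auto simp: smult_assoc1 Pi_def subset_iff)
    then show "s \<odot>\<^bsub>M\<^esub> (c v \<odot>\<^bsub>M\<^esub> v) \<in> lincomb I X"
      using lincomb_single[OF assms(1-3), of "s \<otimes> c v" v] \<open>v \<in> X\<close> I.I_r_closed[OF assms(4)] c by auto
  qed
  finally show ?thesis .
qed

lemma ideal_times_eq_lincomb:
  assumes "finite X" "X \<subseteq> carrier M" "ideal I R" "carrier M = span_module R M X"
  shows "ideal_times_module R I M = lincomb I X"
proof -
  interpret I: ideal I R by fact
  have sub: "{s \<odot>\<^bsub>M\<^esub> x |s x. s \<in> I \<and> x \<in> carrier M} \<subseteq> carrier M" by auto
  show ?thesis
  proof
    have "s \<odot>\<^bsub>M\<^esub> x \<in> lincomb I X" if "s \<in> I" "x \<in> carrier M" for s x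
      using smult_lincomb_mem[OF assms(1-3) that(1)] span_eq_lincomb[OF assms(1,2)] assms(4) that(2)
      by simp
    then show "ideal_times_module R I M \<subseteq> lincomb I X"
      unfolding ideal_times_module_def
      by (intro span_minimal lincomb_submodule assms) auto
    show "lincomb I X \<subseteq> ideal_times_module R I M"
      unfolding ideal_times_module_def
      by (intro lincomb_minimal span_submodule[OF sub] subsetD[OF span_superset])
        (use assms(2) in \<open>auto simp: subset_iff\<close>)
  qed
qed

lemma ideal_times_submodule:
  assumes "I \<subseteq> carrier R"
  shows "submodule (ideal_times_module R I M) R M"
  unfolding ideal_times_module_def using assms by (intro span_submodule) auto

lemma ideal_times_mem: "s \<in> I \<Longrightarrow> x \<in> carrier M \<Longrightarrow> s \<odot>\<^bsub>M\<^esub> x \<in> ideal_times_module R I M"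
  unfolding ideal_times_module_def by (rule subsetD[OF span_superset]) blast

lemma ideal_times_minimal:
  "submodule N R M \<Longrightarrow> (\<And>s x. s \<in> I \<Longrightarrow> x \<in> carrier M \<Longrightarrow> s \<odot>\<^bsub>M\<^esub> x \<in> N) \<Longrightarrow> ideal_times_module R I M \<subseteq> N"
  unfolding ideal_times_module_def by (intro span_minimal) auto

lemma submodule_family_maximal_span:
  assumes noeth: "noetherian_ring R"
    and "finite X" "X \<subseteq> carrier M" "F \<noteq> {}"
    and "\<And>N. N \<in> F \<Longrightarrow> submodule N R M \<and> N \<subseteq> lincomb (carrier R) X"
  shows "\<exists>N\<in>F. \<forall>L\<in>F. N \<subseteq> L \<longrightarrow> L = N"
  using assms(2-)
proof (induction X arbitrary: F rule: finite_induct)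
  case empty
  then obtain N where N: "N \<in> F" by blast
  have "L = {\<zero>\<^bsub>M\<^esub>}" if "L \<in> F" for L
    using empty.prems(3)[OF that] submodule_zero by (force simp: lincomb_def)
  then show ?case using N by blast
next
  case (insert v X)
  interpret noetherian_ring R by fact
  let ?X = "lincomb (carrier R) X"
  have X: "finite X" "X \<subseteq> carrier M" "v \<in> carrier M" using insert by auto
  have sX: "submodule ?X R M" by (rule lincomb_submodule[OF X(1,2) oneideal])
  define I where "I N = {s \<in> carrier R. \<exists>y\<in>?X. s \<odot>\<^bsub>M\<^esub> v \<oplus>\<^bsub>M\<^esub> y \<in> N}" for N
  have ideal_I: "ideal (I N) R" if "N \<in> F" for N
  proof (rule idealI)
    have N: "submodule N R M" using insert.prems(3)[OF that] by blast
    show "subgroup (I N) (add_monoid R)"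
    proof (rule R.add.subgroupI)
      show "I N \<subseteq> carrier R" by (auto simp: I_def)
      have "\<zero> \<in> I N"
        using X submodule_zero[OF sX] submodule_zero[OF N] by (auto simp: I_def intro!: bexI[of _ "\<zero>\<^bsub>M\<^esub>"])
      then show "I N \<noteq> {}" by blast
    next
      fix a assume "a \<in> I N"
      then obtain y where y: "a \<in> carrier R" "y \<in> ?X" "a \<odot>\<^bsub>M\<^esub> v \<oplus>\<^bsub>M\<^esub> y \<in> N" by (auto simp: I_def)
      have "y \<in> carrier M" using y submodule_subset[OF sX] by blast
      then have "(\<ominus>a) \<odot>\<^bsub>M\<^esub> v \<oplus>\<^bsub>M\<^esub> (\<ominus>\<^bsub>M\<^esub> y) = \<ominus>\<^bsub>M\<^esub> (a \<odot>\<^bsub>M\<^esub> v \<oplus>\<^bsub>M\<^esub> y)"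
        using y X by (simp add: smult_l_minus M.minus_add)
      then show "\<ominus> a \<in> I N"
        using y submodule_minus[OF N y(3)] submodule_minus[OF sX y(2)] unfolding I_def by force
    next
      fix a b assume "a \<in> I N" "b \<in> I N"
      then obtain y z where y: "a \<in> carrier R" "y \<in> ?X" "a \<odot>\<^bsub>M\<^esub> v \<oplus>\<^bsub>M\<^esub> y \<in> N"
        and z: "b \<in> carrier R" "z \<in> ?X" "b \<odot>\<^bsub>M\<^esub> v \<oplus>\<^bsub>M\<^esub> z \<in> N" by (auto simp: I_def)
      have "y \<in> carrier M" "z \<in> carrier M" using y z submodule_subset[OF sX] by blast+
      then have "(a \<oplus> b) \<odot>\<^bsub>M\<^esub> v \<oplus>\<^bsub>M\<^esub> (y \<oplus>\<^bsub>M\<^esub> z) = (a \<odot>\<^bsub>M\<^esub> v \<oplus>\<^bsub>M\<^esub> y) \<oplus>\<^bsub>M\<^esub> (b \<odot>\<^bsub>M\<^esub> v \<oplus>\<^bsub>M\<^esub> z)"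
        using y z X by (simp add: smult_l_distr M.a_ac)
      then show "a \<oplus> b \<in> I N"
        using y z submodule_add[OF N y(3) z(3)] submodule_add[OF sX y(2) z(2)] unfolding I_def by force
    qed
    have l: "x \<otimes> a \<in> I N" if "a \<in> I N" "x \<in> carrier R" for a x
    proof -
      obtain y where y: "a \<in> carrier R" "y \<in> ?X" "a \<odot>\<^bsub>M\<^esub> v \<oplus>\<^bsub>M\<^esub> y \<in> N" using \<open>a \<in> I N\<close> by (auto simp: I_def)
      have "y \<in> carrier M" using y submodule_subset[OF sX] by blast
      then have "(x \<otimes> a) \<odot>\<^bsub>M\<^esub> v \<oplus>\<^bsub>M\<^esub> x \<odot>\<^bsub>M\<^esub> y = x \<odot>\<^bsub>M\<^esub> (a \<odot>\<^bsub>M\<^esub> v \<oplus>\<^bsub>M\<^esub> y)"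
        using y X that by (simp add: smult_assoc1 smult_r_distr)
      then show ?thesis
        using y that submodule_smult[OF N _ y(3)] submodule_smult[OF sX _ y(2)] unfolding I_def by force
    qed
    show "\<And>a x. a \<in> I N \<Longrightarrow> x \<in> carrier R \<Longrightarrow> x \<otimes> a \<in> I N" by (rule l)
    show "\<And>a x. a \<in> I N \<Longrightarrow> x \<in> carrier R \<Longrightarrow> a \<otimes> x \<in> I N"
      using l by (metis (no_types, lifting) I_def R.m_comm mem_Collect_eq)
  qed (rule ring_axioms)
  obtain J where J: "J \<in> I ` F" "\<And>K. K \<in> I ` F \<Longrightarrow> J \<subseteq> K \<Longrightarrow> K = J"
    by (rule ideal_family_maximal[of "I ` F"]) (use insert.prems(2) ideal_I in auto)
  let ?F = "(\<lambda>N. N \<inter> ?X) ` {N \<in> F. I N = J}"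
  have "\<exists>N\<in>?F. \<forall>L\<in>?F. N \<subseteq> L \<longrightarrow> L = N"
  proof (rule insert.IH)
    show "?F \<noteq> {}" using J(1) by blast
    fix N assume "N \<in> ?F"
    then obtain N' where N': "N' \<in> F" "N = N' \<inter> ?X" by blast
    then have "submodule N' R M" using insert.prems(3) by blast
    then have "submodule N R M" unfolding N'(2)
      by (intro submoduleI) (use sX submodule_subset in \<open>auto intro: submodule_zero submodule_minus submodule_add submodule_smult\<close>)
    then show "submodule N R M \<and> N \<subseteq> ?X" using N' by blast
  qed (use X in auto)
  then obtain N0 where N0: "N0 \<in> ?F" "\<forall>L\<in>?F. N0 \<subseteq> L \<longrightarrow> L = N0" ..
  from N0(1) obtain N where N: "N \<in> F" "I N = J" and N0_eq: "N0 = N \<inter> ?X" by blast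
  have N3: "L \<inter> ?X = N \<inter> ?X" if "L \<in> F" "I L = J" "N \<inter> ?X \<subseteq> L \<inter> ?X" for L
    using N0(2) that unfolding N0_eq by simp
  have "L = N" if L: "L \<in> F" "N \<subseteq> L" for L
  proof
    have sN: "submodule N R M" and sL: "submodule L R M" using insert.prems(3) N L by blast+
    have IL: "I L = J"
      using J(2)[of "I L"] L N(2) by (auto simp: I_def)
    have eq: "L \<inter> ?X = N \<inter> ?X" using N3[OF L(1) IL] L(2) by blast
    show "L \<subseteq> N"
    proof
      fix x assume x: "x \<in> L"
      then have "x \<in> lincomb (carrier R) (insert v X)" using insert.prems(3)[OF L(1)] by blast
      then obtain c where c: "c \<in> insert v X \<rightarrow> carrier R" "x = (\<Oplus>\<^bsub>M\<^esub>w\<in>insert v X. c w \<odot>\<^bsub>M\<^esub> w)"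
        by (auto simp: lincomb_def)
      define y where "y = (\<Oplus>\<^bsub>M\<^esub>w\<in>X. c w \<odot>\<^bsub>M\<^esub> w)"
      have y: "y \<in> ?X" using c unfolding y_def lincomb_def by auto
      have x_eq: "x = c v \<odot>\<^bsub>M\<^esub> v \<oplus>\<^bsub>M\<^esub> y"
        unfolding c(2) y_def using insert.hyps c(1) X by (subst M.finsum_insert) (auto simp: Pi_def subset_iff)
      have "c v \<in> I L" using x x_eq y c by (auto simp: I_def)
      then have "c v \<in> I N" using IL N(2) by simp
      then obtain z where z: "z \<in> ?X" "c v \<odot>\<^bsub>M\<^esub> v \<oplus>\<^bsub>M\<^esub> z \<in> N" by (auto simp: I_def)
      have car: "y \<in> carrier M" "z \<in> carrier M" using y z submodule_subset[OF sX] by blast+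
      have cv: "c v \<odot>\<^bsub>M\<^esub> v \<in> carrier M" using c X by auto
      have "x \<ominus>\<^bsub>M\<^esub> (c v \<odot>\<^bsub>M\<^esub> v \<oplus>\<^bsub>M\<^esub> z) = (c v \<odot>\<^bsub>M\<^esub> v \<ominus>\<^bsub>M\<^esub> c v \<odot>\<^bsub>M\<^esub> v) \<oplus>\<^bsub>M\<^esub> (y \<ominus>\<^bsub>M\<^esub> z)"
        unfolding x_eq a_minus_def using car cv by (simp add: M.minus_add M.a_ac)
      then have xz: "x \<ominus>\<^bsub>M\<^esub> (c v \<odot>\<^bsub>M\<^esub> v \<oplus>\<^bsub>M\<^esub> z) = y \<ominus>\<^bsub>M\<^esub> z"
        using car cv by (simp add: a_minus_def M.r_neg)
      have "y \<ominus>\<^bsub>M\<^esub> z \<in> L \<inter> ?X"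
        using submodule_diff[OF sX y z(1)] submodule_diff[OF sL x] z(2) L(2) xz by (metis IntI subsetD)
      then have "y \<ominus>\<^bsub>M\<^esub> z \<in> N" using eq by blast
      then show "x \<in> N"
        using submodule_diff_cancel[OF sN _ z(2)] xz submodule_subset[OF sL] x by auto
    qed
  qed (rule that(2))
  then show ?case using N(1) by blast
qed

lemma submodule_family_maximal:
  assumes "noetherian_ring R" "fin_gen_module R M" "F \<noteq> {}" "\<And>N. N \<in> F \<Longrightarrow> submodule N R M"
  obtains N where "N \<in> F" "\<And>L. L \<in> F \<Longrightarrow> N \<subseteq> L \<Longrightarrow> L = N"
proof -
  obtain X where X: "finite X" "X \<subseteq> carrier M" "carrier M = span_module R M X"
    using assms(2) by (auto simp: fin_gen_module_def)
  have "\<exists>N\<in>F. \<forall>L\<in>F. N \<subseteq> L \<longrightarrow> L = N"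
    using X span_eq_lincomb[OF X(1,2)] assms submodule_subset
    by (intro submodule_family_maximal_span[OF assms(1) X(1,2) assms(3)]) auto
  then show ?thesis using that by blast
qed

end

context smodule
begin

lemma add_diff_cancel: "x \<in> carrier M \<Longrightarrow> y \<in> carrier M \<Longrightarrow> x \<oplus>\<^bsub>M\<^esub> (y \<ominus>\<^bsub>M\<^esub> x) = y"
  by (simp add: a_minus_def M.a_comm[of y "\<ominus>\<^bsub>M\<^esub> x"] M.r_neg2)

lemma add_add_diff_cancel:
  "a \<in> carrier M \<Longrightarrow> b \<in> carrier M \<Longrightarrow> c \<in> carrier M
    \<Longrightarrow> (a \<oplus>\<^bsub>M\<^esub> (b \<oplus>\<^bsub>M\<^esub> c)) \<ominus>\<^bsub>M\<^esub> (a \<oplus>\<^bsub>M\<^esub> c) = b"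
  using add_diff_cancel[of a b]
  by (simp add: a_minus_def M.minus_add M.a_ac M.r_neg1 M.r_neg2 M.r_neg)

lemma plus_smult_submodule:
  assumes sB: "submodule B R M" and pc: "p \<in> carrier R"
  defines "U \<equiv> {b \<oplus>\<^bsub>M\<^esub> p \<odot>\<^bsub>M\<^esub> y |b y. b \<in> B \<and> y \<in> carrier M}"
  shows "submodule U R M" "B \<subseteq> U" "\<And>y. y \<in> carrier M \<Longrightarrow> p \<odot>\<^bsub>M\<^esub> y \<in> U"
proof -
  have Bc: "B \<subseteq> carrier M" by (rule submodule_subset[OF sB])
  show "submodule U R M"
  proof (rule submoduleI)
    show "U \<subseteq> carrier M" unfolding U_def using pc Bc by auto
    show "\<zero>\<^bsub>M\<^esub> \<in> U" unfolding U_def using pc submodule_zero[OF sB]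
      by (auto intro!: exI[of _ "\<zero>\<^bsub>M\<^esub>"])
  next
    fix a assume "a \<in> U"
    then obtain b y where a: "a = b \<oplus>\<^bsub>M\<^esub> p \<odot>\<^bsub>M\<^esub> y" "b \<in> B" "y \<in> carrier M" unfolding U_def by blast
    then have "\<ominus>\<^bsub>M\<^esub> a = (\<ominus>\<^bsub>M\<^esub> b) \<oplus>\<^bsub>M\<^esub> p \<odot>\<^bsub>M\<^esub> (\<ominus>\<^bsub>M\<^esub> y)"
      using Bc pc by (simp add: M.minus_add smult_r_minus subset_iff)
    then show "\<ominus>\<^bsub>M\<^esub> a \<in> U" unfolding U_def using a submodule_minus[OF sB] by blast
    fix r assume r: "r \<in> carrier R"
    then have "r \<odot>\<^bsub>M\<^esub> (p \<odot>\<^bsub>M\<^esub> y) = p \<odot>\<^bsub>M\<^esub> (r \<odot>\<^bsub>M\<^esub> y)"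
      using a(3) pc smult_assoc1[of r p y] smult_assoc1[of p r y] R.m_comm[of r p] by simp
    then have "r \<odot>\<^bsub>M\<^esub> a = r \<odot>\<^bsub>M\<^esub> b \<oplus>\<^bsub>M\<^esub> p \<odot>\<^bsub>M\<^esub> (r \<odot>\<^bsub>M\<^esub> y)"
      using a Bc pc r by (simp add: smult_r_distr subset_iff)
    then show "r \<odot>\<^bsub>M\<^esub> a \<in> U" unfolding U_def using a r submodule_smult[OF sB] by blast
  next
    fix a a' assume "a \<in> U" "a' \<in> U"
    then obtain b y b' y' where a: "a = b \<oplus>\<^bsub>M\<^esub> p \<odot>\<^bsub>M\<^esub> y" "b \<in> B" "y \<in> carrier M"
      "a' = b' \<oplus>\<^bsub>M\<^esub> p \<odot>\<^bsub>M\<^esub> y'" "b' \<in> B" "y' \<in> carrier M" unfolding U_def by blast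
    then have "a \<oplus>\<^bsub>M\<^esub> a' = (b \<oplus>\<^bsub>M\<^esub> b') \<oplus>\<^bsub>M\<^esub> p \<odot>\<^bsub>M\<^esub> (y \<oplus>\<^bsub>M\<^esub> y')"
      using Bc pc by (simp add: M.a_ac smult_r_distr subset_iff)
    then show "a \<oplus>\<^bsub>M\<^esub> a' \<in> U" unfolding U_def using a submodule_add[OF sB] by blast
  qed
  show "B \<subseteq> U"
  proof
    fix b assume "b \<in> B"
    moreover from this have "b = b \<oplus>\<^bsub>M\<^esub> p \<odot>\<^bsub>M\<^esub> \<zero>\<^bsub>M\<^esub>" using Bc pc by auto
    ultimately show "b \<in> U" unfolding U_def using M.zero_closed by blast
  qed
  show "p \<odot>\<^bsub>M\<^esub> y \<in> U" if "y \<in> carrier M" for y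
  proof -
    have "p \<odot>\<^bsub>M\<^esub> y = \<zero>\<^bsub>M\<^esub> \<oplus>\<^bsub>M\<^esub> p \<odot>\<^bsub>M\<^esub> y" using that pc by simp
    then show ?thesis unfolding U_def using that submodule_zero[OF sB] by blast
  qed
qed

lemma smult_vimage_submodule:
  assumes sB: "submodule B R M" and pc: "p \<in> carrier R"
  shows "submodule {y \<in> carrier M. p \<odot>\<^bsub>M\<^esub> y \<in> B} R M"
proof (rule submoduleI)
  show "\<zero>\<^bsub>M\<^esub> \<in> {y \<in> carrier M. p \<odot>\<^bsub>M\<^esub> y \<in> B}" using pc submodule_zero[OF sB] by auto
next
  fix r a assume r: "r \<in> carrier R" and "a \<in> {y \<in> carrier M. p \<odot>\<^bsub>M\<^esub> y \<in> B}"
  then have a: "a \<in> carrier M" "p \<odot>\<^bsub>M\<^esub> a \<in> B" by auto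
  then have "p \<odot>\<^bsub>M\<^esub> (r \<odot>\<^bsub>M\<^esub> a) = r \<odot>\<^bsub>M\<^esub> (p \<odot>\<^bsub>M\<^esub> a)"
    using r pc smult_assoc1[of r p a] smult_assoc1[of p r a] R.m_comm[of r p] by simp
  then show "r \<odot>\<^bsub>M\<^esub> a \<in> {y \<in> carrier M. p \<odot>\<^bsub>M\<^esub> y \<in> B}" using a r submodule_smult[OF sB r a(2)] by auto
qed (use pc submodule_minus[OF sB] submodule_add[OF sB] smult_r_distr smult_r_minus in auto)

end

locale complete_noetherian = complete_local_cring S \<mm> + noetherian_ring S
  for S :: "('a, 'r) ring_scheme" (structure) and \<mm>
begin

definition mpow :: "nat \<Rightarrow> 'a set"
  where "mpow k = \<mm> [^]\<^bsub>ideals_set S\<^esub> k"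

lemma m_ideal: "ideal \<mm> S"
  using maximal by (rule maximalideal.axioms(1))

lemma m_closed': "s \<in> \<mm> \<Longrightarrow> s \<in> carrier S"
  using m_ideal by (rule ideal.Icarr)

lemma mpow_0: "mpow 0 = carrier S"
  by (simp add: mpow_def nat_pow_def ideals_set_def)

lemma mpow_Suc: "mpow (Suc k) = mpow k \<cdot> \<mm>"
  by (simp add: mpow_def nat_pow_def ideals_set_def)

lemma mpow_ideal: "ideal (mpow k) S"
  by (induction k) (simp_all add: mpow_0 mpow_Suc oneideal ideal_prod_is_ideal m_ideal)

lemma mpow_closed: "s \<in> mpow k \<Longrightarrow> s \<in> carrier S"
  using mpow_ideal by (rule ideal.Icarr)

lemma mpow_1: "mpow (Suc 0) = \<mm>"
  unfolding mpow_Suc mpow_0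
  using ideal_prod_one[OF m_ideal] ideal_prod_commute[OF m_ideal oneideal] by simp

lemma mpow_add: "mpow (i + j) = mpow i \<cdot> mpow j"
proof (induction j)
  case 0
  show ?case using ideal_prod_one[OF mpow_ideal] by (simp add: mpow_0)
next
  case (Suc j)
  then show ?case
    by (simp add: mpow_Suc ideal_prod_assoc mpow_ideal m_ideal)
qed

lemma mpow_mult: "s \<in> mpow i \<Longrightarrow> t \<in> mpow j \<Longrightarrow> s \<otimes> t \<in> mpow (i + j)"
  unfolding mpow_add by (rule ideal_prod.prod)

lemma mpow_decreasing: "i \<le> j \<Longrightarrow> mpow j \<subseteq> mpow i"
  using ideal_prod_inter[OF mpow_ideal mpow_ideal, of i "j - i"] mpow_add[of i "j - i"] by simp

lemma one_notin_m: "\<one> \<notin> \<mm>"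
  using maximal ideal.one_imp_carrier[OF m_ideal] maximalideal.I_notcarr by metis

lemma unit_if_notin_m:
  assumes "s \<in> carrier S" "s \<notin> \<mm>"
  shows "s \<in> Units S"
proof (rule ccontr)
  assume nu: "s \<notin> Units S"
  let ?F = "{I. ideal I S \<and> s \<in> I \<and> \<one> \<notin> I}"
  have "\<one> \<notin> PIdl s"
  proof
    assume "\<one> \<in> PIdl s"
    then obtain x where "x \<in> carrier S" "x \<otimes> s = \<one>"
      unfolding cgenideal_def by auto
    then show False using nu assms(1) m_comm unfolding Units_def by auto
  qed
  then have ne: "?F \<noteq> {}"
    using cgenideal_ideal[OF assms(1)] cgenideal_self[OF assms(1)] by blast
  obtain I where I: "I \<in> ?F" "\<And>J. J \<in> ?F \<Longrightarrow> I \<subseteq> J \<Longrightarrow> J = I"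
    using ideal_family_maximal[OF ne] by auto
  have "maximalideal I S"
  proof (rule maximalidealI)
    show "ideal I S" using I by blast
    show "carrier S \<noteq> I" using I by auto
    fix J assume J: "ideal J S" "I \<subseteq> J" "J \<subseteq> carrier S"
    show "J = I \<or> J = carrier S"
    proof (cases "\<one> \<in> J")
      case True
      then show ?thesis using ideal.one_imp_carrier[OF J(1)] by simp
    next
      case False
      then show ?thesis using I(2)[of J] I(1) J by blast
    qed
  qed
  then show False using maximal_unique I(1) assms(2) by blast
qed

lemma one_minus_m_unit: "s \<in> \<mm> \<Longrightarrow> \<one> \<ominus> s \<in> Units S"
proof (rule unit_if_notin_m)
  assume s: "s \<in> \<mm>"
  then show "\<one> \<ominus> s \<in> carrier S" using m_closed' by simp
  show "\<one> \<ominus> s \<notin> \<mm>"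
  proof
    interpret m: ideal \<mm> S by (rule m_ideal)
    assume "\<one> \<ominus> s \<in> \<mm>"
    then have "(\<one> \<ominus> s) \<oplus> s \<in> \<mm>" using s by simp
    moreover have "(\<one> \<ominus> s) \<oplus> s = \<one>" using m_closed'[OF s] by algebra
    ultimately show False using one_notin_m by simp
  qed
qed

end

locale complete_noetherian_module = complete_noetherian S \<mm> + M: smodule S M
  for S :: "('a, 'r) ring_scheme" (structure) and \<mm> and M :: "('a, 'b) module" (structure)
begin

lemma nakayama:
  assumes "submodule Q S M" "finite X" "X \<subseteq> carrier M"
    and "\<And>x. x \<in> X \<Longrightarrow> \<exists>q\<in>Q. \<exists>y\<in>M.lincomb \<mm> X. x = q \<oplus>\<^bsub>M\<^esub> y"
  shows "X \<subseteq> Q"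
  using assms(2-)
proof (induction X rule: finite_induct)
  case empty
  show ?case by simp
next
  case (insert v X)
  interpret m: ideal \<mm> S by (rule m_ideal)
  have X: "finite X" "X \<subseteq> carrier M" "v \<in> carrier M" using insert by auto
  have Qc: "Q \<subseteq> carrier M" using assms(1) by (rule M.submodule_subset)
  have lX: "submodule (M.lincomb \<mm> X) S M" by (rule M.lincomb_submodule[OF X(1,2) m_ideal])
  have split: "\<exists>q\<in>Q. \<exists>s\<in>\<mm>. \<exists>y\<in>M.lincomb \<mm> X. x = q \<oplus>\<^bsub>M\<^esub> (s \<odot>\<^bsub>M\<^esub> v \<oplus>\<^bsub>M\<^esub> y)"
    if x: "x \<in> insert v X" for x
  proof -
    obtain q c where q: "q \<in> Q" "c \<in> insert v X \<rightarrow> \<mm>"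
      "x = q \<oplus>\<^bsub>M\<^esub> (\<Oplus>\<^bsub>M\<^esub>w\<in>insert v X. c w \<odot>\<^bsub>M\<^esub> w)"
      using insert.prems(2)[OF x] unfolding M.lincomb_def by blast
    have "(\<Oplus>\<^bsub>M\<^esub>w\<in>insert v X. c w \<odot>\<^bsub>M\<^esub> w) = c v \<odot>\<^bsub>M\<^esub> v \<oplus>\<^bsub>M\<^esub> (\<Oplus>\<^bsub>M\<^esub>w\<in>X. c w \<odot>\<^bsub>M\<^esub> w)"
      using insert.hyps q(2) X m_closed' by (subst M.M.finsum_insert) (auto simp: Pi_def subset_iff)
    moreover have "(\<Oplus>\<^bsub>M\<^esub>w\<in>X. c w \<odot>\<^bsub>M\<^esub> w) \<in> M.lincomb \<mm> X"
      using q(2) unfolding M.lincomb_def by auto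
    ultimately show ?thesis using q by auto
  qed
  obtain q s y where v: "q \<in> Q" "s \<in> \<mm>" "y \<in> M.lincomb \<mm> X" "v = q \<oplus>\<^bsub>M\<^esub> (s \<odot>\<^bsub>M\<^esub> v \<oplus>\<^bsub>M\<^esub> y)"
    using split[of v] by auto
  obtain u where u: "u \<in> carrier S" "u \<otimes> (\<one> \<ominus> s) = \<one>"
    using one_minus_m_unit[OF v(2)] unfolding Units_def by blast
  have sc: "s \<in> carrier S" by (rule m_closed'[OF v(2)])
  have qy: "q \<in> carrier M" "y \<in> carrier M" using v Qc M.submodule_subset[OF lX] by blast+
  have "(\<one> \<ominus> s) \<odot>\<^bsub>M\<^esub> v = v \<ominus>\<^bsub>M\<^esub> s \<odot>\<^bsub>M\<^esub> v"
    using M.smult_diff_l[OF one_closed sc X(3)] X by simp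
  also have "\<dots> = (q \<oplus>\<^bsub>M\<^esub> (s \<odot>\<^bsub>M\<^esub> v \<oplus>\<^bsub>M\<^esub> y)) \<ominus>\<^bsub>M\<^esub> s \<odot>\<^bsub>M\<^esub> v"
    using v(4) by simp
  also have "\<dots> = q \<oplus>\<^bsub>M\<^esub> y"
    using qy sc X(3) by (simp add: a_minus_def M.M.a_ac M.M.r_neg M.M.r_neg1)
  finally have 1: "(\<one> \<ominus> s) \<odot>\<^bsub>M\<^esub> v = q \<oplus>\<^bsub>M\<^esub> y" .
  have "v = (u \<otimes> (\<one> \<ominus> s)) \<odot>\<^bsub>M\<^esub> v" using u X by simp
  also have "\<dots> = u \<odot>\<^bsub>M\<^esub> (q \<oplus>\<^bsub>M\<^esub> y)"
    using M.smult_assoc1[OF u(1) _ X(3)] sc 1 by simp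
  also have "\<dots> = u \<odot>\<^bsub>M\<^esub> q \<oplus>\<^bsub>M\<^esub> u \<odot>\<^bsub>M\<^esub> y"
    using u qy by (simp add: M.smult_r_distr)
  finally have v2: "v = u \<odot>\<^bsub>M\<^esub> q \<oplus>\<^bsub>M\<^esub> u \<odot>\<^bsub>M\<^esub> y" .
  have uq: "u \<odot>\<^bsub>M\<^esub> q \<in> Q" "u \<odot>\<^bsub>M\<^esub> y \<in> M.lincomb \<mm> X"
    using M.submodule_smult[OF assms(1) u(1) v(1)] M.submodule_smult[OF lX u(1) v(3)] by auto
  have "X \<subseteq> Q"
  proof (rule insert.IH[OF X(2)])
    fix x assume "x \<in> X"
    then obtain q' s' y' where x: "q' \<in> Q" "s' \<in> \<mm>" "y' \<in> M.lincomb \<mm> X"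
      "x = q' \<oplus>\<^bsub>M\<^esub> (s' \<odot>\<^bsub>M\<^esub> v \<oplus>\<^bsub>M\<^esub> y')" using split[of x] by auto
    let ?q = "q' \<oplus>\<^bsub>M\<^esub> s' \<odot>\<^bsub>M\<^esub> (u \<odot>\<^bsub>M\<^esub> q)" and ?y = "s' \<odot>\<^bsub>M\<^esub> (u \<odot>\<^bsub>M\<^esub> y) \<oplus>\<^bsub>M\<^esub> y'"
    have c: "q' \<in> carrier M" "y' \<in> carrier M" "s' \<in> carrier S"
      using x Qc M.submodule_subset[OF lX] m_closed' by blast+
    have "s' \<odot>\<^bsub>M\<^esub> v = s' \<odot>\<^bsub>M\<^esub> (u \<odot>\<^bsub>M\<^esub> q) \<oplus>\<^bsub>M\<^esub> s' \<odot>\<^bsub>M\<^esub> (u \<odot>\<^bsub>M\<^esub> y)"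
      using c u qy by (subst v2) (simp add: M.smult_r_distr)
    then have "x = ?q \<oplus>\<^bsub>M\<^esub> ?y"
      unfolding x(4) using c u qy by (simp add: M.M.a_ac)
    moreover have "?q \<in> Q"
      by (rule M.submodule_add[OF assms(1) x(1) M.submodule_smult[OF assms(1) c(3) uq(1)]])
    moreover have "?y \<in> M.lincomb \<mm> X"
      by (rule M.submodule_add[OF lX M.submodule_smult[OF lX c(3) uq(2)] x(3)])
    ultimately show "\<exists>q\<in>Q. \<exists>y\<in>M.lincomb \<mm> X. x = q \<oplus>\<^bsub>M\<^esub> y" by blast
  qed
  moreover have "v \<in> Q"
  proof -
    have "M.lincomb \<mm> X \<subseteq> Q"
      using \<open>X \<subseteq> Q\<close> m_closed' by (intro M.lincomb_minimal assms(1) M.submodule_smult) auto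
    then show ?thesis using v2 uq M.submodule_add[OF assms(1)] by auto
  qed
  ultimately show ?case by simp
qed

abbreviation Fil :: "nat \<Rightarrow> 'b set"
  where "Fil k \<equiv> ideal_times_module S (mpow k) M"

lemma Fil_submodule: "submodule (Fil k) S M"
  by (intro M.ideal_times_submodule subsetI mpow_closed)

lemma Fil_0: "Fil 0 = carrier M"
proof
  show "Fil 0 \<subseteq> carrier M" by (rule M.submodule_subset[OF Fil_submodule])
  show "carrier M \<subseteq> Fil 0"
    using M.ideal_times_mem[of \<one> "mpow 0"] by (auto simp: mpow_0)
qed

lemma Fil_decreasing:
  assumes "i \<le> j"
  shows "Fil j \<subseteq> Fil i"
proof (rule M.ideal_times_minimal[OF Fil_submodule])
  show "s \<odot>\<^bsub>M\<^esub> x \<in> Fil i" if "s \<in> mpow j" "x \<in> carrier M" for s x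
    using that mpow_decreasing[OF assms] by (intro M.ideal_times_mem) auto
qed

lemma Fil_closed: "x \<in> Fil k \<Longrightarrow> x \<in> carrier M"
  using M.submodule_subset[OF Fil_submodule] by blast

end

locale fg_module = complete_noetherian_module +
  assumes fin_gen: "fin_gen_module S M"
begin

lemma generators:
  obtains X where "finite X" "X \<subseteq> carrier M" "carrier M = span_module S M X"
    "carrier M = M.lincomb (carrier S) X" "\<And>k. Fil k = M.lincomb (mpow k) X"
proof -
  obtain X where X: "finite X" "X \<subseteq> carrier M" "carrier M = span_module S M X"
    using fin_gen unfolding fin_gen_module_def by blast
  show ?thesis
    using that[OF X] M.span_eq_lincomb[OF X(1,2)] M.ideal_times_eq_lincomb[OF X(1,2) mpow_ideal X(3)] X(3)
    by metis
qed

lemma submodules_maximal: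
  assumes "F \<noteq> {}" "\<And>N. N \<in> F \<Longrightarrow> submodule N S M"
  shows "\<exists>N\<in>F. \<forall>L\<in>F. N \<subseteq> L \<longrightarrow> L = N"
  using M.submodule_family_maximal[OF noetherian_ring_axioms fin_gen assms] by metis

lemma submodule_generators:
  assumes N: "submodule N S M"
  obtains X where "finite X" "X \<subseteq> N" "N = span_module S M X"
proof -
  let ?F = "{span_module S M X |X. finite X \<and> X \<subseteq> N}"
  have Nc: "N \<subseteq> carrier M" by (rule M.submodule_subset[OF N])
  have ne: "?F \<noteq> {}" by blast
  have sub: "submodule L S M" if "L \<in> ?F" for L
    using that M.span_submodule Nc by fastforce
  obtain L where L: "L \<in> ?F" "\<forall>K\<in>?F. L \<subseteq> K \<longrightarrow> K = L"
    using submodules_maximal[OF ne sub] ..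
  then obtain X where X: "finite X" "X \<subseteq> N" "L = span_module S M X" by blast
  have "N \<subseteq> L"
  proof
    fix x assume x: "x \<in> N"
    have sub: "submodule (span_module S M (insert x X)) S M"
      using x X Nc by (intro M.span_submodule) auto
    have sup: "insert x X \<subseteq> span_module S M (insert x X)" by (rule M.span_superset)
    then have "L \<subseteq> span_module S M (insert x X)"
      unfolding X(3) by (intro M.span_minimal[OF sub]) blast
    then have "span_module S M (insert x X) = L"
      using X x by (intro L(2)[rule_format]) auto
    then show "x \<in> L" using sup by blast
  qed
  moreover have "L \<subseteq> N" unfolding X(3) by (rule M.span_minimal[OF N X(2)])
  ultimately show ?thesis using that[OF X(1,2)] X(3) by blast
qed

text \<open>Nilpotency of each single element of \<open>\<mm>\<close> modulo \<open>L\<close> is uniform: a maximal counterexample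
  \<open>B\<close> above \<open>L\<close> is killed by passing to \<open>B + p M\<close> and \<open>{y. p y \<in> B}\<close>, with \<open>p\<close> the last power of
  some \<open>s \<in> \<mm>\<close> not annihilating \<open>M / B\<close>.\<close>

lemma Fil_subset_if_nilpotent:
  assumes L: "submodule L S M"
    and nil: "\<And>s. s \<in> \<mm> \<Longrightarrow> \<exists>k::nat. \<forall>x\<in>carrier M. (s [^] k) \<odot>\<^bsub>M\<^esub> x \<in> L"
  shows "\<exists>k. Fil k \<subseteq> L"
proof (rule ccontr)
  assume no: "\<nexists>k. Fil k \<subseteq> L"
  let ?F = "{B. submodule B S M \<and> L \<subseteq> B \<and> (\<nexists>k. Fil k \<subseteq> B)}"
  have ne: "?F \<noteq> {}" using no L by blast
  obtain B where B: "B \<in> ?F" "\<forall>K\<in>?F. B \<subseteq> K \<longrightarrow> K = B"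
    using submodules_maximal[OF ne] by auto
  have sB: "submodule B S M" and LB: "L \<subseteq> B" and nB: "\<nexists>k. Fil k \<subseteq> B" using B(1) by auto
  have Bc: "B \<subseteq> carrier M" by (rule M.submodule_subset[OF sB])
  have larger: "\<exists>k. Fil k \<subseteq> U" if "submodule U S M" "B \<subseteq> U" "U \<noteq> B" for U
    using B(2) that LB by blast
  have "\<not> Fil 1 \<subseteq> B" using nB by blast
  then obtain s x where s: "s \<in> \<mm>" "x \<in> carrier M" "s \<odot>\<^bsub>M\<^esub> x \<notin> B"
    using M.ideal_times_minimal[OF sB, of "mpow 1"] by (auto simp: mpow_1)
  have sc: "s \<in> carrier S" by (rule m_closed'[OF s(1)])
  define P where "P k \<longleftrightarrow> (\<forall>x\<in>carrier M. (s [^] (k::nat)) \<odot>\<^bsub>M\<^esub> x \<in> B)" for k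
  have ex: "\<exists>k. P k" using nil[OF s(1)] LB unfolding P_def by blast
  define k where "k = (LEAST k. P k)"
  have Pk: "P k" unfolding k_def by (rule LeastI_ex[OF ex])
  have "\<not> P 0" using s unfolding P_def by (metis M.smult_one M.smult_closed m_closed' nat_pow_0)
  then have "k \<noteq> 0" using Pk by metis
  then obtain j where j: "k = Suc j" by (cases k) auto
  have nPj: "\<not> P j" using not_less_Least[of j P] unfolding k_def[symmetric] j by simp
  define p where "p = s [^] j"
  have pc: "p \<in> carrier S" unfolding p_def using sc by simp
  have psB: "p \<odot>\<^bsub>M\<^esub> (s \<odot>\<^bsub>M\<^esub> y) \<in> B" if "y \<in> carrier M" for y
  proof -
    have "(s [^] k) \<odot>\<^bsub>M\<^esub> y = p \<odot>\<^bsub>M\<^esub> (s \<odot>\<^bsub>M\<^esub> y)"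
      unfolding j p_def using sc that M.smult_assoc1[of "s [^] j" s y] by (simp add: nat_pow_Suc)
    then show ?thesis using Pk that unfolding P_def by auto
  qed
  define U where "U = {b \<oplus>\<^bsub>M\<^esub> p \<odot>\<^bsub>M\<^esub> y |b y. b \<in> B \<and> y \<in> carrier M}"
  define V where "V = {y \<in> carrier M. p \<odot>\<^bsub>M\<^esub> y \<in> B}"
  note U = M.plus_smult_submodule[OF sB pc, folded U_def]
  have sV: "submodule V S M" unfolding V_def by (rule M.smult_vimage_submodule[OF sB pc])
  have BV: "B \<subseteq> V" unfolding V_def using Bc M.submodule_smult[OF sB pc] by auto
  obtain y where y: "y \<in> carrier M" "p \<odot>\<^bsub>M\<^esub> y \<notin> B" using nPj unfolding P_def p_def by blast
  have "U \<noteq> B" using y U(3)[OF y(1)] by blast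
  then obtain K where K: "Fil K \<subseteq> U" using larger[OF U(1,2)] by blast
  have "s \<odot>\<^bsub>M\<^esub> x \<in> V" unfolding V_def using s sc psB by auto
  then have "V \<noteq> B" using s by blast
  then obtain K' where K': "Fil K' \<subseteq> V" using larger[OF sV BV] by blast
  have "Fil (K' + K) \<subseteq> B"
  proof (rule M.ideal_times_minimal[OF sB])
    fix t x assume "t \<in> mpow (K' + K)" and x: "x \<in> carrier M"
    from this(1)[unfolded mpow_add] show "t \<odot>\<^bsub>M\<^esub> x \<in> B"
    proof induction
      case (prod t1 t2)
      have c: "t1 \<in> carrier S" "t2 \<in> carrier S" using prod mpow_closed by blast+
      have "t2 \<odot>\<^bsub>M\<^esub> x \<in> U" using M.ideal_times_mem[OF prod(2) x] K by blast
      then obtain b y where b: "t2 \<odot>\<^bsub>M\<^esub> x = b \<oplus>\<^bsub>M\<^esub> p \<odot>\<^bsub>M\<^esub> y" "b \<in> B" "y \<in> carrier M"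
        unfolding U_def by blast
      have "t1 \<odot>\<^bsub>M\<^esub> y \<in> V" using M.ideal_times_mem[OF prod(1) b(3)] K' by blast
      then have 1: "p \<odot>\<^bsub>M\<^esub> (t1 \<odot>\<^bsub>M\<^esub> y) \<in> B" unfolding V_def by blast
      have "t1 \<odot>\<^bsub>M\<^esub> (p \<odot>\<^bsub>M\<^esub> y) = p \<odot>\<^bsub>M\<^esub> (t1 \<odot>\<^bsub>M\<^esub> y)"
        using b(3) pc c M.smult_assoc1[of t1 p y] M.smult_assoc1[of p t1 y] m_comm[of t1 p] by simp
      then have "(t1 \<otimes> t2) \<odot>\<^bsub>M\<^esub> x = t1 \<odot>\<^bsub>M\<^esub> b \<oplus>\<^bsub>M\<^esub> p \<odot>\<^bsub>M\<^esub> (t1 \<odot>\<^bsub>M\<^esub> y)"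
        using b Bc c x pc by (simp add: M.smult_assoc1 M.smult_r_distr subset_iff)
      then show ?case using M.submodule_add[OF sB M.submodule_smult[OF sB c(1) b(2)] 1] by simp
    next
      case (sum t1 t2)
      then have "t1 \<in> carrier S" "t2 \<in> carrier S"
        unfolding mpow_add[symmetric] using mpow_closed by blast+
      then show ?case using sum M.submodule_add[OF sB] x by (simp add: M.smult_l_distr)
    qed
  qed
  then show False using nB by blast
qed

text \<open>Krull's argument: for \<open>N = (\<Inter>k. Fil k)\<close>, a submodule \<open>L\<close> that is maximal with
  \<open>\<mm>N \<subseteq> L\<close> and \<open>L \<inter> N \<subseteq> \<mm>N\<close> contains some \<open>Fil k\<close> and hence \<open>N\<close>, so that \<open>N = \<mm>N\<close>.\<close>

lemma Fil_separated:
  assumes "\<And>k. x \<in> Fil k"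
  shows "x = \<zero>\<^bsub>M\<^esub>"
proof -
  define N where "N = (\<Inter>k. Fil k)"
  have sN: "submodule N S M"
    unfolding N_def
    by (rule M.submoduleI)
      (auto intro: Fil_closed M.submodule_zero M.submodule_minus M.submodule_add M.submodule_smult Fil_submodule)
  have Nc: "N \<subseteq> carrier M" by (rule M.submodule_subset[OF sN])
  obtain X where X: "finite X" "X \<subseteq> N" "N = span_module S M X"
    by (rule submodule_generators[OF sN])
  have Xc: "X \<subseteq> carrier M" using X Nc by blast
  have N_lin: "N = M.lincomb (carrier S) X" using X(3) M.span_eq_lincomb[OF X(1) Xc] by simp
  define mN where "mN = M.lincomb \<mm> X"
  have smN: "submodule mN S M" unfolding mN_def by (rule M.lincomb_submodule[OF X(1) Xc m_ideal])
  let ?F = "{L. submodule L S M \<and> mN \<subseteq> L \<and> L \<inter> N \<subseteq> mN}"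
  have ne: "?F \<noteq> {}" using smN by blast
  obtain L where L: "L \<in> ?F" "\<forall>K\<in>?F. L \<subseteq> K \<longrightarrow> K = L"
    using submodules_maximal[OF ne] by auto
  have sL: "submodule L S M" and mNL: "mN \<subseteq> L" and LN: "L \<inter> N \<subseteq> mN" using L(1) by auto
  have Lc: "L \<subseteq> carrier M" by (rule M.submodule_subset[OF sL])
  have "\<exists>k. Fil k \<subseteq> L"
  proof (rule Fil_subset_if_nilpotent[OF sL])
    fix s assume s: "s \<in> \<mm>"
    have sc: "s \<in> carrier S" by (rule m_closed'[OF s])
    define V where "V k = {y \<in> carrier M. (s [^] (k::nat)) \<odot>\<^bsub>M\<^esub> y \<in> L}" for k
    have sV: "submodule (V k) S M" for k
      unfolding V_def by (rule M.smult_vimage_submodule[OF sL nat_pow_closed[OF sc]])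
    have s_pow: "(s [^] Suc k) \<odot>\<^bsub>M\<^esub> y = s \<odot>\<^bsub>M\<^esub> ((s [^] k) \<odot>\<^bsub>M\<^esub> y)" if "y \<in> carrier M" for k y
      using that sc M.smult_assoc1[of s "s [^] k" y] m_comm[of "s [^] k" s] by (simp add: nat_pow_Suc)
    obtain W where W: "W \<in> range V" "\<forall>K\<in>range V. W \<subseteq> K \<longrightarrow> K = W"
      using submodules_maximal[of "range V"] sV by blast
    then obtain k where k: "W = V k" by blast
    have "V k \<subseteq> V (Suc k)"
    proof
      fix y assume "y \<in> V k"
      then show "y \<in> V (Suc k)"
        unfolding V_def using s_pow M.submodule_smult[OF sL sc] by auto
    qed
    then have Veq: "V (Suc k) = V k" using W(2) k by blast
    define p where "p = s [^] k"
    have pc: "p \<in> carrier S" unfolding p_def using sc by simp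
    define U where "U = {b \<oplus>\<^bsub>M\<^esub> p \<odot>\<^bsub>M\<^esub> y |b y. b \<in> L \<and> y \<in> carrier M}"
    note U = M.plus_smult_submodule[OF sL pc, folded U_def]
    have "U \<inter> N \<subseteq> mN"
    proof
      fix z assume "z \<in> U \<inter> N"
      then obtain b y where z: "z = b \<oplus>\<^bsub>M\<^esub> p \<odot>\<^bsub>M\<^esub> y" "b \<in> L" "y \<in> carrier M" "z \<in> N"
        unfolding U_def by blast
      have bc: "b \<in> carrier M" using z Lc by blast
      have "s \<odot>\<^bsub>M\<^esub> z \<in> L"
        using M.smult_lincomb_mem[OF X(1) Xc m_ideal s] z(4) N_lin mNL unfolding mN_def by blast
      moreover have "s \<odot>\<^bsub>M\<^esub> z = (s [^] Suc k) \<odot>\<^bsub>M\<^esub> y \<oplus>\<^bsub>M\<^esub> s \<odot>\<^bsub>M\<^esub> b"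
        unfolding s_pow[OF z(3)] p_def[symmetric] z(1)
        using bc z pc sc by (simp add: M.smult_r_distr M.M.a_comm)
      ultimately have "(s [^] Suc k) \<odot>\<^bsub>M\<^esub> y \<in> L"
        using M.submodule_add_cancel[OF sL _ M.submodule_smult[OF sL sc z(2)], of "(s [^] Suc k) \<odot>\<^bsub>M\<^esub> y"]
          sc z(3) by simp
      then have "y \<in> V k" using Veq z(3) unfolding V_def by blast
      then have "p \<odot>\<^bsub>M\<^esub> y \<in> L" unfolding V_def p_def by blast
      then have "z \<in> L" unfolding z(1) using M.submodule_add[OF sL z(2)] by blast
      then show "z \<in> mN" using LN z(4) by blast
    qed
    then have "U = L" using L(2) U(1,2) mNL by blast
    then have "p \<odot>\<^bsub>M\<^esub> y \<in> L" if "y \<in> carrier M" for y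
      using U(3)[OF that] by simp
    then show "\<exists>k::nat. \<forall>x\<in>carrier M. (s [^] k) \<odot>\<^bsub>M\<^esub> x \<in> L" unfolding p_def by blast
  qed
  then have "N \<subseteq> L" unfolding N_def by blast
  then have "N \<subseteq> mN" using LN by blast
  have "X \<subseteq> {\<zero>\<^bsub>M\<^esub>}"
  proof (rule nakayama[OF _ X(1) Xc])
    show "submodule {\<zero>\<^bsub>M\<^esub>} S M" by (rule M.submoduleI) auto
    fix x assume "x \<in> X"
    then have "x \<in> mN" "x \<in> carrier M" using X(2) \<open>N \<subseteq> mN\<close> Nc by blast+
    then show "\<exists>q\<in>{\<zero>\<^bsub>M\<^esub>}. \<exists>y\<in>M.lincomb \<mm> X. x = q \<oplus>\<^bsub>M\<^esub> y" unfolding mN_def by (intro bexI[of _ "\<zero>\<^bsub>M\<^esub>"] bexI[of _ x]) auto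
  qed
  moreover have "submodule {\<zero>\<^bsub>M\<^esub>} S M" by (rule M.submoduleI) auto
  ultimately have "N \<subseteq> {\<zero>\<^bsub>M\<^esub>}" unfolding X(3) using M.span_minimal by blast
  then show ?thesis using assms unfolding N_def by blast
qed

lemma Fil_complete:
  assumes x: "\<And>k. x k \<in> carrier M" and diff: "\<And>k. x (Suc k) \<ominus>\<^bsub>M\<^esub> x k \<in> Fil k"
  obtains y where "y \<in> carrier M" "\<And>k. y \<ominus>\<^bsub>M\<^esub> x k \<in> Fil k"
proof -
  obtain X where X: "finite X" "X \<subseteq> carrier M" "\<And>k. Fil k = M.lincomb (mpow k) X"
    using generators by metis
  have "\<exists>c. c \<in> X \<rightarrow> mpow k \<and> x (Suc k) \<ominus>\<^bsub>M\<^esub> x k = (\<Oplus>\<^bsub>M\<^esub>v\<in>X. c v \<odot>\<^bsub>M\<^esub> v)" for k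
    using diff[of k] unfolding X(3) M.lincomb_def by blast
  then obtain c where c: "\<And>k. c k \<in> X \<rightarrow> mpow k"
    "\<And>k. x (Suc k) \<ominus>\<^bsub>M\<^esub> x k = (\<Oplus>\<^bsub>M\<^esub>v\<in>X. c k v \<odot>\<^bsub>M\<^esub> v)" by metis
  have cc: "c k v \<in> carrier S" if "v \<in> X" for k v using c(1)[of k] that mpow_closed by blast
  define t where "t v k = (\<Oplus>i\<in>{..<k}. c i v)" for v and k :: nat
  have tc: "t v k \<in> carrier S" if "v \<in> X" for v k
    unfolding t_def using cc[OF that] by auto
  have t_Suc: "t v (Suc k) = t v k \<oplus> c k v" if "v \<in> X" for v k
  proof -
    have "t v (Suc k) = c k v \<oplus> t v k"
      unfolding t_def lessThan_Suc using cc[OF that] by (subst finsum_insert) auto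
    then show ?thesis using a_comm[OF cc[OF that] tc[OF that]] by simp
  qed
  have "\<exists>z\<in>carrier S. \<forall>k. z \<ominus> t v k \<in> mpow k" if v: "v \<in> X" for v
    unfolding mpow_def
  proof (rule complete)
    show "t v k \<in> carrier S" for k by (rule tc[OF v])
    fix k
    have "t v (Suc k) \<ominus> t v k = c k v"
      unfolding t_Suc[OF v] using tc[OF v, of k] cc[OF v, of k] by algebra
    then show "t v (Suc k) \<ominus> t v k \<in> \<mm> [^]\<^bsub>ideals_set S\<^esub> k"
      using c(1)[of k] v unfolding mpow_def by auto
  qed
  then obtain z where z: "\<And>v. v \<in> X \<Longrightarrow> z v \<in> carrier S"
    "\<And>v k. v \<in> X \<Longrightarrow> z v \<ominus> t v k \<in> mpow k" by metis
  define y where "y = x 0 \<oplus>\<^bsub>M\<^esub> (\<Oplus>\<^bsub>M\<^esub>v\<in>X. z v \<odot>\<^bsub>M\<^esub> v)"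
  have Xc: "v \<in> carrier M" if "v \<in> X" for v using X that by blast
  have s1: "(\<Oplus>\<^bsub>M\<^esub>v\<in>X. z v \<odot>\<^bsub>M\<^esub> v) \<in> carrier M" using z Xc by auto
  have s2: "(\<Oplus>\<^bsub>M\<^esub>v\<in>X. t v k \<odot>\<^bsub>M\<^esub> v) \<in> carrier M" for k using tc Xc by auto
  have xk: "x k = x 0 \<oplus>\<^bsub>M\<^esub> (\<Oplus>\<^bsub>M\<^esub>v\<in>X. t v k \<odot>\<^bsub>M\<^esub> v)" for k
  proof (induction k)
    case 0
    have "(\<Oplus>\<^bsub>M\<^esub>v\<in>X. t v 0 \<odot>\<^bsub>M\<^esub> v) = \<zero>\<^bsub>M\<^esub>"
      unfolding t_def using Xc by (intro M.M.add.finprod_one_eqI) auto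
    then show ?case using x by simp
  next
    case (Suc k)
    have "x (Suc k) = x k \<oplus>\<^bsub>M\<^esub> (x (Suc k) \<ominus>\<^bsub>M\<^esub> x k)"
      by (simp add: M.add_diff_cancel x)
    also have "\<dots> = x k \<oplus>\<^bsub>M\<^esub> (\<Oplus>\<^bsub>M\<^esub>v\<in>X. c k v \<odot>\<^bsub>M\<^esub> v)" by (simp only: c(2))
    also have "\<dots> = x 0 \<oplus>\<^bsub>M\<^esub> ((\<Oplus>\<^bsub>M\<^esub>v\<in>X. t v k \<odot>\<^bsub>M\<^esub> v) \<oplus>\<^bsub>M\<^esub> (\<Oplus>\<^bsub>M\<^esub>v\<in>X. c k v \<odot>\<^bsub>M\<^esub> v))"
      by (subst Suc) (use x[of 0] s2[of k] cc Xc in \<open>simp add: M.M.a_assoc\<close>)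
    also have "(\<Oplus>\<^bsub>M\<^esub>v\<in>X. t v k \<odot>\<^bsub>M\<^esub> v) \<oplus>\<^bsub>M\<^esub> (\<Oplus>\<^bsub>M\<^esub>v\<in>X. c k v \<odot>\<^bsub>M\<^esub> v)
        = (\<Oplus>\<^bsub>M\<^esub>v\<in>X. t v k \<odot>\<^bsub>M\<^esub> v \<oplus>\<^bsub>M\<^esub> c k v \<odot>\<^bsub>M\<^esub> v)"
      using tc cc Xc by (subst M.M.finsum_addf) auto
    also have "\<dots> = (\<Oplus>\<^bsub>M\<^esub>v\<in>X. t v (Suc k) \<odot>\<^bsub>M\<^esub> v)"
      using tc cc Xc by (intro M.M.finsum_cong') (auto simp: t_Suc M.smult_l_distr)
    finally show ?case .
  qed
  have "y \<ominus>\<^bsub>M\<^esub> x k \<in> Fil k" for k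
  proof -
    have "(\<Oplus>\<^bsub>M\<^esub>v\<in>X. z v \<odot>\<^bsub>M\<^esub> v) = (\<Oplus>\<^bsub>M\<^esub>v\<in>X. (z v \<ominus> t v k) \<odot>\<^bsub>M\<^esub> v \<oplus>\<^bsub>M\<^esub> t v k \<odot>\<^bsub>M\<^esub> v)"
    proof (rule M.M.finsum_cong'[OF refl])
      fix v assume v: "v \<in> X"
      have "(z v \<ominus> t v k) \<oplus> t v k = z v" using z(1)[OF v] tc[OF v, of k] by algebra
      then show "z v \<odot>\<^bsub>M\<^esub> v = (z v \<ominus> t v k) \<odot>\<^bsub>M\<^esub> v \<oplus>\<^bsub>M\<^esub> t v k \<odot>\<^bsub>M\<^esub> v"
        using M.smult_l_distr[of "z v \<ominus> t v k" "t v k" v] z(1)[OF v] tc[OF v, of k] Xc[OF v] by simp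
    qed (use z tc Xc in auto)
    also have "\<dots> = (\<Oplus>\<^bsub>M\<^esub>v\<in>X. (z v \<ominus> t v k) \<odot>\<^bsub>M\<^esub> v) \<oplus>\<^bsub>M\<^esub> (\<Oplus>\<^bsub>M\<^esub>v\<in>X. t v k \<odot>\<^bsub>M\<^esub> v)"
      using z tc Xc by (intro M.M.finsum_addf) auto
    finally have 1: "(\<Oplus>\<^bsub>M\<^esub>v\<in>X. z v \<odot>\<^bsub>M\<^esub> v)
      = (\<Oplus>\<^bsub>M\<^esub>v\<in>X. (z v \<ominus> t v k) \<odot>\<^bsub>M\<^esub> v) \<oplus>\<^bsub>M\<^esub> (\<Oplus>\<^bsub>M\<^esub>v\<in>X. t v k \<odot>\<^bsub>M\<^esub> v)" .
    have s3: "(\<Oplus>\<^bsub>M\<^esub>v\<in>X. (z v \<ominus> t v k) \<odot>\<^bsub>M\<^esub> v) \<in> carrier M" using z tc Xc by auto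
    have "y \<ominus>\<^bsub>M\<^esub> x k = (\<Oplus>\<^bsub>M\<^esub>v\<in>X. (z v \<ominus> t v k) \<odot>\<^bsub>M\<^esub> v)"
      unfolding y_def 1 xk[of k] by (rule M.add_add_diff_cancel[OF x s3 s2])
    then show ?thesis unfolding X(3) M.lincomb_def using z(2) by auto
  qed
  moreover have "y \<in> carrier M" unfolding y_def using x s1 by simp
  ultimately show ?thesis using that by blast
qed

end

context smodule
begin

lemma submoduleI_smult:
  assumes "H \<subseteq> carrier M" "\<zero>\<^bsub>M\<^esub> \<in> H" "\<And>a b. a \<in> H \<Longrightarrow> b \<in> H \<Longrightarrow> a \<oplus>\<^bsub>M\<^esub> b \<in> H"
    "\<And>a x. a \<in> carrier R \<Longrightarrow> x \<in> H \<Longrightarrow> a \<odot>\<^bsub>M\<^esub> x \<in> H"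
  shows "submodule H R M"
proof (rule submoduleI)
  fix a assume a: "a \<in> H"
  then have "\<ominus>\<^bsub>M\<^esub> a = (\<ominus> \<one>) \<odot>\<^bsub>M\<^esub> a" using assms(1) by (simp add: smult_l_minus subset_iff)
  then show "\<ominus>\<^bsub>M\<^esub> a \<in> H" using assms(4)[OF _ a, of "\<ominus> \<one>"] by simp
qed (use assms in auto)

end

lemma (in complete_noetherian) bilinear_ideal_times:
  assumes "smodule S M1" "smodule S M2" "smodule S M3"
    and closed: "\<And>x y. x \<in> carrier M1 \<Longrightarrow> y \<in> carrier M2 \<Longrightarrow> \<beta> x y \<in> carrier M3"
    and add_l: "\<And>x x' y. x \<in> carrier M1 \<Longrightarrow> x' \<in> carrier M1 \<Longrightarrow> y \<in> carrier M2
      \<Longrightarrow> \<beta> (x \<oplus>\<^bsub>M1\<^esub> x') y = \<beta> x y \<oplus>\<^bsub>M3\<^esub> \<beta> x' y"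
    and add_r: "\<And>x y y'. x \<in> carrier M1 \<Longrightarrow> y \<in> carrier M2 \<Longrightarrow> y' \<in> carrier M2
      \<Longrightarrow> \<beta> x (y \<oplus>\<^bsub>M2\<^esub> y') = \<beta> x y \<oplus>\<^bsub>M3\<^esub> \<beta> x y'"
    and smult_l: "\<And>s x y. s \<in> carrier S \<Longrightarrow> x \<in> carrier M1 \<Longrightarrow> y \<in> carrier M2
      \<Longrightarrow> \<beta> (s \<odot>\<^bsub>M1\<^esub> x) y = s \<odot>\<^bsub>M3\<^esub> \<beta> x y"
    and smult_r: "\<And>s x y. s \<in> carrier S \<Longrightarrow> x \<in> carrier M1 \<Longrightarrow> y \<in> carrier M2
      \<Longrightarrow> \<beta> x (s \<odot>\<^bsub>M2\<^esub> y) = s \<odot>\<^bsub>M3\<^esub> \<beta> x y"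
    and x: "x \<in> ideal_times_module S (mpow i) M1" and y: "y \<in> ideal_times_module S (mpow j) M2"
  shows "\<beta> x y \<in> ideal_times_module S (mpow (i + j)) M3"
proof -
  interpret M1: smodule S M1 by fact
  interpret M2: smodule S M2 by fact
  interpret M3: smodule S M3 by fact
  let ?F = "ideal_times_module S (mpow (i + j)) M3"
  have sF: "submodule ?F S M3" by (intro M3.ideal_times_submodule subsetI mpow_closed)
  have zl: "\<beta> \<zero>\<^bsub>M1\<^esub> y = \<zero>\<^bsub>M3\<^esub>" if "y \<in> carrier M2" for y
    using smult_l[of \<zero> "\<zero>\<^bsub>M1\<^esub>" y] closed[of "\<zero>\<^bsub>M1\<^esub>" y] that by simp
  have zr: "\<beta> x \<zero>\<^bsub>M2\<^esub> = \<zero>\<^bsub>M3\<^esub>" if "x \<in> carrier M1" for x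
    using smult_r[of \<zero> x "\<zero>\<^bsub>M2\<^esub>"] closed[of x "\<zero>\<^bsub>M2\<^esub>"] that by simp
  have gen: "\<beta> (t \<odot>\<^bsub>M1\<^esub> x) y \<in> ?F" if t: "t \<in> mpow i" "x \<in> carrier M1"
    and y: "y \<in> ideal_times_module S (mpow j) M2" for t x y
  proof -
    have tc: "t \<in> carrier S" using t mpow_closed by blast
    let ?H = "{y \<in> carrier M2. \<beta> (t \<odot>\<^bsub>M1\<^esub> x) y \<in> ?F}"
    have "submodule ?H S M2"
      by (rule M2.submoduleI_smult)
        (use t tc sF in \<open>auto simp: zr add_r smult_r intro: M3.submodule_zero M3.submodule_add M3.submodule_smult\<close>)
    moreover have "s \<odot>\<^bsub>M2\<^esub> y \<in> ?H" if "s \<in> mpow j" "y \<in> carrier M2" for s y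
    proof -
      have sc: "s \<in> carrier S" using that mpow_closed by blast
      have "\<beta> (t \<odot>\<^bsub>M1\<^esub> x) (s \<odot>\<^bsub>M2\<^esub> y) = (t \<otimes> s) \<odot>\<^bsub>M3\<^esub> \<beta> x y"
        using t tc sc that closed M3.smult_assoc1[of t s "\<beta> x y"] M3.smult_assoc1[of s t "\<beta> x y"] m_comm[of t s]
        by (simp add: smult_l smult_r)
      then show ?thesis
        using t that sc closed M3.ideal_times_mem[OF mpow_mult[OF t(1) that(1)]] by simp
    qed
    ultimately have "ideal_times_module S (mpow j) M2 \<subseteq> ?H"
      by (rule M2.ideal_times_minimal)
    then show ?thesis using y by blast
  qed
  have yc: "y \<in> carrier M2"
    using y M2.submodule_subset[OF M2.ideal_times_submodule] mpow_closed by blast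
  let ?H = "{x \<in> carrier M1. \<beta> x y \<in> ?F}"
  have "submodule ?H S M1"
    by (rule M1.submoduleI_smult)
      (use yc sF in \<open>auto simp: zl add_l smult_l intro: M3.submodule_zero M3.submodule_add M3.submodule_smult\<close>)
  then have "ideal_times_module S (mpow i) M1 \<subseteq> ?H"
    by (rule M1.ideal_times_minimal) (use gen y mpow_closed in auto)
  then show ?thesis using x by blast
qed

locale fg_algebra = fg_module S \<mm> E + E: ring E
  for S :: "('a, 'r) ring_scheme" (structure) and \<mm> and E :: "('a, 'b) module" (structure) +
  assumes smult_mult_l: "\<lbrakk>s \<in> carrier S; x \<in> carrier E; y \<in> carrier E\<rbrakk>
      \<Longrightarrow> (s \<odot>\<^bsub>E\<^esub> x) \<otimes>\<^bsub>E\<^esub> y = s \<odot>\<^bsub>E\<^esub> (x \<otimes>\<^bsub>E\<^esub> y)"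
    and smult_mult_r: "\<lbrakk>s \<in> carrier S; x \<in> carrier E; y \<in> carrier E\<rbrakk>
      \<Longrightarrow> x \<otimes>\<^bsub>E\<^esub> (s \<odot>\<^bsub>E\<^esub> y) = s \<odot>\<^bsub>E\<^esub> (x \<otimes>\<^bsub>E\<^esub> y)"
begin

lemma Fil_mult: "x \<in> Fil i \<Longrightarrow> y \<in> Fil j \<Longrightarrow> x \<otimes>\<^bsub>E\<^esub> y \<in> Fil (i + j)"
  by (rule bilinear_ideal_times[of E E E "(\<otimes>\<^bsub>E\<^esub>)"])
    (auto simp: E.l_distr E.r_distr smult_mult_l smult_mult_r M.smodule_axioms)

lemma Fil_mult_l: "x \<in> carrier E \<Longrightarrow> y \<in> Fil j \<Longrightarrow> x \<otimes>\<^bsub>E\<^esub> y \<in> Fil j"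
  using Fil_mult[of x 0 y j] by (simp add: Fil_0)

lemma Fil_mult_r: "x \<in> Fil i \<Longrightarrow> y \<in> carrier E \<Longrightarrow> x \<otimes>\<^bsub>E\<^esub> y \<in> Fil i"
  using Fil_mult[of x i y 0] by (simp add: Fil_0)

lemma Fil_ideal: "ideal (Fil k) E"
proof (rule idealI)
  show "subgroup (Fil k) (add_monoid E)" using Fil_submodule by (rule submodule.axioms(1))
qed (auto intro: Fil_mult_l Fil_mult_r E.ring_axioms)

lemma right_inverse_one_minus:
  assumes "a \<in> Fil 1"
  shows "\<exists>x\<in>carrier E. (\<one>\<^bsub>E\<^esub> \<ominus>\<^bsub>E\<^esub> a) \<otimes>\<^bsub>E\<^esub> x = \<one>\<^bsub>E\<^esub>"
proof -
  have ac: "a \<in> carrier E" using assms Fil_closed by blast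
  obtain X where X: "finite X" "X \<subseteq> carrier E" "carrier E = span_module S E X"
    "\<And>k. Fil k = M.lincomb (mpow k) X"
    using generators by metis
  let ?u = "\<one>\<^bsub>E\<^esub> \<ominus>\<^bsub>E\<^esub> a"
  let ?Q = "(\<lambda>x. ?u \<otimes>\<^bsub>E\<^esub> x) ` carrier E"
  have Q: "submodule ?Q S E"
  proof (rule M.submoduleI_smult)
    show "\<zero>\<^bsub>E\<^esub> \<in> ?Q" using ac by (auto intro!: image_eqI[of _ _ "\<zero>\<^bsub>E\<^esub>"])
  next
    fix x y assume "x \<in> ?Q" "y \<in> ?Q"
    then obtain x' y' where "x = ?u \<otimes>\<^bsub>E\<^esub> x'" "y = ?u \<otimes>\<^bsub>E\<^esub> y'" "x' \<in> carrier E" "y' \<in> carrier E" by blast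
    then show "x \<oplus>\<^bsub>E\<^esub> y \<in> ?Q" using ac by (intro image_eqI[of _ _ "x' \<oplus>\<^bsub>E\<^esub> y'"]) (auto simp: E.r_distr)
  next
    fix s x assume s: "s \<in> carrier S" and "x \<in> ?Q"
    then obtain x' where "x = ?u \<otimes>\<^bsub>E\<^esub> x'" "x' \<in> carrier E" by blast
    then show "s \<odot>\<^bsub>E\<^esub> x \<in> ?Q" using ac s by (intro image_eqI[of _ _ "s \<odot>\<^bsub>E\<^esub> x'"]) (auto simp: smult_mult_r)
  qed (use ac in auto)
  have "X \<subseteq> ?Q"
  proof (rule nakayama[OF Q X(1,2)])
    fix x assume "x \<in> X"
    then have x: "x \<in> carrier E" using X(2) by blast
    have "x = ?u \<otimes>\<^bsub>E\<^esub> x \<oplus>\<^bsub>E\<^esub> a \<otimes>\<^bsub>E\<^esub> x" using ac x by algebra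
    moreover have "a \<otimes>\<^bsub>E\<^esub> x \<in> M.lincomb \<mm> X"
      using Fil_mult_r[OF assms x] X(4)[of 1] by (simp add: mpow_1)
    ultimately show "\<exists>q\<in>?Q. \<exists>y\<in>M.lincomb \<mm> X. x = q \<oplus>\<^bsub>E\<^esub> y" using x by blast
  qed
  then have "carrier E \<subseteq> ?Q" using M.span_minimal[OF Q] X(3) by simp
  then show ?thesis using E.one_closed by (smt (verit) image_iff subsetD)
qed

lemma one_minus_Fil_unit:
  assumes "a \<in> Fil 1"
  shows "\<one>\<^bsub>E\<^esub> \<ominus>\<^bsub>E\<^esub> a \<in> Units E"
proof -
  interpret F: ideal "Fil 1" E by (rule Fil_ideal)
  have ac: "a \<in> carrier E" using assms Fil_closed by blast
  obtain x where x: "x \<in> carrier E" "(\<one>\<^bsub>E\<^esub> \<ominus>\<^bsub>E\<^esub> a) \<otimes>\<^bsub>E\<^esub> x = \<one>\<^bsub>E\<^esub>"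
    using right_inverse_one_minus[OF assms] by blast
  let ?b = "\<ominus>\<^bsub>E\<^esub> (a \<otimes>\<^bsub>E\<^esub> x)"
  have "?b \<in> Fil 1" by (rule F.a_inv_closed[OF Fil_mult_r[OF assms x(1)]])
  then obtain y where y: "y \<in> carrier E" "(\<one>\<^bsub>E\<^esub> \<ominus>\<^bsub>E\<^esub> ?b) \<otimes>\<^bsub>E\<^esub> y = \<one>\<^bsub>E\<^esub>"
    using right_inverse_one_minus by blast
  have "\<one>\<^bsub>E\<^esub> \<ominus>\<^bsub>E\<^esub> ?b = (\<one>\<^bsub>E\<^esub> \<ominus>\<^bsub>E\<^esub> a) \<otimes>\<^bsub>E\<^esub> x \<oplus>\<^bsub>E\<^esub> a \<otimes>\<^bsub>E\<^esub> x" unfolding x(2) using ac x(1) by algebra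
  also have "\<dots> = x" using ac x(1) by algebra
  finally have xy: "x \<otimes>\<^bsub>E\<^esub> y = \<one>\<^bsub>E\<^esub>" using y(2) by simp
  have uc: "\<one>\<^bsub>E\<^esub> \<ominus>\<^bsub>E\<^esub> a \<in> carrier E" using ac by simp
  have "y = (\<one>\<^bsub>E\<^esub> \<ominus>\<^bsub>E\<^esub> a) \<otimes>\<^bsub>E\<^esub> x \<otimes>\<^bsub>E\<^esub> y" using x(2) y(1) by simp
  also have "\<dots> = \<one>\<^bsub>E\<^esub> \<ominus>\<^bsub>E\<^esub> a" using E.m_assoc[OF uc x(1) y(1)] xy uc by simp
  finally have "x \<otimes>\<^bsub>E\<^esub> (\<one>\<^bsub>E\<^esub> \<ominus>\<^bsub>E\<^esub> a) = \<one>\<^bsub>E\<^esub>" using xy by simp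
  then show ?thesis using x uc unfolding Units_def by auto
qed

lemma one_minus_nilpotent_unit:
  assumes ac: "a \<in> carrier E" and "a [^]\<^bsub>E\<^esub> (k::nat) \<in> Fil 1"
  shows "\<one>\<^bsub>E\<^esub> \<ominus>\<^bsub>E\<^esub> a \<in> Units E"
proof -
  have pc: "a [^]\<^bsub>E\<^esub> n \<in> carrier E" for n :: nat using ac by simp
  have "\<exists>g\<in>carrier E. (\<one>\<^bsub>E\<^esub> \<ominus>\<^bsub>E\<^esub> a) \<otimes>\<^bsub>E\<^esub> g = \<one>\<^bsub>E\<^esub> \<ominus>\<^bsub>E\<^esub> a [^]\<^bsub>E\<^esub> n \<and>
      g \<otimes>\<^bsub>E\<^esub> (\<one>\<^bsub>E\<^esub> \<ominus>\<^bsub>E\<^esub> a) = \<one>\<^bsub>E\<^esub> \<ominus>\<^bsub>E\<^esub> a [^]\<^bsub>E\<^esub> n" for n :: nat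
  proof (induction n)
    case 0
    show ?case using ac by (intro bexI[of _ "\<zero>\<^bsub>E\<^esub>"]) (auto simp: a_minus_def M.M.r_neg)
  next
    case (Suc n)
    then obtain g where g: "g \<in> carrier E" "(\<one>\<^bsub>E\<^esub> \<ominus>\<^bsub>E\<^esub> a) \<otimes>\<^bsub>E\<^esub> g = \<one>\<^bsub>E\<^esub> \<ominus>\<^bsub>E\<^esub> a [^]\<^bsub>E\<^esub> n"
      "g \<otimes>\<^bsub>E\<^esub> (\<one>\<^bsub>E\<^esub> \<ominus>\<^bsub>E\<^esub> a) = \<one>\<^bsub>E\<^esub> \<ominus>\<^bsub>E\<^esub> a [^]\<^bsub>E\<^esub> n" by blast
    let ?p = "a [^]\<^bsub>E\<^esub> n"
    have s: "a [^]\<^bsub>E\<^esub> Suc n = ?p \<otimes>\<^bsub>E\<^esub> a" "a [^]\<^bsub>E\<^esub> Suc n = a \<otimes>\<^bsub>E\<^esub> ?p"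
      using ac by (simp, rule E.nat_pow_Suc2)
    have "(\<one>\<^bsub>E\<^esub> \<ominus>\<^bsub>E\<^esub> a) \<otimes>\<^bsub>E\<^esub> (g \<oplus>\<^bsub>E\<^esub> ?p) = (\<one>\<^bsub>E\<^esub> \<ominus>\<^bsub>E\<^esub> a) \<otimes>\<^bsub>E\<^esub> g \<oplus>\<^bsub>E\<^esub> (?p \<ominus>\<^bsub>E\<^esub> a \<otimes>\<^bsub>E\<^esub> ?p)"
      using g(1) pc[of n] ac by algebra
    also have "\<dots> = \<one>\<^bsub>E\<^esub> \<ominus>\<^bsub>E\<^esub> a [^]\<^bsub>E\<^esub> Suc n" unfolding g s(2) using pc[of n] ac by algebra
    finally have 1: "(\<one>\<^bsub>E\<^esub> \<ominus>\<^bsub>E\<^esub> a) \<otimes>\<^bsub>E\<^esub> (g \<oplus>\<^bsub>E\<^esub> ?p) = \<one>\<^bsub>E\<^esub> \<ominus>\<^bsub>E\<^esub> a [^]\<^bsub>E\<^esub> Suc n" .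
    have "(g \<oplus>\<^bsub>E\<^esub> ?p) \<otimes>\<^bsub>E\<^esub> (\<one>\<^bsub>E\<^esub> \<ominus>\<^bsub>E\<^esub> a) = g \<otimes>\<^bsub>E\<^esub> (\<one>\<^bsub>E\<^esub> \<ominus>\<^bsub>E\<^esub> a) \<oplus>\<^bsub>E\<^esub> (?p \<ominus>\<^bsub>E\<^esub> ?p \<otimes>\<^bsub>E\<^esub> a)"
      using g(1) pc[of n] ac by (simp add: a_minus_def E.l_distr E.r_distr E.r_minus M.M.minus_add M.M.a_ac)
    also have "\<dots> = \<one>\<^bsub>E\<^esub> \<ominus>\<^bsub>E\<^esub> a [^]\<^bsub>E\<^esub> Suc n" unfolding g s(1) using pc[of n] ac by algebra
    finally show ?case using 1 g(1) pc by blast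
  qed
  then obtain g where g: "g \<in> carrier E" "(\<one>\<^bsub>E\<^esub> \<ominus>\<^bsub>E\<^esub> a) \<otimes>\<^bsub>E\<^esub> g = \<one>\<^bsub>E\<^esub> \<ominus>\<^bsub>E\<^esub> a [^]\<^bsub>E\<^esub> k"
    "g \<otimes>\<^bsub>E\<^esub> (\<one>\<^bsub>E\<^esub> \<ominus>\<^bsub>E\<^esub> a) = \<one>\<^bsub>E\<^esub> \<ominus>\<^bsub>E\<^esub> a [^]\<^bsub>E\<^esub> k" by blast
  obtain u where u: "u \<in> carrier E" "(\<one>\<^bsub>E\<^esub> \<ominus>\<^bsub>E\<^esub> a [^]\<^bsub>E\<^esub> k) \<otimes>\<^bsub>E\<^esub> u = \<one>\<^bsub>E\<^esub>" "u \<otimes>\<^bsub>E\<^esub> (\<one>\<^bsub>E\<^esub> \<ominus>\<^bsub>E\<^esub> a [^]\<^bsub>E\<^esub> k) = \<one>\<^bsub>E\<^esub>"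
    using one_minus_Fil_unit[OF assms(2)] unfolding Units_def by auto
  have c: "\<one>\<^bsub>E\<^esub> \<ominus>\<^bsub>E\<^esub> a \<in> carrier E" using ac by simp
  have "(\<one>\<^bsub>E\<^esub> \<ominus>\<^bsub>E\<^esub> a) \<otimes>\<^bsub>E\<^esub> (g \<otimes>\<^bsub>E\<^esub> u) = \<one>\<^bsub>E\<^esub>"
    using E.m_assoc[OF c g(1) u(1)] g(2) u(2) by simp
  moreover have "(u \<otimes>\<^bsub>E\<^esub> g) \<otimes>\<^bsub>E\<^esub> (\<one>\<^bsub>E\<^esub> \<ominus>\<^bsub>E\<^esub> a) = \<one>\<^bsub>E\<^esub>"
    using E.m_assoc[OF u(1) g(1) c] g(3) u(3) by simp
  ultimately show ?thesis using E.inv_unique[of "u \<otimes>\<^bsub>E\<^esub> g" "\<one>\<^bsub>E\<^esub> \<ominus>\<^bsub>E\<^esub> a" "g \<otimes>\<^bsub>E\<^esub> u"] c g(1) u(1)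
    unfolding Units_def by auto
qed

definition congr :: "nat \<Rightarrow> 'b \<Rightarrow> 'b \<Rightarrow> bool"
  where "congr k x y \<longleftrightarrow> x \<ominus>\<^bsub>E\<^esub> y \<in> Fil k"

lemma congr_refl: "x \<in> carrier E \<Longrightarrow> congr k x x"
  unfolding congr_def using M.submodule_zero[OF Fil_submodule] by (simp add: a_minus_def M.M.r_neg)

lemma congr_trans:
  assumes "congr k x y" "congr k y z" "x \<in> carrier E" "y \<in> carrier E" "z \<in> carrier E"
  shows "congr k x z"
proof -
  have "x \<ominus>\<^bsub>E\<^esub> z = (x \<ominus>\<^bsub>E\<^esub> y) \<oplus>\<^bsub>E\<^esub> (y \<ominus>\<^bsub>E\<^esub> z)" using assms by algebra
  then show ?thesis using assms M.submodule_add[OF Fil_submodule] unfolding congr_def by metis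
qed

lemma congr_sym:
  assumes "congr k x y" "x \<in> carrier E" "y \<in> carrier E"
  shows "congr k y x"
proof -
  have "y \<ominus>\<^bsub>E\<^esub> x = \<ominus>\<^bsub>E\<^esub> (x \<ominus>\<^bsub>E\<^esub> y)" using assms by algebra
  then show ?thesis using assms M.submodule_minus[OF Fil_submodule] unfolding congr_def by metis
qed

lemma congr_add:
  assumes "congr k x y" "congr k x' y'" "x \<in> carrier E" "y \<in> carrier E" "x' \<in> carrier E" "y' \<in> carrier E"
  shows "congr k (x \<oplus>\<^bsub>E\<^esub> x') (y \<oplus>\<^bsub>E\<^esub> y')"
proof -
  have "(x \<oplus>\<^bsub>E\<^esub> x') \<ominus>\<^bsub>E\<^esub> (y \<oplus>\<^bsub>E\<^esub> y') = (x \<ominus>\<^bsub>E\<^esub> y) \<oplus>\<^bsub>E\<^esub> (x' \<ominus>\<^bsub>E\<^esub> y')" using assms by algebra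
  then show ?thesis using assms M.submodule_add[OF Fil_submodule] unfolding congr_def by metis
qed

lemma congr_mult_l:
  assumes "congr k x y" "x \<in> carrier E" "y \<in> carrier E" "z \<in> carrier E"
  shows "congr k (z \<otimes>\<^bsub>E\<^esub> x) (z \<otimes>\<^bsub>E\<^esub> y)"
proof -
  have "z \<otimes>\<^bsub>E\<^esub> x \<ominus>\<^bsub>E\<^esub> z \<otimes>\<^bsub>E\<^esub> y = z \<otimes>\<^bsub>E\<^esub> (x \<ominus>\<^bsub>E\<^esub> y)" using assms by algebra
  then show ?thesis using assms Fil_mult_l unfolding congr_def by metis
qed

lemma congr_mult_r:
  assumes "congr k x y" "x \<in> carrier E" "y \<in> carrier E" "z \<in> carrier E"
  shows "congr k (x \<otimes>\<^bsub>E\<^esub> z) (y \<otimes>\<^bsub>E\<^esub> z)"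
proof -
  have "x \<otimes>\<^bsub>E\<^esub> z \<ominus>\<^bsub>E\<^esub> y \<otimes>\<^bsub>E\<^esub> z = (x \<ominus>\<^bsub>E\<^esub> y) \<otimes>\<^bsub>E\<^esub> z" using assms by algebra
  then show ?thesis using assms Fil_mult_r unfolding congr_def by metis
qed

lemma congr_mult:
  assumes "congr k x y" "congr k x' y'" "x \<in> carrier E" "y \<in> carrier E" "x' \<in> carrier E" "y' \<in> carrier E"
  shows "congr k (x \<otimes>\<^bsub>E\<^esub> x') (y \<otimes>\<^bsub>E\<^esub> y')"
  by (rule congr_trans[OF congr_mult_r[OF assms(1)] congr_mult_l[OF assms(2)]]) (use assms in auto)

lemma congr_all_eq:
  assumes "\<And>k. congr k x y" "x \<in> carrier E" "y \<in> carrier E"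
  shows "x = y"
proof -
  have "x \<ominus>\<^bsub>E\<^esub> y = \<zero>\<^bsub>E\<^esub>" using assms(1) unfolding congr_def by (rule Fil_separated)
  then show ?thesis using assms by (metis M.add_diff_cancel M.M.r_zero)
qed

lemma congr_mono: "congr j x y \<Longrightarrow> i \<le> j \<Longrightarrow> congr i x y"
  using Fil_decreasing unfolding congr_def by blast

primrec power_span :: "'b \<Rightarrow> nat \<Rightarrow> 'b set"
  where "power_span a 0 = {\<zero>\<^bsub>E\<^esub>}"
  | "power_span a (Suc n) = {s \<odot>\<^bsub>E\<^esub> \<one>\<^bsub>E\<^esub> \<oplus>\<^bsub>E\<^esub> a \<otimes>\<^bsub>E\<^esub> y |s y. s \<in> carrier S \<and> y \<in> power_span a n}"

lemma power_span_submodule: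
  assumes a: "a \<in> carrier E"
  shows "submodule (power_span a n) S E"
proof (induction n)
  case 0
  show ?case by (rule M.submoduleI_smult) auto
next
  case (Suc n)
  note sub = M.submodule_subset[OF Suc]
  show ?case
  proof (rule M.submoduleI_smult)
    show "power_span a (Suc n) \<subseteq> carrier E" using a sub by auto
    have "\<zero>\<^bsub>E\<^esub> = \<zero> \<odot>\<^bsub>E\<^esub> \<one>\<^bsub>E\<^esub> \<oplus>\<^bsub>E\<^esub> a \<otimes>\<^bsub>E\<^esub> \<zero>\<^bsub>E\<^esub>" using a by simp
    then show "\<zero>\<^bsub>E\<^esub> \<in> power_span a (Suc n)" using M.submodule_zero[OF Suc] zero_closed by (simp only: power_span.simps) blast
  next
    fix x x' assume "x \<in> power_span a (Suc n)" "x' \<in> power_span a (Suc n)"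
    then obtain s y s' y' where x: "x = s \<odot>\<^bsub>E\<^esub> \<one>\<^bsub>E\<^esub> \<oplus>\<^bsub>E\<^esub> a \<otimes>\<^bsub>E\<^esub> y" "s \<in> carrier S" "y \<in> power_span a n"
      and x': "x' = s' \<odot>\<^bsub>E\<^esub> \<one>\<^bsub>E\<^esub> \<oplus>\<^bsub>E\<^esub> a \<otimes>\<^bsub>E\<^esub> y'" "s' \<in> carrier S" "y' \<in> power_span a n" by auto
    have "y \<in> carrier E" "y' \<in> carrier E" using sub x x' by blast+
    then have "x \<oplus>\<^bsub>E\<^esub> x' = (s \<oplus> s') \<odot>\<^bsub>E\<^esub> \<one>\<^bsub>E\<^esub> \<oplus>\<^bsub>E\<^esub> a \<otimes>\<^bsub>E\<^esub> (y \<oplus>\<^bsub>E\<^esub> y')"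
      using x x' a by (simp add: M.smult_l_distr E.r_distr M.M.a_ac)
    then show "x \<oplus>\<^bsub>E\<^esub> x' \<in> power_span a (Suc n)"
      using M.submodule_add[OF Suc x(3) x'(3)] x(2) x'(2) by auto
  next
    fix t x assume t: "t \<in> carrier S" and "x \<in> power_span a (Suc n)"
    then obtain s y where x: "x = s \<odot>\<^bsub>E\<^esub> \<one>\<^bsub>E\<^esub> \<oplus>\<^bsub>E\<^esub> a \<otimes>\<^bsub>E\<^esub> y" "s \<in> carrier S" "y \<in> power_span a n" by auto
    have "y \<in> carrier E" using sub x by blast
    then have "t \<odot>\<^bsub>E\<^esub> x = (t \<otimes> s) \<odot>\<^bsub>E\<^esub> \<one>\<^bsub>E\<^esub> \<oplus>\<^bsub>E\<^esub> a \<otimes>\<^bsub>E\<^esub> (t \<odot>\<^bsub>E\<^esub> y)"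
      using x a t by (simp add: M.smult_r_distr M.smult_assoc1 smult_mult_r)
    then show "t \<odot>\<^bsub>E\<^esub> x \<in> power_span a (Suc n)"
      using M.submodule_smult[OF Suc t x(3)] x(2) t by auto
  qed
qed

lemma power_span_commute:
  assumes a: "a \<in> carrier E" and "x \<in> power_span a n"
  shows "a \<otimes>\<^bsub>E\<^esub> x = x \<otimes>\<^bsub>E\<^esub> a"
  using assms(2)
proof (induction n arbitrary: x)
  case 0
  then show ?case using a by simp
next
  case (Suc n)
  then obtain s y where x: "x = s \<odot>\<^bsub>E\<^esub> \<one>\<^bsub>E\<^esub> \<oplus>\<^bsub>E\<^esub> a \<otimes>\<^bsub>E\<^esub> y" "s \<in> carrier S" "y \<in> power_span a n" by auto
  have y: "y \<in> carrier E" using x M.submodule_subset[OF power_span_submodule[OF a]] by blast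
  have "x \<otimes>\<^bsub>E\<^esub> a = s \<odot>\<^bsub>E\<^esub> a \<oplus>\<^bsub>E\<^esub> a \<otimes>\<^bsub>E\<^esub> (y \<otimes>\<^bsub>E\<^esub> a)"
    using x y a by (simp add: E.l_distr smult_mult_l E.m_assoc)
  moreover have "a \<otimes>\<^bsub>E\<^esub> x = s \<odot>\<^bsub>E\<^esub> a \<oplus>\<^bsub>E\<^esub> a \<otimes>\<^bsub>E\<^esub> (a \<otimes>\<^bsub>E\<^esub> y)"
    using x y a by (simp add: E.r_distr smult_mult_r)
  ultimately show ?case using Suc.IH[OF x(3)] by simp
qed

lemma power_in_power_span:
  assumes a: "a \<in> carrier E"
  shows "a [^]\<^bsub>E\<^esub> n \<in> power_span a (Suc n)"
proof (induction n)
  case 0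
  have "\<one>\<^bsub>E\<^esub> = \<one> \<odot>\<^bsub>E\<^esub> \<one>\<^bsub>E\<^esub> \<oplus>\<^bsub>E\<^esub> a \<otimes>\<^bsub>E\<^esub> \<zero>\<^bsub>E\<^esub>" using a by simp
  then show ?case using one_closed unfolding E.nat_pow_0 power_span.simps by blast
next
  case (Suc n)
  have "a [^]\<^bsub>E\<^esub> Suc n = \<zero> \<odot>\<^bsub>E\<^esub> \<one>\<^bsub>E\<^esub> \<oplus>\<^bsub>E\<^esub> a \<otimes>\<^bsub>E\<^esub> a [^]\<^bsub>E\<^esub> n"
    using a E.nat_pow_Suc2[OF a] by simp
  then show ?case using Suc zero_closed unfolding power_span.simps(2)[of a "Suc n"] by blast
qed

lemma power_span_leading:
  assumes a: "a \<in> carrier E" and x: "x \<in> power_span a n"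
  shows "x \<in> Fil 1 \<or> (\<exists>r<n. \<exists>u\<in>Units S. \<exists>c\<in>carrier E. a \<otimes>\<^bsub>E\<^esub> c = c \<otimes>\<^bsub>E\<^esub> a \<and>
    congr 1 x (u \<odot>\<^bsub>E\<^esub> a [^]\<^bsub>E\<^esub> r \<oplus>\<^bsub>E\<^esub> a [^]\<^bsub>E\<^esub> Suc r \<otimes>\<^bsub>E\<^esub> c))"
  using x
proof (induction n arbitrary: x)
  case 0
  then show ?case using M.submodule_zero[OF Fil_submodule] by simp
next
  case (Suc n)
  then obtain s y where x: "x = s \<odot>\<^bsub>E\<^esub> \<one>\<^bsub>E\<^esub> \<oplus>\<^bsub>E\<^esub> a \<otimes>\<^bsub>E\<^esub> y" "s \<in> carrier S" "y \<in> power_span a n" by auto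
  have y: "y \<in> carrier E" using x M.submodule_subset[OF power_span_submodule[OF a]] by blast
  have xc: "x \<in> carrier E" using x y a by simp
  show ?case
  proof (cases "s \<in> \<mm>")
    case False
    then have u: "s \<in> Units S" using unit_if_notin_m x(2) by blast
    have "x = s \<odot>\<^bsub>E\<^esub> a [^]\<^bsub>E\<^esub> (0::nat) \<oplus>\<^bsub>E\<^esub> a [^]\<^bsub>E\<^esub> Suc 0 \<otimes>\<^bsub>E\<^esub> y" using x a y by simp
    then show ?thesis
      using u y power_span_commute[OF a x(3)] congr_refl[OF xc] by (metis zero_less_Suc)
  next
    case True
    have s: "s \<odot>\<^bsub>E\<^esub> \<one>\<^bsub>E\<^esub> \<in> Fil 1" using M.ideal_times_mem[of s "mpow 1"] True by (simp add: mpow_1)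
    have cx: "congr 1 x (a \<otimes>\<^bsub>E\<^esub> y)"
    proof -
      have "x \<ominus>\<^bsub>E\<^esub> a \<otimes>\<^bsub>E\<^esub> y = s \<odot>\<^bsub>E\<^esub> \<one>\<^bsub>E\<^esub>" unfolding x(1) using x(2) y a
        by (simp add: a_minus_def M.M.a_assoc M.M.r_neg)
      then show ?thesis unfolding congr_def using s by simp
    qed
    from Suc.IH[OF x(3)] show ?thesis
    proof
      assume "y \<in> Fil 1"
      then have "a \<otimes>\<^bsub>E\<^esub> y \<in> Fil 1" using Fil_mult_l a by blast
      then have "x \<in> Fil 1" unfolding x(1) using s M.submodule_add[OF Fil_submodule] by blast
      then show ?thesis ..
    next
      assume "\<exists>r<n. \<exists>u\<in>Units S. \<exists>c\<in>carrier E. a \<otimes>\<^bsub>E\<^esub> c = c \<otimes>\<^bsub>E\<^esub> a \<and>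
        congr 1 y (u \<odot>\<^bsub>E\<^esub> a [^]\<^bsub>E\<^esub> r \<oplus>\<^bsub>E\<^esub> a [^]\<^bsub>E\<^esub> Suc r \<otimes>\<^bsub>E\<^esub> c)"
      then obtain r u c where r: "r < n" "u \<in> Units S" "c \<in> carrier E" "a \<otimes>\<^bsub>E\<^esub> c = c \<otimes>\<^bsub>E\<^esub> a"
        "congr 1 y (u \<odot>\<^bsub>E\<^esub> a [^]\<^bsub>E\<^esub> r \<oplus>\<^bsub>E\<^esub> a [^]\<^bsub>E\<^esub> Suc r \<otimes>\<^bsub>E\<^esub> c)" by blast
      let ?z = "u \<odot>\<^bsub>E\<^esub> a [^]\<^bsub>E\<^esub> r \<oplus>\<^bsub>E\<^esub> a [^]\<^bsub>E\<^esub> Suc r \<otimes>\<^bsub>E\<^esub> c"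
      have u: "u \<in> carrier S" using r(2) by blast
      have pc: "a [^]\<^bsub>E\<^esub> k \<in> carrier E" for k :: nat using a by simp
      have zc: "?z \<in> carrier E" using u a pc r(3) by (intro M.M.a_closed M.smult_closed E.m_closed) auto
      have "a \<otimes>\<^bsub>E\<^esub> ?z = u \<odot>\<^bsub>E\<^esub> (a \<otimes>\<^bsub>E\<^esub> a [^]\<^bsub>E\<^esub> r) \<oplus>\<^bsub>E\<^esub> (a \<otimes>\<^bsub>E\<^esub> a [^]\<^bsub>E\<^esub> Suc r) \<otimes>\<^bsub>E\<^esub> c"
        using u pc[of r] pc[of "Suc r"] r(3) a
        by (simp add: E.r_distr smult_mult_r E.m_assoc[symmetric] del: E.nat_pow_Suc)
      then have "a \<otimes>\<^bsub>E\<^esub> ?z = u \<odot>\<^bsub>E\<^esub> a [^]\<^bsub>E\<^esub> Suc r \<oplus>\<^bsub>E\<^esub> a [^]\<^bsub>E\<^esub> Suc (Suc r) \<otimes>\<^bsub>E\<^esub> c"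
        by (simp only: E.nat_pow_Suc2[OF a, symmetric])
      moreover have "congr 1 x (a \<otimes>\<^bsub>E\<^esub> ?z)"
        by (rule congr_trans[OF cx congr_mult_l[OF r(5)]]) (use a y zc xc in auto)
      ultimately show ?thesis using r by (metis Suc_less_eq)
    qed
  qed
qed

lemma power_congr:
  assumes a: "a \<in> carrier E"
  shows "\<exists>r::nat. \<exists>c\<in>carrier E. a \<otimes>\<^bsub>E\<^esub> c = c \<otimes>\<^bsub>E\<^esub> a \<and> congr 1 (a [^]\<^bsub>E\<^esub> r) (a [^]\<^bsub>E\<^esub> r \<otimes>\<^bsub>E\<^esub> (a \<otimes>\<^bsub>E\<^esub> c))"
proof -
  have pc: "a [^]\<^bsub>E\<^esub> k \<in> carrier E" for k :: nat using a by simp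
  have inc: "power_span a n \<subseteq> power_span a (Suc n)" for n
  proof (induction n)
    case 0
    then show ?case using M.submodule_zero[OF power_span_submodule[OF a, of "Suc 0"]] by simp
  next
    case (Suc n)
    have "x \<in> power_span a (Suc (Suc n))" if xs: "x \<in> power_span a (Suc n)" for x
    proof -
      obtain s y where x: "x = s \<odot>\<^bsub>E\<^esub> \<one>\<^bsub>E\<^esub> \<oplus>\<^bsub>E\<^esub> a \<otimes>\<^bsub>E\<^esub> y" "s \<in> carrier S" "y \<in> power_span a n"
        using xs unfolding power_span.simps by blast
      then have "y \<in> power_span a (Suc n)" using Suc by blast
      then show ?thesis unfolding power_span.simps(2)[of a "Suc n"] using x by blast
    qed
    then show ?case by (rule subsetI)
  qed
  have "\<exists>N\<in>range (power_span a). \<forall>L\<in>range (power_span a). N \<subseteq> L \<longrightarrow> L = N"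
    by (rule submodules_maximal) (auto intro: power_span_submodule[OF a])
  then obtain d where "\<forall>L\<in>range (power_span a). power_span a d \<subseteq> L \<longrightarrow> L = power_span a d"
    by (auto simp only: image_iff bex_simps)
  then have d: "power_span a (Suc d) = power_span a d" using inc[of d] by blast
  have "a [^]\<^bsub>E\<^esub> d \<in> power_span a d" using power_in_power_span[OF a, of d] unfolding d .
  from power_span_leading[OF a this] show ?thesis
  proof
    assume *: "a [^]\<^bsub>E\<^esub> d \<in> Fil 1"
    then have "a [^]\<^bsub>E\<^esub> d \<otimes>\<^bsub>E\<^esub> (a \<otimes>\<^bsub>E\<^esub> \<zero>\<^bsub>E\<^esub>) = \<zero>\<^bsub>E\<^esub>" using a pc by simp
    then have "congr 1 (a [^]\<^bsub>E\<^esub> d) (a [^]\<^bsub>E\<^esub> d \<otimes>\<^bsub>E\<^esub> (a \<otimes>\<^bsub>E\<^esub> \<zero>\<^bsub>E\<^esub>))"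
      unfolding congr_def using * pc by (simp add: a_minus_def)
    then show ?thesis using a by (intro exI[of _ d] bexI[of _ "\<zero>\<^bsub>E\<^esub>"]) auto
  next
    assume "\<exists>r<d. \<exists>u\<in>Units S. \<exists>c\<in>carrier E. a \<otimes>\<^bsub>E\<^esub> c = c \<otimes>\<^bsub>E\<^esub> a \<and>
      congr 1 (a [^]\<^bsub>E\<^esub> d) (u \<odot>\<^bsub>E\<^esub> a [^]\<^bsub>E\<^esub> r \<oplus>\<^bsub>E\<^esub> a [^]\<^bsub>E\<^esub> Suc r \<otimes>\<^bsub>E\<^esub> c)"
    then obtain r u c where r: "r < d" "u \<in> Units S" "c \<in> carrier E" "a \<otimes>\<^bsub>E\<^esub> c = c \<otimes>\<^bsub>E\<^esub> a"
      "congr 1 (a [^]\<^bsub>E\<^esub> d) (u \<odot>\<^bsub>E\<^esub> a [^]\<^bsub>E\<^esub> r \<oplus>\<^bsub>E\<^esub> a [^]\<^bsub>E\<^esub> Suc r \<otimes>\<^bsub>E\<^esub> c)" by blast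
    let ?p = "a [^]\<^bsub>E\<^esub> r" and ?q = "a [^]\<^bsub>E\<^esub> (d - Suc r)"
    have u: "u \<in> carrier S" "inv u \<in> carrier S" "inv u \<otimes> u = \<one>" using r(2) by auto
    have qa: "a \<otimes>\<^bsub>E\<^esub> ?q = ?q \<otimes>\<^bsub>E\<^esub> a" using E.nat_pow_Suc2[OF a] by simp
    have dp: "a [^]\<^bsub>E\<^esub> d = ?p \<otimes>\<^bsub>E\<^esub> (a \<otimes>\<^bsub>E\<^esub> ?q)"
    proof -
      have "a [^]\<^bsub>E\<^esub> d = a [^]\<^bsub>E\<^esub> (r + Suc (d - Suc r))" using r(1) by simp
      also have "\<dots> = ?p \<otimes>\<^bsub>E\<^esub> a [^]\<^bsub>E\<^esub> Suc (d - Suc r)" by (rule E.nat_pow_mult[OF a, symmetric])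
      finally show ?thesis using E.nat_pow_Suc2[OF a] by simp
    qed
    have sp: "a [^]\<^bsub>E\<^esub> Suc r \<otimes>\<^bsub>E\<^esub> c = ?p \<otimes>\<^bsub>E\<^esub> (a \<otimes>\<^bsub>E\<^esub> c)" using a r(3) pc[of r] by (simp add: E.m_assoc)
    let ?c = "inv u \<odot>\<^bsub>E\<^esub> (?q \<ominus>\<^bsub>E\<^esub> c)"
    have cc: "?c \<in> carrier E" using u pc r(3) by simp
    have comm: "a \<otimes>\<^bsub>E\<^esub> ?c = ?c \<otimes>\<^bsub>E\<^esub> a"
      using u a pc[of "d - Suc r"] r(3,4) qa
      by (simp add: smult_mult_l smult_mult_r a_minus_def E.r_distr E.l_distr E.r_minus E.l_minus)
    have "?p \<ominus>\<^bsub>E\<^esub> ?p \<otimes>\<^bsub>E\<^esub> (a \<otimes>\<^bsub>E\<^esub> ?c)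
        = (\<ominus> (inv u)) \<odot>\<^bsub>E\<^esub> (a [^]\<^bsub>E\<^esub> d \<ominus>\<^bsub>E\<^esub> (u \<odot>\<^bsub>E\<^esub> ?p \<oplus>\<^bsub>E\<^esub> a [^]\<^bsub>E\<^esub> Suc r \<otimes>\<^bsub>E\<^esub> c))"
    proof -
      let ?aq = "?p \<otimes>\<^bsub>E\<^esub> (a \<otimes>\<^bsub>E\<^esub> ?q)" and ?ac = "?p \<otimes>\<^bsub>E\<^esub> (a \<otimes>\<^bsub>E\<^esub> c)"
      have car: "?aq \<in> carrier E" "?ac \<in> carrier E" "?p \<in> carrier E" using a pc r(3) by auto
      have "?p \<otimes>\<^bsub>E\<^esub> (a \<otimes>\<^bsub>E\<^esub> ?c) = inv u \<odot>\<^bsub>E\<^esub> (?aq \<ominus>\<^bsub>E\<^esub> ?ac)"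
        using u a pc[of "d - Suc r"] pc[of r] r(3)
        by (simp add: smult_mult_r a_minus_def E.r_distr E.r_minus)
      moreover have "?p = inv u \<odot>\<^bsub>E\<^esub> (u \<odot>\<^bsub>E\<^esub> ?p)"
        using M.smult_assoc1[OF u(2,1) car(3)] u(3) car by simp
      ultimately have "?p \<ominus>\<^bsub>E\<^esub> ?p \<otimes>\<^bsub>E\<^esub> (a \<otimes>\<^bsub>E\<^esub> ?c)
          = inv u \<odot>\<^bsub>E\<^esub> (u \<odot>\<^bsub>E\<^esub> ?p) \<ominus>\<^bsub>E\<^esub> inv u \<odot>\<^bsub>E\<^esub> (?aq \<ominus>\<^bsub>E\<^esub> ?ac)" by simp
      then show ?thesis
        unfolding dp sp using u car
        by (simp add: a_minus_def M.smult_l_minus M.smult_r_minus M.smult_r_distr M.M.minus_add M.M.a_ac)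
    qed
    then have "congr 1 ?p (?p \<otimes>\<^bsub>E\<^esub> (a \<otimes>\<^bsub>E\<^esub> ?c))"
      using r(5) u M.submodule_smult[OF Fil_submodule] unfolding congr_def by simp
    then show ?thesis using comm cc by blast
  qed
qed

text \<open>\<open>3e\<^sup>2 - 2e\<^sup>3\<close>, a Newton step for the equation \<open>e\<^sup>2 = e\<close>\<close>

definition newton :: "'b \<Rightarrow> 'b"
  where "newton e = (e \<otimes>\<^bsub>E\<^esub> e) \<otimes>\<^bsub>E\<^esub> (\<one>\<^bsub>E\<^esub> \<oplus>\<^bsub>E\<^esub> ((\<one>\<^bsub>E\<^esub> \<ominus>\<^bsub>E\<^esub> e) \<oplus>\<^bsub>E\<^esub> (\<one>\<^bsub>E\<^esub> \<ominus>\<^bsub>E\<^esub> e)))"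

lemma newton_step:
  assumes e: "e \<in> carrier E" and ef: "e \<otimes>\<^bsub>E\<^esub> (\<one>\<^bsub>E\<^esub> \<ominus>\<^bsub>E\<^esub> e) \<in> Fil k"
  shows "congr k (newton e) e" "newton e \<otimes>\<^bsub>E\<^esub> (\<one>\<^bsub>E\<^esub> \<ominus>\<^bsub>E\<^esub> newton e) \<in> Fil (k + k)"
proof -
  define f where "f = \<one>\<^bsub>E\<^esub> \<ominus>\<^bsub>E\<^esub> e"
  have f: "f \<in> carrier E" unfolding f_def using e by simp
  have fe: "f \<otimes>\<^bsub>E\<^esub> e = e \<otimes>\<^bsub>E\<^esub> f"
    unfolding f_def using e by (simp add: a_minus_def E.l_distr E.r_distr E.l_minus E.r_minus)
  have one: "\<one>\<^bsub>E\<^esub> = e \<oplus>\<^bsub>E\<^esub> f" unfolding f_def using M.add_diff_cancel e by simp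
  have n: "newton e = (e \<otimes>\<^bsub>E\<^esub> e) \<otimes>\<^bsub>E\<^esub> (e \<oplus>\<^bsub>E\<^esub> (f \<oplus>\<^bsub>E\<^esub> (f \<oplus>\<^bsub>E\<^esub> f)))"
    unfolding newton_def f_def[symmetric] using one e f by (simp add: M.M.a_assoc)
  have nc: "newton e \<in> carrier E" unfolding n using e f by simp
  have fe': "f \<otimes>\<^bsub>E\<^esub> (e \<otimes>\<^bsub>E\<^esub> x) = e \<otimes>\<^bsub>E\<^esub> (f \<otimes>\<^bsub>E\<^esub> x)" if "x \<in> carrier E" for x
    using fe e f that by (metis E.m_assoc)
  have one3: "\<one>\<^bsub>E\<^esub> = (e \<oplus>\<^bsub>E\<^esub> f) \<otimes>\<^bsub>E\<^esub> ((e \<oplus>\<^bsub>E\<^esub> f) \<otimes>\<^bsub>E\<^esub> (e \<oplus>\<^bsub>E\<^esub> f))" by (simp add: one[symmetric])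
  let ?g = "(f \<otimes>\<^bsub>E\<^esub> f) \<otimes>\<^bsub>E\<^esub> (f \<oplus>\<^bsub>E\<^esub> (e \<oplus>\<^bsub>E\<^esub> (e \<oplus>\<^bsub>E\<^esub> e)))"
  have gc: "?g \<in> carrier E" using e f by simp
  have sum: "newton e \<oplus>\<^bsub>E\<^esub> ?g = \<one>\<^bsub>E\<^esub>"
    unfolding n one3 using e f by (simp add: E.l_distr E.r_distr E.m_assoc fe fe' M.M.a_ac)
  have gn: "\<one>\<^bsub>E\<^esub> \<ominus>\<^bsub>E\<^esub> newton e = ?g"
    unfolding sum[symmetric] using gc nc by (simp add: a_minus_def M.M.a_ac M.M.r_neg1 M.M.r_neg2 M.add_diff_cancel[unfolded a_minus_def])
  have ef': "e \<otimes>\<^bsub>E\<^esub> f \<in> Fil k" using ef f_def by simp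
  let ?h1 = "e \<oplus>\<^bsub>E\<^esub> (f \<oplus>\<^bsub>E\<^esub> (f \<oplus>\<^bsub>E\<^esub> f))" and ?h2 = "f \<oplus>\<^bsub>E\<^esub> (e \<oplus>\<^bsub>E\<^esub> (e \<oplus>\<^bsub>E\<^esub> e))"
  have "newton e \<otimes>\<^bsub>E\<^esub> ?g = ((e \<otimes>\<^bsub>E\<^esub> f) \<otimes>\<^bsub>E\<^esub> (e \<otimes>\<^bsub>E\<^esub> f)) \<otimes>\<^bsub>E\<^esub> (?h1 \<otimes>\<^bsub>E\<^esub> ?h2)"
    unfolding n using e f by (simp add: E.l_distr E.r_distr E.m_assoc fe fe' M.M.a_ac)
  moreover have "((e \<otimes>\<^bsub>E\<^esub> f) \<otimes>\<^bsub>E\<^esub> (e \<otimes>\<^bsub>E\<^esub> f)) \<otimes>\<^bsub>E\<^esub> (?h1 \<otimes>\<^bsub>E\<^esub> ?h2) \<in> Fil (k + k)"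
    using e f by (intro Fil_mult_r[OF Fil_mult[OF ef' ef']]) simp
  ultimately show "newton e \<otimes>\<^bsub>E\<^esub> (\<one>\<^bsub>E\<^esub> \<ominus>\<^bsub>E\<^esub> newton e) \<in> Fil (k + k)" unfolding gn by simp
  have ee: "e = e \<otimes>\<^bsub>E\<^esub> ((e \<oplus>\<^bsub>E\<^esub> f) \<otimes>\<^bsub>E\<^esub> (e \<oplus>\<^bsub>E\<^esub> f))" using e by (simp add: one[symmetric])
  have "newton e \<ominus>\<^bsub>E\<^esub> e = (e \<otimes>\<^bsub>E\<^esub> f) \<otimes>\<^bsub>E\<^esub> (e \<ominus>\<^bsub>E\<^esub> f)"
  proof -
    have "newton e = (e \<otimes>\<^bsub>E\<^esub> f) \<otimes>\<^bsub>E\<^esub> (e \<ominus>\<^bsub>E\<^esub> f) \<oplus>\<^bsub>E\<^esub> e \<otimes>\<^bsub>E\<^esub> ((e \<oplus>\<^bsub>E\<^esub> f) \<otimes>\<^bsub>E\<^esub> (e \<oplus>\<^bsub>E\<^esub> f))"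
      unfolding n using e f
      by (simp add: a_minus_def E.l_distr E.r_distr E.l_minus E.r_minus E.m_assoc fe fe' M.M.a_ac M.M.r_neg1 M.M.r_neg2 M.M.r_neg)
    then have "newton e = (e \<otimes>\<^bsub>E\<^esub> f) \<otimes>\<^bsub>E\<^esub> (e \<ominus>\<^bsub>E\<^esub> f) \<oplus>\<^bsub>E\<^esub> e" using ee by simp
    then show ?thesis using e f by (simp add: a_minus_def M.M.a_assoc M.M.r_neg)
  qed
  moreover have "(e \<otimes>\<^bsub>E\<^esub> f) \<otimes>\<^bsub>E\<^esub> (e \<ominus>\<^bsub>E\<^esub> f) \<in> Fil k" using e f by (intro Fil_mult_r[OF ef']) simp
  ultimately show "congr k (newton e) e" unfolding congr_def by simp
qed

lemma idempotent_lift: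
  assumes e0: "e0 \<in> carrier E" and id: "congr 1 (e0 \<otimes>\<^bsub>E\<^esub> e0) e0"
  obtains e where "e \<in> carrier E" "e \<otimes>\<^bsub>E\<^esub> e = e" "congr 1 e e0"
    "\<And>x. x \<in> carrier E \<Longrightarrow> x \<otimes>\<^bsub>E\<^esub> e0 = e0 \<otimes>\<^bsub>E\<^esub> x \<Longrightarrow> x \<otimes>\<^bsub>E\<^esub> e = e \<otimes>\<^bsub>E\<^esub> x"
proof -
  define s where "s k = (newton ^^ k) e0" for k
  have s0: "s 0 = e0" and sS: "s (Suc k) = newton (s k)" for k unfolding s_def by simp_all
  have newton_closed: "newton e \<in> carrier E" if "e \<in> carrier E" for e
    unfolding newton_def using that by simp
  have sc: "s k \<in> carrier E" for k
    by (induction k) (simp_all add: s0 sS e0 newton_closed)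
  have s_idem: "s k \<otimes>\<^bsub>E\<^esub> (\<one>\<^bsub>E\<^esub> \<ominus>\<^bsub>E\<^esub> s k) \<in> Fil (Suc k)" for k
  proof (induction k)
    case 0
    have "e0 \<otimes>\<^bsub>E\<^esub> (\<one>\<^bsub>E\<^esub> \<ominus>\<^bsub>E\<^esub> e0) = e0 \<ominus>\<^bsub>E\<^esub> e0 \<otimes>\<^bsub>E\<^esub> e0"
      using e0 by (simp add: a_minus_def E.r_distr E.r_minus)
    then show ?case using congr_sym[OF id] e0 unfolding s0 congr_def by simp
  next
    case (Suc k)
    have "newton (s k) \<otimes>\<^bsub>E\<^esub> (\<one>\<^bsub>E\<^esub> \<ominus>\<^bsub>E\<^esub> newton (s k)) \<in> Fil (Suc k + Suc k)"
      by (rule newton_step(2)[OF sc Suc])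
    moreover have "Fil (Suc k + Suc k) \<subseteq> Fil (Suc (Suc k))" by (rule Fil_decreasing) simp
    ultimately show ?case unfolding sS by blast
  qed
  have s_step: "congr (Suc k) (s (Suc k)) (s k)" for k
    unfolding sS by (rule newton_step(1)[OF sc s_idem])
  obtain e where e: "e \<in> carrier E" "\<And>k. e \<ominus>\<^bsub>E\<^esub> s k \<in> Fil k"
  proof (rule Fil_complete[of s])
    show "s (Suc k) \<ominus>\<^bsub>E\<^esub> s k \<in> Fil k" for k
      using congr_mono[OF s_step[of k], of k] unfolding congr_def by simp
  qed (use sc in blast)+
  have es: "congr k e (s k)" for k unfolding congr_def by (rule e(2))
  show ?thesis
  proof
    show "e \<in> carrier E" by fact
    show "e \<otimes>\<^bsub>E\<^esub> e = e"
    proof (rule congr_all_eq)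
      fix k
      have "s k \<ominus>\<^bsub>E\<^esub> s k \<otimes>\<^bsub>E\<^esub> s k = s k \<otimes>\<^bsub>E\<^esub> (\<one>\<^bsub>E\<^esub> \<ominus>\<^bsub>E\<^esub> s k)"
        using sc[of k] by (simp add: a_minus_def E.r_distr E.r_minus)
      then have "congr k (s k) (s k \<otimes>\<^bsub>E\<^esub> s k)"
        using s_idem[of k] Fil_decreasing[of k "Suc k"] unfolding congr_def by auto
      then have 1: "congr k (s k \<otimes>\<^bsub>E\<^esub> s k) (s k)" by (rule congr_sym) (use sc in auto)
      have 2: "congr k (e \<otimes>\<^bsub>E\<^esub> e) (s k \<otimes>\<^bsub>E\<^esub> s k)" by (rule congr_mult[OF es es]) (use e sc in auto)
      have 3: "congr k (s k) e" by (rule congr_sym[OF es]) (use e sc in auto)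
      show "congr k (e \<otimes>\<^bsub>E\<^esub> e) e"
        by (rule congr_trans[OF congr_trans[OF 2 1] 3]) (use e sc in auto)
    qed (use e in auto)
    have "congr 1 (s 1) e0" using s_step[of 0] s0 by simp
    then show "congr 1 e e0" by (rule congr_trans[OF es]) (use e sc e0 in auto)
    fix x assume x: "x \<in> carrier E" "x \<otimes>\<^bsub>E\<^esub> e0 = e0 \<otimes>\<^bsub>E\<^esub> x"
    have newton_comm: "x \<otimes>\<^bsub>E\<^esub> newton y = newton y \<otimes>\<^bsub>E\<^esub> x"
      if y: "y \<in> carrier E" and xy: "x \<otimes>\<^bsub>E\<^esub> y = y \<otimes>\<^bsub>E\<^esub> x" for y
    proof -
      have xyz: "x \<otimes>\<^bsub>E\<^esub> (y \<otimes>\<^bsub>E\<^esub> z) = y \<otimes>\<^bsub>E\<^esub> (x \<otimes>\<^bsub>E\<^esub> z)" if "z \<in> carrier E" for z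
        using that y xy x(1) by (metis E.m_assoc)
      show ?thesis
        unfolding newton_def using x(1) y
        by (simp add: a_minus_def E.l_distr E.r_distr E.l_minus E.r_minus E.m_assoc xy xyz)
    qed
    have sx: "x \<otimes>\<^bsub>E\<^esub> s k = s k \<otimes>\<^bsub>E\<^esub> x" for k
      by (induction k) (simp_all add: s0 sS x newton_comm sc)
    show "x \<otimes>\<^bsub>E\<^esub> e = e \<otimes>\<^bsub>E\<^esub> x"
    proof (rule congr_all_eq)
      fix k
      have 1: "congr k (x \<otimes>\<^bsub>E\<^esub> e) (s k \<otimes>\<^bsub>E\<^esub> x)"
        unfolding sx[symmetric] by (rule congr_mult_l[OF es]) (use e sc x in auto)
      have 2: "congr k (s k \<otimes>\<^bsub>E\<^esub> x) (e \<otimes>\<^bsub>E\<^esub> x)"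
        by (rule congr_mult_r[OF congr_sym[OF es]]) (use e sc x in auto)
      show "congr k (x \<otimes>\<^bsub>E\<^esub> e) (e \<otimes>\<^bsub>E\<^esub> x)"
        by (rule congr_trans[OF 1 2]) (use e sc x in auto)
    qed (use e x in auto)
  qed
qed

lemma fitting:
  assumes a: "a \<in> carrier E"
  obtains e w r where "e \<in> carrier E" "w \<in> carrier E" "e \<otimes>\<^bsub>E\<^esub> e = e" "a \<otimes>\<^bsub>E\<^esub> e = e \<otimes>\<^bsub>E\<^esub> a"
    "a \<otimes>\<^bsub>E\<^esub> w = e" "w \<otimes>\<^bsub>E\<^esub> a = e" "e \<otimes>\<^bsub>E\<^esub> w = w" "w \<otimes>\<^bsub>E\<^esub> e = w"
    "a [^]\<^bsub>E\<^esub> (r::nat) \<otimes>\<^bsub>E\<^esub> (\<one>\<^bsub>E\<^esub> \<ominus>\<^bsub>E\<^esub> e) \<in> Fil 1"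
proof -
  obtain r :: nat and c where c: "c \<in> carrier E" "a \<otimes>\<^bsub>E\<^esub> c = c \<otimes>\<^bsub>E\<^esub> a"
    and cr: "congr 1 (a [^]\<^bsub>E\<^esub> r) (a [^]\<^bsub>E\<^esub> r \<otimes>\<^bsub>E\<^esub> (a \<otimes>\<^bsub>E\<^esub> c))"
    using power_congr[OF a] by blast
  define z where "z = a \<otimes>\<^bsub>E\<^esub> c"
  have zc: "z \<in> carrier E" unfolding z_def using a c by simp
  have pc: "x [^]\<^bsub>E\<^esub> k \<in> carrier E" if "x \<in> carrier E" for x and k :: nat using that by simp
  have acz: "a \<otimes>\<^bsub>E\<^esub> z = z \<otimes>\<^bsub>E\<^esub> a" "c \<otimes>\<^bsub>E\<^esub> z = z \<otimes>\<^bsub>E\<^esub> c"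
    unfolding z_def using a c by (simp_all add: E.m_assoc c(2)[symmetric]) (metis E.m_assoc c)
  define p where "p = a [^]\<^bsub>E\<^esub> r"
  have p: "p \<in> carrier E" unfolding p_def using a by simp
  have pz: "congr 1 p (p \<otimes>\<^bsub>E\<^esub> z [^]\<^bsub>E\<^esub> j)" for j :: nat
  proof (induction j)
    case 0
    show ?case using p congr_refl by simp
  next
    case (Suc j)
    have "congr 1 (p \<otimes>\<^bsub>E\<^esub> z) (p \<otimes>\<^bsub>E\<^esub> z [^]\<^bsub>E\<^esub> j \<otimes>\<^bsub>E\<^esub> z)"
      by (rule congr_mult_r[OF Suc]) (use p zc in auto)
    then have "congr 1 (p \<otimes>\<^bsub>E\<^esub> z) (p \<otimes>\<^bsub>E\<^esub> z [^]\<^bsub>E\<^esub> Suc j)"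
      using p zc by (simp add: E.m_assoc)
    then show ?case
      by (rule congr_trans[OF cr[folded p_def z_def]]) (use p zc in auto)
  qed
  define e0 where "e0 = z [^]\<^bsub>E\<^esub> Suc r"
  have e0: "e0 \<in> carrier E" unfolding e0_def using zc by simp
  have e0_eq: "e0 = (c [^]\<^bsub>E\<^esub> Suc r \<otimes>\<^bsub>E\<^esub> a) \<otimes>\<^bsub>E\<^esub> p"
  proof -
    have "e0 = c [^]\<^bsub>E\<^esub> Suc r \<otimes>\<^bsub>E\<^esub> a [^]\<^bsub>E\<^esub> Suc r"
      unfolding e0_def z_def c(2) by (rule E.pow_mult_distrib[OF c(2)[symmetric] c(1) a])
    also have "a [^]\<^bsub>E\<^esub> Suc r = a \<otimes>\<^bsub>E\<^esub> p" unfolding p_def by (rule E.nat_pow_Suc2[OF a])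
    finally show ?thesis using a c p pc[OF c(1), of "Suc r"] by (simp add: E.m_assoc del: E.nat_pow_Suc)
  qed
  let ?q = "c [^]\<^bsub>E\<^esub> Suc r \<otimes>\<^bsub>E\<^esub> a"
  have q: "?q \<in> carrier E" using a c by (intro E.m_closed pc)
  have "congr 1 (?q \<otimes>\<^bsub>E\<^esub> p) (?q \<otimes>\<^bsub>E\<^esub> (p \<otimes>\<^bsub>E\<^esub> e0))"
    unfolding e0_def by (rule congr_mult_l[OF pz p]) (use p zc q in auto)
  then have "congr 1 e0 (e0 \<otimes>\<^bsub>E\<^esub> e0)"
    using E.m_assoc[OF q p e0] e0_eq by simp
  then have id: "congr 1 (e0 \<otimes>\<^bsub>E\<^esub> e0) e0" by (rule congr_sym) (use e0 in auto)
  obtain e where e: "e \<in> carrier E" "e \<otimes>\<^bsub>E\<^esub> e = e" "congr 1 e e0"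
    and comm: "\<And>x. x \<in> carrier E \<Longrightarrow> x \<otimes>\<^bsub>E\<^esub> e0 = e0 \<otimes>\<^bsub>E\<^esub> x \<Longrightarrow> x \<otimes>\<^bsub>E\<^esub> e = e \<otimes>\<^bsub>E\<^esub> x"
    using idempotent_lift[OF e0 id] by metis
  have pow_comm: "x \<otimes>\<^bsub>E\<^esub> y [^]\<^bsub>E\<^esub> n = y [^]\<^bsub>E\<^esub> n \<otimes>\<^bsub>E\<^esub> x"
    if "x \<in> carrier E" "y \<in> carrier E" "x \<otimes>\<^bsub>E\<^esub> y = y \<otimes>\<^bsub>E\<^esub> x" for x y and n :: nat
    using E.group_commutes_pow[OF that(3)[symmetric] that(2,1), of n] by simp
  have ae: "a \<otimes>\<^bsub>E\<^esub> e = e \<otimes>\<^bsub>E\<^esub> a"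
    by (rule comm[OF a]) (unfold e0_def, rule pow_comm[OF a zc acz(1)])
  have ce: "c \<otimes>\<^bsub>E\<^esub> e = e \<otimes>\<^bsub>E\<^esub> c"
    by (rule comm[OF c(1)]) (unfold e0_def, rule pow_comm[OF c(1) zc acz(2)])
  let ?f = "\<one>\<^bsub>E\<^esub> \<ominus>\<^bsub>E\<^esub> e"
  have fc: "?f \<in> carrier E" using e by simp
  have ef: "e \<otimes>\<^bsub>E\<^esub> ?f = \<zero>\<^bsub>E\<^esub>" "?f \<otimes>\<^bsub>E\<^esub> e = \<zero>\<^bsub>E\<^esub>" "?f \<otimes>\<^bsub>E\<^esub> ?f = ?f"
    using e by (simp_all add: a_minus_def E.l_distr E.r_distr E.l_minus E.r_minus M.M.r_neg M.M.a_ac)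
  define h where "h = c \<otimes>\<^bsub>E\<^esub> z [^]\<^bsub>E\<^esub> r"
  have hc: "h \<in> carrier E" unfolding h_def using c zc by simp
  have ah: "a \<otimes>\<^bsub>E\<^esub> h = e0"
    unfolding h_def e0_def using a c zc E.nat_pow_Suc2[OF zc, of r]
    by (simp add: E.m_assoc[symmetric] z_def[symmetric] del: E.nat_pow_Suc)
  have ha: "h \<otimes>\<^bsub>E\<^esub> a = e0"
  proof -
    have "h \<otimes>\<^bsub>E\<^esub> a = c \<otimes>\<^bsub>E\<^esub> (a \<otimes>\<^bsub>E\<^esub> z [^]\<^bsub>E\<^esub> r)"
      unfolding h_def using a c zc pow_comm[OF a zc acz(1), of r] by (simp add: E.m_assoc)
    also have "\<dots> = z \<otimes>\<^bsub>E\<^esub> z [^]\<^bsub>E\<^esub> r"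
      unfolding z_def c(2) using a c zc by (simp add: E.m_assoc)
    finally show ?thesis unfolding e0_def using E.nat_pow_Suc2[OF zc, of r] by simp
  qed
  have ze: "z \<otimes>\<^bsub>E\<^esub> e = e \<otimes>\<^bsub>E\<^esub> z"
    unfolding z_def using a c e ae ce by (metis E.m_assoc)
  have he: "h \<otimes>\<^bsub>E\<^esub> e = e \<otimes>\<^bsub>E\<^esub> h"
    unfolding h_def using c e zc ce pow_comm[OF e(1) zc ze[symmetric], of r] E.nat_pow_closed[OF zc, of r]
    by (metis E.m_assoc)
  let ?b = "a \<otimes>\<^bsub>E\<^esub> e \<oplus>\<^bsub>E\<^esub> ?f" and ?b' = "h \<otimes>\<^bsub>E\<^esub> e \<oplus>\<^bsub>E\<^esub> ?f"
  have bc: "?b \<in> carrier E" "?b' \<in> carrier E" using a e hc by auto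
  have prod: "(x \<otimes>\<^bsub>E\<^esub> e \<oplus>\<^bsub>E\<^esub> ?f) \<otimes>\<^bsub>E\<^esub> (y \<otimes>\<^bsub>E\<^esub> e \<oplus>\<^bsub>E\<^esub> ?f) = (x \<otimes>\<^bsub>E\<^esub> y) \<otimes>\<^bsub>E\<^esub> e \<oplus>\<^bsub>E\<^esub> ?f"
    if xy: "x \<in> carrier E" "y \<in> carrier E" "y \<otimes>\<^bsub>E\<^esub> e = e \<otimes>\<^bsub>E\<^esub> y" for x y
  proof -
    have 1: "(x \<otimes>\<^bsub>E\<^esub> e) \<otimes>\<^bsub>E\<^esub> (y \<otimes>\<^bsub>E\<^esub> e) = (x \<otimes>\<^bsub>E\<^esub> y) \<otimes>\<^bsub>E\<^esub> e"
      using xy e by (metis E.m_assoc E.m_closed)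
    have 2: "(x \<otimes>\<^bsub>E\<^esub> e) \<otimes>\<^bsub>E\<^esub> ?f = \<zero>\<^bsub>E\<^esub>"
      using xy(1) e(1) fc ef by (simp add: E.m_assoc)
    have 3: "?f \<otimes>\<^bsub>E\<^esub> (y \<otimes>\<^bsub>E\<^esub> e) = \<zero>\<^bsub>E\<^esub>"
      unfolding xy(3) using E.m_assoc[OF fc e(1) xy(2)] ef xy(2) by simp
    show ?thesis
      using xy e(1) fc 1 2 3 ef(3) by (simp add: E.l_distr E.r_distr del: E.r_minus)
  qed
  have near: "e0 \<otimes>\<^bsub>E\<^esub> e \<oplus>\<^bsub>E\<^esub> ?f \<in> Units E"
  proof -
    have "congr 1 (e0 \<otimes>\<^bsub>E\<^esub> e) (e \<otimes>\<^bsub>E\<^esub> e)"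
      by (rule congr_mult_r[OF congr_sym[OF e(3)]]) (use e e0 in auto)
    then have "congr 1 (e0 \<otimes>\<^bsub>E\<^esub> e \<oplus>\<^bsub>E\<^esub> ?f) (e \<oplus>\<^bsub>E\<^esub> ?f)"
      unfolding e(2) by (rule congr_add[OF _ congr_refl]) (use e e0 in auto)
    moreover have "e \<oplus>\<^bsub>E\<^esub> ?f = \<one>\<^bsub>E\<^esub>" using M.add_diff_cancel e by simp
    ultimately have "congr 1 \<one>\<^bsub>E\<^esub> (e0 \<otimes>\<^bsub>E\<^esub> e \<oplus>\<^bsub>E\<^esub> ?f)"
      using congr_sym e(1) e0 fc by simp
    then have "\<one>\<^bsub>E\<^esub> \<ominus>\<^bsub>E\<^esub> (\<one>\<^bsub>E\<^esub> \<ominus>\<^bsub>E\<^esub> (e0 \<otimes>\<^bsub>E\<^esub> e \<oplus>\<^bsub>E\<^esub> ?f)) \<in> Units E"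
      unfolding congr_def by (rule one_minus_Fil_unit)
    moreover have "\<one>\<^bsub>E\<^esub> \<ominus>\<^bsub>E\<^esub> (\<one>\<^bsub>E\<^esub> \<ominus>\<^bsub>E\<^esub> x) = x" if "x \<in> carrier E" for x
      using that by (simp add: a_minus_def M.M.minus_add M.M.r_neg M.M.r_neg2 M.M.a_assoc[symmetric])
    ultimately show ?thesis using e(1) e0 fc by simp
  qed
  have bb: "?b \<otimes>\<^bsub>E\<^esub> ?b' \<in> Units E" "?b' \<otimes>\<^bsub>E\<^esub> ?b \<in> Units E"
    using near prod[OF a hc he] prod[OF hc a ae] ah ha by simp_all
  obtain u where u: "u \<in> carrier E" "(?b \<otimes>\<^bsub>E\<^esub> ?b') \<otimes>\<^bsub>E\<^esub> u = \<one>\<^bsub>E\<^esub>" using bb(1) unfolding Units_def by auto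
  obtain u' where u': "u' \<in> carrier E" "u' \<otimes>\<^bsub>E\<^esub> (?b' \<otimes>\<^bsub>E\<^esub> ?b) = \<one>\<^bsub>E\<^esub>" using bb(2) unfolding Units_def by auto
  define v where "v = ?b' \<otimes>\<^bsub>E\<^esub> u"
  have v: "v \<in> carrier E" unfolding v_def using bc u by simp
  have bv: "?b \<otimes>\<^bsub>E\<^esub> v = \<one>\<^bsub>E\<^esub>" unfolding v_def using E.m_assoc[OF bc u(1)] u(2) by simp
  have "(u' \<otimes>\<^bsub>E\<^esub> ?b') \<otimes>\<^bsub>E\<^esub> ?b = \<one>\<^bsub>E\<^esub>" using E.m_assoc[OF u'(1) bc(2,1)] u'(2) by simp
  then have "u' \<otimes>\<^bsub>E\<^esub> ?b' = v" using E.inv_unique[OF _ bv, of "u' \<otimes>\<^bsub>E\<^esub> ?b'"] bc u' v by simp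
  then have vb: "v \<otimes>\<^bsub>E\<^esub> ?b = \<one>\<^bsub>E\<^esub>" using E.m_assoc[OF u'(1) bc(2,1)] u'(2) by simp
  have be: "?b \<otimes>\<^bsub>E\<^esub> e = a \<otimes>\<^bsub>E\<^esub> e" "e \<otimes>\<^bsub>E\<^esub> ?b = a \<otimes>\<^bsub>E\<^esub> e"
  proof -
    show "?b \<otimes>\<^bsub>E\<^esub> e = a \<otimes>\<^bsub>E\<^esub> e" using a e fc ef by (simp add: E.l_distr E.m_assoc)
    have "e \<otimes>\<^bsub>E\<^esub> (a \<otimes>\<^bsub>E\<^esub> e) = a \<otimes>\<^bsub>E\<^esub> e" using a e ae by (metis E.m_assoc)
    then show "e \<otimes>\<^bsub>E\<^esub> ?b = a \<otimes>\<^bsub>E\<^esub> e" using a e fc ef by (simp add: E.r_distr)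
  qed
  have ve: "v \<otimes>\<^bsub>E\<^esub> e = e \<otimes>\<^bsub>E\<^esub> v"
  proof -
    have "v \<otimes>\<^bsub>E\<^esub> e = v \<otimes>\<^bsub>E\<^esub> (e \<otimes>\<^bsub>E\<^esub> (?b \<otimes>\<^bsub>E\<^esub> v))" using bv e v by simp
    also have "\<dots> = (v \<otimes>\<^bsub>E\<^esub> (?b \<otimes>\<^bsub>E\<^esub> e)) \<otimes>\<^bsub>E\<^esub> v"
      using E.m_assoc[OF e(1) bc(1) v, symmetric] E.m_assoc[OF v E.m_closed[OF bc(1) e(1)] v]
      unfolding be by simp
    also have "v \<otimes>\<^bsub>E\<^esub> (?b \<otimes>\<^bsub>E\<^esub> e) = e" using E.m_assoc[OF v bc(1) e(1)] vb e by simp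
    finally show ?thesis .
  qed
  let ?w = "e \<otimes>\<^bsub>E\<^esub> v"
  show ?thesis
  proof (rule that[of e ?w r])
    show "a \<otimes>\<^bsub>E\<^esub> ?w = e"
    proof -
      have "a \<otimes>\<^bsub>E\<^esub> ?w = (a \<otimes>\<^bsub>E\<^esub> e) \<otimes>\<^bsub>E\<^esub> v" using a e v by (simp add: E.m_assoc)
      also have "\<dots> = e \<otimes>\<^bsub>E\<^esub> (?b \<otimes>\<^bsub>E\<^esub> v)" using be(2) E.m_assoc[OF e(1) bc(1) v] by simp
      finally show ?thesis using bv e by simp
    qed
    show "?w \<otimes>\<^bsub>E\<^esub> a = e"
    proof -
      have "?w \<otimes>\<^bsub>E\<^esub> a = v \<otimes>\<^bsub>E\<^esub> (a \<otimes>\<^bsub>E\<^esub> e)" using a e v ve ae by (simp add: E.m_assoc[symmetric])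
      also have "\<dots> = (v \<otimes>\<^bsub>E\<^esub> ?b) \<otimes>\<^bsub>E\<^esub> e" using be(1) E.m_assoc[OF v bc(1) e(1)] by simp
      finally show ?thesis using vb e by simp
    qed
    show "e \<otimes>\<^bsub>E\<^esub> ?w = ?w" using e v by (simp add: E.m_assoc[symmetric])
    show "?w \<otimes>\<^bsub>E\<^esub> e = ?w" using e v ve by (metis E.m_assoc E.m_closed)
    show "a [^]\<^bsub>E\<^esub> r \<otimes>\<^bsub>E\<^esub> (\<one>\<^bsub>E\<^esub> \<ominus>\<^bsub>E\<^esub> e) \<in> Fil 1"
    proof -
      have 1: "congr 1 p (p \<otimes>\<^bsub>E\<^esub> e0)" unfolding e0_def by (rule pz)
      have 2: "congr 1 (p \<otimes>\<^bsub>E\<^esub> e0) (p \<otimes>\<^bsub>E\<^esub> e)"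
        by (rule congr_mult_l[OF congr_sym[OF e(3)]]) (use e e0 p in auto)
      have "congr 1 p (p \<otimes>\<^bsub>E\<^esub> e)" by (rule congr_trans[OF 1 2]) (use e e0 p in auto)
      moreover have "p \<otimes>\<^bsub>E\<^esub> ?f = p \<ominus>\<^bsub>E\<^esub> p \<otimes>\<^bsub>E\<^esub> e" using p e by (simp add: a_minus_def E.r_distr E.r_minus)
      ultimately show ?thesis unfolding congr_def p_def by simp
    qed
  qed (use e v ae in auto)
qed

end

section \<open>Local rings\<close>

context ring
begin

lemma local_ring_one_neq_zero: "local_ring R \<Longrightarrow> \<one> \<noteq> \<zero>"
proof
  assume "local_ring R" "\<one> = \<zero>"
  then have "\<zero> \<in> carrier R - Units R"
    unfolding local_ring_def by (metis additive_subgroup.zero_closed ideal.axioms(1))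
  then show False using \<open>\<one> = \<zero>\<close> Units_one_closed by simp
qed

lemma local_ring_add_unit:
  assumes "local_ring R" "x \<in> carrier R" "y \<in> carrier R" "x \<oplus> y \<in> Units R"
  shows "x \<in> Units R \<or> y \<in> Units R"
proof (rule ccontr)
  assume "\<not> ?thesis"
  then have "x \<oplus> y \<in> carrier R - Units R"
    using assms unfolding local_ring_def
    by (metis Diff_iff additive_subgroup.a_closed ideal.axioms(1))
  then show False using assms(4) by simp
qed

lemma local_ring_idempotent:
  assumes "local_ring R" "e \<in> carrier R" "e \<otimes> e = e"
  shows "e = \<zero> \<or> e = \<one>"
proof -
  have s: "e \<oplus> (\<one> \<ominus> e) = \<one>" using assms(2) by (simp add: a_minus_def a_comm[of \<one>] r_neg2)
  have ef: "e \<otimes> (\<one> \<ominus> e) = \<zero>" using assms by (simp add: a_minus_def r_distr r_minus r_neg)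
  have fe: "(\<one> \<ominus> e) \<otimes> e = \<zero>" using assms by (simp add: a_minus_def l_distr l_minus r_neg)
  have "e \<in> Units R \<or> \<one> \<ominus> e \<in> Units R"
    using local_ring_add_unit[OF assms(1,2), of "\<one> \<ominus> e"] s assms(2) by simp
  then show ?thesis
  proof
    assume "e \<in> Units R"
    then obtain u where "u \<in> carrier R" "u \<otimes> e = \<one>" unfolding Units_def by blast
    then have "e = u \<otimes> (e \<otimes> e)" using assms(2) m_assoc[of u e e] by simp
    then show ?thesis using assms(3) \<open>u \<otimes> e = \<one>\<close> by simp
  next
    assume "\<one> \<ominus> e \<in> Units R"
    then obtain u where "u \<in> carrier R" "u \<otimes> (\<one> \<ominus> e) = \<one>" unfolding Units_def by blast
    then have "e = u \<otimes> ((\<one> \<ominus> e) \<otimes> e)" using assms(2) m_assoc[of u "\<one> \<ominus> e" e] by simp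
    then show ?thesis using fe \<open>u \<in> carrier R\<close> by simp
  qed
qed

lemma local_ring_finsum_unit:
  assumes "local_ring R" "finite A" "f \<in> A \<rightarrow> carrier R" "finsum R f A \<in> Units R"
  shows "\<exists>i\<in>A. f i \<in> Units R"
  using assms(2-)
proof (induction A rule: finite_induct)
  case empty
  then have "\<zero> \<in> Units R" by simp
  then show ?case using local_ring_one_neq_zero[OF assms(1)] by (metis Units_r_inv_ex l_null)
next
  case (insert i A)
  then have "f i \<oplus> finsum R f A \<in> Units R" by (simp add: Pi_def)
  then have "f i \<in> Units R \<or> finsum R f A \<in> Units R"
    using insert.prems(1) by (intro local_ring_add_unit[OF assms(1)]) auto
  then show ?case using insert by auto
qed

lemma local_ringI:
  assumes "\<one> \<noteq> \<zero>" and unit: "\<And>a. a \<in> carrier R \<Longrightarrow> a \<in> Units R \<or> \<one> \<ominus> a \<in> Units R"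
  shows "local_ring R"
proof -
  have left: "y \<in> Units R" if xy: "x \<in> carrier R" "y \<in> carrier R" "x \<otimes> y = \<one>" for x y
  proof -
    let ?e = "y \<otimes> x"
    have "?e \<otimes> ?e = y \<otimes> (x \<otimes> y) \<otimes> x" using xy(1,2) by (simp only: m_assoc m_closed)
    then have ee: "?e \<otimes> ?e = ?e" using xy by simp
    have "?e \<in> Units R \<or> \<one> \<ominus> ?e \<in> Units R" using unit xy by simp
    then have "?e = \<one>"
    proof
      assume "?e \<in> Units R"
      then obtain u where u: "u \<in> carrier R" "u \<otimes> ?e = \<one>" unfolding Units_def by blast
      have "?e = u \<otimes> ?e \<otimes> ?e" using u xy by simp
      also have "\<dots> = u \<otimes> (?e \<otimes> ?e)" using u(1) xy by (intro m_assoc) auto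
      finally show ?thesis using ee u by simp
    next
      assume "\<one> \<ominus> ?e \<in> Units R"
      then obtain u where u: "u \<in> carrier R" "u \<otimes> (\<one> \<ominus> ?e) = \<one>" unfolding Units_def by blast
      have "(\<one> \<ominus> ?e) \<otimes> y = y \<ominus> ?e \<otimes> y" using xy by (simp add: a_minus_def l_distr l_minus)
      also have "\<dots> = \<zero>" using xy m_assoc[of y x y] by (simp add: a_minus_def r_neg)
      finally have 0: "(\<one> \<ominus> ?e) \<otimes> y = \<zero>" .
      have "y = u \<otimes> (\<one> \<ominus> ?e) \<otimes> y" using u xy by simp
      also have "\<dots> = u \<otimes> ((\<one> \<ominus> ?e) \<otimes> y)" using u(1) xy by (intro m_assoc) auto
      also have "\<dots> = \<zero>" using 0 u by simp
      finally have "x \<otimes> y = \<zero>" using xy(1) by simp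
      then show ?thesis using xy(3) assms(1) by metis
    qed
    then show ?thesis using xy unfolding Units_def by auto
  qed
  have left': "x \<in> Units R" if xy: "x \<in> carrier R" "y \<in> carrier R" "x \<otimes> y = \<one>" for x y
  proof -
    have y: "y \<in> Units R" by (rule left[OF xy])
    then have "x = inv y" using xy by (metis inv_char Units_inv_closed Units_r_inv inv_unique)
    then show ?thesis using y by simp
  qed
  have mult_l: "x \<in> Units R \<and> y \<in> Units R" if xy: "x \<in> carrier R" "y \<in> carrier R" "x \<otimes> y \<in> Units R" for x y
  proof -
    obtain u where u: "u \<in> carrier R" "u \<otimes> (x \<otimes> y) = \<one>" "(x \<otimes> y) \<otimes> u = \<one>"
      using xy(3) unfolding Units_def by blast
    have "x \<otimes> (y \<otimes> u) = \<one>" "(u \<otimes> x) \<otimes> y = \<one>" using u xy m_assoc by auto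
    then show ?thesis using left'[of x "y \<otimes> u"] left[of "u \<otimes> x" y] u(1) xy by simp
  qed
  have sum: "x \<in> Units R \<or> y \<in> Units R" if xy: "x \<in> carrier R" "y \<in> carrier R" "x \<oplus> y \<in> Units R" for x y
  proof -
    obtain u where u: "u \<in> carrier R" "u \<otimes> (x \<oplus> y) = \<one>" using xy(3) unfolding Units_def by blast
    then have "u \<otimes> x \<oplus> u \<otimes> y = \<one>" using xy by (simp add: r_distr)
    then have "\<one> \<ominus> u \<otimes> x = u \<otimes> y"
      using u(1) xy by (metis a_minus_def add.inv_solve_right' a_comm m_closed add.m_closed one_closed)
    then have "u \<otimes> x \<in> Units R \<or> u \<otimes> y \<in> Units R" using unit[of "u \<otimes> x"] u xy by auto
    then show ?thesis using mult_l u(1) xy by blast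
  qed
  show ?thesis
    unfolding local_ring_def
  proof (rule idealI)
    show "subgroup (carrier R - Units R) (add_monoid R)"
    proof (rule add.subgroupI)
      have "\<zero> \<notin> Units R" using assms(1) by (metis Units_r_inv_ex l_null)
      then show "carrier R - Units R \<noteq> {}" by blast
    next
      fix a assume a: "a \<in> carrier R - Units R"
      have "\<ominus> a \<notin> Units R"
      proof
        assume "\<ominus> a \<in> Units R"
        then have "(\<ominus> a) \<otimes> (\<ominus> \<one>) \<in> Units R" by (intro Units_m_closed) auto
        then show False using a by (simp add: r_minus l_minus)
      qed
      then show "\<ominus> a \<in> carrier R - Units R" using a by simp
    next
      fix a b assume "a \<in> carrier R - Units R" "b \<in> carrier R - Units R"
      then show "a \<oplus> b \<in> carrier R - Units R" using sum[of a b] by auto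
    qed auto
    show "x \<otimes> a \<in> carrier R - Units R" "a \<otimes> x \<in> carrier R - Units R"
      if "a \<in> carrier R - Units R" "x \<in> carrier R" for a x
      using that mult_l[of x a] mult_l[of a x] by auto
  qed (rule ring_axioms)
qed

end

lemma matching_of_fibres:
  assumes fin: "\<And>c. c \<in> p ` I \<Longrightarrow> finite {i \<in> I. p i = c}"
    and card: "\<And>c. c \<in> p ` I \<Longrightarrow> card {i \<in> I. p i = c} \<le> card {j \<in> J. q j = c}"
  shows "\<exists>\<sigma>. inj_on \<sigma> I \<and> \<sigma> ` I \<subseteq> J \<and> (\<forall>i\<in>I. q (\<sigma> i) = p i)"
proof -
  have "\<exists>f. f ` {i \<in> I. p i = c} \<subseteq> {j \<in> J. q j = c} \<and> inj_on f {i \<in> I. p i = c}" if c: "c \<in> p ` I" for c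
  proof (rule card_le_inj)
    show "finite {i \<in> I. p i = c}" by (rule fin[OF c])
    have "card {i \<in> I. p i = c} \<noteq> 0" using fin[OF c] c by (auto simp: card_eq_0_iff)
    then show "finite {j \<in> J. q j = c}" using card[OF c] by (metis card.infinite le_zero_eq)
  qed (rule card[OF c])
  then have "\<forall>c\<in>p ` I. \<exists>f. f ` {i \<in> I. p i = c} \<subseteq> {j \<in> J. q j = c} \<and> inj_on f {i \<in> I. p i = c}" by (rule ballI)
  then obtain f where "\<forall>c\<in>p ` I. f c ` {i \<in> I. p i = c} \<subseteq> {j \<in> J. q j = c} \<and> inj_on (f c) {i \<in> I. p i = c}"
    by (rule bchoice[THEN exE])
  then have f: "inj_on (f c) {i \<in> I. p i = c}" "f c ` {i \<in> I. p i = c} \<subseteq> {j \<in> J. q j = c}"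
    if "c \<in> p ` I" for c using that by blast+
  define \<sigma> where "\<sigma> i = f (p i) i" for i
  have \<sigma>: "\<sigma> i \<in> J \<and> q (\<sigma> i) = p i" if "i \<in> I" for i
    using f(2)[of "p i"] that unfolding \<sigma>_def by blast
  have "inj_on \<sigma> I"
  proof (rule inj_onI)
    fix i j assume ij: "i \<in> I" "j \<in> I" "\<sigma> i = \<sigma> j"
    then have "p i = p j" using \<sigma> by metis
    then show "i = j" using f(1)[of "p i"] ij unfolding \<sigma>_def inj_on_def by auto
  qed
  then show ?thesis using \<sigma> by blast
qed

lemma bij_matching_of_fibres:
  assumes fin: "\<And>c. finite {i \<in> I. p i = c}" "\<And>c. finite {j \<in> J. q j = c}"
    and card: "\<And>c. card {i \<in> I. p i = c} = card {j \<in> J. q j = c}"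
  shows "\<exists>\<sigma>. bij_betw \<sigma> I J \<and> (\<forall>i\<in>I. q (\<sigma> i) = p i)"
proof -
  obtain \<sigma> where \<sigma>: "inj_on \<sigma> I" "\<sigma> ` I \<subseteq> J" "\<And>i. i \<in> I \<Longrightarrow> q (\<sigma> i) = p i"
    using matching_of_fibres[of p I J q] fin card by auto
  have "J \<subseteq> \<sigma> ` I"
  proof
    fix j assume j: "j \<in> J"
    let ?A = "{i \<in> I. p i = q j}" and ?B = "{j' \<in> J. q j' = q j}"
    have "\<sigma> ` ?A \<subseteq> ?B" using \<sigma> by auto
    moreover have "card (\<sigma> ` ?A) = card ?B"
      using card[of "q j"] card_image[of \<sigma> ?A] inj_on_subset[OF \<sigma>(1), of ?A] by auto
    ultimately have "\<sigma> ` ?A = ?B" by (intro card_subset_eq fin)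
    then show "j \<in> \<sigma> ` I" using j by blast
  qed
  then show ?thesis using \<sigma> unfolding bij_betw_def by blast
qed

section \<open>Linear categories\<close>

context S_category
begin

declare Comp_closed [simp] Ident_closed [simp] Comp_Ident_left [simp] Comp_Ident_right [simp]

lemma Hom_smodule: "X \<in> Obj C \<Longrightarrow> Y \<in> Obj C \<Longrightarrow> smodule S (Hom C X Y)"
  using Hom_module by (rule smodule.intro)

lemma Hom_abelian: "X \<in> Obj C \<Longrightarrow> Y \<in> Obj C \<Longrightarrow> abelian_group (Hom C X Y)"
  using Hom_module module.axioms(2) by blast

lemma Hom_zero [simp]: "X \<in> Obj C \<Longrightarrow> Y \<in> Obj C \<Longrightarrow> \<zero>\<^bsub>Hom C X Y\<^esub> \<in> Mor C X Y"
  by (simp add: Hom_abelian abelian_group.axioms(1) abelian_monoid.zero_closed)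

lemma Hom_add [simp]: "\<lbrakk>X \<in> Obj C; Y \<in> Obj C; f \<in> Mor C X Y; g \<in> Mor C X Y\<rbrakk>
    \<Longrightarrow> f \<oplus>\<^bsub>Hom C X Y\<^esub> g \<in> Mor C X Y"
  by (simp add: Hom_abelian abelian_group.axioms(1) abelian_monoid.a_closed)

lemma Hom_smult [simp]: "\<lbrakk>X \<in> Obj C; Y \<in> Obj C; s \<in> carrier S; f \<in> Mor C X Y\<rbrakk>
    \<Longrightarrow> s \<odot>\<^bsub>Hom C X Y\<^esub> f \<in> Mor C X Y"
  by (rule module.smult_closed[OF Hom_module])

lemma Hom_neg [simp]: "\<lbrakk>X \<in> Obj C; Y \<in> Obj C; f \<in> Mor C X Y\<rbrakk> \<Longrightarrow> \<ominus>\<^bsub>Hom C X Y\<^esub> f \<in> Mor C X Y"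
  by (simp add: Hom_abelian abelian_group.a_inv_closed)

lemma Hom_minus [simp]: "\<lbrakk>X \<in> Obj C; Y \<in> Obj C; f \<in> Mor C X Y; g \<in> Mor C X Y\<rbrakk>
    \<Longrightarrow> f \<ominus>\<^bsub>Hom C X Y\<^esub> g \<in> Mor C X Y"
  by (simp add: Hom_abelian abelian_group.minus_closed)

lemma Hom_add_zero [simp]: "\<lbrakk>X \<in> Obj C; Y \<in> Obj C; f \<in> Mor C X Y\<rbrakk> \<Longrightarrow> f \<oplus>\<^bsub>Hom C X Y\<^esub> \<zero>\<^bsub>Hom C X Y\<^esub> = f"
  "\<lbrakk>X \<in> Obj C; Y \<in> Obj C; f \<in> Mor C X Y\<rbrakk> \<Longrightarrow> \<zero>\<^bsub>Hom C X Y\<^esub> \<oplus>\<^bsub>Hom C X Y\<^esub> f = f"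
  using Hom_abelian[of X Y] by (simp_all add: abelian_group.axioms(1) abelian_monoid.r_zero abelian_monoid.l_zero)

lemma Comp_zero_left [simp]:
  assumes "X \<in> Obj C" "Y \<in> Obj C" "Z \<in> Obj C" "f \<in> Mor C X Y"
  shows "Comp C X Y Z \<zero>\<^bsub>Hom C Y Z\<^esub> f = \<zero>\<^bsub>Hom C X Z\<^esub>"
proof -
  interpret YZ: smodule S "Hom C Y Z" using assms by (intro Hom_smodule)
  interpret XZ: smodule S "Hom C X Z" using assms by (intro Hom_smodule)
  show ?thesis using Comp_smult_left[OF assms(1-3) zero_closed _ assms(4), of "\<zero>\<^bsub>Hom C Y Z\<^esub>"] assms by simp
qed

lemma Comp_zero_right [simp]:
  assumes "X \<in> Obj C" "Y \<in> Obj C" "Z \<in> Obj C" "g \<in> Mor C Y Z"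
  shows "Comp C X Y Z g \<zero>\<^bsub>Hom C X Y\<^esub> = \<zero>\<^bsub>Hom C X Z\<^esub>"
proof -
  interpret XY: smodule S "Hom C X Y" using assms by (intro Hom_smodule)
  interpret XZ: smodule S "Hom C X Z" using assms by (intro Hom_smodule)
  show ?thesis using Comp_smult_right[OF assms(1-3) zero_closed assms(4), of "\<zero>\<^bsub>Hom C X Y\<^esub>"] assms by simp
qed

lemma Comp_neg_left [simp]:
  assumes "X \<in> Obj C" "Y \<in> Obj C" "Z \<in> Obj C" "g \<in> Mor C Y Z" "f \<in> Mor C X Y"
  shows "Comp C X Y Z (\<ominus>\<^bsub>Hom C Y Z\<^esub> g) f = \<ominus>\<^bsub>Hom C X Z\<^esub> Comp C X Y Z g f"
proof -
  interpret YZ: smodule S "Hom C Y Z" using assms by (intro Hom_smodule)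
  interpret XZ: smodule S "Hom C X Z" using assms by (intro Hom_smodule)
  have "Comp C X Y Z (\<ominus>\<^bsub>Hom C Y Z\<^esub> g) f = Comp C X Y Z ((\<ominus> \<one>) \<odot>\<^bsub>Hom C Y Z\<^esub> g) f"
    using assms by (simp add: YZ.smult_l_minus)
  also have "\<dots> = \<ominus>\<^bsub>Hom C X Z\<^esub> Comp C X Y Z g f"
    using assms by (simp add: Comp_smult_left XZ.smult_l_minus)
  finally show ?thesis .
qed

lemma Comp_neg_right [simp]:
  assumes "X \<in> Obj C" "Y \<in> Obj C" "Z \<in> Obj C" "g \<in> Mor C Y Z" "f \<in> Mor C X Y"
  shows "Comp C X Y Z g (\<ominus>\<^bsub>Hom C X Y\<^esub> f) = \<ominus>\<^bsub>Hom C X Z\<^esub> Comp C X Y Z g f"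
proof -
  interpret XY: smodule S "Hom C X Y" using assms by (intro Hom_smodule)
  interpret XZ: smodule S "Hom C X Z" using assms by (intro Hom_smodule)
  have "Comp C X Y Z g (\<ominus>\<^bsub>Hom C X Y\<^esub> f) = Comp C X Y Z g ((\<ominus> \<one>) \<odot>\<^bsub>Hom C X Y\<^esub> f)"
    using assms by (simp add: XY.smult_l_minus)
  also have "\<dots> = \<ominus>\<^bsub>Hom C X Z\<^esub> Comp C X Y Z g f"
    using assms by (simp add: Comp_smult_right XZ.smult_l_minus)
  finally show ?thesis .
qed

lemma Comp_minus_left:
  assumes "X \<in> Obj C" "Y \<in> Obj C" "Z \<in> Obj C" "g \<in> Mor C Y Z" "g' \<in> Mor C Y Z" "f \<in> Mor C X Y"
  shows "Comp C X Y Z (g \<ominus>\<^bsub>Hom C Y Z\<^esub> g') f = Comp C X Y Z g f \<ominus>\<^bsub>Hom C X Z\<^esub> Comp C X Y Z g' f"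
  using assms by (simp add: a_minus_def Comp_add_left)

lemma Comp_minus_right:
  assumes "X \<in> Obj C" "Y \<in> Obj C" "Z \<in> Obj C" "g \<in> Mor C Y Z" "f \<in> Mor C X Y" "f' \<in> Mor C X Y"
  shows "Comp C X Y Z g (f \<ominus>\<^bsub>Hom C X Y\<^esub> f') = Comp C X Y Z g f \<ominus>\<^bsub>Hom C X Z\<^esub> Comp C X Y Z g f'"
  using assms by (simp add: a_minus_def Comp_add_right)

lemma Comp_finsum_right:
  assumes "X \<in> Obj C" "Y \<in> Obj C" "Z \<in> Obj C" "g \<in> Mor C Y Z" "f \<in> A \<rightarrow> Mor C X Y"
  shows "Comp C X Y Z g (finsum (Hom C X Y) f A) = finsum (Hom C X Z) (\<lambda>i. Comp C X Y Z g (f i)) A"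
proof -
  interpret XY: abelian_group "Hom C X Y" using assms by (intro Hom_abelian)
  interpret XZ: abelian_group "Hom C X Z" using assms by (intro Hom_abelian)
  show ?thesis
  proof (cases "finite A")
    case True
    then show ?thesis using assms(5)
      by induction (use assms in \<open>simp_all add: Pi_def Comp_add_right\<close>)
  next
    case False
    then show ?thesis using assms by (simp add: XY.finsum_infinite XZ.finsum_infinite)
  qed
qed

lemma Comp_finsum_left:
  assumes "X \<in> Obj C" "Y \<in> Obj C" "Z \<in> Obj C" "f \<in> Mor C X Y" "g \<in> A \<rightarrow> Mor C Y Z"
  shows "Comp C X Y Z (finsum (Hom C Y Z) g A) f = finsum (Hom C X Z) (\<lambda>i. Comp C X Y Z (g i) f) A"
proof -
  interpret YZ: abelian_group "Hom C Y Z" using assms by (intro Hom_abelian)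
  interpret XZ: abelian_group "Hom C X Z" using assms by (intro Hom_abelian)
  show ?thesis
  proof (cases "finite A")
    case True
    then show ?thesis using assms(5)
      by induction (use assms in \<open>simp_all add: Pi_def Comp_add_left\<close>)
  next
    case False
    then show ?thesis using assms by (simp add: YZ.finsum_infinite XZ.finsum_infinite)
  qed
qed

lemma Comp_reassoc:
  assumes "Comp C X Y Z g f = h"
    and "W \<in> Obj C" "X \<in> Obj C" "Y \<in> Obj C" "Z \<in> Obj C" "g \<in> Mor C Y Z" "f \<in> Mor C X Y" "x \<in> Mor C W X"
  shows "Comp C W Y Z g (Comp C W X Y f x) = Comp C W X Z h x"
  using Comp_assoc[OF assms(2-)] assms(1) by simp

lemma minus_self: "\<lbrakk>X \<in> Obj C; Y \<in> Obj C; f \<in> Mor C X Y\<rbrakk> \<Longrightarrow> f \<ominus>\<^bsub>Hom C X Y\<^esub> f = \<zero>\<^bsub>Hom C X Y\<^esub>"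
  using Hom_abelian[of X Y] by (simp add: a_minus_def abelian_group.r_neg)

lemma minus_zero_right: "\<lbrakk>X \<in> Obj C; Y \<in> Obj C; f \<in> Mor C X Y\<rbrakk> \<Longrightarrow> f \<ominus>\<^bsub>Hom C X Y\<^esub> \<zero>\<^bsub>Hom C X Y\<^esub> = f"
  using Comp_neg_right[of X Y Y "\<zero>\<^bsub>Hom C Y Y\<^esub>" f] Comp_neg_left[of X X Y f "\<zero>\<^bsub>Hom C X X\<^esub>"]
  by (simp add: a_minus_def)

lemma eq_if_minus_zero:
  assumes "X \<in> Obj C" "Y \<in> Obj C" "f \<in> Mor C X Y" "g \<in> Mor C X Y" "f \<ominus>\<^bsub>Hom C X Y\<^esub> g = \<zero>\<^bsub>Hom C X Y\<^esub>"
  shows "f = g"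
proof -
  interpret smodule S "Hom C X Y" using assms by (intro Hom_smodule)
  show ?thesis using add_diff_cancel[OF assms(4,3)] assms by simp
qed

lemma End_simps [simp]: "carrier (End C X) = Mor C X X" "f \<otimes>\<^bsub>End C X\<^esub> g = Comp C X X X f g"
  "\<one>\<^bsub>End C X\<^esub> = Ident C X" "\<zero>\<^bsub>End C X\<^esub> = \<zero>\<^bsub>Hom C X X\<^esub>" "f \<oplus>\<^bsub>End C X\<^esub> g = f \<oplus>\<^bsub>Hom C X X\<^esub> g"
  "s \<odot>\<^bsub>End C X\<^esub> f = s \<odot>\<^bsub>Hom C X X\<^esub> f"
  by (simp_all add: End_def)

lemma End_neg [simp]: "\<ominus>\<^bsub>End C X\<^esub> f = \<ominus>\<^bsub>Hom C X X\<^esub> f"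
  by (simp add: a_inv_def End_def)

lemma End_minus [simp]: "f \<ominus>\<^bsub>End C X\<^esub> g = f \<ominus>\<^bsub>Hom C X X\<^esub> g"
  by (simp add: a_minus_def)

lemma End_finsum [simp]: "finsum (End C X) f A = finsum (Hom C X X) f A"
  by (simp add: finsum_def End_def)

lemma End_module:
  assumes X: "X \<in> Obj C"
  shows "module S (End C X)"
proof -
  interpret H: module S "Hom C X X" by (rule Hom_module[OF X X])
  show ?thesis
  proof (rule moduleI)
    show "abelian_group (End C X)"
      by (rule abelian_groupI)
        (auto simp: H.M.a_assoc X intro!: H.M.a_comm bexI[where x="\<ominus>\<^bsub>Hom C X X\<^esub> _"] H.M.l_neg)
  qed (simp_all add: is_cring H.smult_l_distr H.smult_r_distr H.smult_assoc1)
qed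

lemma End_ring: "X \<in> Obj C \<Longrightarrow> ring (End C X)"
proof (rule ringI)
  assume X: "X \<in> Obj C"
  show "abelian_group (End C X)" using End_module[OF X] by (rule module.axioms(2))
  show "Group.monoid (End C X)" by (rule monoidI) (auto simp: X Comp_assoc)
qed (auto simp: Comp_add_left Comp_add_right)

lemma Units_End_iff: "X \<in> Obj C \<Longrightarrow> f \<in> Units (End C X) \<longleftrightarrow> invertible C X X f"
  unfolding Units_def invertible_def by auto

lemma invertibleI: "f \<in> Mor C X Y \<Longrightarrow> g \<in> Mor C Y X \<Longrightarrow> Comp C X Y X g f = Ident C X
    \<Longrightarrow> Comp C Y X Y f g = Ident C Y \<Longrightarrow> invertible C X Y f"
  unfolding invertible_def by blast

lemma invertibleE:
  assumes "invertible C X Y f"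
  obtains g where "f \<in> Mor C X Y" "g \<in> Mor C Y X" "Comp C X Y X g f = Ident C X" "Comp C Y X Y f g = Ident C Y"
    "invertible C Y X g"
  using assms unfolding invertible_def by blast

lemma invertible_Ident: "X \<in> Obj C \<Longrightarrow> invertible C X X (Ident C X)"
  by (rule invertibleI[of _ _ _ "Ident C X"]) auto

lemma invertible_Comp:
  assumes "X \<in> Obj C" "Y \<in> Obj C" "Z \<in> Obj C" "invertible C Y Z g" "invertible C X Y f"
  shows "invertible C X Z (Comp C X Y Z g f)"
proof -
  obtain g' where g: "g \<in> Mor C Y Z" "g' \<in> Mor C Z Y" "Comp C Y Z Y g' g = Ident C Y" "Comp C Z Y Z g g' = Ident C Z"
    using assms(4) by (rule invertibleE)
  obtain f' where f: "f \<in> Mor C X Y" "f' \<in> Mor C Y X" "Comp C X Y X f' f = Ident C X" "Comp C Y X Y f f' = Ident C Y"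
    using assms(5) by (rule invertibleE)
  show ?thesis
    by (rule invertibleI[of _ _ _ "Comp C Z Y X f' g'"])
      (use assms f g in \<open>simp_all add: Comp_assoc Comp_reassoc[OF g(3)] Comp_reassoc[OF f(4)]\<close>)
qed

lemma isomorphic_refl: "X \<in> Obj C \<Longrightarrow> isomorphic C X X"
  unfolding isomorphic_def by (intro exI[of _ "Ident C X"] invertible_Ident)

lemma isomorphic_sym: "isomorphic C X Y \<Longrightarrow> isomorphic C Y X"
  unfolding isomorphic_def by (metis invertibleE)

lemma isomorphic_trans: "\<lbrakk>X \<in> Obj C; Y \<in> Obj C; Z \<in> Obj C; isomorphic C X Y; isomorphic C Y Z\<rbrakk> \<Longrightarrow> isomorphic C X Z"
  unfolding isomorphic_def using invertible_Comp by blast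

lemma invertible_cancel_left:
  assumes "X \<in> Obj C" "Y \<in> Obj C" "Z \<in> Obj C" "f \<in> Mor C X Y" "invertible C Y Z g" "invertible C X Z (Comp C X Y Z g f)"
  shows "invertible C X Y f"
proof -
  obtain g' where g: "g \<in> Mor C Y Z" "g' \<in> Mor C Z Y" "Comp C Y Z Y g' g = Ident C Y" "invertible C Z Y g'"
    using assms(5) by (rule invertibleE)
  have "invertible C X Y (Comp C X Z Y g' (Comp C X Y Z g f))"
    by (rule invertible_Comp[OF assms(1,3,2) g(4) assms(6)])
  moreover have "Comp C X Z Y g' (Comp C X Y Z g f) = f"
    using assms(1-4) g(1,2) by (simp add: Comp_reassoc[OF g(3)])
  ultimately show ?thesis by simp
qed

lemma local_End_nonzero: "X \<in> Obj C \<Longrightarrow> local_ring (End C X) \<Longrightarrow> Ident C X \<noteq> \<zero>\<^bsub>Hom C X X\<^esub>"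
  using ring.local_ring_one_neq_zero[OF End_ring] by auto

lemma retract_of_local:
  assumes X: "X \<in> Obj C" "local_ring (End C X)" and Z: "Z \<in> Obj C" "Ident C Z \<noteq> \<zero>\<^bsub>Hom C Z Z\<^esub>"
    and a: "a \<in> Mor C Z X" and b: "b \<in> Mor C X Z" and ba: "Comp C Z X Z b a = Ident C Z"
  shows "invertible C Z X a" "invertible C X Z b"
proof -
  let ?e = "Comp C X Z X a b"
  have e: "?e \<in> Mor C X X" using X Z a b by simp
  have "Comp C X X X ?e ?e = ?e"
    using X Z a b by (simp add: Comp_assoc Comp_reassoc[OF ba])
  then have "?e = \<zero>\<^bsub>Hom C X X\<^esub> \<or> ?e = Ident C X"
    using ring.local_ring_idempotent[OF End_ring[OF X(1)] X(2), of ?e] e by simp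
  moreover have "?e \<noteq> \<zero>\<^bsub>Hom C X X\<^esub>"
  proof
    assume "?e = \<zero>\<^bsub>Hom C X X\<^esub>"
    then have "Comp C Z X Z b (Comp C Z X X ?e a) = \<zero>\<^bsub>Hom C Z Z\<^esub>" using X Z a b by simp
    then show False using X Z a b by (simp add: Comp_assoc Comp_reassoc[OF ba] ba)
  qed
  ultimately have "?e = Ident C X" by simp
  then show "invertible C Z X a" "invertible C X Z b" using a b ba by (auto intro: invertibleI)
qed

lemma retract_of_local_unit:
  assumes X: "X \<in> Obj C" "local_ring (End C X)" and Z: "Z \<in> Obj C" "Ident C Z \<noteq> \<zero>\<^bsub>Hom C Z Z\<^esub>"
    and a: "a \<in> Mor C Z X" and b: "b \<in> Mor C X Z" and ba: "invertible C Z Z (Comp C Z X Z b a)"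
  shows "invertible C Z X a" "invertible C X Z b"
proof -
  obtain v where v: "v \<in> Mor C Z Z" "Comp C Z Z Z v (Comp C Z X Z b a) = Ident C Z"
    "Comp C Z Z Z (Comp C Z X Z b a) v = Ident C Z"
    using ba by (rule invertibleE)
  show "invertible C Z X a"
    by (rule retract_of_local(1)[OF X Z a, of "Comp C X Z Z v b"]) (use X Z a b v in \<open>simp_all add: Comp_assoc\<close>)
  show "invertible C X Z b"
    by (rule retract_of_local(2)[OF X Z _ b, of "Comp C Z Z X a v"]) (use X Z a b v in \<open>simp_all add: Comp_assoc\<close>)
qed

lemma local_ring_isomorphic:
  assumes X: "X \<in> Obj C" "local_ring (End C X)" and Y: "Y \<in> Obj C" and iso: "isomorphic C X Y"
  shows "local_ring (End C Y)"
proof (rule ring.local_ringI[OF End_ring[OF Y]])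
  obtain f where "invertible C X Y f" using iso unfolding isomorphic_def by blast
  then obtain g where f: "f \<in> Mor C X Y" "g \<in> Mor C Y X" "Comp C X Y X g f = Ident C X" "Comp C Y X Y f g = Ident C Y"
    and inv: "invertible C X Y f" "invertible C Y X g"
    by (metis invertibleE)
  show "\<one>\<^bsub>End C Y\<^esub> \<noteq> \<zero>\<^bsub>End C Y\<^esub>"
  proof
    assume "\<one>\<^bsub>End C Y\<^esub> = \<zero>\<^bsub>End C Y\<^esub>"
    then have "Comp C X Y X g (Comp C X Y Y (Ident C Y) f) = Comp C X Y X g (Comp C X Y Y \<zero>\<^bsub>Hom C Y Y\<^esub> f)" by simp
    then show False using local_End_nonzero[OF X] X(1) Y f by simp
  qed
  fix a assume "a \<in> carrier (End C Y)"
  then have a: "a \<in> Mor C Y Y" by simp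
  have conj: "b \<in> Units (End C Y)" if "b \<in> Mor C Y Y" "Comp C X Y X g (Comp C X Y Y b f) \<in> Units (End C X)" for b
  proof -
    have "invertible C X X (Comp C X Y X g (Comp C X Y Y b f))" using that X by (simp add: Units_End_iff)
    then have "invertible C X Y (Comp C X Y Y b f)"
      using invertible_cancel_left[OF X(1) Y X(1) _ inv(2)] that X Y f by simp
    then have "invertible C Y Y (Comp C Y X Y (Comp C X Y Y b f) g)"
      using invertible_Comp[OF Y X(1) Y _ inv(2)] by simp
    then show ?thesis using that X Y f by (simp add: Comp_assoc f(4) Units_End_iff)
  qed
  let ?b = "Comp C X Y X g (Comp C X Y Y a f)"
  interpret EX: ring "End C X" by (rule End_ring[OF X(1)])
  have b: "?b \<in> carrier (End C X)" using a X Y f by simp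
  have "?b \<oplus>\<^bsub>End C X\<^esub> (\<one>\<^bsub>End C X\<^esub> \<ominus>\<^bsub>End C X\<^esub> ?b) = \<one>\<^bsub>End C X\<^esub>"
    using smodule.add_diff_cancel[OF smodule.intro[OF End_module[OF X(1)]] b EX.one_closed] .
  then have "?b \<in> Units (End C X) \<or> \<one>\<^bsub>End C X\<^esub> \<ominus>\<^bsub>End C X\<^esub> ?b \<in> Units (End C X)"
    using EX.local_ring_add_unit[OF X(2) b, of "\<one>\<^bsub>End C X\<^esub> \<ominus>\<^bsub>End C X\<^esub> ?b"] b EX.minus_closed EX.Units_one_closed by auto
  moreover have "\<one>\<^bsub>End C X\<^esub> \<ominus>\<^bsub>End C X\<^esub> ?b = Comp C X Y X g (Comp C X Y Y (Ident C Y \<ominus>\<^bsub>Hom C Y Y\<^esub> a) f)"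
    using a X Y f by (simp add: Comp_minus_left Comp_minus_right)
  ultimately show "a \<in> Units (End C Y) \<or> \<one>\<^bsub>End C Y\<^esub> \<ominus>\<^bsub>End C Y\<^esub> a \<in> Units (End C Y)"
    using conj[OF a] conj[of "Ident C Y \<ominus>\<^bsub>Hom C Y Y\<^esub> a"] a X Y by auto
qed

end

section \<open>Decompositions into local objects\<close>

context S_category
begin

lemma direct_sumD:
  assumes "direct_sum C I X A \<iota> \<pi>"
  shows "A \<in> Obj C" "\<And>i. i \<in> I \<Longrightarrow> X i \<in> Obj C" "\<And>i. i \<in> I \<Longrightarrow> \<iota> i \<in> Mor C (X i) A"
    "\<And>i. i \<in> I \<Longrightarrow> \<pi> i \<in> Mor C A (X i)"
    "\<And>i. i \<in> I \<Longrightarrow> Comp C (X i) A (X i) (\<pi> i) (\<iota> i) = Ident C (X i)"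
    "\<And>i j. i \<in> I \<Longrightarrow> j \<in> I \<Longrightarrow> i \<noteq> j \<Longrightarrow> Comp C (X i) A (X j) (\<pi> j) (\<iota> i) = \<zero>\<^bsub>Hom C (X i) (X j)\<^esub>"
  using assms unfolding direct_sum_def by auto

lemma direct_sum_ex1:
  assumes "direct_sum C I X A \<iota> \<pi>" "B \<in> Obj C" "\<forall>i\<in>I. f i \<in> Mor C (X i) B"
  shows "\<exists>!h. h \<in> Mor C A B \<and> (\<forall>i\<in>I. Comp C (X i) A B h (\<iota> i) = f i)"
proof -
  have "\<forall>B\<in>Obj C. \<forall>f. (\<forall>i\<in>I. f i \<in> Mor C (X i) B) \<longrightarrow>
      (\<exists>!h. h \<in> Mor C A B \<and> (\<forall>i\<in>I. Comp C (X i) A B h (\<iota> i) = f i))"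
    using assms(1) unfolding direct_sum_def by (elim conjE)
  from bspec[OF this assms(2)]
  have "(\<forall>i\<in>I. f i \<in> Mor C (X i) B) \<longrightarrow>
      (\<exists>!h. h \<in> Mor C A B \<and> (\<forall>i\<in>I. Comp C (X i) A B h (\<iota> i) = f i))" by (rule spec)
  then show ?thesis using assms(3) by (rule mp)
qed

lemma direct_sum_ex:
  assumes "direct_sum C I X A \<iota> \<pi>" "B \<in> Obj C" "\<And>i. i \<in> I \<Longrightarrow> f i \<in> Mor C (X i) B"
  obtains h where "h \<in> Mor C A B" "\<And>i. i \<in> I \<Longrightarrow> Comp C (X i) A B h (\<iota> i) = f i"
  using direct_sum_ex1[OF assms(1,2), of f] assms(3) by blast

lemma direct_sum_eqI:
  assumes "direct_sum C I X A \<iota> \<pi>" "B \<in> Obj C" "h \<in> Mor C A B" "h' \<in> Mor C A B"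
    and "\<And>i. i \<in> I \<Longrightarrow> Comp C (X i) A B h (\<iota> i) = Comp C (X i) A B h' (\<iota> i)"
  shows "h = h'"
proof -
  note ds = direct_sumD[OF assms(1)]
  have "\<forall>i\<in>I. Comp C (X i) A B h' (\<iota> i) \<in> Mor C (X i) B" using ds assms by simp
  from direct_sum_ex1[OF assms(1,2) this] show ?thesis using assms(3-5) by blast
qed

text \<open>Automatic for finite \<open>I\<close>, as the components then add up to the identity of the local object \<open>Z\<close>.
  For infinite \<open>I\<close> this is what makes the exchange argument work.\<close>

definition detecting :: "'i set \<Rightarrow> ('i \<Rightarrow> 'o) \<Rightarrow> 'o \<Rightarrow> ('i \<Rightarrow> 'm) \<Rightarrow> ('i \<Rightarrow> 'm) \<Rightarrow> bool"
  where "detecting I X A \<iota> \<pi> \<longleftrightarrow>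
    (\<forall>Z\<in>Obj C. local_ring (End C Z) \<longrightarrow> (\<forall>a\<in>Mor C Z A. \<forall>b\<in>Mor C A Z. Comp C Z A Z b a = Ident C Z \<longrightarrow>
      (\<exists>i\<in>I. invertible C Z Z (Comp C Z (X i) Z (Comp C (X i) A Z b (\<iota> i)) (Comp C Z A (X i) (\<pi> i) a)))))"

lemma detectingD:
  assumes "detecting I X A \<iota> \<pi>" "Z \<in> Obj C" "local_ring (End C Z)" "a \<in> Mor C Z A" "b \<in> Mor C A Z"
    "Comp C Z A Z b a = Ident C Z"
  obtains i where "i \<in> I" "invertible C Z Z (Comp C Z (X i) Z (Comp C (X i) A Z b (\<iota> i)) (Comp C Z A (X i) (\<pi> i) a))"
  using assms unfolding detecting_def by blast

lemma exchange:
  assumes ds: "direct_sum C I X A \<iota> \<pi>" and loc: "\<And>i. i \<in> I \<Longrightarrow> local_ring (End C (X i))"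
    and det: "detecting I X A \<iota> \<pi>" and Z: "Z \<in> Obj C" "local_ring (End C Z)"
    and "finite K"
    and "\<And>k. k \<in> K \<Longrightarrow> f k \<in> Mor C Z A" "\<And>k. k \<in> K \<Longrightarrow> g k \<in> Mor C A Z"
    and "\<And>k. k \<in> K \<Longrightarrow> Comp C Z A Z (g k) (f k) = Ident C Z"
    and "\<And>k l. k \<in> K \<Longrightarrow> l \<in> K \<Longrightarrow> k \<noteq> l \<Longrightarrow> Comp C Z A Z (g k) (f l) = \<zero>\<^bsub>Hom C Z Z\<^esub>"
    and "T \<subseteq> I" "\<And>k i. k \<in> K \<Longrightarrow> i \<in> T \<Longrightarrow> Comp C (X i) A Z (g k) (\<iota> i) = \<zero>\<^bsub>Hom C (X i) Z\<^esub>"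
  shows "\<exists>U. U \<subseteq> I - T \<and> finite U \<and> card U = card K \<and> (\<forall>i\<in>U. isomorphic C (X i) Z)"
  using assms(6-)
proof (induction K arbitrary: g T rule: finite_induct)
  case empty
  show ?case by (intro exI[of _ "{}"]) auto
next
  case (insert k K)
  note dsD = direct_sumD[OF ds]
  note Znz = local_End_nonzero[OF Z]
  have A: "A \<in> Obj C" by (rule dsD)
  have gk: "g k \<in> Mor C A Z" and fk: "f k \<in> Mor C Z A" and gfk: "Comp C Z A Z (g k) (f k) = Ident C Z"
    using insert.prems by auto
  obtain i where i: "i \<in> I"
    and inv: "invertible C Z Z (Comp C Z (X i) Z (Comp C (X i) A Z (g k) (\<iota> i)) (Comp C Z A (X i) (\<pi> i) (f k)))"
    by (rule detectingD[OF det Z fk gk gfk])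
  have Xi: "X i \<in> Obj C" "\<iota> i \<in> Mor C (X i) A" "\<pi> i \<in> Mor C A (X i)" using dsD i by auto
  let ?u = "Comp C (X i) A Z (g k) (\<iota> i)"
  have "invertible C (X i) Z ?u"
    by (rule retract_of_local_unit(2)[OF Xi(1) loc[OF i] Z(1) Znz _ _ inv]) (use A Z Xi gk fk in auto)
  then obtain v where u: "?u \<in> Mor C (X i) Z" "v \<in> Mor C Z (X i)" "Comp C (X i) Z (X i) v ?u = Ident C (X i)"
    and iso: "isomorphic C (X i) Z"
    unfolding isomorphic_def by (metis invertibleE)
  have iT: "i \<notin> T"
  proof
    assume "i \<in> T"
    then have "?u = \<zero>\<^bsub>Hom C (X i) Z\<^esub>" using insert.prems by simp
    then have "Ident C (X i) = \<zero>\<^bsub>Hom C (X i) (X i)\<^esub>" using u Xi Z by simp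
    then show False using local_End_nonzero[OF Xi(1) loc[OF i]] by simp
  qed
  define w where "w l = Comp C Z (X i) Z (Comp C (X i) A Z (g l) (\<iota> i)) v" for l
  have w: "w l \<in> Mor C Z Z" if "l \<in> K" for l
    unfolding w_def using insert.prems(2)[of l] that A Z Xi u by simp
  define g' where "g' l = g l \<ominus>\<^bsub>Hom C A Z\<^esub> Comp C A Z Z (w l) (g k)" for l
  have gl: "g l \<in> Mor C A Z" if "l \<in> K" for l using insert.prems(2) that by simp
  have g'f: "Comp C Z A Z (g' l) (f m) = Comp C Z A Z (g l) (f m)" if "l \<in> K" "m \<in> K" for l m
  proof -
    have "m \<noteq> k" using that insert.hyps by blast
    then have "Comp C Z A Z (g k) (f m) = \<zero>\<^bsub>Hom C Z Z\<^esub>" using insert.prems(4) that by simp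
    then show ?thesis
      unfolding g'_def using A Z gk gl[OF that(1)] w[OF that(1)] insert.prems(1)[of m] that
      by (simp add: Comp_minus_left Comp_assoc minus_zero_right)
  qed
  have g'i: "Comp C (X j) A Z (g' l) (\<iota> j) = \<zero>\<^bsub>Hom C (X j) Z\<^esub>" if "l \<in> K" "j \<in> insert i T" for l j
  proof (cases "j = i")
    case True
    have "Comp C (X i) Z Z (w l) ?u = Comp C (X i) A Z (g l) (\<iota> i)"
      unfolding w_def using A Z Xi u gl[OF that(1)] gk by (simp add: Comp_assoc)
    then show ?thesis
      unfolding g'_def True using A Z Xi gk gl[OF that(1)] w[OF that(1)]
      by (simp add: Comp_minus_left Comp_assoc minus_self)
  next
    case False
    then have j: "j \<in> T" using that by blast
    then have jI: "j \<in> I" using insert.prems(5) by blast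
    have "Comp C (X j) A Z (g l) (\<iota> j) = \<zero>\<^bsub>Hom C (X j) Z\<^esub>" "Comp C (X j) A Z (g k) (\<iota> j) = \<zero>\<^bsub>Hom C (X j) Z\<^esub>"
      using insert.prems(6) that(1) j by auto
    then show ?thesis
      unfolding g'_def using A Z dsD(2,3)[OF jI] gk gl[OF that(1)] w[OF that(1)]
      by (simp add: Comp_minus_left Comp_assoc minus_self)
  qed
  have "\<exists>U. U \<subseteq> I - insert i T \<and> finite U \<and> card U = card K \<and> (\<forall>i\<in>U. isomorphic C (X i) Z)"
  proof (rule insert.IH)
    show "g' l \<in> Mor C A Z" if "l \<in> K" for l
      unfolding g'_def using A Z gk gl[OF that] w[OF that] by simp
    show "insert i T \<subseteq> I" using i insert.prems(5) by blast
  qed (use g'f g'i insert.prems in auto)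
  then obtain U where U: "U \<subseteq> I - insert i T" "finite U" "card U = card K" "\<forall>i\<in>U. isomorphic C (X i) Z" by blast
  then have "i \<notin> U" by blast
  then show ?case
    using U iso i iT insert.hyps by (intro exI[of _ "insert i U"]) auto
qed

lemma multiplicity_le:
  assumes ds: "direct_sum C I X A \<iota> \<pi>"
    and ds': "direct_sum C J Y A \<kappa> \<rho>" and loc': "\<And>j. j \<in> J \<Longrightarrow> local_ring (End C (Y j))"
    and det: "detecting J Y A \<kappa> \<rho>" and Z: "Z \<in> Obj C" "local_ring (End C Z)"
    and F: "finite F" "F \<subseteq> I" "\<And>i. i \<in> F \<Longrightarrow> isomorphic C (X i) Z"
  shows "\<exists>U. U \<subseteq> J \<and> finite U \<and> card U = card F \<and> (\<forall>j\<in>U. isomorphic C (Y j) Z)"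
proof -
  note dsD = direct_sumD[OF ds]
  have A: "A \<in> Obj C" by (rule dsD)
  have "\<forall>i\<in>F. \<exists>t t'. t \<in> Mor C (X i) Z \<and> t' \<in> Mor C Z (X i) \<and> Comp C Z (X i) Z t t' = Ident C Z"
    using F(3) unfolding isomorphic_def by (metis invertibleE)
  then obtain t t' where t: "\<And>i. i \<in> F \<Longrightarrow> t i \<in> Mor C (X i) Z" "\<And>i. i \<in> F \<Longrightarrow> t' i \<in> Mor C Z (X i)"
    "\<And>i. i \<in> F \<Longrightarrow> Comp C Z (X i) Z (t i) (t' i) = Ident C Z" by metis
  have I: "X i \<in> Obj C" "\<iota> i \<in> Mor C (X i) A" "\<pi> i \<in> Mor C A (X i)" "Comp C (X i) A (X i) (\<pi> i) (\<iota> i) = Ident C (X i)"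
    if "i \<in> F" for i using that F(2) dsD by auto
  have "\<exists>U. U \<subseteq> J - {} \<and> finite U \<and> card U = card F \<and> (\<forall>j\<in>U. isomorphic C (Y j) Z)"
  proof (rule exchange[OF ds' loc' det Z F(1), where f = "\<lambda>i. Comp C Z (X i) A (\<iota> i) (t' i)"
        and g = "\<lambda>i. Comp C A (X i) Z (t i) (\<pi> i)"])
    fix i assume i: "i \<in> F"
    show "Comp C Z (X i) A (\<iota> i) (t' i) \<in> Mor C Z A" "Comp C A (X i) Z (t i) (\<pi> i) \<in> Mor C A Z"
      using I[OF i] t[OF i] A Z by auto
    show "Comp C Z A Z (Comp C A (X i) Z (t i) (\<pi> i)) (Comp C Z (X i) A (\<iota> i) (t' i)) = Ident C Z"
      using I[OF i] t[OF i] A Z by (simp add: Comp_assoc Comp_reassoc[OF I(4)[OF i]])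
    fix j assume j: "j \<in> F" "i \<noteq> j"
    have 0: "Comp C (X j) A (X i) (\<pi> i) (\<iota> j) = \<zero>\<^bsub>Hom C (X j) (X i)\<^esub>" using dsD(6) i j F(2) by auto
    show "Comp C Z A Z (Comp C A (X i) Z (t i) (\<pi> i)) (Comp C Z (X j) A (\<iota> j) (t' j)) = \<zero>\<^bsub>Hom C Z Z\<^esub>"
      using I[OF i] t[OF i] I[OF j(1)] t[OF j(1)] A Z by (simp add: Comp_assoc Comp_reassoc[OF 0])
  qed auto
  then show ?thesis by simp
qed

definition iso_class :: "'o \<Rightarrow> 'o set"
  where "iso_class X = {Y \<in> Obj C. isomorphic C X Y}"

lemma iso_class_eq_iff:
  assumes "X \<in> Obj C" "Y \<in> Obj C"
  shows "iso_class X = iso_class Y \<longleftrightarrow> isomorphic C X Y"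
proof
  assume "iso_class X = iso_class Y"
  then show "isomorphic C X Y"
    using isomorphic_refl[OF assms(2)] assms unfolding iso_class_def by blast
next
  assume "isomorphic C X Y"
  then show "iso_class X = iso_class Y"
    unfolding iso_class_def using assms isomorphic_trans isomorphic_sym by blast
qed

definition finite_multiplicities :: "'i set \<Rightarrow> ('i \<Rightarrow> 'o) \<Rightarrow> bool"
  where "finite_multiplicities I X \<longleftrightarrow> (\<forall>Z\<in>Obj C. local_ring (End C Z) \<longrightarrow> finite {i \<in> I. isomorphic C (X i) Z})"

lemma finite_card_le_if_finite_subsets:
  assumes "finite B" "\<And>F. finite F \<Longrightarrow> F \<subseteq> A \<Longrightarrow> card F \<le> card B"
  shows "finite A \<and> card A \<le> card B"
proof -
  have "finite A"
  proof (rule ccontr)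
    assume "infinite A"
    then obtain F where "finite F" "card F = Suc (card B)" "F \<subseteq> A" by (metis infinite_arbitrarily_large)
    then show False using assms(2)[of F] by simp
  qed
  then show ?thesis using assms(2)[of A] by simp
qed

lemma multiplicities_compare:
  assumes ds: "direct_sum C I X A \<iota> \<pi>"
    and ds': "direct_sum C J Y A \<kappa> \<rho>" and loc': "\<And>j. j \<in> J \<Longrightarrow> local_ring (End C (Y j))"
    and det: "detecting J Y A \<kappa> \<rho>" and fin: "finite_multiplicities J Y"
    and Z: "Z \<in> Obj C" "local_ring (End C Z)"
  shows "finite {i \<in> I. isomorphic C (X i) Z}"
    "card {i \<in> I. isomorphic C (X i) Z} \<le> card {j \<in> J. isomorphic C (Y j) Z}"
proof -
  let ?B = "{j \<in> J. isomorphic C (Y j) Z}"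
  have finB: "finite ?B" using fin Z unfolding finite_multiplicities_def by blast
  have "card F \<le> card ?B" if F: "finite F" "F \<subseteq> {i \<in> I. isomorphic C (X i) Z}" for F
  proof -
    obtain U where "U \<subseteq> J" "card U = card F" "\<forall>j\<in>U. isomorphic C (Y j) Z"
      using multiplicity_le[OF ds ds' loc' det Z F(1)] F(2) by blast
    then show ?thesis using card_mono[OF finB, of U] by auto
  qed
  from finite_card_le_if_finite_subsets[OF finB this]
  show "finite {i \<in> I. isomorphic C (X i) Z}" "card {i \<in> I. isomorphic C (X i) Z} \<le> card ?B" by blast+
qed

lemma iso_fibre:
  assumes "direct_sum C I X A \<iota> \<pi>" "Z \<in> Obj C"
  shows "{i \<in> I. iso_class (X i) = iso_class Z} = {i \<in> I. isomorphic C (X i) Z}"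
  using iso_class_eq_iff direct_sumD(2)[OF assms(1)] assms(2) by blast

lemma detecting_transfer:
  assumes ds: "direct_sum C I X A \<iota> \<pi>" and loc: "\<And>i. i \<in> I \<Longrightarrow> local_ring (End C (X i))"
    and ds': "direct_sum C J Y A \<kappa> \<rho>" and loc': "\<And>j. j \<in> J \<Longrightarrow> local_ring (End C (Y j))"
    and det: "detecting J Y A \<kappa> \<rho>" and fin: "finite_multiplicities J Y"
  shows "detecting I X A \<iota> \<pi>"
proof -
  note dI = direct_sumD[OF ds] and dJ = direct_sumD[OF ds']
  have A: "A \<in> Obj C" by (rule dI)
  have "\<exists>\<sigma>. inj_on \<sigma> I \<and> \<sigma> ` I \<subseteq> J \<and> (\<forall>i\<in>I. iso_class (Y (\<sigma> i)) = iso_class (X i))"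
  proof (rule matching_of_fibres)
    fix c assume "c \<in> (\<lambda>i. iso_class (X i)) ` I"
    then obtain i where i: "i \<in> I" and c: "c = iso_class (X i)" by blast
    show "finite {i \<in> I. iso_class (X i) = c}"
      unfolding c iso_fibre[OF ds dI(2)[OF i]]
      by (rule multiplicities_compare(1)[OF ds ds' loc' det fin dI(2)[OF i] loc[OF i]])
    show "card {i \<in> I. iso_class (X i) = c} \<le> card {j \<in> J. iso_class (Y j) = c}"
      unfolding c iso_fibre[OF ds dI(2)[OF i]] iso_fibre[OF ds' dI(2)[OF i]]
      by (rule multiplicities_compare(2)[OF ds ds' loc' det fin dI(2)[OF i] loc[OF i]])
  qed
  then obtain \<sigma> where inj: "inj_on \<sigma> I" and \<sigma>J: "\<And>i. i \<in> I \<Longrightarrow> \<sigma> i \<in> J"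
    and cls: "\<And>i. i \<in> I \<Longrightarrow> iso_class (Y (\<sigma> i)) = iso_class (X i)" by (auto simp: image_subset_iff)
  have "\<forall>i\<in>I. \<exists>t t'. t \<in> Mor C (Y (\<sigma> i)) (X i) \<and> t' \<in> Mor C (X i) (Y (\<sigma> i)) \<and>
      Comp C (X i) (Y (\<sigma> i)) (X i) t t' = Ident C (X i)"
  proof
    fix i assume i: "i \<in> I"
    have "isomorphic C (Y (\<sigma> i)) (X i)" using cls[OF i] iso_class_eq_iff dI(2)[OF i] dJ(2)[OF \<sigma>J[OF i]] by blast
    then show "\<exists>t t'. t \<in> Mor C (Y (\<sigma> i)) (X i) \<and> t' \<in> Mor C (X i) (Y (\<sigma> i)) \<and>
      Comp C (X i) (Y (\<sigma> i)) (X i) t t' = Ident C (X i)"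
      unfolding isomorphic_def by (metis invertibleE)
  qed
  then obtain t t' where t: "\<And>i. i \<in> I \<Longrightarrow> t i \<in> Mor C (Y (\<sigma> i)) (X i)" "\<And>i. i \<in> I \<Longrightarrow> t' i \<in> Mor C (X i) (Y (\<sigma> i))"
    "\<And>i. i \<in> I \<Longrightarrow> Comp C (X i) (Y (\<sigma> i)) (X i) (t i) (t' i) = Ident C (X i)" by metis
  have Ii: "X i \<in> Obj C" "\<iota> i \<in> Mor C (X i) A" "\<pi> i \<in> Mor C A (X i)" "Y (\<sigma> i) \<in> Obj C"
    "\<kappa> (\<sigma> i) \<in> Mor C (Y (\<sigma> i)) A" "\<rho> (\<sigma> i) \<in> Mor C A (Y (\<sigma> i))" if "i \<in> I" for i
    using that dI dJ \<sigma>J by auto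
  obtain \<psi> where \<psi>: "\<psi> \<in> Mor C A A"
    "\<And>i. i \<in> I \<Longrightarrow> Comp C (X i) A A \<psi> (\<iota> i) = Comp C (X i) (Y (\<sigma> i)) A (\<kappa> (\<sigma> i)) (t' i)"
    by (rule direct_sum_ex[OF ds A, of "\<lambda>i. Comp C (X i) (Y (\<sigma> i)) A (\<kappa> (\<sigma> i)) (t' i)"]) (use Ii t A in auto)
  let ?inv = "the_inv_into I \<sigma>"
  have inv: "?inv (\<sigma> i) = i" if "i \<in> I" for i using the_inv_into_f_f[OF inj that] .
  obtain \<phi> where \<phi>: "\<phi> \<in> Mor C A A"
    "\<And>j. j \<in> J \<Longrightarrow> Comp C (Y j) A A \<phi> (\<kappa> j) = (if j \<in> \<sigma> ` I then Comp C (Y j) (X (?inv j)) A (\<iota> (?inv j)) (t (?inv j))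
       else \<zero>\<^bsub>Hom C (Y j) A\<^esub>)"
    by (rule direct_sum_ex[OF ds' A, of "\<lambda>j. if j \<in> \<sigma> ` I then Comp C (Y j) (X (?inv j)) A (\<iota> (?inv j)) (t (?inv j))
       else \<zero>\<^bsub>Hom C (Y j) A\<^esub>"]) (use Ii t A dJ inv in auto)
  have \<phi>\<sigma>: "Comp C (Y (\<sigma> i)) A A \<phi> (\<kappa> (\<sigma> i)) = Comp C (Y (\<sigma> i)) (X i) A (\<iota> i) (t i)" if "i \<in> I" for i
    using \<phi>(2)[OF \<sigma>J[OF that]] inv[OF that] that by simp
  have \<phi>\<psi>: "Comp C A A A \<phi> \<psi> = Ident C A"
  proof (rule direct_sum_eqI[OF ds A])
    fix i assume i: "i \<in> I"
    show "Comp C (X i) A A (Comp C A A A \<phi> \<psi>) (\<iota> i) = Comp C (X i) A A (Ident C A) (\<iota> i)"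
      using \<phi> \<psi> A Ii[OF i] t[OF i] by (simp add: Comp_assoc \<psi>(2)[OF i] Comp_reassoc[OF \<phi>\<sigma>[OF i]] t(3)[OF i])
  qed (use \<phi> \<psi> A in auto)
  have \<rho>\<psi>: "Comp C A A (Y (\<sigma> i)) (\<rho> (\<sigma> i)) \<psi> = Comp C A (X i) (Y (\<sigma> i)) (t' i) (\<pi> i)" if i: "i \<in> I" for i
  proof (rule direct_sum_eqI[OF ds Ii(4)[OF i]])
    fix k assume k: "k \<in> I"
    show "Comp C (X k) A (Y (\<sigma> i)) (Comp C A A (Y (\<sigma> i)) (\<rho> (\<sigma> i)) \<psi>) (\<iota> k)
      = Comp C (X k) A (Y (\<sigma> i)) (Comp C A (X i) (Y (\<sigma> i)) (t' i) (\<pi> i)) (\<iota> k)"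
    proof (cases "k = i")
      case True
      show ?thesis unfolding True
        using \<psi> A Ii[OF i] t[OF i]
        by (simp add: Comp_assoc \<psi>(2)[OF i] Comp_reassoc[OF dJ(5)[OF \<sigma>J[OF i]]] dI(5)[OF i])
    next
      case False
      then have "\<sigma> k \<noteq> \<sigma> i" using inj i k unfolding inj_on_def by blast
      note z = dJ(6)[OF \<sigma>J[OF k] \<sigma>J[OF i] this]
      show ?thesis
        using \<psi> A Ii[OF i] t[OF i] Ii[OF k] t[OF k]
        by (simp add: Comp_assoc \<psi>(2)[OF k] Comp_reassoc[OF z] dI(6)[OF k i False])
    qed
  qed (use \<psi> A Ii[OF i] t[OF i] in auto)
  show ?thesis
    unfolding detecting_def
  proof (intro ballI impI)
    fix Z a b assume Z: "Z \<in> Obj C" "local_ring (End C Z)" and ab: "a \<in> Mor C Z A" "b \<in> Mor C A Z"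
      "Comp C Z A Z b a = Ident C Z"
    let ?b = "Comp C A A Z b \<phi>" and ?a = "Comp C Z A A \<psi> a"
    have ba: "Comp C Z A Z ?b ?a = Ident C Z"
      using Z A ab \<phi> \<psi> by (simp add: Comp_assoc Comp_reassoc[OF \<phi>\<psi>])
    obtain j where j: "j \<in> J"
      "invertible C Z Z (Comp C Z (Y j) Z (Comp C (Y j) A Z ?b (\<kappa> j)) (Comp C Z A (Y j) (\<rho> j) ?a))"
      by (rule detectingD[OF det Z _ _ ba]) (use Z A ab \<phi> \<psi> in auto)
    have jo: "Y j \<in> Obj C" "\<kappa> j \<in> Mor C (Y j) A" "\<rho> j \<in> Mor C A (Y j)" using dJ j by auto
    have "j \<in> \<sigma> ` I"
    proof (rule ccontr)
      assume "j \<notin> \<sigma> ` I"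
      then have z: "Comp C (Y j) A A \<phi> (\<kappa> j) = \<zero>\<^bsub>Hom C (Y j) A\<^esub>" using \<phi>(2)[OF j(1)] by simp
      then have "invertible C Z Z \<zero>\<^bsub>Hom C Z Z\<^esub>"
        using j(2) Z A ab \<phi>(1) \<psi>(1) jo by (simp add: Comp_assoc)
      then show False using local_End_nonzero[OF Z] Z(1) by (auto elim: invertibleE)
    qed
    then obtain i where i: "i \<in> I" "j = \<sigma> i" by blast
    have "Comp C Z (Y j) Z (Comp C (Y j) A Z ?b (\<kappa> j)) (Comp C Z A (Y j) (\<rho> j) ?a)
       = Comp C Z (X i) Z (Comp C (X i) A Z b (\<iota> i)) (Comp C Z A (X i) (\<pi> i) a)"
      unfolding i(2) using Z A ab \<phi>(1) \<psi>(1) Ii[OF i(1)] t[OF i(1)]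
      by (simp add: Comp_assoc Comp_reassoc[OF \<phi>\<sigma>[OF i(1)]] Comp_reassoc[OF \<rho>\<psi>[OF i(1)]] Comp_reassoc[OF t(3)[OF i(1)]])
    then show "\<exists>i\<in>I. invertible C Z Z (Comp C Z (X i) Z (Comp C (X i) A Z b (\<iota> i)) (Comp C Z A (X i) (\<pi> i) a))"
      using j(2) i(1) by auto
  qed
qed

lemma krull_schmidt_if_detecting:
  assumes ds: "direct_sum C I X A \<iota> \<pi>" and loc: "\<And>i. i \<in> I \<Longrightarrow> local_ring (End C (X i))"
    and ds': "direct_sum C J Y A \<kappa> \<rho>" and loc': "\<And>j. j \<in> J \<Longrightarrow> local_ring (End C (Y j))"
    and det: "detecting I X A \<iota> \<pi>" "detecting J Y A \<kappa> \<rho>"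
    and fin: "finite_multiplicities I X" "finite_multiplicities J Y"
  shows "\<exists>\<sigma>. bij_betw \<sigma> I J \<and> (\<forall>i\<in>I. isomorphic C (X i) (Y (\<sigma> i)))"
proof -
  note dI = direct_sumD[OF ds] and dJ = direct_sumD[OF ds']
  have fib: "finite {i \<in> I. iso_class (X i) = c} \<and> finite {j \<in> J. iso_class (Y j) = c} \<and>
      card {i \<in> I. iso_class (X i) = c} = card {j \<in> J. iso_class (Y j) = c}" for c
  proof (cases "\<exists>Z\<in>Obj C. local_ring (End C Z) \<and> c = iso_class Z")
    case True
    then obtain Z where Z: "Z \<in> Obj C" "local_ring (End C Z)" and c: "c = iso_class Z" by blast
    show ?thesis
      unfolding c iso_fibre[OF ds Z(1)] iso_fibre[OF ds' Z(1)]
      using multiplicities_compare[OF ds ds' loc' det(2) fin(2) Z] multiplicities_compare[OF ds' ds loc det(1) fin(1) Z]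
      by (simp add: le_antisym)
  next
    case False
    have "{i \<in> I. iso_class (X i) = c} = {}" using False dI(2) loc by auto
    moreover have "{j \<in> J. iso_class (Y j) = c} = {}" using False dJ(2) loc' by auto
    ultimately show ?thesis by (simp only: card.empty finite.emptyI simp_thms)
  qed
  have "\<exists>\<sigma>. bij_betw \<sigma> I J \<and> (\<forall>i\<in>I. iso_class (Y (\<sigma> i)) = iso_class (X i))"
    by (rule bij_matching_of_fibres) (use fib in simp_all)
  then obtain \<sigma> where bij: "bij_betw \<sigma> I J" and cls: "\<And>i. i \<in> I \<Longrightarrow> iso_class (Y (\<sigma> i)) = iso_class (X i)" by blast
  have "isomorphic C (X i) (Y (\<sigma> i))" if i: "i \<in> I" for i
  proof -
    have "\<sigma> i \<in> J" using bij i by (rule bij_betwE[THEN bspec])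
    then have "Y (\<sigma> i) \<in> Obj C" by (rule dJ(2))
    from iso_class_eq_iff[OF dI(2)[OF i] this] cls[OF i, symmetric] show ?thesis by (rule iffD1)
  qed
  then show ?thesis using bij by blast
qed

lemma biproductD:
  assumes "biproduct C X Y A i j p q"
  shows "X \<in> Obj C" "Y \<in> Obj C" "A \<in> Obj C" "i \<in> Mor C X A" "j \<in> Mor C Y A" "p \<in> Mor C A X" "q \<in> Mor C A Y"
    "Comp C X A X p i = Ident C X" "Comp C Y A Y q j = Ident C Y"
    "Comp C X A Y q i = \<zero>\<^bsub>Hom C X Y\<^esub>" "Comp C Y A X p j = \<zero>\<^bsub>Hom C Y X\<^esub>"
    "Comp C A X A i p \<oplus>\<^bsub>Hom C A A\<^esub> Comp C A Y A j q = Ident C A"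
  using assms unfolding biproduct_def by auto

lemma local_indecomposable:
  assumes A: "A \<in> Obj C" "local_ring (End C A)"
  shows "indecomposable C A"
  unfolding indecomposable_def
proof (intro conjI allI impI)
  show "A \<in> Obj C" by fact
  show "\<not> zero_object C A" using local_End_nonzero[OF A] unfolding zero_object_def by simp
  fix X Y i j p q assume b: "biproduct C X Y A i j p q"
  note bD = biproductD[OF b]
  have "Comp C A A A (Comp C A X A i p) (Comp C A X A i p) = Comp C A X A i p"
    using bD by (simp add: Comp_assoc Comp_reassoc[OF bD(8)])
  then have "Comp C A X A i p = \<zero>\<^bsub>Hom C A A\<^esub> \<or> Comp C A X A i p = Ident C A"
    using ring.local_ring_idempotent[OF End_ring[OF A(1)] A(2), of "Comp C A X A i p"] bD by simp
  then show "zero_object C X \<or> zero_object C Y"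
  proof
    assume z: "Comp C A X A i p = \<zero>\<^bsub>Hom C A A\<^esub>"
    have "Ident C X = Comp C X A X p (Comp C X A A (Comp C A X A i p) i)"
      using bD by (simp add: Comp_assoc)
    also have "\<dots> = \<zero>\<^bsub>Hom C X X\<^esub>" unfolding z using bD by simp
    finally show ?thesis unfolding zero_object_def using bD by simp
  next
    assume z: "Comp C A X A i p = Ident C A"
    have "Ident C Y = Comp C Y A Y q (Comp C Y A A (Comp C A X A i p) j)" unfolding z using bD by simp
    also have "\<dots> = \<zero>\<^bsub>Hom C Y Y\<^esub>" using bD by (simp add: Comp_assoc)
    finally show ?thesis unfolding zero_object_def using bD by simp
  qed
qed

end

text \<open>The data from which uniqueness of decompositions and the description of the radical follow
  formally. The complements replace splitting of idempotents, which is not available in a homotopy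
  category.\<close>

locale detecting_category = S_category S C for S :: "('a, 'r) ring_scheme" (structure)
    and C :: "('o, 'a, 'm) linear_category" +
  assumes detecting_decomposition: "A \<in> Obj C \<Longrightarrow> \<exists>(I::nat set) X \<iota> \<pi>. direct_sum C I X A \<iota> \<pi> \<and>
    (\<forall>i\<in>I. local_ring (End C (X i))) \<and> detecting I X A \<iota> \<pi> \<and> finite_multiplicities I X \<and>
    (\<forall>i\<in>I. \<exists>Y j q. biproduct C (X i) Y A (\<iota> i) j (\<pi> i) q)"
begin

lemma decomposition_detecting:
  assumes ds: "direct_sum C I X A \<iota> \<pi>" and loc: "\<And>i. i \<in> I \<Longrightarrow> local_ring (End C (X i))"
  shows "detecting I X A \<iota> \<pi>" "finite_multiplicities I X"
proof -
  obtain J :: "nat set" and Y \<kappa> \<rho> where J: "direct_sum C J Y A \<kappa> \<rho>" "\<forall>j\<in>J. local_ring (End C (Y j))"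
    "detecting J Y A \<kappa> \<rho>" "finite_multiplicities J Y"
    using detecting_decomposition[OF direct_sumD(1)[OF ds]] by blast
  have loc': "\<And>j. j \<in> J \<Longrightarrow> local_ring (End C (Y j))" using J(2) by blast
  show "detecting I X A \<iota> \<pi>" by (rule detecting_transfer[OF ds loc J(1) loc' J(3,4)])
  show "finite_multiplicities I X"
    unfolding finite_multiplicities_def
    using multiplicities_compare(1)[OF ds J(1) loc' J(3,4)] by blast
qed

lemma krull_schmidt: "krull_schmidt TYPE('i) C"
  unfolding krull_schmidt_def
proof (intro allI impI)
  fix A and I J :: "'i set" and X \<iota> \<pi> Y \<kappa> \<rho>
  assume *: "direct_sum C I X A \<iota> \<pi> \<and> (\<forall>i\<in>I. local_ring (End C (X i))) \<and>
    direct_sum C J Y A \<kappa> \<rho> \<and> (\<forall>j\<in>J. local_ring (End C (Y j)))"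
  then have ds: "direct_sum C I X A \<iota> \<pi>" "direct_sum C J Y A \<kappa> \<rho>"
    and loc: "\<And>i. i \<in> I \<Longrightarrow> local_ring (End C (X i))" "\<And>j. j \<in> J \<Longrightarrow> local_ring (End C (Y j))" by blast+
  show "\<exists>\<sigma>. bij_betw \<sigma> I J \<and> (\<forall>i\<in>I. isomorphic C (X i) (Y (\<sigma> i)))"
    by (rule krull_schmidt_if_detecting[OF ds(1) loc(1) ds(2) loc(2) decomposition_detecting(1)[OF ds(1) loc(1)]
          decomposition_detecting(1)[OF ds(2) loc(2)] decomposition_detecting(2)[OF ds(1) loc(1)]
          decomposition_detecting(2)[OF ds(2) loc(2)]])
qed

lemma indecomposable_local:
  assumes "indecomposable C A"
  shows "local_ring (End C A)"
proof -
  have A: "A \<in> Obj C" and nz: "\<not> zero_object C A"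
    and split: "\<And>X Y i j p q. biproduct C X Y A i j p q \<Longrightarrow> zero_object C X \<or> zero_object C Y"
    using assms unfolding indecomposable_def by (simp_all only: simp_thms)
  obtain I :: "nat set" and X \<iota> \<pi> where ds: "direct_sum C I X A \<iota> \<pi>" and loc: "\<forall>i\<in>I. local_ring (End C (X i))"
    and compl: "\<forall>i\<in>I. \<exists>Y j q. biproduct C (X i) Y A (\<iota> i) j (\<pi> i) q"
    using detecting_decomposition[OF A] by (elim exE conjE) (rule that)
  have "I \<noteq> {}"
  proof
    assume "I = {}"
    then have "Ident C A = \<zero>\<^bsub>Hom C A A\<^esub>"
      by (intro direct_sum_eqI[OF ds A Ident_closed[OF A] Hom_zero[OF A A]]) simp
    then show False using nz A unfolding zero_object_def by simp
  qed
  then obtain i where i: "i \<in> I" by blast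
  then obtain Y j q where b: "biproduct C (X i) Y A (\<iota> i) j (\<pi> i) q" using compl by blast
  note bD = biproductD[OF b]
  have li: "local_ring (End C (X i))" using loc i by blast
  have "\<not> zero_object C (X i)" using local_End_nonzero[OF bD(1) li] unfolding zero_object_def by simp
  then have Y: "Ident C Y = \<zero>\<^bsub>Hom C Y Y\<^esub>" using split[OF b] unfolding zero_object_def by blast
  have "Comp C A Y A j q = Comp C A Y A j (Comp C A Y Y (Ident C Y) q)" using bD by simp
  also have "\<dots> = \<zero>\<^bsub>Hom C A A\<^esub>" unfolding Y using bD by simp
  finally have "Comp C A (X i) A (\<iota> i) (\<pi> i) = Ident C A" using bD(12) bD by simp
  then have "isomorphic C (X i) A"
    unfolding isomorphic_def using bD by (blast intro: invertibleI)
  then show ?thesis by (rule local_ring_isomorphic[OF bD(1) li A])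
qed

lemma component_invertible:
  assumes f: "f \<in> Mor C A B"
    and dA: "direct_sum C I X A \<iota> \<pi>" "\<And>i. i \<in> I \<Longrightarrow> local_ring (End C (X i))"
    and dB: "direct_sum C J Y B \<kappa> \<rho>" "\<And>j. j \<in> J \<Longrightarrow> local_ring (End C (Y j))"
    and Z: "Z \<in> Obj C" "local_ring (End C Z)"
    and ab: "a \<in> Mor C Z A" "b \<in> Mor C B Z" "Comp C Z B Z b (Comp C Z A B f a) = Ident C Z"
  shows "\<exists>i\<in>I. \<exists>j\<in>J. invertible C (X i) (Y j) (Comp C (X i) A (Y j) (Comp C A B (Y j) (\<rho> j) f) (\<iota> i))"
proof -
  note dAD = direct_sumD[OF dA(1)] and dBD = direct_sumD[OF dB(1)]
  note nz = local_End_nonzero[OF Z]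
  have A: "A \<in> Obj C" and B: "B \<in> Obj C" using dAD(1) dBD(1) .
  have fa: "Comp C Z A B f a \<in> Mor C Z B" using Z A B f ab by simp
  obtain j where j: "j \<in> J"
    and inv_j: "invertible C Z Z (Comp C Z (Y j) Z (Comp C (Y j) B Z b (\<kappa> j)) (Comp C Z B (Y j) (\<rho> j) (Comp C Z A B f a)))"
    by (rule detectingD[OF decomposition_detecting(1)[OF dB] Z fa ab(2,3)])
  note Yj = dBD(2)[OF j] dBD(3)[OF j] dBD(4)[OF j]
  let ?k = "Comp C (Y j) B Z b (\<kappa> j)" and ?r = "Comp C A B (Y j) (\<rho> j) f"
  have kr: "?k \<in> Mor C (Y j) Z" "?r \<in> Mor C A (Y j)" using Yj A B Z f ab by auto
  have eq: "Comp C Z B (Y j) (\<rho> j) (Comp C Z A B f a) = Comp C Z A (Y j) ?r a"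
    using Yj A B Z f ab by (simp add: Comp_assoc)
  have inv_k: "invertible C (Y j) Z ?k"
    by (rule retract_of_local_unit(2)[OF Yj(1) dB(2)[OF j] Z(1) nz _ _ inv_j]) (use Yj A B Z f ab in auto)
  obtain v where v: "v \<in> Mor C Z Z" "Comp C Z Z Z (Comp C Z (Y j) Z ?k (Comp C Z A (Y j) ?r a)) v = Ident C Z"
    using inv_j[unfolded eq] by (rule invertibleE)
  let ?a = "Comp C Z Z A a v" and ?b = "Comp C A (Y j) Z ?k ?r"
  have ab': "?a \<in> Mor C Z A" "?b \<in> Mor C A Z" using v kr A Yj Z ab by auto
  have "Comp C Z A Z ?b ?a = Comp C Z Z Z (Comp C Z (Y j) Z ?k (Comp C Z A (Y j) ?r a)) v"
    using v(1) kr A Yj(1) Z ab(1) by (simp add: Comp_assoc[where X = "Y j" and Y = Z] Comp_assoc[where X = A] Comp_assoc[where X = Z] Comp_assoc[where X = "Y j"])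
  then have ba': "Comp C Z A Z ?b ?a = Ident C Z" using v(2) by simp
  obtain i where i: "i \<in> I"
    and inv_i: "invertible C Z Z (Comp C Z (X i) Z (Comp C (X i) A Z ?b (\<iota> i)) (Comp C Z A (X i) (\<pi> i) ?a))"
    by (rule detectingD[OF decomposition_detecting(1)[OF dA] Z ab' ba'])
  note Xi = dAD(2)[OF i] dAD(3)[OF i] dAD(4)[OF i]
  have "invertible C (X i) Z (Comp C (X i) A Z ?b (\<iota> i))"
    by (rule retract_of_local_unit(2)[OF Xi(1) dA(2)[OF i] Z(1) nz _ _ inv_i]) (use Xi A Z ab' in auto)
  moreover have "Comp C (X i) A Z ?b (\<iota> i) = Comp C (X i) (Y j) Z ?k (Comp C (X i) A (Y j) ?r (\<iota> i))"
    by (rule Comp_assoc) (use Xi A Yj Z kr in auto)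
  ultimately have "invertible C (X i) (Y j) (Comp C (X i) A (Y j) ?r (\<iota> i))"
    using invertible_cancel_left[OF Xi(1) Yj(1) Z(1) _ inv_k] kr Xi A Yj by simp
  then show ?thesis using i j by blast
qed

lemma radical_iff:
  assumes A: "A \<in> Obj C" and B: "B \<in> Obj C" and f: "f \<in> Mor C A B"
  shows "f \<in> radical C A B \<longleftrightarrow> \<not> (\<exists>Z\<in>Obj C. local_ring (End C Z) \<and> (\<exists>a\<in>Mor C Z A. \<exists>b\<in>Mor C B Z.
    Comp C Z B Z b (Comp C Z A B f a) = Ident C Z))"
proof
  assume "f \<in> radical C A B"
  then obtain I J :: "nat set" and X \<iota> \<pi> Y \<kappa> \<rho> where
    dA: "direct_sum C I X A \<iota> \<pi>" "\<forall>i\<in>I. indecomposable C (X i)"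
    and dB: "direct_sum C J Y B \<kappa> \<rho>" "\<forall>j\<in>J. indecomposable C (Y j)"
    and no: "\<forall>i\<in>I. \<forall>j\<in>J. \<not> invertible C (X i) (Y j) (Comp C (X i) A (Y j) (Comp C A B (Y j) (\<rho> j) f) (\<iota> i))"
    unfolding radical_def by blast
  have loc: "\<And>i. i \<in> I \<Longrightarrow> local_ring (End C (X i))" "\<And>j. j \<in> J \<Longrightarrow> local_ring (End C (Y j))"
    using dA(2) dB(2) indecomposable_local by blast+
  show "\<not> (\<exists>Z\<in>Obj C. local_ring (End C Z) \<and> (\<exists>a\<in>Mor C Z A. \<exists>b\<in>Mor C B Z.
    Comp C Z B Z b (Comp C Z A B f a) = Ident C Z))"
    using component_invertible[OF f dA(1) loc(1) dB(1) loc(2)] no by blast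
next
  assume no: "\<not> (\<exists>Z\<in>Obj C. local_ring (End C Z) \<and> (\<exists>a\<in>Mor C Z A. \<exists>b\<in>Mor C B Z.
    Comp C Z B Z b (Comp C Z A B f a) = Ident C Z))"
  obtain I :: "nat set" and X \<iota> \<pi> where dA: "direct_sum C I X A \<iota> \<pi>" "\<forall>i\<in>I. local_ring (End C (X i))"
    using detecting_decomposition[OF A] by blast
  obtain J :: "nat set" and Y \<kappa> \<rho> where dB: "direct_sum C J Y B \<kappa> \<rho>" "\<forall>j\<in>J. local_ring (End C (Y j))"
    using detecting_decomposition[OF B] by blast
  have "\<not> invertible C (X i) (Y j) (Comp C (X i) A (Y j) (Comp C A B (Y j) (\<rho> j) f) (\<iota> i))"
    if ij: "i \<in> I" "j \<in> J" for i j
  proof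
    assume "invertible C (X i) (Y j) (Comp C (X i) A (Y j) (Comp C A B (Y j) (\<rho> j) f) (\<iota> i))"
    then obtain g where g: "g \<in> Mor C (Y j) (X i)"
      "Comp C (X i) (Y j) (X i) g (Comp C (X i) A (Y j) (Comp C A B (Y j) (\<rho> j) f) (\<iota> i)) = Ident C (X i)"
      by (rule invertibleE)
    note X = direct_sumD(2-4)[OF dA(1) ij(1)] and Y = direct_sumD(2-4)[OF dB(1) ij(2)]
    have "Comp C (X i) B (X i) (Comp C B (Y j) (X i) g (\<rho> j)) (Comp C (X i) A B f (\<iota> i)) = Ident C (X i)"
      using g X Y A B f by (simp add: Comp_assoc)
    moreover have "Comp C B (Y j) (X i) g (\<rho> j) \<in> Mor C B (X i)" using g X Y B by simp
    ultimately show False using no X dA(2) ij by blast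
  qed
  moreover have "\<forall>i\<in>I. indecomposable C (X i)" "\<forall>j\<in>J. indecomposable C (Y j)"
    using dA dB direct_sumD(2) local_indecomposable by metis+
  ultimately show "f \<in> radical C A B"
    unfolding radical_def using dA(1) dB(1) f
    by (intro CollectI conjI exI[of _ I] exI[of _ X] exI[of _ \<iota>] exI[of _ \<pi>] exI[of _ J] exI[of _ Y]
        exI[of _ \<kappa>] exI[of _ \<rho>]) simp_all
qed

end

context fg_algebra
begin

lemma annihilator_submodule:
  assumes "e \<in> carrier E"
  shows "submodule {x \<in> carrier E. e \<otimes>\<^bsub>E\<^esub> x = \<zero>\<^bsub>E\<^esub>} S E"
  by (rule M.submoduleI_smult) (use assms in \<open>auto simp: E.r_distr smult_mult_r\<close>)

lemma orthogonal_idempotents_finite: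
  assumes Q: "Q \<subseteq> carrier E" and idem: "\<And>e. e \<in> Q \<Longrightarrow> e \<otimes>\<^bsub>E\<^esub> e = e \<and> e \<noteq> \<zero>\<^bsub>E\<^esub>"
    and orth: "\<And>e f. e \<in> Q \<Longrightarrow> f \<in> Q \<Longrightarrow> e \<noteq> f \<Longrightarrow> e \<otimes>\<^bsub>E\<^esub> f = \<zero>\<^bsub>E\<^esub>"
  shows "finite Q"
proof -
  let ?G = "span_module S E ` {F. finite F \<and> F \<subseteq> Q}"
  have "\<exists>N\<in>?G. \<forall>L\<in>?G. N \<subseteq> L \<longrightarrow> L = N"
    by (rule submodules_maximal) (use Q in \<open>auto intro!: M.span_submodule\<close>)
  then obtain F where F: "finite F" "F \<subseteq> Q"
    and max: "\<And>F'. finite F' \<Longrightarrow> F' \<subseteq> Q \<Longrightarrow> span_module S E F \<subseteq> span_module S E F'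
      \<Longrightarrow> span_module S E F' = span_module S E F" by auto
  have "Q \<subseteq> F"
  proof
    fix e assume e: "e \<in> Q"
    have Fc: "F \<subseteq> carrier E" and ec: "e \<in> carrier E" using F Q e by auto
    have "F \<subseteq> span_module S E (insert e F)" using M.span_superset[of "insert e F"] by blast
    moreover have "submodule (span_module S E (insert e F)) S E"
      by (rule M.span_submodule) (use Fc ec in auto)
    ultimately have "span_module S E F \<subseteq> span_module S E (insert e F)"
      by (intro M.span_minimal)
    then have "span_module S E (insert e F) = span_module S E F"
      by (intro max) (use F e in auto)
    then have e_span: "e \<in> span_module S E F" using M.span_superset[of "insert e F"] by blast
    show "e \<in> F"
    proof (rule ccontr)
      assume "e \<notin> F"
      then have "F \<subseteq> {x \<in> carrier E. e \<otimes>\<^bsub>E\<^esub> x = \<zero>\<^bsub>E\<^esub>}" using orth[OF e] F(2) Fc by blast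
      from M.span_minimal[OF annihilator_submodule[OF ec] this]
      have "e \<otimes>\<^bsub>E\<^esub> e = \<zero>\<^bsub>E\<^esub>" using e_span by blast
      then show False using idem[OF e] by simp
    qed
  qed
  then show ?thesis using F(1) finite_subset by blast
qed

lemma idempotent_chain_minimal:
  assumes Q: "Q \<noteq> {}" "Q \<subseteq> carrier E" and idem: "\<And>e. e \<in> Q \<Longrightarrow> e \<otimes>\<^bsub>E\<^esub> e = e"
    and chain: "\<And>e f. e \<in> Q \<Longrightarrow> f \<in> Q \<Longrightarrow>
      e \<otimes>\<^bsub>E\<^esub> f = e \<and> f \<otimes>\<^bsub>E\<^esub> e = e \<or> e \<otimes>\<^bsub>E\<^esub> f = f \<and> f \<otimes>\<^bsub>E\<^esub> e = f"
  shows "\<exists>e\<in>Q. \<forall>f\<in>Q. e \<otimes>\<^bsub>E\<^esub> f = e \<and> f \<otimes>\<^bsub>E\<^esub> e = e"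
proof -
  define Ann where "Ann e = {x \<in> carrier E. e \<otimes>\<^bsub>E\<^esub> x = \<zero>\<^bsub>E\<^esub>}" for e
  have "\<exists>N\<in>Ann ` Q. \<forall>L\<in>Ann ` Q. N \<subseteq> L \<longrightarrow> L = N"
    by (rule submodules_maximal) (use Q in \<open>auto simp: Ann_def intro: annihilator_submodule\<close>)
  then obtain e where e: "e \<in> Q" and max: "\<And>f. f \<in> Q \<Longrightarrow> Ann e \<subseteq> Ann f \<Longrightarrow> Ann f = Ann e" by auto
  have ec: "e \<in> carrier E" using e Q by blast
  have "e \<otimes>\<^bsub>E\<^esub> f = e \<and> f \<otimes>\<^bsub>E\<^esub> e = e" if f: "f \<in> Q" for f
  proof (rule disjE[OF chain[OF e f]])
    assume ef: "e \<otimes>\<^bsub>E\<^esub> f = f \<and> f \<otimes>\<^bsub>E\<^esub> e = f"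
    have fc: "f \<in> carrier E" using f Q by blast
    have "x \<in> Ann f" if "x \<in> Ann e" for x
    proof -
      have x: "x \<in> carrier E" "e \<otimes>\<^bsub>E\<^esub> x = \<zero>\<^bsub>E\<^esub>" using that unfolding Ann_def by auto
      have "f \<otimes>\<^bsub>E\<^esub> x = f \<otimes>\<^bsub>E\<^esub> (e \<otimes>\<^bsub>E\<^esub> x)" using ef E.m_assoc[OF fc ec x(1)] by simp
      then show ?thesis using x fc unfolding Ann_def by simp
    qed
    then have "Ann f = Ann e" using max[OF f] by blast
    moreover have "\<one>\<^bsub>E\<^esub> \<ominus>\<^bsub>E\<^esub> f \<in> Ann f"
      unfolding Ann_def using fc idem[OF f] by (simp add: a_minus_def E.r_distr E.r_minus M.M.r_neg)
    ultimately have "e \<otimes>\<^bsub>E\<^esub> (\<one>\<^bsub>E\<^esub> \<ominus>\<^bsub>E\<^esub> f) = \<zero>\<^bsub>E\<^esub>" unfolding Ann_def by blast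
    then have "e \<ominus>\<^bsub>E\<^esub> f = \<zero>\<^bsub>E\<^esub>" using ec fc ef by (simp add: a_minus_def E.r_distr E.r_minus)
    then have "e = f" using ec fc by (metis M.add_diff_cancel M.M.r_zero)
    then show ?thesis using idem[OF e] by simp
  qed
  then show ?thesis using e by blast
qed

end

section \<open>The category of complexes\<close>

lemma Ch_simps [simp]:
  "Obj (Ch C) = Collect (is_chain_complex C)"
  "carrier (Hom (Ch C) A B) = Collect (is_chain_map C A B)"
  "\<zero>\<^bsub>Hom (Ch C) A B\<^esub> = (\<lambda>n. \<zero>\<^bsub>Hom C (ob A n) (ob B n)\<^esub>)"
  "f \<oplus>\<^bsub>Hom (Ch C) A B\<^esub> g = (\<lambda>n. f n \<oplus>\<^bsub>Hom C (ob A n) (ob B n)\<^esub> g n)"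
  "s \<odot>\<^bsub>Hom (Ch C) A B\<^esub> f = (\<lambda>n. s \<odot>\<^bsub>Hom C (ob A n) (ob B n)\<^esub> f n)"
  "Comp (Ch C) A B D g f = (\<lambda>n. Comp C (ob A n) (ob B n) (ob D n) (g n) (f n))"
  "Ident (Ch C) A = (\<lambda>n. Ident C (ob A n))"
  by (simp_all add: Ch_def)

lemma chain_complexD:
  assumes "is_chain_complex C A"
  shows "ob A n \<in> Obj C" "diff A n \<in> Mor C (ob A n) (ob A (n - 1))"
    "Comp C (ob A n) (ob A (n - 1)) (ob A (n - 2)) (diff A (n - 1)) (diff A n) = \<zero>\<^bsub>Hom C (ob A n) (ob A (n - 2))\<^esub>"
  using assms unfolding is_chain_complex_def by blast+

lemma chain_mapD:
  assumes "is_chain_map C A B f"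
  shows "f n \<in> Mor C (ob A n) (ob B n)"
    "Comp C (ob A n) (ob B n) (ob B (n - 1)) (diff B n) (f n)
      = Comp C (ob A n) (ob A (n - 1)) (ob B (n - 1)) (f (n - 1)) (diff A n)"
  using assms unfolding is_chain_map_def by blast+

context S_category
begin

lemma Ch_abelian:
  assumes A: "is_chain_complex C A" and B: "is_chain_complex C B"
  shows "abelian_group (Hom (Ch C) A B)"
proof -
  note AB = chain_complexD[OF A] chain_complexD[OF B]
  note ag = Hom_abelian[OF AB(1) AB(4)]
  note am = ag[THEN abelian_group.axioms(1)]
  show ?thesis
  proof (rule abelian_groupI)
    show "\<zero>\<^bsub>Hom (Ch C) A B\<^esub> \<in> carrier (Hom (Ch C) A B)"
      using AB by (simp add: is_chain_map_def)
  next
    fix f g assume "f \<in> carrier (Hom (Ch C) A B)" "g \<in> carrier (Hom (Ch C) A B)"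
    then have f: "is_chain_map C A B f" and g: "is_chain_map C A B g" by simp_all
    note fg = chain_mapD[OF f] chain_mapD[OF g]
    show "f \<oplus>\<^bsub>Hom (Ch C) A B\<^esub> g \<in> carrier (Hom (Ch C) A B)"
      using AB fg by (simp add: is_chain_map_def Comp_add_left Comp_add_right)
    show "f \<oplus>\<^bsub>Hom (Ch C) A B\<^esub> g = g \<oplus>\<^bsub>Hom (Ch C) A B\<^esub> f"
      using am fg by (simp add: abelian_monoid.a_comm)
    show "\<zero>\<^bsub>Hom (Ch C) A B\<^esub> \<oplus>\<^bsub>Hom (Ch C) A B\<^esub> f = f"
      using AB fg by simp
    show "\<exists>y\<in>carrier (Hom (Ch C) A B). y \<oplus>\<^bsub>Hom (Ch C) A B\<^esub> f = \<zero>\<^bsub>Hom (Ch C) A B\<^esub>"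
    proof (rule bexI[of _ "\<lambda>n. \<ominus>\<^bsub>Hom C (ob A n) (ob B n)\<^esub> f n"])
      show "(\<lambda>n. \<ominus>\<^bsub>Hom C (ob A n) (ob B n)\<^esub> f n) \<in> carrier (Hom (Ch C) A B)"
        using AB fg by (simp add: is_chain_map_def)
    qed (use ag fg in \<open>simp add: abelian_group.l_neg\<close>)
    fix h assume "h \<in> carrier (Hom (Ch C) A B)"
    then have h: "is_chain_map C A B h" by simp
    show "f \<oplus>\<^bsub>Hom (Ch C) A B\<^esub> g \<oplus>\<^bsub>Hom (Ch C) A B\<^esub> h = f \<oplus>\<^bsub>Hom (Ch C) A B\<^esub> (g \<oplus>\<^bsub>Hom (Ch C) A B\<^esub> h)"
      using am fg chain_mapD[OF h] by (simp add: abelian_monoid.a_assoc)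
  qed
qed

lemma Ch_S_category: "S_category S (Ch C)"
proof (intro S_category.intro S_category_axioms.intro)
  show "cring S" by (rule is_cring)
next
  fix A B assume "A \<in> Obj (Ch C)" "B \<in> Obj (Ch C)"
  then have A: "is_chain_complex C A" and B: "is_chain_complex C B" by simp_all
  note AB = chain_complexD[OF A] chain_complexD[OF B]
  note m = Hom_module[OF AB(1) AB(4)]
  show "Module.module S (Hom (Ch C) A B)"
  proof (rule moduleI)
    show "abelian_group (Hom (Ch C) A B)" by (rule Ch_abelian[OF A B])
    fix s t f g assume s: "s \<in> carrier S" and "f \<in> carrier (Hom (Ch C) A B)"
    then have f: "is_chain_map C A B f" by simp
    note fD = chain_mapD[OF f]
    show "s \<odot>\<^bsub>Hom (Ch C) A B\<^esub> f \<in> carrier (Hom (Ch C) A B)"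
      using AB fD s by (simp add: is_chain_map_def Comp_smult_left Comp_smult_right)
    show "(s \<otimes> t) \<odot>\<^bsub>Hom (Ch C) A B\<^esub> f = s \<odot>\<^bsub>Hom (Ch C) A B\<^esub> (t \<odot>\<^bsub>Hom (Ch C) A B\<^esub> f)"
      "(s \<oplus> t) \<odot>\<^bsub>Hom (Ch C) A B\<^esub> f = s \<odot>\<^bsub>Hom (Ch C) A B\<^esub> f \<oplus>\<^bsub>Hom (Ch C) A B\<^esub> t \<odot>\<^bsub>Hom (Ch C) A B\<^esub> f"
      if "t \<in> carrier S"
      using m s that fD by (simp_all add: module.smult_assoc1 module.smult_l_distr)
    show "s \<odot>\<^bsub>Hom (Ch C) A B\<^esub> (f \<oplus>\<^bsub>Hom (Ch C) A B\<^esub> g) = s \<odot>\<^bsub>Hom (Ch C) A B\<^esub> f \<oplus>\<^bsub>Hom (Ch C) A B\<^esub> s \<odot>\<^bsub>Hom (Ch C) A B\<^esub> g"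
      if "g \<in> carrier (Hom (Ch C) A B)"
      using that chain_mapD(1)[of C A B g] module.smult_r_distr[OF m s fD(1)] by simp
  next
    show "\<one> \<odot>\<^bsub>Hom (Ch C) A B\<^esub> f = f" if "f \<in> carrier (Hom (Ch C) A B)" for f
      using m that chain_mapD(1)[of C A B f] by (simp add: module.smult_one)
  qed (rule is_cring)
next
  fix A assume "A \<in> Obj (Ch C)"
  then show "Ident (Ch C) A \<in> Mor (Ch C) A A" by (simp add: is_chain_map_def chain_complexD)
next
  fix A B D f g assume "A \<in> Obj (Ch C)" "B \<in> Obj (Ch C)" "D \<in> Obj (Ch C)"
    "g \<in> Mor (Ch C) B D" "f \<in> Mor (Ch C) A B"
  then have c: "is_chain_complex C A" "is_chain_complex C B" "is_chain_complex C D"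
    and m: "is_chain_map C B D g" "is_chain_map C A B f" by simp_all
  note cD = c[THEN chain_complexD(1)] c[THEN chain_complexD(2)]
  note mD = m[THEN chain_mapD(1)] m[THEN chain_mapD(2)]
  show "Comp (Ch C) A B D g f \<in> Mor (Ch C) A D"
    unfolding Ch_simps mem_Collect_eq is_chain_map_def
  proof (intro allI conjI)
    fix n
    show "Comp C (ob A n) (ob B n) (ob D n) (g n) (f n) \<in> Mor C (ob A n) (ob D n)"
      using cD mD by simp
    show "Comp C (ob A n) (ob D n) (ob D (n - 1)) (diff D n) (Comp C (ob A n) (ob B n) (ob D n) (g n) (f n))
      = Comp C (ob A n) (ob A (n - 1)) (ob D (n - 1)) (Comp C (ob A (n - 1)) (ob B (n - 1)) (ob D (n - 1)) (g (n - 1)) (f (n - 1))) (diff A n)"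
      using cD mD by (simp add: Comp_assoc Comp_reassoc[OF mD(3)])
  qed
next
  fix A B f assume "A \<in> Obj (Ch C)" "B \<in> Obj (Ch C)" "f \<in> Mor (Ch C) A B"
  then show "Comp (Ch C) A B B (Ident (Ch C) B) f = f" "Comp (Ch C) A A B f (Ident (Ch C) A) = f"
    by (simp_all add: chain_complexD chain_mapD(1))
next
  fix A B D E h g f assume "A \<in> Obj (Ch C)" "B \<in> Obj (Ch C)" "D \<in> Obj (Ch C)" "E \<in> Obj (Ch C)"
    "h \<in> Mor (Ch C) D E" "g \<in> Mor (Ch C) B D" "f \<in> Mor (Ch C) A B"
  then show "Comp (Ch C) A B E (Comp (Ch C) B D E h g) f = Comp (Ch C) A D E h (Comp (Ch C) A B D g f)"
    by (simp add: Comp_assoc chain_complexD(1) chain_mapD(1))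
next
  fix A B D g g' f assume "A \<in> Obj (Ch C)" "B \<in> Obj (Ch C)" "D \<in> Obj (Ch C)"
    "g \<in> Mor (Ch C) B D" "g' \<in> Mor (Ch C) B D" "f \<in> Mor (Ch C) A B"
  then show "Comp (Ch C) A B D (g \<oplus>\<^bsub>Hom (Ch C) B D\<^esub> g') f
      = Comp (Ch C) A B D g f \<oplus>\<^bsub>Hom (Ch C) A D\<^esub> Comp (Ch C) A B D g' f"
    by (simp add: Comp_add_left chain_complexD(1) chain_mapD(1))
next
  fix A B D g f f' assume "A \<in> Obj (Ch C)" "B \<in> Obj (Ch C)" "D \<in> Obj (Ch C)"
    "g \<in> Mor (Ch C) B D" "f \<in> Mor (Ch C) A B" "f' \<in> Mor (Ch C) A B"
  then show "Comp (Ch C) A B D g (f \<oplus>\<^bsub>Hom (Ch C) A B\<^esub> f')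
      = Comp (Ch C) A B D g f \<oplus>\<^bsub>Hom (Ch C) A D\<^esub> Comp (Ch C) A B D g f'"
    by (simp add: Comp_add_right chain_complexD(1) chain_mapD(1))
next
  fix A B D s g f assume "A \<in> Obj (Ch C)" "B \<in> Obj (Ch C)" "D \<in> Obj (Ch C)" "s \<in> carrier S"
    "g \<in> Mor (Ch C) B D" "f \<in> Mor (Ch C) A B"
  then show "Comp (Ch C) A B D (s \<odot>\<^bsub>Hom (Ch C) B D\<^esub> g) f = s \<odot>\<^bsub>Hom (Ch C) A D\<^esub> Comp (Ch C) A B D g f"
    "Comp (Ch C) A B D g (s \<odot>\<^bsub>Hom (Ch C) A B\<^esub> f) = s \<odot>\<^bsub>Hom (Ch C) A D\<^esub> Comp (Ch C) A B D g f"
    by (simp_all add: Comp_smult_left Comp_smult_right chain_complexD(1) chain_mapD(1))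
qed

lemma Ch_neg:
  assumes A: "is_chain_complex C A" and B: "is_chain_complex C B" and f: "is_chain_map C A B f"
  shows "\<ominus>\<^bsub>Hom (Ch C) A B\<^esub> f = (\<lambda>n. \<ominus>\<^bsub>Hom C (ob A n) (ob B n)\<^esub> f n)"
proof -
  interpret H: abelian_group "Hom (Ch C) A B" by (rule Ch_abelian[OF A B])
  note AB = chain_complexD[OF A] chain_complexD[OF B]
  note ag = Hom_abelian[OF AB(1) AB(4)]
  show ?thesis
  proof (rule H.minus_equality)
    show "(\<lambda>n. \<ominus>\<^bsub>Hom C (ob A n) (ob B n)\<^esub> f n) \<in> carrier (Hom (Ch C) A B)"
      using AB chain_mapD[OF f] by (simp add: is_chain_map_def)
  qed (use f ag chain_mapD(1)[OF f] in \<open>simp_all add: abelian_group.l_neg\<close>)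
qed

lemma Ch_minus:
  assumes "is_chain_complex C A" "is_chain_complex C B" "is_chain_map C A B g"
  shows "f \<ominus>\<^bsub>Hom (Ch C) A B\<^esub> g = (\<lambda>n. f n \<ominus>\<^bsub>Hom C (ob A n) (ob B n)\<^esub> g n)"
  using Ch_neg[OF assms] by (simp add: a_minus_def)

lemma Ch_finsum:
  assumes A: "is_chain_complex C A" and B: "is_chain_complex C B" and f: "\<And>i. i \<in> I \<Longrightarrow> is_chain_map C A B (f i)"
  shows "finsum (Hom (Ch C) A B) f I n = finsum (Hom C (ob A n) (ob B n)) (\<lambda>i. f i n) I"
proof -
  interpret H: abelian_group "Hom (Ch C) A B" by (rule Ch_abelian[OF A B])
  interpret Hn: abelian_group "Hom C (ob A n) (ob B n)"
    using chain_complexD(1)[OF A] chain_complexD(1)[OF B] by (rule Hom_abelian)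
  show ?thesis
  proof (cases "finite I")
    case True
    then show ?thesis using f
    proof (induction I)
      case (insert i I)
      then have "finsum (Hom (Ch C) A B) f (insert i I) = f i \<oplus>\<^bsub>Hom (Ch C) A B\<^esub> finsum (Hom (Ch C) A B) f I"
        by (intro H.finsum_insert) auto
      moreover have "finsum (Hom C (ob A n) (ob B n)) (\<lambda>i. f i n) (insert i I)
          = f i n \<oplus>\<^bsub>Hom C (ob A n) (ob B n)\<^esub> finsum (Hom C (ob A n) (ob B n)) (\<lambda>i. f i n) I"
        using insert chain_mapD(1)[of C A B] by (intro Hn.finsum_insert) auto
      ultimately show ?case using insert by simp
    qed simp
  next
    case False
    then show ?thesis by (simp add: H.finsum_infinite Hn.finsum_infinite)
  qed
qed

text \<open>Splitting degreewise: the differential of the summand is \<open>p d i\<close>, and \<open>i\<close>, \<open>p\<close> commute with the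
  differentials because \<open>i p\<close> does.\<close>

lemma Ch_summand:
  assumes A: "is_chain_complex C A" and e: "is_chain_map C A A e"
    and X: "\<And>n. X n \<in> Obj C" and i: "\<And>n. i n \<in> Mor C (X n) (ob A n)" and p: "\<And>n. p n \<in> Mor C (ob A n) (X n)"
    and pi: "\<And>n. Comp C (X n) (ob A n) (X n) (p n) (i n) = Ident C (X n)"
    and ip: "\<And>n. Comp C (ob A n) (X n) (ob A n) (i n) (p n) = e n"
  defines "B \<equiv> \<lparr>ob = X, diff = (\<lambda>n. Comp C (X n) (ob A n) (X (n - 1)) (Comp C (ob A n) (ob A (n - 1)) (X (n - 1)) (p (n - 1)) (diff A n)) (i n))\<rparr>"
  shows "is_chain_complex C B" "is_chain_map C B A i" "is_chain_map C A B p"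
proof -
  note AD = chain_complexD[OF A] and eD = chain_mapD[OF e]
  have ei: "Comp C (X n) (ob A n) (ob A n) (e n) (i n) = i n" for n
    unfolding ip[symmetric] using AD(1) X i p pi by (simp add: Comp_assoc)
  have pe: "Comp C (ob A n) (ob A n) (X n) (p n) (e n) = p n" for n
    unfolding ip[symmetric] using AD(1) X i p pi by (simp add: Comp_reassoc[OF pi])
  have id: "Comp C (X n) (X (n - 1)) (ob A (n - 1)) (i (n - 1)) (diff B n) = Comp C (X n) (ob A n) (ob A (n - 1)) (diff A n) (i n)" for n
    unfolding B_def using AD X i p eD(1)
    by (simp add: Comp_assoc Comp_reassoc[OF ip] Comp_reassoc[OF eD(2)[symmetric]] ei)
  have pd: "Comp C (ob A n) (X n) (X (n - 1)) (diff B n) (p n) = Comp C (ob A n) (ob A (n - 1)) (X (n - 1)) (p (n - 1)) (diff A n)" for n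
    unfolding B_def using AD X i p eD(1)
    by (simp add: Comp_assoc ip eD(2) Comp_reassoc[OF pe])
  have dB: "diff B n \<in> Mor C (X n) (X (n - 1))" for n
    unfolding B_def using AD X i p by simp
  have obB: "ob B = X" unfolding B_def by simp
  have dd: "Comp C (X n) (X (n - 1)) (X (n - 2)) (diff B (n - 1)) (diff B n) = \<zero>\<^bsub>Hom C (X n) (X (n - 2))\<^esub>" for n
  proof -
    have pd': "Comp C (ob A (n - 1)) (X (n - 1)) (X (n - 2)) (diff B (n - 1)) (p (n - 1))
        = Comp C (ob A (n - 1)) (ob A (n - 2)) (X (n - 2)) (p (n - 2)) (diff A (n - 1))"
      and dA': "diff A (n - 1) \<in> Mor C (ob A (n - 1)) (ob A (n - 2))" and dB': "diff B (n - 1) \<in> Mor C (X (n - 1)) (X (n - 2))"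
      using pd[of "n - 1"] AD(2)[of "n - 1"] dB[of "n - 1"] by simp_all
    have "Comp C (X n) (X (n - 1)) (X (n - 2)) (diff B (n - 1)) (diff B n)
        = Comp C (X n) (X (n - 1)) (X (n - 2)) (diff B (n - 1)) (Comp C (X n) (ob A n) (X (n - 1)) (Comp C (ob A n) (ob A (n - 1)) (X (n - 1)) (p (n - 1)) (diff A n)) (i n))"
      by (simp add: B_def)
    also have "\<dots> = Comp C (X n) (ob A (n - 1)) (X (n - 2)) (Comp C (ob A (n - 1)) (ob A (n - 2)) (X (n - 2)) (p (n - 2)) (diff A (n - 1))) (Comp C (X n) (ob A n) (ob A (n - 1)) (diff A n) (i n))"
      using AD(1,2) X i p dB' dA' by (simp add: Comp_assoc Comp_reassoc[OF pd'])
    also have "\<dots> = \<zero>\<^bsub>Hom C (X n) (X (n - 2))\<^esub>"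
      using AD(1,2) X i p dA' by (simp add: Comp_assoc Comp_reassoc[OF AD(3)])
    finally show ?thesis .
  qed
  show "is_chain_complex C B" unfolding is_chain_complex_def obB using X dB dd by blast
  show "is_chain_map C B A i" unfolding is_chain_map_def obB using i id by simp
  show "is_chain_map C A B p" unfolding is_chain_map_def obB using p pd by simp
qed

end

context additive_category
begin

lemma Ch_zero_object: "\<exists>Z. zero_object (Ch C) Z"
proof -
  obtain Z where Z: "Z \<in> Obj C" "Ident C Z = \<zero>\<^bsub>Hom C Z Z\<^esub>"
    using zero_object_ex unfolding zero_object_def by blast
  let ?Z = "\<lparr>ob = \<lambda>_::int. Z, diff = \<lambda>_. \<zero>\<^bsub>Hom C Z Z\<^esub>\<rparr>"
  have "is_chain_complex C ?Z" unfolding is_chain_complex_def using Z(1) by simp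
  then show ?thesis unfolding zero_object_def using Z(2) by (intro exI[of _ ?Z]) simp
qed

lemma Ch_biproduct:
  assumes A: "is_chain_complex C A" and B: "is_chain_complex C B"
  shows "\<exists>P i j p q. biproduct (Ch C) A B P i j p q"
proof -
  note AD = chain_complexD[OF A] and BD = chain_complexD[OF B]
  have "\<forall>n. \<exists>P i j p q. biproduct C (ob A n) (ob B n) P i j p q"
    using biproduct_ex AD(1) BD(1) by blast
  then obtain P i j p q where b: "\<And>n. biproduct C (ob A n) (ob B n) (P n) (i n) (j n) (p n) (q n)" by metis
  note bD = biproductD[OF b]
  define d where "d n = Comp C (P n) (ob A n) (P (n - 1)) (Comp C (ob A n) (ob A (n - 1)) (P (n - 1)) (i (n - 1)) (diff A n)) (p n)
    \<oplus>\<^bsub>Hom C (P n) (P (n - 1))\<^esub> Comp C (P n) (ob B n) (P (n - 1)) (Comp C (ob B n) (ob B (n - 1)) (P (n - 1)) (j (n - 1)) (diff B n)) (q n)" for n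
  have d: "d n \<in> Mor C (P n) (P (n - 1))" for n unfolding d_def using AD BD bD by simp
  have di: "Comp C (ob A n) (P n) (P (n - 1)) (d n) (i n) = Comp C (ob A n) (ob A (n - 1)) (P (n - 1)) (i (n - 1)) (diff A n)" for n
    unfolding d_def using AD(1,2) BD(1,2) bD(3-7) by (simp add: Comp_add_left Comp_assoc bD(8-11))
  have dj: "Comp C (ob B n) (P n) (P (n - 1)) (d n) (j n) = Comp C (ob B n) (ob B (n - 1)) (P (n - 1)) (j (n - 1)) (diff B n)" for n
    unfolding d_def using AD(1,2) BD(1,2) bD(3-7) by (simp add: Comp_add_left Comp_assoc bD(8-11))
  have pd: "Comp C (P n) (P (n - 1)) (ob A (n - 1)) (p (n - 1)) (d n) = Comp C (P n) (ob A n) (ob A (n - 1)) (diff A n) (p n)" for n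
    unfolding d_def using AD(1,2) BD(1,2) bD(3-7)
    by (simp add: Comp_add_right Comp_assoc Comp_reassoc[OF bD(8)] Comp_reassoc[OF bD(11)])
  have qd: "Comp C (P n) (P (n - 1)) (ob B (n - 1)) (q (n - 1)) (d n) = Comp C (P n) (ob B n) (ob B (n - 1)) (diff B n) (q n)" for n
    unfolding d_def using AD(1,2) BD(1,2) bD(3-7)
    by (simp add: Comp_add_right Comp_assoc Comp_reassoc[OF bD(9)] Comp_reassoc[OF bD(10)])
  have dd: "Comp C (P n) (P (n - 1)) (P (n - 2)) (d (n - 1)) (d n) = \<zero>\<^bsub>Hom C (P n) (P (n - 2))\<^esub>" for n
  proof -
    have c: "d (n - 1) \<in> Mor C (P (n - 1)) (P (n - 2))" "diff A (n - 1) \<in> Mor C (ob A (n - 1)) (ob A (n - 2))"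
      "diff B (n - 1) \<in> Mor C (ob B (n - 1)) (ob B (n - 2))"
      using d[of "n - 1"] AD(2)[of "n - 1"] BD(2)[of "n - 1"] by simp_all
    have di': "Comp C (ob A (n - 1)) (P (n - 1)) (P (n - 2)) (d (n - 1)) (i (n - 1)) = Comp C (ob A (n - 1)) (ob A (n - 2)) (P (n - 2)) (i (n - 2)) (diff A (n - 1))"
      and dj': "Comp C (ob B (n - 1)) (P (n - 1)) (P (n - 2)) (d (n - 1)) (j (n - 1)) = Comp C (ob B (n - 1)) (ob B (n - 2)) (P (n - 2)) (j (n - 2)) (diff B (n - 1))"
      using di[of "n - 1"] dj[of "n - 1"] by simp_all
    have "Comp C (P n) (P (n - 1)) (P (n - 2)) (d (n - 1)) (d n)
      = Comp C (P n) (P (n - 1)) (P (n - 2)) (d (n - 1)) (Comp C (P n) (ob A n) (P (n - 1)) (Comp C (ob A n) (ob A (n - 1)) (P (n - 1)) (i (n - 1)) (diff A n)) (p n)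
        \<oplus>\<^bsub>Hom C (P n) (P (n - 1))\<^esub> Comp C (P n) (ob B n) (P (n - 1)) (Comp C (ob B n) (ob B (n - 1)) (P (n - 1)) (j (n - 1)) (diff B n)) (q n))"
      by (simp add: d_def)
    also have "\<dots> = \<zero>\<^bsub>Hom C (P n) (P (n - 2))\<^esub>"
      using AD(1,2) BD(1,2) bD(3-7) c
      by (simp add: Comp_add_right Comp_assoc Comp_reassoc[OF di'] Comp_reassoc[OF dj']
          Comp_reassoc[OF AD(3)] Comp_reassoc[OF BD(3)])
    finally show ?thesis .
  qed
  let ?P = "\<lparr>ob = P, diff = d\<rparr>"
  have P: "is_chain_complex C ?P" unfolding is_chain_complex_def using bD(3) d dd by simp
  have maps: "is_chain_map C A ?P i" "is_chain_map C B ?P j" "is_chain_map C ?P A p" "is_chain_map C ?P B q"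
    unfolding is_chain_map_def using bD(4-7) di dj pd qd by simp_all
  have "biproduct (Ch C) A B ?P i j p q"
    unfolding biproduct_def using A B P maps bD(8-12) by simp
  then show ?thesis by blast
qed

lemma Ch_additive: "additive_category S (Ch C)"
  using Ch_S_category Ch_zero_object Ch_biproduct
  by (intro additive_category.intro additive_category_axioms.intro) auto

end

context fully_additive_category
begin

lemma Ch_idempotent_splits:
  assumes A: "is_chain_complex C A" and e: "is_chain_map C A A e" and ee: "Comp (Ch C) A A A e e = e"
  obtains X Y i j p q where "biproduct (Ch C) X Y A i j p q" "Comp (Ch C) A X A i p = e"
proof -
  note AD = chain_complexD[OF A] and eD = chain_mapD[OF e]
  interpret Ch: S_category S "Ch C" by (rule Ch_S_category)
  have "\<forall>n. \<exists>X Y i j p q. biproduct C X Y (ob A n) i j p q \<and> Comp C (ob A n) X (ob A n) i p = e n"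
    using idempotent_splits AD(1) eD(1) ee by (auto simp: fun_eq_iff)
  then obtain X Y i j p q where b: "\<And>n. biproduct C (X n) (Y n) (ob A n) (i n) (j n) (p n) (q n)"
    and ip: "\<And>n. Comp C (ob A n) (X n) (ob A n) (i n) (p n) = e n" by metis
  note bD = biproductD[OF b]
  define f where "f = Ident (Ch C) A \<ominus>\<^bsub>Hom (Ch C) A A\<^esub> e"
  have f: "is_chain_map C A A f" using Ch.Hom_minus[of A A "Ident (Ch C) A" e] Ch.Ident_closed[of A] A e unfolding f_def by simp
  have fn: "f n = Ident C (ob A n) \<ominus>\<^bsub>Hom C (ob A n) (ob A n)\<^esub> e n" for n
    unfolding f_def Ch_minus[OF A A e] by simp
  have jq: "Comp C (ob A n) (Y n) (ob A n) (j n) (q n) = f n" for n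
  proof -
    interpret H: smodule S "Hom C (ob A n) (ob A n)" by (intro Hom_smodule AD)
    have "f n = (e n \<oplus>\<^bsub>Hom C (ob A n) (ob A n)\<^esub> Comp C (ob A n) (Y n) (ob A n) (j n) (q n)) \<ominus>\<^bsub>Hom C (ob A n) (ob A n)\<^esub> e n"
      unfolding fn bD(12)[symmetric] ip ..
    also have "\<dots> = Comp C (ob A n) (Y n) (ob A n) (j n) (q n)"
      using H.add_add_diff_cancel[of "e n" "Comp C (ob A n) (Y n) (ob A n) (j n) (q n)" "\<zero>\<^bsub>Hom C (ob A n) (ob A n)\<^esub>"]
        bD(2,5,7) AD(1) eD(1) by simp
    finally show ?thesis by simp
  qed
  note B = Ch_summand[OF A e bD(1) bD(4) bD(6) bD(8) ip]
  note D = Ch_summand[OF A f bD(2) bD(5) bD(7) bD(9) jq]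
  let ?B = "\<lparr>ob = X, diff = \<lambda>n. Comp C (X n) (ob A n) (X (n - 1)) (Comp C (ob A n) (ob A (n - 1)) (X (n - 1)) (p (n - 1)) (diff A n)) (i n)\<rparr>"
  let ?D = "\<lparr>ob = Y, diff = \<lambda>n. Comp C (Y n) (ob A n) (Y (n - 1)) (Comp C (ob A n) (ob A (n - 1)) (Y (n - 1)) (q (n - 1)) (diff A n)) (j n)\<rparr>"
  have "biproduct (Ch C) ?B ?D A i j p q"
    unfolding biproduct_def using B D A bD(8-12) by simp
  moreover have "Comp (Ch C) A ?B A i p = e" using ip by simp
  ultimately show ?thesis by (rule that)
qed

end

locale complete_locally_finite = complete_noetherian S \<mm> + locally_finite_category S C
  for S :: "('a, 'r) ring_scheme" (structure) and \<mm> and C :: "('o, 'a, 'm) linear_category"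
begin

sublocale Ch: additive_category S "Ch C"
  by (rule Ch_additive)

abbreviation nilp :: "'o \<Rightarrow> 'm \<Rightarrow> bool"
  where "nilp X a \<equiv> nilpotent_mod S \<mm> C X a"

lemma Hom_fg_module: "X \<in> Obj C \<Longrightarrow> Y \<in> Obj C \<Longrightarrow> fg_module S \<mm> (Hom C X Y)"
  by (intro fg_module.intro complete_noetherian_module.intro fg_module_axioms.intro
      complete_noetherian_axioms Hom_smodule Hom_fin_gen)

lemma submodule_End: "submodule N S (End C X) \<longleftrightarrow> submodule N S (Hom C X X)"
  unfolding submodule_def submodule_axioms_def by (simp add: End_def)

lemma span_End: "span_module S (End C X) Y = span_module S (Hom C X X) Y"
  unfolding span_module_def submodule_End ..

lemma ideal_times_End: "ideal_times_module S I (End C X) = ideal_times_module S I (Hom C X X)"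
  unfolding ideal_times_module_def span_End by simp

lemma End_fg_algebra: "X \<in> Obj C \<Longrightarrow> fg_algebra S \<mm> (End C X)"
proof (intro fg_algebra.intro fg_module.intro complete_noetherian_module.intro fg_module_axioms.intro
    fg_algebra_axioms.intro complete_noetherian_axioms End_ring)
  assume X: "X \<in> Obj C"
  show "smodule S (End C X)" by (rule smodule.intro[OF End_module[OF X]])
  show "fin_gen_module S (End C X)"
    using Hom_fin_gen[OF X X] unfolding fin_gen_module_def span_End by simp
qed (auto simp: Comp_smult_left Comp_smult_right)

lemma nilp_iff:
  assumes X: "X \<in> Obj C" and a: "a \<in> Mor C X X"
  shows "nilp X a \<longleftrightarrow> (\<exists>k::nat. a [^]\<^bsub>End C X\<^esub> k \<in> ideal_times_module S \<mm> (Hom C X X))"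
proof -
  interpret E: fg_algebra S \<mm> "End C X" by (rule End_fg_algebra[OF X])
  let ?N = "ideal_times_module S \<mm> (End C X)"
  have N: "?N = E.Fil 1" by (simp add: mpow_1)
  interpret N: ideal ?N "End C X" unfolding N by (rule E.Fil_ideal)
  interpret Q: ring "End C X Quot ?N" by (rule N.quotient_is_ring)
  have ac: "a \<in> carrier (End C X)" using a by simp
  have pow: "(?N +>\<^bsub>End C X\<^esub> a) [^]\<^bsub>End C X Quot ?N\<^esub> k = ?N +>\<^bsub>End C X\<^esub> (a [^]\<^bsub>End C X\<^esub> k)" for k :: nat
  proof (induction k)
    case 0
    show ?case by (simp add: FactRing_def)
  next
    case (Suc k)
    have "(?N +>\<^bsub>End C X\<^esub> a [^]\<^bsub>End C X\<^esub> k) \<otimes>\<^bsub>End C X Quot ?N\<^esub> (?N +>\<^bsub>End C X\<^esub> a)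
        = ?N +>\<^bsub>End C X\<^esub> (a [^]\<^bsub>End C X\<^esub> k \<otimes>\<^bsub>End C X\<^esub> a)"
      using N.rcoset_mult_add[OF E.E.nat_pow_closed[OF ac] ac] by (simp only: FactRing_def monoid.simps)
    then show ?case by (simp only: Q.nat_pow_Suc E.E.nat_pow_Suc Suc)
  qed
  have coset: "?N +>\<^bsub>End C X\<^esub> x = ?N \<longleftrightarrow> x \<in> ?N" if "x \<in> carrier (End C X)" for x
    using N.a_rcos_const N.a_rcos_self[OF that] by blast
  have "nilp X a \<longleftrightarrow> (\<exists>k::nat. ?N +>\<^bsub>End C X\<^esub> (a [^]\<^bsub>End C X\<^esub> k) = ?N)"
    unfolding nilpotent_mod_def Let_def pow by (simp add: FactRing_def)
  also have "\<dots> \<longleftrightarrow> (\<exists>k::nat. a [^]\<^bsub>End C X\<^esub> k \<in> ?N)"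
    using coset[OF E.E.nat_pow_closed[OF ac]] by blast
  finally show ?thesis unfolding ideal_times_End .
qed

lemma nilp_one_minus_invertible:
  assumes X: "X \<in> Obj C" and a: "a \<in> Mor C X X" and n: "nilp X a"
  shows "invertible C X X (Ident C X \<ominus>\<^bsub>Hom C X X\<^esub> a)"
proof -
  interpret E: fg_algebra S \<mm> "End C X" by (rule End_fg_algebra[OF X])
  obtain k :: nat where "a [^]\<^bsub>End C X\<^esub> k \<in> E.Fil 1"
    using n nilp_iff[OF X a] by (auto simp: mpow_1 ideal_times_End)
  then show ?thesis using E.one_minus_nilpotent_unit[of a k] a Units_End_iff[OF X] by simp
qed

lemma Comp_ideal_times:
  assumes "X \<in> Obj C" "Y \<in> Obj C" "Z \<in> Obj C"
    "g \<in> ideal_times_module S (mpow i) (Hom C Y Z)" "f \<in> ideal_times_module S (mpow j) (Hom C X Y)"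
  shows "Comp C X Y Z g f \<in> ideal_times_module S (mpow (i + j)) (Hom C X Z)"
  by (rule bilinear_ideal_times[OF _ _ _ _ _ _ _ _ assms(4,5)])
    (use assms in \<open>auto simp: Hom_smodule Comp_add_left Comp_add_right Comp_smult_left Comp_smult_right\<close>)

lemma ideal_times_0: "X \<in> Obj C \<Longrightarrow> Y \<in> Obj C \<Longrightarrow> ideal_times_module S (mpow 0) (Hom C X Y) = Mor C X Y"
  by (rule complete_noetherian_module.Fil_0[OF fg_module.axioms(1)[OF Hom_fg_module]])

lemma nilp_swap:
  assumes X: "X \<in> Obj C" and Y: "Y \<in> Obj C" and f: "f \<in> Mor C X Y" and g: "g \<in> Mor C Y X"
    and n: "nilp X (Comp C X Y X g f)"
  shows "nilp Y (Comp C Y X Y f g)"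
proof -
  let ?a = "Comp C X Y X g f" and ?b = "Comp C Y X Y f g"
  interpret EX: ring "End C X" by (rule End_ring[OF X])
  interpret EY: ring "End C Y" by (rule End_ring[OF Y])
  have a: "?a \<in> Mor C X X" and b: "?b \<in> Mor C Y Y" using X Y f g by auto
  have pc: "?a [^]\<^bsub>End C X\<^esub> k \<in> Mor C X X" for k :: nat using EX.nat_pow_closed[of ?a k] a by simp
  obtain k :: nat where k: "?a [^]\<^bsub>End C X\<^esub> k \<in> ideal_times_module S (mpow 1) (Hom C X X)"
    using n nilp_iff[OF X a] by (auto simp: mpow_1)
  have "?b [^]\<^bsub>End C Y\<^esub> Suc j = Comp C Y X Y f (Comp C Y X X (?a [^]\<^bsub>End C X\<^esub> j) g)" for j :: nat
  proof (induction j)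
    case 0
    then show ?case using X Y f g by simp
  next
    case (Suc j)
    have "?b [^]\<^bsub>End C Y\<^esub> Suc (Suc j) = Comp C Y Y Y (?b [^]\<^bsub>End C Y\<^esub> Suc j) ?b"
      by (subst EY.nat_pow_Suc) simp
    also have "\<dots> = Comp C Y X Y f (Comp C Y X X (Comp C X X X (?a [^]\<^bsub>End C X\<^esub> j) ?a) g)"
      unfolding Suc using X Y f g pc[of j] by (simp add: Comp_assoc)
    finally show ?case by simp
  qed
  moreover have "Comp C Y X X (?a [^]\<^bsub>End C X\<^esub> k) g \<in> ideal_times_module S (mpow (1 + 0)) (Hom C Y X)"
    by (rule Comp_ideal_times[OF Y X X k]) (simp add: ideal_times_0 X Y g)
  then have "Comp C Y X Y f (Comp C Y X X (?a [^]\<^bsub>End C X\<^esub> k) g) \<in> ideal_times_module S (mpow (0 + (1 + 0))) (Hom C Y Y)"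
    by (intro Comp_ideal_times[OF Y X Y]) (simp_all add: ideal_times_0 X Y f)
  ultimately have "?b [^]\<^bsub>End C Y\<^esub> Suc k \<in> ideal_times_module S \<mm> (Hom C Y Y)" by (simp only: mpow_1 add_0 add_0_right One_nat_def)
  then show ?thesis using nilp_iff[OF Y b] by blast
qed

lemma intertwining_zero:
  assumes X: "X \<in> Obj C" and Y: "Y \<in> Obj C" and x: "x \<in> Mor C X Y" and u: "u \<in> Mor C Y Y"
    and v: "v \<in> Mor C X X" and fixed: "Comp C X X Y (Comp C X Y Y u x) v = x"
    and small: "u \<in> ideal_times_module S \<mm> (Hom C Y Y) \<or> v \<in> ideal_times_module S \<mm> (Hom C X X)"
  shows "x = \<zero>\<^bsub>Hom C X Y\<^esub>"
proof -
  interpret H: fg_module S \<mm> "Hom C X Y" by (rule Hom_fg_module[OF X Y])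
  obtain i j where ij: "i + j = 1" "u \<in> ideal_times_module S (mpow i) (Hom C Y Y)" "v \<in> ideal_times_module S (mpow j) (Hom C X X)"
  proof -
    have "u \<in> ideal_times_module S (mpow 0) (Hom C Y Y)" "v \<in> ideal_times_module S (mpow 0) (Hom C X X)"
      using X Y u v ideal_times_0 by simp_all
    then show ?thesis using small that[of 1 0] that[of 0 1] by (auto simp: mpow_1)
  qed
  have "x \<in> H.Fil k" for k
  proof (induction k)
    case 0
    show ?case using x ideal_times_0[OF X Y] by simp
  next
    case (Suc k)
    have "Comp C X X Y (Comp C X Y Y u x) v \<in> H.Fil ((i + k) + j)"
      by (rule Comp_ideal_times[OF X X Y Comp_ideal_times[OF X Y Y ij(2) Suc] ij(3)])
    moreover have "i + k + j = Suc k" using ij(1) by simp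
    ultimately show ?case using fixed by simp
  qed
  then show ?thesis by (rule H.Fil_separated)
qed

lemma Ch_fitting:
  assumes A: "is_chain_complex C A" and a: "is_chain_map C A A a"
  obtains e w where "is_chain_map C A A e" "is_chain_map C A A w"
    "Comp (Ch C) A A A e e = e" "Comp (Ch C) A A A a w = e" "Comp (Ch C) A A A w a = e"
    "\<And>n. e n = \<zero>\<^bsub>Hom C (ob A n) (ob A n)\<^esub> \<Longrightarrow> nilp (ob A n) (a n)"
proof -
  note AD = chain_complexD[OF A] and aD = chain_mapD[OF a]
  have "\<forall>n. \<exists>e w. \<exists>r::nat. e \<in> Mor C (ob A n) (ob A n) \<and> w \<in> Mor C (ob A n) (ob A n) \<and>
      Comp C (ob A n) (ob A n) (ob A n) e e = e \<and>
      Comp C (ob A n) (ob A n) (ob A n) (a n) e = Comp C (ob A n) (ob A n) (ob A n) e (a n) \<and>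
      Comp C (ob A n) (ob A n) (ob A n) (a n) w = e \<and> Comp C (ob A n) (ob A n) (ob A n) w (a n) = e \<and>
      Comp C (ob A n) (ob A n) (ob A n) e w = w \<and> Comp C (ob A n) (ob A n) (ob A n) w e = w \<and>
      Comp C (ob A n) (ob A n) (ob A n) (a n [^]\<^bsub>End C (ob A n)\<^esub> r) (Ident C (ob A n) \<ominus>\<^bsub>Hom C (ob A n) (ob A n)\<^esub> e)
        \<in> ideal_times_module S \<mm> (Hom C (ob A n) (ob A n))"
  proof
    fix n
    interpret E: fg_algebra S \<mm> "End C (ob A n)" by (rule End_fg_algebra[OF AD(1)])
    obtain e w r where "e \<in> carrier (End C (ob A n))" "w \<in> carrier (End C (ob A n))"
      "e \<otimes>\<^bsub>End C (ob A n)\<^esub> e = e" "a n \<otimes>\<^bsub>End C (ob A n)\<^esub> e = e \<otimes>\<^bsub>End C (ob A n)\<^esub> a n"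
      "a n \<otimes>\<^bsub>End C (ob A n)\<^esub> w = e" "w \<otimes>\<^bsub>End C (ob A n)\<^esub> a n = e" "e \<otimes>\<^bsub>End C (ob A n)\<^esub> w = w"
      "w \<otimes>\<^bsub>End C (ob A n)\<^esub> e = w"
      "a n [^]\<^bsub>End C (ob A n)\<^esub> (r::nat) \<otimes>\<^bsub>End C (ob A n)\<^esub> (\<one>\<^bsub>End C (ob A n)\<^esub> \<ominus>\<^bsub>End C (ob A n)\<^esub> e) \<in> E.Fil 1"
      using E.fitting[of "a n"] aD(1) by auto
    then show "\<exists>e w. \<exists>r::nat. e \<in> Mor C (ob A n) (ob A n) \<and> w \<in> Mor C (ob A n) (ob A n) \<and>
      Comp C (ob A n) (ob A n) (ob A n) e e = e \<and>
      Comp C (ob A n) (ob A n) (ob A n) (a n) e = Comp C (ob A n) (ob A n) (ob A n) e (a n) \<and>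
      Comp C (ob A n) (ob A n) (ob A n) (a n) w = e \<and> Comp C (ob A n) (ob A n) (ob A n) w (a n) = e \<and>
      Comp C (ob A n) (ob A n) (ob A n) e w = w \<and> Comp C (ob A n) (ob A n) (ob A n) w e = w \<and>
      Comp C (ob A n) (ob A n) (ob A n) (a n [^]\<^bsub>End C (ob A n)\<^esub> r) (Ident C (ob A n) \<ominus>\<^bsub>Hom C (ob A n) (ob A n)\<^esub> e)
        \<in> ideal_times_module S \<mm> (Hom C (ob A n) (ob A n))"
      by (intro exI[of _ e] exI[of _ w] exI[of _ r]) (simp add: mpow_1 ideal_times_End)
  qed
  then obtain e w and r :: "int \<Rightarrow> nat" where
    e: "\<And>n. e n \<in> Mor C (ob A n) (ob A n)" and w: "\<And>n. w n \<in> Mor C (ob A n) (ob A n)"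
    and ee: "\<And>n. Comp C (ob A n) (ob A n) (ob A n) (e n) (e n) = e n"
    and ae: "\<And>n. Comp C (ob A n) (ob A n) (ob A n) (a n) (e n) = Comp C (ob A n) (ob A n) (ob A n) (e n) (a n)"
    and aw: "\<And>n. Comp C (ob A n) (ob A n) (ob A n) (a n) (w n) = e n"
    and wa: "\<And>n. Comp C (ob A n) (ob A n) (ob A n) (w n) (a n) = e n"
    and ew: "\<And>n. Comp C (ob A n) (ob A n) (ob A n) (e n) (w n) = w n"
    and we: "\<And>n. Comp C (ob A n) (ob A n) (ob A n) (w n) (e n) = w n"
    and small: "\<And>n. Comp C (ob A n) (ob A n) (ob A n) (a n [^]\<^bsub>End C (ob A n)\<^esub> r n) (Ident C (ob A n) \<ominus>\<^bsub>Hom C (ob A n) (ob A n)\<^esub> e n)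
        \<in> ideal_times_module S \<mm> (Hom C (ob A n) (ob A n))"
    by metis
  define f where "f n = Ident C (ob A n) \<ominus>\<^bsub>Hom C (ob A n) (ob A n)\<^esub> e n" for n
  define ap where "ap n k = a n [^]\<^bsub>End C (ob A n)\<^esub> k" for n and k :: nat
  define wp where "wp n k = w n [^]\<^bsub>End C (ob A n)\<^esub> k" for n and k :: nat
  have f: "f n \<in> Mor C (ob A n) (ob A n)" for n unfolding f_def using AD(1) e by simp
  have pc: "ap n k \<in> Mor C (ob A n) (ob A n)" "wp n k \<in> Mor C (ob A n) (ob A n)" for n k
  proof -
    interpret E: ring "End C (ob A n)" by (rule End_ring[OF AD(1)])
    show "ap n k \<in> Mor C (ob A n) (ob A n)" "wp n k \<in> Mor C (ob A n) (ob A n)"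
      unfolding ap_def wp_def using E.nat_pow_closed[of "a n" k] E.nat_pow_closed[of "w n" k] aD(1) w by auto
  qed
  have apS: "ap n (Suc k) = Comp C (ob A n) (ob A n) (ob A n) (ap n k) (a n)"
    "ap n (Suc k) = Comp C (ob A n) (ob A n) (ob A n) (a n) (ap n k)" and ap0: "ap n 0 = Ident C (ob A n)"
    and wpS: "wp n (Suc k) = Comp C (ob A n) (ob A n) (ob A n) (wp n k) (w n)"
    "wp n (Suc k) = Comp C (ob A n) (ob A n) (ob A n) (w n) (wp n k)" and wp0: "wp n 0 = Ident C (ob A n)" for n k
  proof -
    interpret E: ring "End C (ob A n)" by (rule End_ring[OF AD(1)])
    show "ap n (Suc k) = Comp C (ob A n) (ob A n) (ob A n) (ap n k) (a n)" "ap n 0 = Ident C (ob A n)"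
      "wp n (Suc k) = Comp C (ob A n) (ob A n) (ob A n) (wp n k) (w n)" "wp n 0 = Ident C (ob A n)"
      unfolding ap_def wp_def by simp_all
    show "ap n (Suc k) = Comp C (ob A n) (ob A n) (ob A n) (a n) (ap n k)"
      "wp n (Suc k) = Comp C (ob A n) (ob A n) (ob A n) (w n) (wp n k)"
      unfolding ap_def wp_def using E.nat_pow_Suc2[of "a n" k] E.nat_pow_Suc2[of "w n" k] aD(1) w by simp_all
  qed
  note car = AD(1) aD(1) e w f pc
  have eap: "Comp C (ob A n) (ob A n) (ob A n) (ap n k) (e n) = Comp C (ob A n) (ob A n) (ob A n) (e n) (ap n k)" for n k
  proof (induction k)
    case 0
    show ?case using car by (simp add: ap0)
  next
    case (Suc k)
    show ?case unfolding apS(2) using car by (simp add: Comp_assoc Suc Comp_reassoc[OF ae])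
  qed
  have wpap: "Comp C (ob A n) (ob A n) (ob A n) (wp n k) (Comp C (ob A n) (ob A n) (ob A n) (e n) (ap n k)) = e n" for n k
  proof (induction k)
    case 0
    show ?case using car by (simp add: ap0 wp0)
  next
    case (Suc k)
    have "Comp C (ob A n) (ob A n) (ob A n) (w n) (Comp C (ob A n) (ob A n) (ob A n) (e n) (ap n (Suc k)))
        = Comp C (ob A n) (ob A n) (ob A n) (e n) (ap n k)"
      unfolding apS(2) using car by (simp add: Comp_assoc Comp_reassoc[OF we] Comp_reassoc[OF wa])
    then show ?case unfolding wpS(1) using car Suc by (simp add: Comp_assoc)
  qed
  have apwp: "Comp C (ob A n) (ob A n) (ob A n) (e n) (Comp C (ob A n) (ob A n) (ob A n) (ap n k) (wp n k)) = e n" for n k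
  proof (induction k)
    case 0
    show ?case using car by (simp add: ap0 wp0)
  next
    case (Suc k)
    have ape: "Comp C (ob A n) (ob A n) (ob A n) (ap n k) (Comp C (ob A n) (ob A n) (ob A n) (e n) (wp n k))
        = Comp C (ob A n) (ob A n) (ob A n) (e n) (Comp C (ob A n) (ob A n) (ob A n) (ap n k) (wp n k))"
      using car by (simp add: Comp_reassoc[OF eap] Comp_assoc)
    show ?case unfolding apS(1) wpS(2) using car
      by (simp add: Comp_assoc Comp_reassoc[OF aw] ape Comp_reassoc[OF ee] Suc ee)
  qed
  have dap: "Comp C (ob A n) (ob A n) (ob A (n - 1)) (diff A n) (ap n k)
      = Comp C (ob A n) (ob A (n - 1)) (ob A (n - 1)) (ap (n - 1) k) (diff A n)" for n k
  proof (induction k)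
    case 0
    show ?case using car AD(2) by (simp add: ap0)
  next
    case (Suc k)
    show ?case
      unfolding apS(2) using car AD(2)
      by (simp add: Comp_assoc Comp_reassoc[OF aD(2)] Suc)
  qed
  have ff: "Comp C (ob A n) (ob A n) (ob A n) (f n) (f n) = f n"
    and fap: "Comp C (ob A n) (ob A n) (ob A n) (f n) (ap n k) = Comp C (ob A n) (ob A n) (ob A n) (ap n k) (f n)" for n k
    using car ee eap unfolding f_def
    by (simp_all add: Comp_minus_left Comp_minus_right minus_self minus_zero_right)
  have edf: "Comp C (ob A n) (ob A (n - 1)) (ob A (n - 1)) (e (n - 1)) (Comp C (ob A n) (ob A n) (ob A (n - 1)) (diff A n) (f n))
      = \<zero>\<^bsub>Hom C (ob A n) (ob A (n - 1))\<^esub>" (is "?x = _") for n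
  proof (rule intertwining_zero)
    let ?u = "wp (n - 1) (r n)" and ?v = "Comp C (ob A n) (ob A n) (ob A n) (ap n (r n)) (f n)"
    show "?u \<in> Mor C (ob A (n - 1)) (ob A (n - 1))" "?v \<in> Mor C (ob A n) (ob A n)" "?x \<in> Mor C (ob A n) (ob A (n - 1))"
      using car AD(2) by simp_all
    have wx: "Comp C (ob A n) (ob A (n - 1)) (ob A (n - 1)) ?u (Comp C (ob A n) (ob A (n - 1)) (ob A (n - 1)) (e (n - 1))
      (Comp C (ob A n) (ob A (n - 1)) (ob A (n - 1)) (ap (n - 1) (r n)) (Comp C (ob A n) (ob A n) (ob A (n - 1)) (diff A n) (f n)))) = ?x"
      using Comp_reassoc[OF wpap[of "n - 1" "r n"], where W = "ob A n" and x = "Comp C (ob A n) (ob A n) (ob A (n - 1)) (diff A n) (f n)"]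
        car AD(2) by (simp add: Comp_assoc)
    have "Comp C (ob A n) (ob A n) (ob A n) (f n) ?v = ?v"
      using car by (simp add: Comp_reassoc[OF fap] Comp_assoc ff)
    then show "Comp C (ob A n) (ob A n) (ob A (n - 1)) (Comp C (ob A n) (ob A (n - 1)) (ob A (n - 1)) ?u ?x) ?v = ?x"
      using wx car AD(2) by (simp add: Comp_assoc Comp_reassoc[OF dap])
    show "?u \<in> ideal_times_module S \<mm> (Hom C (ob A (n - 1)) (ob A (n - 1))) \<or>
      ?v \<in> ideal_times_module S \<mm> (Hom C (ob A n) (ob A n))"
      using small[of n] unfolding ap_def f_def by simp
  qed (use AD(1) in auto)
  have fde: "Comp C (ob A n) (ob A (n - 1)) (ob A (n - 1)) (f (n - 1)) (Comp C (ob A n) (ob A n) (ob A (n - 1)) (diff A n) (e n))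
      = \<zero>\<^bsub>Hom C (ob A n) (ob A (n - 1))\<^esub>" (is "?x = _") for n
  proof (rule intertwining_zero)
    let ?u = "Comp C (ob A (n - 1)) (ob A (n - 1)) (ob A (n - 1)) (ap (n - 1) (r (n - 1))) (f (n - 1))"
    let ?v = "wp n (r (n - 1))"
    show "?u \<in> Mor C (ob A (n - 1)) (ob A (n - 1))" "?v \<in> Mor C (ob A n) (ob A n)" "?x \<in> Mor C (ob A n) (ob A (n - 1))"
      using car AD(2) by simp_all
    have "Comp C (ob A n) (ob A n) (ob A (n - 1)) (Comp C (ob A n) (ob A (n - 1)) (ob A (n - 1)) ?u ?x) ?v
      = Comp C (ob A n) (ob A (n - 1)) (ob A (n - 1)) (f (n - 1)) (Comp C (ob A n) (ob A (n - 1)) (ob A (n - 1)) (ap (n - 1) (r (n - 1)))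
         (Comp C (ob A n) (ob A n) (ob A (n - 1)) (diff A n) (Comp C (ob A n) (ob A n) (ob A n) (e n) ?v)))"
      using car AD(2) by (simp add: Comp_assoc Comp_reassoc[OF ff] Comp_reassoc[OF fap])
    also have "Comp C (ob A n) (ob A (n - 1)) (ob A (n - 1)) (ap (n - 1) (r (n - 1)))
         (Comp C (ob A n) (ob A n) (ob A (n - 1)) (diff A n) (Comp C (ob A n) (ob A n) (ob A n) (e n) ?v))
       = Comp C (ob A n) (ob A n) (ob A (n - 1)) (diff A n) (Comp C (ob A n) (ob A n) (ob A n) (e n)
          (Comp C (ob A n) (ob A n) (ob A n) (ap n (r (n - 1))) ?v))"
      using car AD(2) by (simp add: Comp_assoc Comp_reassoc[OF dap[symmetric]] Comp_reassoc[OF eap])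
    finally show "Comp C (ob A n) (ob A n) (ob A (n - 1)) (Comp C (ob A n) (ob A (n - 1)) (ob A (n - 1)) ?u ?x) ?v = ?x"
      unfolding apwp .
    show "?u \<in> ideal_times_module S \<mm> (Hom C (ob A (n - 1)) (ob A (n - 1))) \<or>
      ?v \<in> ideal_times_module S \<mm> (Hom C (ob A n) (ob A n))"
      using small[of "n - 1"] unfolding ap_def f_def by simp
  qed (use AD(1) in auto)
  have de: "Comp C (ob A n) (ob A n) (ob A (n - 1)) (diff A n) (e n) = Comp C (ob A n) (ob A (n - 1)) (ob A (n - 1)) (e (n - 1)) (diff A n)" for n
  proof -
    let ?ede = "Comp C (ob A n) (ob A (n - 1)) (ob A (n - 1)) (e (n - 1)) (Comp C (ob A n) (ob A n) (ob A (n - 1)) (diff A n) (e n))"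
    let ?ed = "Comp C (ob A n) (ob A (n - 1)) (ob A (n - 1)) (e (n - 1)) (diff A n)"
    let ?de = "Comp C (ob A n) (ob A n) (ob A (n - 1)) (diff A n) (e n)"
    have c: "?ede \<in> Mor C (ob A n) (ob A (n - 1))" "?ed \<in> Mor C (ob A n) (ob A (n - 1))" "?de \<in> Mor C (ob A n) (ob A (n - 1))"
      using AD(1,2) e by simp_all
    have "?ed \<ominus>\<^bsub>Hom C (ob A n) (ob A (n - 1))\<^esub> ?ede = \<zero>\<^bsub>Hom C (ob A n) (ob A (n - 1))\<^esub>"
      unfolding edf[of n, symmetric] unfolding f_def using AD(1,2) e by (simp add: Comp_minus_right)
    from eq_if_minus_zero[OF AD(1) AD(1) c(2,1) this] have "?ed = ?ede" .
    moreover have "?de \<ominus>\<^bsub>Hom C (ob A n) (ob A (n - 1))\<^esub> ?ede = \<zero>\<^bsub>Hom C (ob A n) (ob A (n - 1))\<^esub>"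
      unfolding fde[of n, symmetric] unfolding f_def using AD(1,2) e by (simp add: Comp_minus_left)
    from eq_if_minus_zero[OF AD(1) AD(1) c(3,1) this] have "?de = ?ede" .
    ultimately show ?thesis by simp
  qed
  have dw: "Comp C (ob A n) (ob A n) (ob A (n - 1)) (diff A n) (w n) = Comp C (ob A n) (ob A (n - 1)) (ob A (n - 1)) (w (n - 1)) (diff A n)" for n
  proof -
    have "Comp C (ob A n) (ob A (n - 1)) (ob A (n - 1)) (w (n - 1)) (diff A n)
       = Comp C (ob A n) (ob A (n - 1)) (ob A (n - 1)) (w (n - 1)) (Comp C (ob A n) (ob A (n - 1)) (ob A (n - 1)) (e (n - 1)) (diff A n))"
      using car AD(2) by (simp add: Comp_reassoc[OF we])
    also have "\<dots> = Comp C (ob A n) (ob A (n - 1)) (ob A (n - 1)) (w (n - 1)) (Comp C (ob A n) (ob A n) (ob A (n - 1)) (diff A n) (Comp C (ob A n) (ob A n) (ob A n) (a n) (w n)))"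
      unfolding de[symmetric] aw ..
    also have "\<dots> = Comp C (ob A n) (ob A n) (ob A (n - 1)) (diff A n) (Comp C (ob A n) (ob A n) (ob A n) (e n) (w n))"
      using car(1-6) AD(2)
      by (simp add: Comp_reassoc[OF aD(2)] Comp_assoc Comp_reassoc[OF wa] Comp_reassoc[OF de[symmetric]])
    finally show ?thesis unfolding ew ..
  qed
  show ?thesis
  proof (rule that[of e w])
    show "is_chain_map C A A e" "is_chain_map C A A w"
      unfolding is_chain_map_def using e w de dw by simp_all
    fix n assume "e n = \<zero>\<^bsub>Hom C (ob A n) (ob A n)\<^esub>"
    then have "f n = Ident C (ob A n)" unfolding f_def using AD(1) by (simp add: minus_zero_right)
    then have "ap n (r n) \<in> ideal_times_module S \<mm> (Hom C (ob A n) (ob A n))"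
      using small[of n] car unfolding ap_def[symmetric] f_def[symmetric] by simp
    then show "nilp (ob A n) (a n)" unfolding ap_def using nilp_iff[OF AD(1) aD(1)] by blast
  qed (simp_all add: ee aw wa)
qed

end

declare Ch_simps [simp del]

lemma Ch_Obj [simp]: "A \<in> Obj (Ch C) \<longleftrightarrow> is_chain_complex C A"
  and Ch_Mor [simp]: "f \<in> Mor (Ch C) A B \<longleftrightarrow> is_chain_map C A B f"
  by (simp_all add: Ch_simps)

lemma Ch_Comp: "Comp (Ch C) A B D g f n = Comp C (ob A n) (ob B n) (ob D n) (g n) (f n)"
  and Ch_Ident: "Ident (Ch C) A n = Ident C (ob A n)"
  and Ch_zero: "\<zero>\<^bsub>Hom (Ch C) A B\<^esub> n = \<zero>\<^bsub>Hom C (ob A n) (ob B n)\<^esub>"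
  and Ch_add: "(f \<oplus>\<^bsub>Hom (Ch C) A B\<^esub> g) n = f n \<oplus>\<^bsub>Hom C (ob A n) (ob B n)\<^esub> g n"
  by (simp_all add: Ch_simps)

context S_category
begin

lemma direct_sumI:
  assumes A: "A \<in> Obj C" and X: "\<And>i. i \<in> I \<Longrightarrow> X i \<in> Obj C"
    and \<iota>: "\<And>i. i \<in> I \<Longrightarrow> \<iota> i \<in> Mor C (X i) A" and \<pi>: "\<And>i. i \<in> I \<Longrightarrow> \<pi> i \<in> Mor C A (X i)"
    and \<pi>\<iota>: "\<And>i j. i \<in> I \<Longrightarrow> j \<in> I \<Longrightarrow> Comp C (X i) A (X j) (\<pi> j) (\<iota> i)
      = (if i = j then Ident C (X i) else \<zero>\<^bsub>Hom C (X i) (X j)\<^esub>)"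
    and ex: "\<And>B f. B \<in> Obj C \<Longrightarrow> (\<And>i. i \<in> I \<Longrightarrow> f i \<in> Mor C (X i) B) \<Longrightarrow>
      \<exists>h\<in>Mor C A B. \<forall>i\<in>I. Comp C (X i) A B h (\<iota> i) = f i"
    and eq: "\<And>B h h'. B \<in> Obj C \<Longrightarrow> h \<in> Mor C A B \<Longrightarrow> h' \<in> Mor C A B \<Longrightarrow>
      (\<And>i. i \<in> I \<Longrightarrow> Comp C (X i) A B h (\<iota> i) = Comp C (X i) A B h' (\<iota> i)) \<Longrightarrow> h = h'"
  shows "direct_sum C I X A \<iota> \<pi>"
proof -
  have "\<exists>!h. h \<in> Mor C A B \<and> (\<forall>i\<in>I. Comp C (X i) A B h (\<iota> i) = f i)"
    if B: "B \<in> Obj C" and f: "\<forall>i\<in>I. f i \<in> Mor C (X i) B" for B f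
  proof (rule ex_ex1I)
    show "\<exists>h. h \<in> Mor C A B \<and> (\<forall>i\<in>I. Comp C (X i) A B h (\<iota> i) = f i)"
      using ex[OF B, of f] f unfolding Bex_def by simp
  next
    fix h h' assume "h \<in> Mor C A B \<and> (\<forall>i\<in>I. Comp C (X i) A B h (\<iota> i) = f i)"
      "h' \<in> Mor C A B \<and> (\<forall>i\<in>I. Comp C (X i) A B h' (\<iota> i) = f i)"
    then show "h = h'" using eq[OF B, of h h'] by simp
  qed
  then have univ: "\<forall>B\<in>Obj C. \<forall>f. (\<forall>i\<in>I. f i \<in> Mor C (X i) B) \<longrightarrow>
      (\<exists>!h. h \<in> Mor C A B \<and> (\<forall>i\<in>I. Comp C (X i) A B h (\<iota> i) = f i))"
    by (intro ballI allI impI)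
  have "\<forall>i\<in>I. X i \<in> Obj C \<and> \<iota> i \<in> Mor C (X i) A \<and> \<pi> i \<in> Mor C A (X i)"
    using X \<iota> \<pi> by simp
  moreover have "\<forall>i\<in>I. \<forall>j\<in>I. Comp C (X i) A (X j) (\<pi> j) (\<iota> i)
      = (if i = j then Ident C (X i) else \<zero>\<^bsub>Hom C (X i) (X j)\<^esub>)"
    using \<pi>\<iota> by (intro ballI)
  ultimately show ?thesis unfolding direct_sum_def using A univ by (intro conjI)
qed

lemma finite_direct_sum:
  assumes A: "A \<in> Obj C" and X: "\<And>i. i \<in> I \<Longrightarrow> X i \<in> Obj C"
    and \<iota>: "\<And>i. i \<in> I \<Longrightarrow> \<iota> i \<in> Mor C (X i) A" and \<pi>: "\<And>i. i \<in> I \<Longrightarrow> \<pi> i \<in> Mor C A (X i)"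
    and \<pi>\<iota>: "\<And>i j. i \<in> I \<Longrightarrow> j \<in> I \<Longrightarrow> Comp C (X i) A (X j) (\<pi> j) (\<iota> i)
      = (if i = j then Ident C (X i) else \<zero>\<^bsub>Hom C (X i) (X j)\<^esub>)"
    and F: "finite F" "F \<subseteq> I" "\<And>i. i \<in> I - F \<Longrightarrow> Ident C (X i) = \<zero>\<^bsub>Hom C (X i) (X i)\<^esub>"
    and sum: "finsum (Hom C A A) (\<lambda>i. Comp C A (X i) A (\<iota> i) (\<pi> i)) F = Ident C A"
  shows "direct_sum C I X A \<iota> \<pi>"
proof (rule direct_sumI[OF A X \<iota> \<pi> \<pi>\<iota>])
  note FI = subsetD[OF F(2)]
  have zero_map: "f = \<zero>\<^bsub>Hom C (X i) B\<^esub>" if "B \<in> Obj C" "i \<in> I - F" "f \<in> Mor C (X i) B" for B f i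
    using Comp_Ident_right[OF X that(1,3)] Comp_zero_right[OF X X that(1,3)] F(3)[OF that(2)] that(2) by simp
  fix B assume B: "B \<in> Obj C"
  have expand: "h = finsum (Hom C A B) (\<lambda>i. Comp C A (X i) B (Comp C (X i) A B h (\<iota> i)) (\<pi> i)) F"
    if h: "h \<in> Mor C A B" for h
  proof -
    interpret H: abelian_group "Hom C A B" by (rule Hom_abelian[OF A B])
    have "h = Comp C A A B h (finsum (Hom C A A) (\<lambda>i. Comp C A (X i) A (\<iota> i) (\<pi> i)) F)"
      unfolding sum using A B h by simp
    also have "\<dots> = finsum (Hom C A B) (\<lambda>i. Comp C A A B h (Comp C A (X i) A (\<iota> i) (\<pi> i))) F"
      by (rule Comp_finsum_right[OF A A B h]) (use A X \<iota> \<pi> FI in auto)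
    also have "\<dots> = finsum (Hom C A B) (\<lambda>i. Comp C A (X i) B (Comp C (X i) A B h (\<iota> i)) (\<pi> i)) F"
      by (rule H.finsum_cong') (use A B X \<iota> \<pi> FI h in \<open>auto simp: Comp_assoc\<close>)
    finally show ?thesis .
  qed
  show "h = h'" if h: "h \<in> Mor C A B" "h' \<in> Mor C A B"
    and eq: "\<And>i. i \<in> I \<Longrightarrow> Comp C (X i) A B h (\<iota> i) = Comp C (X i) A B h' (\<iota> i)" for h h'
  proof -
    interpret H: abelian_group "Hom C A B" by (rule Hom_abelian[OF A B])
    have "finsum (Hom C A B) (\<lambda>i. Comp C A (X i) B (Comp C (X i) A B h (\<iota> i)) (\<pi> i)) F
        = finsum (Hom C A B) (\<lambda>i. Comp C A (X i) B (Comp C (X i) A B h' (\<iota> i)) (\<pi> i)) F"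
      by (rule H.finsum_cong') (use A B X \<iota> \<pi> FI h eq in auto)
    then show ?thesis by (rule trans[OF trans[OF expand[OF h(1)]] expand[OF h(2), symmetric]])
  qed
  fix f assume f: "\<And>i. i \<in> I \<Longrightarrow> f i \<in> Mor C (X i) B"
  let ?h = "finsum (Hom C A B) (\<lambda>i. Comp C A (X i) B (f i) (\<pi> i)) F"
  interpret H: abelian_group "Hom C A B" by (rule Hom_abelian[OF A B])
  have "?h \<in> Mor C A B" by (rule H.finsum_closed) (use A B X f \<pi> FI in auto)
  moreover have "Comp C (X j) A B ?h (\<iota> j) = f j" if j: "j \<in> I" for j
  proof -
    interpret J: abelian_group "Hom C (X j) B" by (rule Hom_abelian[OF X[OF j] B])
    have "Comp C (X j) A B ?h (\<iota> j) = finsum (Hom C (X j) B) (\<lambda>i. Comp C (X j) A B (Comp C A (X i) B (f i) (\<pi> i)) (\<iota> j)) F"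
      by (rule Comp_finsum_left[OF X[OF j] A B \<iota>[OF j]]) (use A B X f \<pi> FI in auto)
    also have "\<dots> = finsum (Hom C (X j) B) (\<lambda>i. if i = j then f j else \<zero>\<^bsub>Hom C (X j) B\<^esub>) F"
      by (rule J.finsum_cong') (use A B X f \<iota> \<pi> FI j in \<open>auto simp: Comp_assoc \<pi>\<iota>\<close>)
    also have "\<dots> = f j"
    proof (cases "j \<in> F")
      case True
      then show ?thesis using J.add.finprod_singleton_swap[OF True F(1), of "\<lambda>_. f j"] f[OF j] by auto
    next
      case False
      then have "f j = \<zero>\<^bsub>Hom C (X j) B\<^esub>" using zero_map[OF B _ f[OF j]] j by blast
      then show ?thesis using False by (auto intro!: J.add.finprod_one_eqI)
    qed
    finally show ?thesis .
  qed
  ultimately show "\<exists>h\<in>Mor C A B. \<forall>i\<in>I. Comp C (X i) A B h (\<iota> i) = f i" by blast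
qed

lemma Ch_direct_sum:
  assumes A: "is_chain_complex C A" and X: "\<And>i. i \<in> I \<Longrightarrow> is_chain_complex C (X i)"
    and \<iota>: "\<And>i. i \<in> I \<Longrightarrow> is_chain_map C (X i) A (\<iota> i)" and \<pi>: "\<And>i. i \<in> I \<Longrightarrow> is_chain_map C A (X i) (\<pi> i)"
    and ds: "\<And>n. direct_sum C I (\<lambda>i. ob (X i) n) (ob A n) (\<lambda>i. \<iota> i n) (\<lambda>i. \<pi> i n)"
  shows "direct_sum (Ch C) I X A \<iota> \<pi>"
proof -
  interpret Ch: S_category S "Ch C" by (rule Ch_S_category)
  note AD = chain_complexD[OF A] and XD = X[THEN chain_complexD(1)] X[THEN chain_complexD(2)]
    and \<iota>D = \<iota>[THEN chain_mapD(1)] \<iota>[THEN chain_mapD(2)] and \<pi>D = \<pi>[THEN chain_mapD(1)]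
  show ?thesis
  proof (rule Ch.direct_sumI)
    fix i j assume "i \<in> I" "j \<in> I"
    then show "Comp (Ch C) (X i) A (X j) (\<pi> j) (\<iota> i) = (if i = j then Ident (Ch C) (X i) else \<zero>\<^bsub>Hom (Ch C) (X i) (X j)\<^esub>)"
      using ds[THEN direct_sumD(5)] ds[THEN direct_sumD(6)] by (auto simp: fun_eq_iff Ch_Comp Ch_Ident Ch_zero)
  next
    fix B f assume "B \<in> Obj (Ch C)" and f: "\<And>i. i \<in> I \<Longrightarrow> f i \<in> Mor (Ch C) (X i) B"
    then have B: "is_chain_complex C B" and f: "\<And>i. i \<in> I \<Longrightarrow> is_chain_map C (X i) B (f i)" by auto
    note BD = chain_complexD[OF B] and fD = f[THEN chain_mapD(1)] f[THEN chain_mapD(2)]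
    have "\<exists>h. h \<in> Mor C (ob A n) (ob B n) \<and> (\<forall>i\<in>I. Comp C (ob (X i) n) (ob A n) (ob B n) h (\<iota> i n) = f i n)" for n
      using direct_sum_ex1[OF ds[of n] BD(1)[of n], where f = "\<lambda>i. f i n"] fD(1) by blast
    then obtain h where h: "\<And>n. h n \<in> Mor C (ob A n) (ob B n)"
      and hi: "\<And>n i. i \<in> I \<Longrightarrow> Comp C (ob (X i) n) (ob A n) (ob B n) (h n) (\<iota> i n) = f i n" by metis
    have "is_chain_map C A B h"
      unfolding is_chain_map_def
    proof (intro allI conjI h)
      fix n
      show "Comp C (ob A n) (ob B n) (ob B (n - 1)) (diff B n) (h n) = Comp C (ob A n) (ob A (n - 1)) (ob B (n - 1)) (h (n - 1)) (diff A n)"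
      proof (rule direct_sum_eqI[OF ds BD(1)])
        fix i assume i: "i \<in> I"
        have "Comp C (ob (X i) n) (ob A n) (ob B (n - 1)) (Comp C (ob A n) (ob A (n - 1)) (ob B (n - 1)) (h (n - 1)) (diff A n)) (\<iota> i n)
           = Comp C (ob (X i) n) (ob (X i) (n - 1)) (ob B (n - 1)) (f i (n - 1)) (diff (X i) n)"
          using AD(1,2) BD(1) XD(1)[OF i] XD(2)[OF i] h \<iota>D(1)[OF i]
          by (simp add: Comp_assoc \<iota>D(2)[OF i] Comp_reassoc[OF hi[OF i]])
        moreover have "Comp C (ob (X i) n) (ob A n) (ob B (n - 1)) (Comp C (ob A n) (ob B n) (ob B (n - 1)) (diff B n) (h n)) (\<iota> i n)
           = Comp C (ob (X i) n) (ob (X i) (n - 1)) (ob B (n - 1)) (f i (n - 1)) (diff (X i) n)"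
          using AD(1) BD(1,2) XD(1)[OF i] h \<iota>D(1)[OF i] by (simp add: Comp_assoc hi[OF i] fD(2)[OF i])
        ultimately show "Comp C (ob (X i) n) (ob A n) (ob B (n - 1)) (Comp C (ob A n) (ob B n) (ob B (n - 1)) (diff B n) (h n)) (\<iota> i n)
          = Comp C (ob (X i) n) (ob A n) (ob B (n - 1)) (Comp C (ob A n) (ob A (n - 1)) (ob B (n - 1)) (h (n - 1)) (diff A n)) (\<iota> i n)"
          by simp
      qed (use AD BD h in auto)
    qed
    then show "\<exists>h\<in>Mor (Ch C) A B. \<forall>i\<in>I. Comp (Ch C) (X i) A B h (\<iota> i) = f i"
      using hi by (intro bexI[of _ h]) (auto simp: fun_eq_iff Ch_Comp)
  next
    fix B h h' assume "B \<in> Obj (Ch C)" "h \<in> Mor (Ch C) A B" "h' \<in> Mor (Ch C) A B"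
      and eq: "\<And>i. i \<in> I \<Longrightarrow> Comp (Ch C) (X i) A B h (\<iota> i) = Comp (Ch C) (X i) A B h' (\<iota> i)"
    then have B: "is_chain_complex C B" and h: "is_chain_map C A B h" "is_chain_map C A B h'" by auto
    show "h = h'"
    proof
      fix n
      show "h n = h' n"
        by (rule direct_sum_eqI[OF ds chain_complexD(1)[OF B] h[THEN chain_mapD(1)]])
          (use eq in \<open>simp add: fun_eq_iff Ch_Comp\<close>)
    qed
  qed (use A X \<iota> \<pi> in auto)
qed

end

text \<open>The form in which decompositions of complexes arise; \<open>F n\<close> contains the summands that are
  nonzero in degree \<open>n\<close>.\<close>

locale locally_finite_sum = complete_locally_finite S \<mm> C
  for S :: "('a, 'r) ring_scheme" (structure) and \<mm> and C :: "('o, 'a, 'm) linear_category" +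
  fixes I :: "'i set" and X :: "'i \<Rightarrow> ('o, 'm) chain_complex" and A \<iota> \<pi> and F :: "int \<Rightarrow> 'i set"
  assumes A: "is_chain_complex C A" and X: "\<And>i. i \<in> I \<Longrightarrow> is_chain_complex C (X i)"
    and \<iota>: "\<And>i. i \<in> I \<Longrightarrow> is_chain_map C (X i) A (\<iota> i)" and \<pi>: "\<And>i. i \<in> I \<Longrightarrow> is_chain_map C A (X i) (\<pi> i)"
    and \<pi>\<iota>: "\<And>i j. i \<in> I \<Longrightarrow> j \<in> I \<Longrightarrow> Comp (Ch C) (X i) A (X j) (\<pi> j) (\<iota> i)
      = (if i = j then Ident (Ch C) (X i) else \<zero>\<^bsub>Hom (Ch C) (X i) (X j)\<^esub>)"
    and F: "\<And>n. finite (F n)" "\<And>n. F n \<subseteq> I"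
      "\<And>n i. i \<in> I - F n \<Longrightarrow> Ident C (ob (X i) n) = \<zero>\<^bsub>Hom C (ob (X i) n) (ob (X i) n)\<^esub>"
    and sum: "\<And>n. finsum (Hom C (ob A n) (ob A n)) (\<lambda>i. Comp C (ob A n) (ob (X i) n) (ob A n) (\<iota> i n) (\<pi> i n)) (F n)
      = Ident C (ob A n)"
    and loc: "\<And>i. i \<in> I \<Longrightarrow> local_ring (End (Ch C) (X i))"
begin

lemma degreewise_direct_sum: "direct_sum C I (\<lambda>i. ob (X i) n) (ob A n) (\<lambda>i. \<iota> i n) (\<lambda>i. \<pi> i n)"
proof (rule finite_direct_sum[OF _ _ _ _ _ F sum])
  fix i j assume "i \<in> I" "j \<in> I"
  from fun_cong[OF \<pi>\<iota>[OF this], of n]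
  show "Comp C (ob (X i) n) (ob A n) (ob (X j) n) (\<pi> j n) (\<iota> i n)
      = (if i = j then Ident C (ob (X i) n) else \<zero>\<^bsub>Hom C (ob (X i) n) (ob (X j) n)\<^esub>)"
    by (simp add: Ch_Comp Ch_Ident Ch_zero split: if_splits)
qed (use A X \<iota> \<pi> in \<open>auto simp: chain_complexD(1) chain_mapD(1)\<close>)

lemma Ch_sum: "direct_sum (Ch C) I X A \<iota> \<pi>"
  by (rule Ch_direct_sum[OF A X \<iota> \<pi> degreewise_direct_sum])

lemma Ch_nonzero_degree:
  assumes "is_chain_complex C Z" "Ident (Ch C) Z \<noteq> \<zero>\<^bsub>Hom (Ch C) Z Z\<^esub>"
  obtains n where "Ident C (ob Z n) \<noteq> \<zero>\<^bsub>Hom C (ob Z n) (ob Z n)\<^esub>"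
  using assms(2) by (auto simp: fun_eq_iff Ch_Ident Ch_zero)

lemma invertible_degree:
  assumes "invertible (Ch C) Y Z f"
  shows "invertible C (ob Y n) (ob Z n) (f n)"
proof -
  obtain g where "is_chain_map C Y Z f" "is_chain_map C Z Y g" "Comp (Ch C) Y Z Y g f = Ident (Ch C) Y"
    "Comp (Ch C) Z Y Z f g = Ident (Ch C) Z"
    using assms unfolding invertible_def by auto
  then show ?thesis
    using chain_mapD(1) by (intro invertibleI[of _ _ _ "g n"]) (auto simp: fun_eq_iff Ch_Comp Ch_Ident)
qed

lemma Ch_detecting: "Ch.detecting I X A \<iota> \<pi>"
  unfolding Ch.detecting_def
proof (intro ballI impI)
  fix Z a b assume "Z \<in> Obj (Ch C)" and lZ: "local_ring (End (Ch C) Z)" and "a \<in> Mor (Ch C) Z A" "b \<in> Mor (Ch C) A Z"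
    and ba: "Comp (Ch C) Z A Z b a = Ident (Ch C) Z"
  then have Z: "is_chain_complex C Z" and a: "is_chain_map C Z A a" and b: "is_chain_map C A Z b" by auto
  interpret E: ring "End (Ch C) Z" using Z by (intro Ch.End_ring) simp
  have "Ident (Ch C) Z \<noteq> \<zero>\<^bsub>Hom (Ch C) Z Z\<^esub>" using Ch.local_End_nonzero[OF _ lZ] Z by simp
  then obtain n where n: "Ident C (ob Z n) \<noteq> \<zero>\<^bsub>Hom C (ob Z n) (ob Z n)\<^esub>" by (rule Ch_nonzero_degree[OF Z])
  define t where "t i = Comp (Ch C) Z (X i) Z (Comp (Ch C) (X i) A Z b (\<iota> i)) (Comp (Ch C) Z A (X i) (\<pi> i) a)" for i
  have t: "is_chain_map C Z Z (t i)" if "i \<in> I" for i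
    unfolding t_def Ch_Mor[symmetric] using A X[OF that] \<iota>[OF that] \<pi>[OF that] Z a b
    by (intro Ch.Comp_closed) auto
  let ?s = "finsum (End (Ch C) Z) t (F n)"
  have tF: "t \<in> F n \<rightarrow> carrier (End (Ch C) Z)" using t F(2)[of n] by auto
  have s: "?s \<in> carrier (End (Ch C) Z)" using tF by (rule E.finsum_closed)
  have AD: "ob A m \<in> Obj C" and ZD: "ob Z m \<in> Obj C" and aD: "a m \<in> Mor C (ob Z m) (ob A m)"
    and bD: "b m \<in> Mor C (ob A m) (ob Z m)" for m
    using A Z a b by (auto simp: chain_complexD(1) chain_mapD(1))
  have XD: "ob (X i) m \<in> Obj C" "\<iota> i m \<in> Mor C (ob (X i) m) (ob A m)" "\<pi> i m \<in> Mor C (ob A m) (ob (X i) m)"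
    if "i \<in> F n" for i m
    using X[of i] \<iota>[of i] \<pi>[of i] F(2)[of n] that by (auto simp: chain_complexD(1) chain_mapD(1))
  interpret Hn: abelian_group "Hom C (ob Z n) (ob Z n)" by (rule Hom_abelian[OF ZD ZD])
  have "?s n = finsum (Hom C (ob Z n) (ob Z n)) (\<lambda>i. t i n) (F n)"
    using Ch_finsum[OF Z Z, of "F n" t n] t F(2)[of n] by auto
  also have "\<dots> = finsum (Hom C (ob Z n) (ob Z n)) (\<lambda>i. Comp C (ob Z n) (ob A n) (ob Z n) (b n)
      (Comp C (ob Z n) (ob A n) (ob A n) (Comp C (ob A n) (ob (X i) n) (ob A n) (\<iota> i n) (\<pi> i n)) (a n))) (F n)"
    by (rule Hn.finsum_cong') (use AD ZD XD aD bD in \<open>auto simp: t_def Ch_Comp Comp_assoc\<close>)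
  also have "\<dots> = Comp C (ob Z n) (ob A n) (ob Z n) (b n) (finsum (Hom C (ob Z n) (ob A n))
      (\<lambda>i. Comp C (ob Z n) (ob A n) (ob A n) (Comp C (ob A n) (ob (X i) n) (ob A n) (\<iota> i n) (\<pi> i n)) (a n)) (F n))"
    by (rule Comp_finsum_right[symmetric]) (use AD ZD XD aD bD in auto)
  also have "finsum (Hom C (ob Z n) (ob A n))
      (\<lambda>i. Comp C (ob Z n) (ob A n) (ob A n) (Comp C (ob A n) (ob (X i) n) (ob A n) (\<iota> i n) (\<pi> i n)) (a n)) (F n)
    = Comp C (ob Z n) (ob A n) (ob A n) (Ident C (ob A n)) (a n)"
    unfolding sum[symmetric] by (rule Comp_finsum_left[symmetric]) (use AD ZD XD aD bD in auto)
  also have "Comp C (ob Z n) (ob A n) (ob Z n) (b n) (Comp C (ob Z n) (ob A n) (ob A n) (Ident C (ob A n)) (a n)) = Ident C (ob Z n)"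
    using AD ZD aD bD fun_cong[OF ba, of n] by (simp add: Ch_Comp Ch_Ident)
  finally have sn: "?s n = Ident C (ob Z n)" .
  have "?s \<in> Units (End (Ch C) Z)"
  proof (rule ccontr)
    assume "?s \<notin> Units (End (Ch C) Z)"
    moreover have "?s \<oplus>\<^bsub>End (Ch C) Z\<^esub> (\<one>\<^bsub>End (Ch C) Z\<^esub> \<ominus>\<^bsub>End (Ch C) Z\<^esub> ?s) = \<one>\<^bsub>End (Ch C) Z\<^esub>"
      using smodule.add_diff_cancel[OF smodule.intro[OF Ch.End_module] s E.one_closed] Z by simp
    ultimately have "\<one>\<^bsub>End (Ch C) Z\<^esub> \<ominus>\<^bsub>End (Ch C) Z\<^esub> ?s \<in> Units (End (Ch C) Z)"
      using E.local_ring_add_unit[OF lZ s E.minus_closed[OF E.one_closed s]] E.Units_one_closed by metis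
    then have "invertible (Ch C) Z Z (Ident (Ch C) Z \<ominus>\<^bsub>Hom (Ch C) Z Z\<^esub> ?s)"
      using Ch.Units_End_iff[of Z] Z by simp
    then have "invertible C (ob Z n) (ob Z n) ((Ident (Ch C) Z \<ominus>\<^bsub>Hom (Ch C) Z Z\<^esub> ?s) n)" by (rule invertible_degree)
    moreover have "(Ident (Ch C) Z \<ominus>\<^bsub>Hom (Ch C) Z Z\<^esub> ?s) n = \<zero>\<^bsub>Hom C (ob Z n) (ob Z n)\<^esub>"
      using Ch_minus[OF Z Z, of ?s "Ident (Ch C) Z"] s sn ZD by (simp add: Ch_Ident minus_self)
    ultimately have "invertible C (ob Z n) (ob Z n) \<zero>\<^bsub>Hom C (ob Z n) (ob Z n)\<^esub>" by simp
    then show False using n ZD unfolding invertible_def by auto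
  qed
  then obtain i where "i \<in> F n" "t i \<in> Units (End (Ch C) Z)"
    using E.local_ring_finsum_unit[OF lZ F(1) tF] by blast
  then show "\<exists>i\<in>I. invertible (Ch C) Z Z (Comp (Ch C) Z (X i) Z (Comp (Ch C) (X i) A Z b (\<iota> i)) (Comp (Ch C) Z A (X i) (\<pi> i) a))"
    using F(2)[of n] Ch.Units_End_iff[of Z] Z unfolding t_def by auto
qed

lemma Ch_finite_multiplicities: "Ch.finite_multiplicities I X"
  unfolding Ch.finite_multiplicities_def
proof (intro ballI impI)
  fix Z assume "Z \<in> Obj (Ch C)" and lZ: "local_ring (End (Ch C) Z)"
  then have Z: "is_chain_complex C Z" by simp
  then have "Ident (Ch C) Z \<noteq> \<zero>\<^bsub>Hom (Ch C) Z Z\<^esub>" using Ch.local_End_nonzero[OF _ lZ] by simp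
  then obtain n where n: "Ident C (ob Z n) \<noteq> \<zero>\<^bsub>Hom C (ob Z n) (ob Z n)\<^esub>" by (rule Ch_nonzero_degree[OF Z])
  have "i \<in> F n" if i: "i \<in> I" "isomorphic (Ch C) (X i) Z" for i
  proof (rule ccontr)
    assume "i \<notin> F n"
    then have 0: "Ident C (ob (X i) n) = \<zero>\<^bsub>Hom C (ob (X i) n) (ob (X i) n)\<^esub>" using F(3) i by blast
    obtain f g where fg: "f \<in> Mor C (ob (X i) n) (ob Z n)" "g \<in> Mor C (ob Z n) (ob (X i) n)"
      "Comp C (ob Z n) (ob (X i) n) (ob Z n) f g = Ident C (ob Z n)"
      using i(2) invertible_degree unfolding isomorphic_def by (metis invertibleE)
    have o: "ob (X i) n \<in> Obj C" "ob Z n \<in> Obj C" using X[OF i(1)] Z by (auto simp: chain_complexD(1))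
    have "Comp C (ob Z n) (ob (X i) n) (ob Z n) f (Comp C (ob Z n) (ob (X i) n) (ob (X i) n) (Ident C (ob (X i) n)) g) = Ident C (ob Z n)"
      using fg o by simp
    then show False using n fg o unfolding 0 by simp
  qed
  then show "finite {i \<in> I. isomorphic (Ch C) (X i) Z}" using F(1)[of n] by (auto intro: finite_subset)
qed

end

section \<open>Primitive idempotents of complexes\<close>

context S_category
begin

text \<open>If \<open>b f a = 1\<close>, then \<open>f a b\<close> is an idempotent through which \<open>f a\<close> factors, so \<open>1 - f a b\<close> annihilates \<open>f a\<close>.\<close>

lemma no_factor_if_invertible:
  assumes A: "A \<in> Obj C" and B: "B \<in> Obj C" and Z: "Z \<in> Obj C"
    and f: "f \<in> Mor C A B" and a: "a \<in> Mor C Z A" and b: "b \<in> Mor C B Z"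
    and bfa: "Comp C Z B Z b (Comp C Z A B f a) = Ident C Z"
    and inv: "invertible C B B (Ident C B \<ominus>\<^bsub>Hom C B B\<^esub> Comp C B A B f (Comp C B Z A a b))"
  shows "Ident C Z = \<zero>\<^bsub>Hom C Z Z\<^esub>"
proof -
  let ?e = "Comp C B A B f (Comp C B Z A a b)"
  have em: "?e \<in> Mor C B B" and fa: "Comp C Z A B f a \<in> Mor C Z B" using assms by simp_all
  obtain v where v: "v \<in> Mor C B B" "Comp C B B B v (Ident C B \<ominus>\<^bsub>Hom C B B\<^esub> ?e) = Ident C B"
    using inv by (rule invertibleE)
  have "Comp C Z B B ?e (Comp C Z A B f a) = Comp C Z A B f a" using assms by (simp add: Comp_assoc)
  then have "Comp C Z B B (Ident C B \<ominus>\<^bsub>Hom C B B\<^esub> ?e) (Comp C Z A B f a) = \<zero>\<^bsub>Hom C Z B\<^esub>"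
    using B Z fa em by (simp add: Comp_minus_left minus_self)
  then have "Comp C Z A B f a = \<zero>\<^bsub>Hom C Z B\<^esub>"
    using Comp_reassoc[OF v(2) Z B B B v(1) Hom_minus[OF B B Ident_closed[OF B] em] fa] B Z fa v by simp
  then show ?thesis using bfa B Z b by simp
qed

end

context complete_locally_finite
begin

definition idempotent :: "('o, 'm) chain_complex \<Rightarrow> (int \<Rightarrow> 'm) \<Rightarrow> bool"
  where "idempotent A e \<longleftrightarrow> is_chain_map C A A e \<and> Comp (Ch C) A A A e e = e"

definition below :: "('o, 'm) chain_complex \<Rightarrow> (int \<Rightarrow> 'm) \<Rightarrow> (int \<Rightarrow> 'm) \<Rightarrow> bool"
  where "below A f e \<longleftrightarrow> Comp (Ch C) A A A f e = f \<and> Comp (Ch C) A A A e f = f"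

definition primitive :: "('o, 'm) chain_complex \<Rightarrow> (int \<Rightarrow> 'm) \<Rightarrow> bool"
  where "primitive A e \<longleftrightarrow> idempotent A e \<and> e \<noteq> \<zero>\<^bsub>Hom (Ch C) A A\<^esub> \<and>
    (\<forall>f. idempotent A f \<longrightarrow> below A f e \<longrightarrow> f = \<zero>\<^bsub>Hom (Ch C) A A\<^esub> \<or> f = e)"

lemma below_trans:
  assumes A: "is_chain_complex C A" and m: "is_chain_map C A A f" "is_chain_map C A A e" "is_chain_map C A A d"
    and "below A f e" "below A e d"
  shows "below A f d"
proof -
  have b: "Comp (Ch C) A A A f e = f" "Comp (Ch C) A A A e f = f" "Comp (Ch C) A A A e d = e" "Comp (Ch C) A A A d e = e"
    using assms unfolding below_def by auto
  have "Comp (Ch C) A A A (Comp (Ch C) A A A f e) d = Comp (Ch C) A A A f (Comp (Ch C) A A A e d)"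
    "Comp (Ch C) A A A (Comp (Ch C) A A A d e) f = Comp (Ch C) A A A d (Comp (Ch C) A A A e f)"
    using A m by (simp_all add: Ch.Comp_assoc)
  then show ?thesis using b unfolding below_def by simp
qed

lemma idempotent_complement:
  assumes A: "is_chain_complex C A" and e: "idempotent A e" and f: "idempotent A f" and fe: "below A f e"
  shows "idempotent A (e \<ominus>\<^bsub>Hom (Ch C) A A\<^esub> f)" "below A (e \<ominus>\<^bsub>Hom (Ch C) A A\<^esub> f) e"
    "Comp (Ch C) A A A f (e \<ominus>\<^bsub>Hom (Ch C) A A\<^esub> f) = \<zero>\<^bsub>Hom (Ch C) A A\<^esub>"
    "Comp (Ch C) A A A (e \<ominus>\<^bsub>Hom (Ch C) A A\<^esub> f) f = \<zero>\<^bsub>Hom (Ch C) A A\<^esub>"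
proof -
  have eD: "e \<in> Mor (Ch C) A A" "Comp (Ch C) A A A e e = e" and fD: "f \<in> Mor (Ch C) A A" "Comp (Ch C) A A A f f = f"
    and b: "Comp (Ch C) A A A f e = f" "Comp (Ch C) A A A e f = f"
    using e f fe unfolding idempotent_def below_def by auto
  have AO: "A \<in> Obj (Ch C)" using A by simp
  note s = AO eD fD b Ch.Comp_minus_left[OF AO AO AO] Ch.Comp_minus_right[OF AO AO AO]
    Ch.Hom_minus[OF AO AO] Ch.minus_self[OF AO AO] Ch.minus_zero_right[OF AO AO]
  show "idempotent A (e \<ominus>\<^bsub>Hom (Ch C) A A\<^esub> f)" "below A (e \<ominus>\<^bsub>Hom (Ch C) A A\<^esub> f) e"
    "Comp (Ch C) A A A f (e \<ominus>\<^bsub>Hom (Ch C) A A\<^esub> f) = \<zero>\<^bsub>Hom (Ch C) A A\<^esub>"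
    "Comp (Ch C) A A A (e \<ominus>\<^bsub>Hom (Ch C) A A\<^esub> f) f = \<zero>\<^bsub>Hom (Ch C) A A\<^esub>"
    unfolding idempotent_def below_def Ch_Mor[symmetric] using s by (simp_all del: Ch_Mor)
qed

text \<open>A minimal idempotent among those below \<open>e\<close> that do not vanish in degree \<open>n\<close> is primitive. Lower
  bounds of chains exist because the chains become stationary in each degree.\<close>

lemma primitive_below:
  assumes A: "is_chain_complex C A" and e: "idempotent A e" and n: "e n \<noteq> \<zero>\<^bsub>Hom C (ob A n) (ob A n)\<^esub>"
  obtains f where "primitive A f" "below A f e"
proof -
  let ?z = "\<lambda>m. \<zero>\<^bsub>Hom C (ob A m) (ob A m)\<^esub>"
  note AD = chain_complexD[OF A]
  define P where "P = {f. idempotent A f \<and> below A f e \<and> f n \<noteq> ?z n}"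
  have PD: "is_chain_map C A A f" "Comp (Ch C) A A A f f = f" "below A f e" "f n \<noteq> ?z n" if "f \<in> P" for f
    using that unfolding P_def idempotent_def by auto
  have eP: "e \<in> P" using e n unfolding P_def idempotent_def below_def by auto
  have "\<exists>m\<in>P. \<forall>a\<in>P. below A a m \<longrightarrow> a = m"
  proof (rule predicate_Zorn)
    show "partial_order_on P (relation_of (\<lambda>a b. below A b a) P)"
    proof (rule partial_order_on_relation_ofI)
      show "below A a a" if "a \<in> P" for a using PD[OF that] unfolding below_def by simp
      show "below A c a" if "a \<in> P" "b \<in> P" "c \<in> P" "below A b a" "below A c b" for a b c
        using below_trans[OF A] PD that by blast
      show "a = b" if "below A b a" "below A a b" for a b using that unfolding below_def by simp
    qed
  next
    fix D assume D: "D \<in> Chains (relation_of (\<lambda>a b. below A b a) P)"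
    then have DP: "D \<subseteq> P" and chain: "\<And>a b. a \<in> D \<Longrightarrow> b \<in> D \<Longrightarrow> below A a b \<or> below A b a"
      unfolding Chains_def relation_of_def by auto
    show "\<exists>u\<in>P. \<forall>a\<in>D. below A u a"
    proof (cases "D = {}")
      case True
      then show ?thesis using eP by blast
    next
      case False
      have "\<exists>c\<in>D. \<forall>f\<in>D. Comp C (ob A m) (ob A m) (ob A m) (c m) (f m) = c m \<and>
          Comp C (ob A m) (ob A m) (ob A m) (f m) (c m) = c m" for m
      proof -
        interpret E: fg_algebra S \<mm> "End C (ob A m)" by (rule End_fg_algebra[OF AD(1)])
        have "\<exists>x\<in>(\<lambda>c. c m) ` D. \<forall>f\<in>(\<lambda>c. c m) ` D. x \<otimes>\<^bsub>End C (ob A m)\<^esub> f = x \<and> f \<otimes>\<^bsub>End C (ob A m)\<^esub> x = x"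
        proof (rule E.idempotent_chain_minimal)
          show "(\<lambda>c. c m) ` D \<noteq> {}" using False by simp
          show "(\<lambda>c. c m) ` D \<subseteq> carrier (End C (ob A m))"
            using DP chain_mapD(1)[OF PD(1)] by auto
          show "x \<otimes>\<^bsub>End C (ob A m)\<^esub> x = x" if "x \<in> (\<lambda>c. c m) ` D" for x
            using that DP PD(2) by (auto simp: fun_eq_iff Ch_Comp)
          show "x \<otimes>\<^bsub>End C (ob A m)\<^esub> f = x \<and> f \<otimes>\<^bsub>End C (ob A m)\<^esub> x = x
            \<or> x \<otimes>\<^bsub>End C (ob A m)\<^esub> f = f \<and> f \<otimes>\<^bsub>End C (ob A m)\<^esub> x = f"
            if x: "x \<in> (\<lambda>c. c m) ` D" and f: "f \<in> (\<lambda>c. c m) ` D" for x f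
          proof -
            obtain c d where "c \<in> D" "d \<in> D" "x = c m" "f = d m" using x f by blast
            then show ?thesis using chain[of c d] unfolding below_def by (auto simp: fun_eq_iff Ch_Comp)
          qed
        qed
        then show ?thesis by simp
      qed
      then obtain c where cD: "\<And>m. c m \<in> D"
        and c: "\<And>m f. f \<in> D \<Longrightarrow> Comp C (ob A m) (ob A m) (ob A m) (c m m) (f m) = c m m"
          "\<And>m f. f \<in> D \<Longrightarrow> Comp C (ob A m) (ob A m) (ob A m) (f m) (c m m) = c m m" by metis
      define l where "l m = c m m" for m
      have l_eq: "f m = l m" if f: "f \<in> D" "below A f (c m)" for f m
        using c[OF f(1), of m] f(2) unfolding below_def l_def by (auto simp: fun_eq_iff Ch_Comp)
      have stationary: "\<exists>f\<in>D. f m = l m \<and> f (m - 1) = l (m - 1)" for m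
      proof -
        have refl: "below A f f" if "f \<in> D" for f using PD(2) DP that unfolding below_def by auto
        from chain[OF cD[of m] cD[of "m - 1"]] show ?thesis
        proof
          assume "below A (c m) (c (m - 1))"
          then show ?thesis using l_eq[OF cD[of m]] refl[OF cD] cD by blast
        next
          assume "below A (c (m - 1)) (c m)"
          then show ?thesis using l_eq[OF cD[of "m - 1"]] refl[OF cD] cD by blast
        qed
      qed
      have lm: "is_chain_map C A A l"
        unfolding is_chain_map_def
      proof
        fix m
        obtain f where "f \<in> D" "f m = l m" "f (m - 1) = l (m - 1)" using stationary by blast
        then show "l m \<in> Mor C (ob A m) (ob A m) \<and> Comp C (ob A m) (ob A m) (ob A (m - 1)) (diff A m) (l m) =
          Comp C (ob A m) (ob A (m - 1)) (ob A (m - 1)) (l (m - 1)) (diff A m)"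
          using chain_mapD[OF PD(1), of f m] DP by auto
      qed
      have ll: "Comp (Ch C) A A A l l = l"
        using c[OF cD] unfolding l_def by (simp add: fun_eq_iff Ch_Comp)
      have lf: "below A l f" if "f \<in> D" for f
        using c[OF that] unfolding below_def l_def by (simp add: fun_eq_iff Ch_Comp)
      obtain f where f: "f \<in> D" using False by blast
      then have "below A l e" using below_trans[OF A lm, of f e] PD(1,3) e lf DP unfolding idempotent_def by blast
      moreover have "l n \<noteq> ?z n" unfolding l_def using PD(4) cD DP by blast
      ultimately have "l \<in> P" using lm ll unfolding P_def idempotent_def by blast
      then show ?thesis using lf by blast
    qed
  qed
  then obtain m where m: "m \<in> P" and min: "\<And>a. a \<in> P \<Longrightarrow> below A a m \<Longrightarrow> a = m" by blast
  have im: "idempotent A m" using m unfolding P_def by blast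
  have "f = \<zero>\<^bsub>Hom (Ch C) A A\<^esub> \<or> f = m" if f: "idempotent A f" "below A f m" for f
  proof (cases "f n = ?z n")
    case False
    have "below A f e" using below_trans[OF A _ _ _ f(2) PD(3)[OF m]] f(1) im e unfolding idempotent_def by blast
    then show ?thesis using min[of f] f False unfolding P_def by blast
  next
    case True
    let ?g = "m \<ominus>\<^bsub>Hom (Ch C) A A\<^esub> f"
    note g = idempotent_complement[OF A im f]
    have fm: "is_chain_map C A A f" and gm: "is_chain_map C A A ?g" using f g unfolding idempotent_def by auto
    have "?g n = m n" using Ch_minus[OF A A fm, of m] True minus_zero_right[OF AD(1) AD(1) chain_mapD(1)[OF PD(1)[OF m]]] by simp
    then have "?g n \<noteq> ?z n" using PD(4)[OF m] by simp
    moreover have "below A ?g e" using below_trans[OF A gm _ _ g(2) PD(3)[OF m]] im e unfolding idempotent_def by blast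
    ultimately have "?g = m" using min g(1,2) unfolding P_def by blast
    then have "Comp (Ch C) A A A f m = \<zero>\<^bsub>Hom (Ch C) A A\<^esub>" using g(3) by simp
    then show ?thesis using f(2) unfolding below_def by simp
  qed
  moreover have "m \<noteq> \<zero>\<^bsub>Hom (Ch C) A A\<^esub>" using PD(4)[OF m] by (auto simp: Ch_zero)
  ultimately have "primitive A m" unfolding primitive_def using im by blast
  then show ?thesis using that PD(3)[OF m] by blast
qed

lemma Ch_invertible_if_degreewise:
  assumes A: "is_chain_complex C A" and B: "is_chain_complex C B" and f: "is_chain_map C A B f"
    and inv: "\<And>n. invertible C (ob A n) (ob B n) (f n)"
  shows "invertible (Ch C) A B f"
proof -
  note AD = chain_complexD[OF A] and BD = chain_complexD[OF B] and fD = chain_mapD[OF f]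
  obtain g where g: "\<And>n. g n \<in> Mor C (ob B n) (ob A n)"
    "\<And>n. Comp C (ob A n) (ob B n) (ob A n) (g n) (f n) = Ident C (ob A n)"
    "\<And>n. Comp C (ob B n) (ob A n) (ob B n) (f n) (g n) = Ident C (ob B n)"
    using inv unfolding invertible_def by metis
  have "Comp C (ob B n) (ob A n) (ob A (n - 1)) (diff A n) (g n) = Comp C (ob B n) (ob B (n - 1)) (ob A (n - 1)) (g (n - 1)) (diff B n)" for n
  proof -
    have "Comp C (ob B n) (ob A n) (ob A (n - 1)) (diff A n) (g n)
        = Comp C (ob B n) (ob B (n - 1)) (ob A (n - 1)) (g (n - 1)) (Comp C (ob B n) (ob A (n - 1)) (ob B (n - 1)) (f (n - 1)) (Comp C (ob B n) (ob A n) (ob A (n - 1)) (diff A n) (g n)))"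
      using AD(1,2) BD(1) fD(1) g(1) by (simp add: Comp_reassoc[OF g(2)])
    also have "\<dots> = Comp C (ob B n) (ob B (n - 1)) (ob A (n - 1)) (g (n - 1)) (diff B n)"
      using AD(1,2) BD(1,2) fD(1) g(1) by (simp add: Comp_reassoc[OF fD(2)[symmetric]] Comp_assoc g(3))
    finally show ?thesis .
  qed
  then have "is_chain_map C B A g" unfolding is_chain_map_def using g(1) by blast
  then show ?thesis
    using f g(2,3) by (intro Ch.invertibleI[of f A B g]) (auto simp: fun_eq_iff Ch_Comp Ch_Ident)
qed

lemma Ch_one_minus_invertible:
  assumes A: "is_chain_complex C A" and a: "is_chain_map C A A a" and nil: "\<And>n. nilp (ob A n) (a n)"
  shows "invertible (Ch C) A A (Ident (Ch C) A \<ominus>\<^bsub>Hom (Ch C) A A\<^esub> a)"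
proof (rule Ch_invertible_if_degreewise[OF A A])
  show "is_chain_map C A A (Ident (Ch C) A \<ominus>\<^bsub>Hom (Ch C) A A\<^esub> a)"
    unfolding Ch_Mor[symmetric] by (rule Ch.Hom_minus) (use A a Ch.Ident_closed[of A] in simp_all)
  show "invertible C (ob A n) (ob A n) ((Ident (Ch C) A \<ominus>\<^bsub>Hom (Ch C) A A\<^esub> a) n)" for n
    using nilp_one_minus_invertible[OF chain_complexD(1)[OF A] chain_mapD(1)[OF a] nil]
    by (simp add: Ch_minus[OF A A a] Ch_Ident)
qed

lemma local_if_idempotents_trivial:
  assumes A: "is_chain_complex C A" and nz: "Ident (Ch C) A \<noteq> \<zero>\<^bsub>Hom (Ch C) A A\<^esub>"
    and triv: "\<And>e. idempotent A e \<Longrightarrow> e = \<zero>\<^bsub>Hom (Ch C) A A\<^esub> \<or> e = Ident (Ch C) A"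
  shows "local_ring (End (Ch C) A)"
proof -
  have AO: "A \<in> Obj (Ch C)" using A by simp
  note AD = chain_complexD[OF A]
  interpret E: ring "End (Ch C) A" by (rule Ch.End_ring[OF AO])
  show ?thesis
  proof (rule E.local_ringI)
    show "\<one>\<^bsub>End (Ch C) A\<^esub> \<noteq> \<zero>\<^bsub>End (Ch C) A\<^esub>" using nz by simp
    fix a assume "a \<in> carrier (End (Ch C) A)"
    then have a: "is_chain_map C A A a" by simp
    obtain e w where e: "is_chain_map C A A e" "Comp (Ch C) A A A e e = e" and w: "is_chain_map C A A w"
      "Comp (Ch C) A A A a w = e" "Comp (Ch C) A A A w a = e"
      and nil: "\<And>n. e n = \<zero>\<^bsub>Hom C (ob A n) (ob A n)\<^esub> \<Longrightarrow> nilp (ob A n) (a n)"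
      by (rule Ch_fitting[OF A a]) blast
    from triv[of e] e have "e = \<zero>\<^bsub>Hom (Ch C) A A\<^esub> \<or> e = Ident (Ch C) A" unfolding idempotent_def by blast
    then show "a \<in> Units (End (Ch C) A) \<or> \<one>\<^bsub>End (Ch C) A\<^esub> \<ominus>\<^bsub>End (Ch C) A\<^esub> a \<in> Units (End (Ch C) A)"
    proof
      assume "e = Ident (Ch C) A"
      then have "a \<in> Units (End (Ch C) A)" using w a unfolding Units_def by auto
      then show ?thesis ..
    next
      assume "e = \<zero>\<^bsub>Hom (Ch C) A A\<^esub>"
      then have "\<And>n. nilp (ob A n) (a n)" using nil by (simp add: Ch_zero)
      then have "invertible (Ch C) A A (Ident (Ch C) A \<ominus>\<^bsub>Hom (Ch C) A A\<^esub> a)"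
        by (rule Ch_one_minus_invertible[OF A a])
      then show ?thesis using Ch.Units_End_iff[OF AO] by simp
    qed
  qed
qed

lemma primitive_summand_local:
  assumes A: "is_chain_complex C A" and e: "primitive A e" and b: "biproduct (Ch C) X Y A i j p q"
    and ip: "Comp (Ch C) A X A i p = e"
  shows "local_ring (End (Ch C) X)"
proof -
  note bD = Ch.biproductD[OF b]
  have X: "is_chain_complex C X" using bD(1) by simp
  have conj: "Comp (Ch C) A X X (Comp (Ch C) X A X p (Comp (Ch C) X X A i f)) p = Comp (Ch C) A X X f p"
    "Comp (Ch C) X A X p (Comp (Ch C) X A A (Comp (Ch C) A X A i (Comp (Ch C) A X X f p)) i) = f"
    if "f \<in> Mor (Ch C) X X" for f
    using that bD by (simp_all add: Ch.Comp_assoc Ch.Comp_reassoc[OF bD(8)] del: Ch_Obj Ch_Mor)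
  show ?thesis
  proof (rule local_if_idempotents_trivial[OF X])
    show "Ident (Ch C) X \<noteq> \<zero>\<^bsub>Hom (Ch C) X X\<^esub>"
    proof
      assume z: "Ident (Ch C) X = \<zero>\<^bsub>Hom (Ch C) X X\<^esub>"
      have "Comp (Ch C) A X A i (Comp (Ch C) A X X (Ident (Ch C) X) p) = e" using ip bD by (simp del: Ch_Obj Ch_Mor)
      then have "e = \<zero>\<^bsub>Hom (Ch C) A A\<^esub>" unfolding z using bD by (simp del: Ch_Obj Ch_Mor)
      then show False using e unfolding primitive_def by blast
    qed
    fix f assume "idempotent X f"
    then have f: "f \<in> Mor (Ch C) X X" "Comp (Ch C) X X X f f = f" unfolding idempotent_def by auto
    define g where "g = Comp (Ch C) A X A i (Comp (Ch C) A X X f p)"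
    have gm: "g \<in> Mor (Ch C) A A" unfolding g_def using f bD by (simp del: Ch_Obj Ch_Mor)
    have "Comp (Ch C) A A A g g = g" "Comp (Ch C) A A A g e = g" "Comp (Ch C) A A A e g = g"
      unfolding g_def ip[symmetric] using f bD
      by (simp_all add: Ch.Comp_assoc Ch.Comp_reassoc[OF bD(8)] Ch.Comp_reassoc[OF f(2)] del: Ch_Obj Ch_Mor)
    then have "g = \<zero>\<^bsub>Hom (Ch C) A A\<^esub> \<or> g = e"
      using e gm unfolding primitive_def idempotent_def below_def by simp
    then show "f = \<zero>\<^bsub>Hom (Ch C) X X\<^esub> \<or> f = Ident (Ch C) X"
    proof
      assume "g = \<zero>\<^bsub>Hom (Ch C) A A\<^esub>"
      then show ?thesis using conj(2)[OF f(1), folded g_def] bD by (simp del: Ch_Obj Ch_Mor)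
    next
      assume "g = e"
      then have "f = Comp (Ch C) X A X p (Comp (Ch C) X A A (Comp (Ch C) A X A i p) i)"
        using conj(2)[OF f(1), folded g_def] ip by simp
      then show ?thesis using bD by (simp add: Ch.Comp_assoc del: Ch_Obj Ch_Mor)
    qed
  qed
qed

lemma complete_primitive_system:
  assumes A: "is_chain_complex C A"
  obtains M where "\<And>e. e \<in> M \<Longrightarrow> primitive A e"
    "\<And>e f. e \<in> M \<Longrightarrow> f \<in> M \<Longrightarrow> e \<noteq> f \<Longrightarrow> Comp (Ch C) A A A e f = \<zero>\<^bsub>Hom (Ch C) A A\<^esub>"
    "\<And>n. finite {e \<in> M. e n \<noteq> \<zero>\<^bsub>Hom C (ob A n) (ob A n)\<^esub>}"
    "\<And>n. finsum (Hom C (ob A n) (ob A n)) (\<lambda>e. e n) {e \<in> M. e n \<noteq> \<zero>\<^bsub>Hom C (ob A n) (ob A n)\<^esub>} = Ident C (ob A n)"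
proof -
  let ?O = "\<zero>\<^bsub>Hom (Ch C) A A\<^esub>"
  note AD = chain_complexD[OF A]
  have AO: "A \<in> Obj (Ch C)" using A by simp
  define F where "F = {M. M \<subseteq> Collect (primitive A) \<and> (\<forall>e\<in>M. \<forall>f\<in>M. e \<noteq> f \<longrightarrow> Comp (Ch C) A A A e f = ?O)}"
  have "\<exists>M\<in>F. \<forall>X\<in>F. M \<subseteq> X \<longrightarrow> X = M"
  proof (rule subset_Zorn')
    fix D assume D: "subset.chain F D"
    have DF: "\<And>M. M \<in> D \<Longrightarrow> M \<in> F" and ch: "\<And>M N. M \<in> D \<Longrightarrow> N \<in> D \<Longrightarrow> M \<subseteq> N \<or> N \<subseteq> M"
      using D unfolding pred_on.chain_def by auto
    have "Comp (Ch C) A A A e f = ?O" if ef: "e \<in> \<Union>D" "f \<in> \<Union>D" "e \<noteq> f" for e f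
    proof -
      obtain M N where MN: "M \<in> D" "N \<in> D" "e \<in> M" "f \<in> N" using ef by blast
      from ch[OF MN(1,2)] obtain L where "L \<in> D" "e \<in> L" "f \<in> L" using MN by blast
      then show ?thesis using DF[of L] ef(3) unfolding F_def by blast
    qed
    moreover have "\<Union>D \<subseteq> Collect (primitive A)" using DF unfolding F_def by blast
    ultimately show "\<Union>D \<in> F" unfolding F_def by blast
  qed
  then obtain M where M: "M \<in> F" and max: "\<And>X. X \<in> F \<Longrightarrow> M \<subseteq> X \<Longrightarrow> X = M" by blast
  have prim: "\<And>e. e \<in> M \<Longrightarrow> primitive A e"
    and orth: "\<And>e f. e \<in> M \<Longrightarrow> f \<in> M \<Longrightarrow> e \<noteq> f \<Longrightarrow> Comp (Ch C) A A A e f = ?O"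
    using M unfolding F_def by auto
  have eM: "is_chain_map C A A e" and ee: "Comp (Ch C) A A A e e = e" if "e \<in> M" for e
    using prim[OF that] unfolding primitive_def idempotent_def by auto
  note eD = eM[THEN chain_mapD(1)] eM[THEN chain_mapD(2)]
  let ?z = "\<lambda>n. \<zero>\<^bsub>Hom C (ob A n) (ob A n)\<^esub>"
  define supp where "supp n = {e \<in> M. e n \<noteq> ?z n}" for n
  have een: "Comp C (ob A n) (ob A n) (ob A n) (e n) (e n) = e n" if "e \<in> M" for e n
    using fun_cong[OF ee[OF that], of n] by (simp add: Ch_Comp)
  have orthn: "Comp C (ob A n) (ob A n) (ob A n) (e n) (f n) = ?z n" if "e \<in> M" "f \<in> M" "e \<noteq> f" for e f n
    using fun_cong[OF orth[OF that], of n] by (simp add: Ch_Comp Ch_zero)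
  have fin: "finite (supp n)" for n
  proof -
    interpret E: fg_algebra S \<mm> "End C (ob A n)" by (rule End_fg_algebra[OF AD(1)])
    have "finite ((\<lambda>e. e n) ` supp n)"
    proof (rule E.orthogonal_idempotents_finite)
      show "x \<otimes>\<^bsub>End C (ob A n)\<^esub> y = \<zero>\<^bsub>End C (ob A n)\<^esub>"
        if "x \<in> (\<lambda>e. e n) ` supp n" "y \<in> (\<lambda>e. e n) ` supp n" "x \<noteq> y" for x y
        using that orthn unfolding supp_def by fastforce
    qed (use eD een in \<open>auto simp: supp_def\<close>)
    moreover have "inj_on (\<lambda>e. e n) (supp n)"
    proof (rule inj_onI)
      fix e f assume "e \<in> supp n" "f \<in> supp n" "e n = f n"
      then show "e = f" using orthn[of e f n] een[of e n] unfolding supp_def by (cases "e = f") auto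
    qed
    ultimately show ?thesis by (rule finite_imageD)
  qed
  have suppM: "e \<in> M" if "e \<in> supp n" for e n using that unfolding supp_def by blast
  define s where "s n = finsum (Hom C (ob A n) (ob A n)) (\<lambda>e. e n) (supp n)" for n
  have sG: "s n = finsum (Hom C (ob A n) (ob A n)) (\<lambda>e. e n) G" if "finite G" "supp n \<subseteq> G" "G \<subseteq> M" for n G
  proof -
    interpret H: abelian_group "Hom C (ob A n) (ob A n)" by (rule Hom_abelian[OF AD(1) AD(1)])
    show ?thesis unfolding s_def
      by (rule H.add.finprod_mono_neutral_cong_left) (use that eD in \<open>auto simp: supp_def\<close>)
  qed
  have s_closed: "s n \<in> Mor C (ob A n) (ob A n)" for n
  proof -
    interpret H: abelian_group "Hom C (ob A n) (ob A n)" by (rule Hom_abelian[OF AD(1) AD(1)])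
    show ?thesis unfolding s_def by (rule H.finsum_closed) (use eD suppM in auto)
  qed
  have sm: "is_chain_map C A A s"
    unfolding is_chain_map_def
  proof (intro allI conjI s_closed)
    fix n
    let ?G = "supp n \<union> supp (n - 1)"
    have G: "finite ?G" "?G \<subseteq> M" using fin suppM by auto
    interpret H: abelian_group "Hom C (ob A n) (ob A (n - 1))" by (rule Hom_abelian[OF AD(1) AD(1)])
    have "Comp C (ob A n) (ob A n) (ob A (n - 1)) (diff A n) (s n)
        = finsum (Hom C (ob A n) (ob A (n - 1))) (\<lambda>e. Comp C (ob A n) (ob A n) (ob A (n - 1)) (diff A n) (e n)) ?G"
      unfolding sG[OF G(1) Un_upper1 G(2)] by (rule Comp_finsum_right) (use AD eD G in auto)
    also have "\<dots> = finsum (Hom C (ob A n) (ob A (n - 1))) (\<lambda>e. Comp C (ob A n) (ob A (n - 1)) (ob A (n - 1)) (e (n - 1)) (diff A n)) ?G"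
      by (rule H.finsum_cong') (use AD eD G in \<open>auto simp: subset_iff\<close>)
    also have "\<dots> = Comp C (ob A n) (ob A (n - 1)) (ob A (n - 1)) (s (n - 1)) (diff A n)"
      unfolding sG[OF G(1) Un_upper2 G(2)] by (rule Comp_finsum_left[symmetric]) (use AD eD G in auto)
    finally show "Comp C (ob A n) (ob A n) (ob A (n - 1)) (diff A n) (s n)
      = Comp C (ob A n) (ob A (n - 1)) (ob A (n - 1)) (s (n - 1)) (diff A n)" .
  qed
  have sen: "Comp C (ob A n) (ob A n) (ob A n) (s n) (e n) = e n \<and> Comp C (ob A n) (ob A n) (ob A n) (e n) (s n) = e n"
    if e: "e \<in> M" for e n
  proof -
    interpret H: abelian_group "Hom C (ob A n) (ob A n)" by (rule Hom_abelian[OF AD(1) AD(1)])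
    have G: "finite (insert e (supp n))" "supp n \<subseteq> insert e (supp n)" "insert e (supp n) \<subseteq> M" using e fin suppM by auto
    have single: "finsum (Hom C (ob A n) (ob A n)) (\<lambda>f. if f = e then e n else ?z n) (insert e (supp n)) = e n"
      using H.add.finprod_singleton_swap[of e "insert e (supp n)" "\<lambda>_. e n"] G(1) eD(1)[OF e] by auto
    have "Comp C (ob A n) (ob A n) (ob A n) (s n) (e n)
        = finsum (Hom C (ob A n) (ob A n)) (\<lambda>f. Comp C (ob A n) (ob A n) (ob A n) (f n) (e n)) (insert e (supp n))"
      unfolding sG[OF G] by (rule Comp_finsum_left) (use AD eD e suppM in auto)
    also have "\<dots> = finsum (Hom C (ob A n) (ob A n)) (\<lambda>f. if f = e then e n else ?z n) (insert e (supp n))"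
      by (rule H.finsum_cong') (use AD eD een orthn e suppM in auto)
    finally have 1: "Comp C (ob A n) (ob A n) (ob A n) (s n) (e n) = e n" unfolding single .
    have "Comp C (ob A n) (ob A n) (ob A n) (e n) (s n)
        = finsum (Hom C (ob A n) (ob A n)) (\<lambda>f. Comp C (ob A n) (ob A n) (ob A n) (e n) (f n)) (insert e (supp n))"
      unfolding sG[OF G] by (rule Comp_finsum_right) (use AD eD e suppM in auto)
    also have "\<dots> = finsum (Hom C (ob A n) (ob A n)) (\<lambda>f. if f = e then e n else ?z n) (insert e (supp n))"
      by (rule H.finsum_cong') (use AD eD een orthn e suppM in auto)
    finally show ?thesis using 1 unfolding single by simp
  qed
  have ss: "Comp (Ch C) A A A s s = s"
  proof
    fix n
    interpret H: abelian_group "Hom C (ob A n) (ob A n)" by (rule Hom_abelian[OF AD(1) AD(1)])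
    have "Comp C (ob A n) (ob A n) (ob A n) (s n) (finsum (Hom C (ob A n) (ob A n)) (\<lambda>e. e n) (supp n))
        = finsum (Hom C (ob A n) (ob A n)) (\<lambda>e. Comp C (ob A n) (ob A n) (ob A n) (s n) (e n)) (supp n)"
      by (rule Comp_finsum_right) (use AD eD s_closed suppM in auto)
    also have "\<dots> = finsum (Hom C (ob A n) (ob A n)) (\<lambda>e. e n) (supp n)"
      by (rule H.finsum_cong') (use AD eD sen suppM in auto)
    finally show "Comp (Ch C) A A A s s n = s n" unfolding s_def[symmetric] Ch_Comp .
  qed
  let ?t = "Ident (Ch C) A \<ominus>\<^bsub>Hom (Ch C) A A\<^esub> s"
  have idI: "idempotent A (Ident (Ch C) A)" and ids: "idempotent A s" and below_s: "below A s (Ident (Ch C) A)"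
    unfolding idempotent_def below_def using Ch.Ident_closed[OF AO] Ch.Comp_Ident_left[OF AO AO]
      Ch.Comp_Ident_right[OF AO AO] sm ss by auto
  note t = idempotent_complement[OF A idI ids below_s]
  have tm: "is_chain_map C A A ?t" using t(1) unfolding idempotent_def by blast
  have "?t = ?O"
  proof (rule ccontr)
    assume "?t \<noteq> ?O"
    then obtain n where "?t n \<noteq> ?z n" by (auto simp: fun_eq_iff Ch_zero)
    from primitive_below[OF A t(1) this] obtain f where f: "primitive A f" "below A f ?t" by blast
    have fm: "f \<in> Mor (Ch C) A A" and fnz: "f \<noteq> ?O" and fff: "Comp (Ch C) A A A f f = f"
      using f(1) unfolding primitive_def idempotent_def by auto
    have ft: "Comp (Ch C) A A A f ?t = f" "Comp (Ch C) A A A ?t f = f" using f(2) unfolding below_def by auto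
    have tm': "?t \<in> Mor (Ch C) A A" and sm': "s \<in> Mor (Ch C) A A" using tm sm by simp_all
    have ef: "Comp (Ch C) A A A e f = ?O \<and> Comp (Ch C) A A A f e = ?O" if e: "e \<in> M" for e
    proof -
      have em: "e \<in> Mor (Ch C) A A" using eM[OF e] by simp
      have es: "Comp (Ch C) A A A e s = e" "Comp (Ch C) A A A s e = e" using sen[OF e] by (auto simp: fun_eq_iff Ch_Comp)
      have et: "Comp (Ch C) A A A e ?t = ?O" "Comp (Ch C) A A A ?t e = ?O"
        using AO em sm' es by (simp_all add: Ch.Comp_minus_left Ch.Comp_minus_right Ch.minus_self del: Ch_Mor Ch_Obj)
      have "Comp (Ch C) A A A e (Comp (Ch C) A A A ?t f) = ?O" "Comp (Ch C) A A A (Comp (Ch C) A A A f ?t) e = ?O"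
        using AO em fm tm' et by (simp_all add: Ch.Comp_reassoc[OF et(1)] Ch.Comp_assoc del: Ch_Mor Ch_Obj)
      then show ?thesis unfolding ft by simp
    qed
    have "insert f M \<in> F" unfolding F_def using prim orth ef f(1) by auto
    then have "f \<in> M" using max by blast
    then have "Comp (Ch C) A A A f f = ?O" using ef by blast
    then show False using fff fnz by simp
  qed
  then have "Ident (Ch C) A = s"
    by (rule Ch.eq_if_minus_zero[OF AO AO Ch.Ident_closed[OF AO], rotated]) (use sm in simp)
  then have "s n = Ident C (ob A n)" for n using Ch_Ident[of C A n] by simp
  then show ?thesis using that[of M] prim orth fin unfolding supp_def s_def by blast
qed

lemma locally_finite_sum_ex:
  assumes A: "is_chain_complex C A"
  shows "\<exists>(I :: nat set) X \<iota> \<pi> F. locally_finite_sum S \<mm> C I X A \<iota> \<pi> F \<and>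
    (\<forall>i\<in>I. \<exists>Y j q. biproduct (Ch C) (X i) Y A (\<iota> i) j (\<pi> i) q)"
proof -
  let ?z = "\<lambda>n. \<zero>\<^bsub>Hom C (ob A n) (ob A n)\<^esub>"
  note AD = chain_complexD[OF A]
  obtain M where prim: "\<And>e. e \<in> M \<Longrightarrow> primitive A e"
    and orth: "\<And>e f. e \<in> M \<Longrightarrow> f \<in> M \<Longrightarrow> e \<noteq> f \<Longrightarrow> Comp (Ch C) A A A e f = \<zero>\<^bsub>Hom (Ch C) A A\<^esub>"
    and fin: "\<And>n. finite {e \<in> M. e n \<noteq> ?z n}"
    and sum: "\<And>n. finsum (Hom C (ob A n) (ob A n)) (\<lambda>e. e n) {e \<in> M. e n \<noteq> ?z n} = Ident C (ob A n)"
    by (rule complete_primitive_system[OF A]) blast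
  have eM: "is_chain_map C A A e" and ee: "Comp (Ch C) A A A e e = e" and enz: "e \<noteq> \<zero>\<^bsub>Hom (Ch C) A A\<^esub>" if "e \<in> M" for e
    using prim[OF that] unfolding primitive_def idempotent_def by auto
  have "M = (\<Union>n. {e \<in> M. e n \<noteq> ?z n})"
    using enz by (fastforce simp: fun_eq_iff Ch_zero)
  moreover have "countable (\<Union>n. {e \<in> M. e n \<noteq> ?z n})"
    by (rule countable_UN[OF countableI_type countable_finite[OF fin]])
  ultimately have "countable M" by simp
  then obtain num :: "(int \<Rightarrow> 'm) \<Rightarrow> nat" where num: "inj_on num M" unfolding countable_def by blast
  define I where "I = num ` M"
  define \<epsilon> where "\<epsilon> = inv_into M num"
  have \<epsilon>M: "\<epsilon> i \<in> M" if "i \<in> I" for i using that unfolding \<epsilon>_def I_def by (rule inv_into_into)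
  have \<epsilon>num: "\<epsilon> (num e) = e" if "e \<in> M" for e unfolding \<epsilon>_def using num that by (rule inv_into_f_f)
  have inj: "inj_on \<epsilon> I" unfolding I_def using \<epsilon>num by (auto intro!: inj_onI)
  have \<epsilon>I: "\<epsilon> ` I = M" unfolding I_def using \<epsilon>num by force
  have "\<exists>X Y i j p q. biproduct (Ch C) X Y A i j p q \<and> Comp (Ch C) A X A i p = e" if e: "e \<in> M" for e
    by (rule Ch_idempotent_splits[OF A eM[OF e] ee[OF e]]) blast
  then have "\<forall>i\<in>I. \<exists>X Y \<iota> j \<pi> q. biproduct (Ch C) X Y A \<iota> j \<pi> q \<and> Comp (Ch C) A X A \<iota> \<pi> = \<epsilon> i"
    using \<epsilon>M by blast
  then obtain X Y \<iota> j \<pi> q where b: "\<And>i. i \<in> I \<Longrightarrow> biproduct (Ch C) (X i) (Y i) A (\<iota> i) (j i) (\<pi> i) (q i)"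
    and \<iota>\<pi>: "\<And>i. i \<in> I \<Longrightarrow> Comp (Ch C) A (X i) A (\<iota> i) (\<pi> i) = \<epsilon> i" by metis
  note bD = Ch.biproductD[OF b]
  have XO: "is_chain_complex C (X i)" and \<iota>m: "is_chain_map C (X i) A (\<iota> i)" and \<pi>m: "is_chain_map C A (X i) (\<pi> i)"
    if "i \<in> I" for i using bD(1,4,6)[OF that] by simp_all
  have \<iota>\<pi>n: "Comp C (ob A n) (ob (X i) n) (ob A n) (\<iota> i n) (\<pi> i n) = \<epsilon> i n" if "i \<in> I" for i n
    using fun_cong[OF \<iota>\<pi>[OF that], of n] by (simp add: Ch_Comp)
  define F where "F n = {i \<in> I. \<epsilon> i n \<noteq> ?z n}" for n
  have \<epsilon>F: "\<epsilon> ` F n = {e \<in> M. e n \<noteq> ?z n}" for n unfolding F_def using \<epsilon>I by auto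
  have injF: "inj_on \<epsilon> (F n)" for n by (rule inj_on_subset[OF inj]) (auto simp: F_def)
  have "locally_finite_sum S \<mm> C I X A \<iota> \<pi> F"
  proof (intro locally_finite_sum.intro locally_finite_sum_axioms.intro complete_locally_finite_axioms A)
    fix i k assume i: "i \<in> I" and k: "k \<in> I"
    show "Comp (Ch C) (X i) A (X k) (\<pi> k) (\<iota> i) = (if i = k then Ident (Ch C) (X i) else \<zero>\<^bsub>Hom (Ch C) (X i) (X k)\<^esub>)"
    proof (cases "i = k")
      case True
      then show ?thesis using bD(8)[OF i] by simp
    next
      case False
      then have "\<epsilon> k \<noteq> \<epsilon> i" using inj i k unfolding inj_on_def by blast
      then have z: "Comp (Ch C) A A A (\<epsilon> k) (\<epsilon> i) = \<zero>\<^bsub>Hom (Ch C) A A\<^esub>" using orth \<epsilon>M i k by blast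
      note bi = bD[OF i] and bk = bD[OF k]
      have "Comp (Ch C) (X i) A (X k) (\<pi> k) (\<iota> i)
        = Comp (Ch C) (X i) A (X k) (\<pi> k) (Comp (Ch C) (X i) A A (Comp (Ch C) A A A (Comp (Ch C) A (X k) A (\<iota> k) (\<pi> k)) (Comp (Ch C) A (X i) A (\<iota> i) (\<pi> i))) (\<iota> i))"
        using bi bk by (simp add: Ch.Comp_assoc Ch.Comp_reassoc[OF bk(8)] del: Ch_Obj Ch_Mor)
      also have "\<dots> = \<zero>\<^bsub>Hom (Ch C) (X i) (X k)\<^esub>"
        unfolding \<iota>\<pi>[OF i] \<iota>\<pi>[OF k] z using bi bk by (simp del: Ch_Obj Ch_Mor)
      finally show ?thesis using False by simp
    qed
  next
    fix n
    show "finite (F n)" using fin[of n] injF[of n] \<epsilon>F[of n] by (metis finite_imageD)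
    show "F n \<subseteq> I" unfolding F_def by blast
    interpret H: abelian_group "Hom C (ob A n) (ob A n)" by (rule Hom_abelian[OF AD(1) AD(1)])
    have "finsum (Hom C (ob A n) (ob A n)) (\<lambda>i. Comp C (ob A n) (ob (X i) n) (ob A n) (\<iota> i n) (\<pi> i n)) (F n)
        = finsum (Hom C (ob A n) (ob A n)) (\<lambda>i. \<epsilon> i n) (F n)"
      by (rule H.finsum_cong') (use \<iota>\<pi>n eM[OF \<epsilon>M, THEN chain_mapD(1)] in \<open>auto simp: F_def\<close>)
    also have "\<dots> = finsum (Hom C (ob A n) (ob A n)) (\<lambda>e. e n) (\<epsilon> ` F n)"
      by (rule H.finsum_reindex[symmetric]) (use injF eM[THEN chain_mapD(1)] in \<open>auto simp: \<epsilon>F\<close>)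
    finally show "finsum (Hom C (ob A n) (ob A n)) (\<lambda>i. Comp C (ob A n) (ob (X i) n) (ob A n) (\<iota> i n) (\<pi> i n)) (F n) = Ident C (ob A n)"
      unfolding \<epsilon>F sum .
    fix i assume "i \<in> I - F n"
    then have i: "i \<in> I" and 0: "\<epsilon> i n = ?z n" unfolding F_def by auto
    have o: "ob (X i) n \<in> Obj C" "\<iota> i n \<in> Mor C (ob (X i) n) (ob A n)" "\<pi> i n \<in> Mor C (ob A n) (ob (X i) n)"
      using XO[OF i] \<iota>m[OF i] \<pi>m[OF i] by (simp_all add: chain_complexD(1) chain_mapD(1))
    have pi: "Comp C (ob (X i) n) (ob A n) (ob (X i) n) (\<pi> i n) (\<iota> i n) = Ident C (ob (X i) n)"
      using fun_cong[OF bD(8)[OF i], of n] by (simp add: Ch_Comp Ch_Ident)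
    have "Comp C (ob (X i) n) (ob A n) (ob (X i) n) (\<pi> i n) (Comp C (ob (X i) n) (ob A n) (ob A n)
        (Comp C (ob A n) (ob (X i) n) (ob A n) (\<iota> i n) (\<pi> i n)) (\<iota> i n)) = Ident C (ob (X i) n)"
      using o AD(1) by (simp add: Comp_assoc pi)
    then show "Ident C (ob (X i) n) = \<zero>\<^bsub>Hom C (ob (X i) n) (ob (X i) n)\<^esub>"
      unfolding \<iota>\<pi>n[OF i] 0 using o AD(1) by simp
  next
    fix i assume i: "i \<in> I"
    show "local_ring (End (Ch C) (X i))" by (rule primitive_summand_local[OF A prim[OF \<epsilon>M[OF i]] b[OF i] \<iota>\<pi>[OF i]])
  qed (use XO \<iota>m \<pi>m in auto)
  then show ?thesis using b by blast
qed

sublocale Ch: detecting_category S "Ch C"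
proof
  fix A assume "A \<in> Obj (Ch C)"
  then have A: "is_chain_complex C A" by simp
  obtain I :: "nat set" and X \<iota> \<pi> F where s: "locally_finite_sum S \<mm> C I X A \<iota> \<pi> F"
    and compl: "\<forall>i\<in>I. \<exists>Y j q. biproduct (Ch C) (X i) Y A (\<iota> i) j (\<pi> i) q"
    using locally_finite_sum_ex[OF A] by (elim exE conjE) (rule that)
  interpret s: locally_finite_sum S \<mm> C I X A \<iota> \<pi> F by (rule s)
  show "\<exists>(I::nat set) X \<iota> \<pi>. direct_sum (Ch C) I X A \<iota> \<pi> \<and>
    (\<forall>i\<in>I. local_ring (End (Ch C) (X i))) \<and> Ch.detecting I X A \<iota> \<pi> \<and> Ch.finite_multiplicities I X \<and>
    (\<forall>i\<in>I. \<exists>Y j q. biproduct (Ch C) (X i) Y A (\<iota> i) j (\<pi> i) q)"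
    by (intro exI[of _ I] exI[of _ X] exI[of _ \<iota>] exI[of _ \<pi>] conjI ballI s.loc s.Ch_sum s.Ch_detecting
        s.Ch_finite_multiplicities compl[rule_format])
qed

lemma not_nilp_factor:
  assumes A: "is_chain_complex C A" and B: "is_chain_complex C B" and f: "is_chain_map C A B f" and g: "is_chain_map C B A g"
    and nn: "\<not> nilp (ob B n) (Comp C (ob B n) (ob A n) (ob B n) (f n) (g n))"
  obtains Z a b where "is_chain_complex C Z" "local_ring (End (Ch C) Z)" "is_chain_map C Z A a" "is_chain_map C B Z b"
    "Comp (Ch C) Z B Z b (Comp (Ch C) Z A B f a) = Ident (Ch C) Z"
proof -
  have AO: "A \<in> Obj (Ch C)" and BO: "B \<in> Obj (Ch C)" and fm: "f \<in> Mor (Ch C) A B" and gm: "g \<in> Mor (Ch C) B A"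
    using A B f g by simp_all
  let ?x = "Comp (Ch C) B A B f g"
  have x: "is_chain_map C B B ?x" using Ch.Comp_closed[OF BO AO BO fm gm] by simp
  obtain e w where e: "is_chain_map C B B e" "Comp (Ch C) B B B e e = e" and w: "is_chain_map C B B w"
    "Comp (Ch C) B B B ?x w = e"
    and nil: "\<And>n. e n = \<zero>\<^bsub>Hom C (ob B n) (ob B n)\<^esub> \<Longrightarrow> nilp (ob B n) (?x n)"
    by (rule Ch_fitting[OF B x]) blast
  have "e n \<noteq> \<zero>\<^bsub>Hom C (ob B n) (ob B n)\<^esub>" using nil[of n] nn by (auto simp: Ch_Comp)
  moreover have ie: "idempotent B e" using e unfolding idempotent_def by blast
  ultimately obtain \<epsilon> where \<epsilon>: "primitive B \<epsilon>" "below B \<epsilon> e" using primitive_below[OF B] by blast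
  have \<epsilon>': "is_chain_map C B B \<epsilon>" "Comp (Ch C) B B B \<epsilon> \<epsilon> = \<epsilon>" "Comp (Ch C) B B B \<epsilon> e = \<epsilon>"
    using \<epsilon> unfolding primitive_def idempotent_def below_def by auto
  obtain X Y i j p q where b: "biproduct (Ch C) X Y B i j p q" and ip: "Comp (Ch C) B X B i p = \<epsilon>"
    by (rule Ch_idempotent_splits[OF B \<epsilon>'(1,2)])
  note bD = Ch.biproductD[OF b]
  have em: "e \<in> Mor (Ch C) B B" and wm: "w \<in> Mor (Ch C) B B" using e w by simp_all
  have "Comp (Ch C) X B X p i = Comp (Ch C) X B X p (Comp (Ch C) X B B \<epsilon> i)"
    unfolding ip[symmetric] using bD by (simp add: Ch.Comp_assoc del: Ch_Obj Ch_Mor)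
  also have "\<dots> = Comp (Ch C) X B X p (Comp (Ch C) X B B (Comp (Ch C) B B B \<epsilon> e) i)" unfolding \<epsilon>'(3) ..
  also have "\<dots> = Comp (Ch C) X B X p (Comp (Ch C) X B B e i)"
    unfolding ip[symmetric] using bD em by (simp add: Ch.Comp_assoc Ch.Comp_reassoc[OF bD(8)] del: Ch_Obj Ch_Mor)
  finally have "Comp (Ch C) X B X p (Comp (Ch C) X B B e i) = Ident (Ch C) X" using bD(8) by simp
  moreover have "Comp (Ch C) X A B f (Comp (Ch C) X B A g (Comp (Ch C) X B B w i)) = Comp (Ch C) X B B e i"
    unfolding w(2)[symmetric] using bD AO BO fm gm wm by (simp add: Ch.Comp_assoc del: Ch_Obj Ch_Mor)
  ultimately have "Comp (Ch C) X B X p (Comp (Ch C) X A B f (Comp (Ch C) X B A g (Comp (Ch C) X B B w i))) = Ident (Ch C) X"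
    by simp
  moreover have "Comp (Ch C) X B A g (Comp (Ch C) X B B w i) \<in> Mor (Ch C) X A"
    using bD AO BO gm wm by (simp del: Ch_Obj Ch_Mor)
  moreover have "local_ring (End (Ch C) X)" by (rule primitive_summand_local[OF B \<epsilon>(1) b ip])
  ultimately show ?thesis using that[of X "Comp (Ch C) X B A g (Comp (Ch C) X B B w i)" p] bD(1,6) by simp
qed

lemma nilp_no_factor:
  assumes A: "is_chain_complex C A" and B: "is_chain_complex C B" and f: "is_chain_map C A B f"
    and nil: "\<And>g n. is_chain_map C B A g \<Longrightarrow> nilp (ob B n) (Comp C (ob B n) (ob A n) (ob B n) (f n) (g n))"
    and g: "is_chain_map C B A g"
  shows "invertible (Ch C) B B (Ident (Ch C) B \<ominus>\<^bsub>Hom (Ch C) B B\<^esub> Comp (Ch C) B A B f g)"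
proof (rule Ch_one_minus_invertible[OF B])
  show "is_chain_map C B B (Comp (Ch C) B A B f g)" using Ch.Comp_closed[of B A B f g] A B f g by simp
  show "nilp (ob B n) (Comp (Ch C) B A B f g n)" for n unfolding Ch_Comp by (rule nil[OF g])
qed

lemma Ch_radical_iff:
  assumes A: "is_chain_complex C A" and B: "is_chain_complex C B" and f: "is_chain_map C A B f"
  shows "f \<in> radical (Ch C) A B \<longleftrightarrow>
    (\<forall>g n. is_chain_map C B A g \<longrightarrow> nilp (ob B n) (Comp C (ob B n) (ob A n) (ob B n) (f n) (g n)))"
proof -
  have AO: "A \<in> Obj (Ch C)" and BO: "B \<in> Obj (Ch C)" and fm: "f \<in> Mor (Ch C) A B" using A B f by simp_all
  note rad = Ch.radical_iff[OF AO BO fm]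
  show ?thesis
  proof
    assume "f \<in> radical (Ch C) A B"
    then show "\<forall>g n. is_chain_map C B A g \<longrightarrow> nilp (ob B n) (Comp C (ob B n) (ob A n) (ob B n) (f n) (g n))"
      unfolding rad using not_nilp_factor[OF A B f] by (metis Ch_Obj Ch_Mor)
  next
    assume nil: "\<forall>g n. is_chain_map C B A g \<longrightarrow> nilp (ob B n) (Comp C (ob B n) (ob A n) (ob B n) (f n) (g n))"
    have "Ident (Ch C) Z = \<zero>\<^bsub>Hom (Ch C) Z Z\<^esub>"
      if Z: "Z \<in> Obj (Ch C)" and a: "a \<in> Mor (Ch C) Z A" and b: "b \<in> Mor (Ch C) B Z"
        and bfa: "Comp (Ch C) Z B Z b (Comp (Ch C) Z A B f a) = Ident (Ch C) Z" for Z a b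
    proof (rule Ch.no_factor_if_invertible[OF AO BO Z fm a b bfa], rule nilp_no_factor[OF A B f])
      show "is_chain_map C B A (Comp (Ch C) B Z A a b)" using Ch.Comp_closed[OF BO Z AO a b] by simp
    qed (use nil in blast)
    then show "f \<in> radical (Ch C) A B" unfolding rad using Ch.local_End_nonzero by blast
  qed
qed

end

section \<open>The homotopy category\<close>

definition homotopy_class :: "('o, 'a, 'm) linear_category
    \<Rightarrow> ('o, 'm) chain_complex \<Rightarrow> ('o, 'm) chain_complex \<Rightarrow> (int \<Rightarrow> 'm) \<Rightarrow> (int \<Rightarrow> 'm) set"
  where "homotopy_class C A B f = null_homotopic C A B +>\<^bsub>Hom (Ch C) A B\<^esub> f"

context S_category
begin

lemma null_homotopicI:
  assumes "is_chain_map C A B f" "\<And>n. h n \<in> Mor C (ob A n) (ob B (n + 1))"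
    "\<And>n. f n = Comp C (ob A n) (ob B (n + 1)) (ob B n) (diff B (n + 1)) (h n)
      \<oplus>\<^bsub>Hom C (ob A n) (ob B n)\<^esub> Comp C (ob A n) (ob A (n - 1)) (ob B n) (h (n - 1)) (diff A n)"
  shows "f \<in> null_homotopic C A B"
  using assms unfolding null_homotopic_def by auto

lemma null_homotopicE:
  assumes "f \<in> null_homotopic C A B"
  obtains h where "is_chain_map C A B f" "\<And>n. h n \<in> Mor C (ob A n) (ob B (n + 1))"
    "\<And>n. f n = Comp C (ob A n) (ob B (n + 1)) (ob B n) (diff B (n + 1)) (h n)
      \<oplus>\<^bsub>Hom C (ob A n) (ob B n)\<^esub> Comp C (ob A n) (ob A (n - 1)) (ob B n) (h (n - 1)) (diff A n)"
  using assms unfolding null_homotopic_def by auto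

lemma diff_Suc:
  assumes "is_chain_complex C B"
  shows "diff B (n + 1) \<in> Mor C (ob B (n + 1)) (ob B n)"
  using chain_complexD(2)[OF assms, of "n + 1"] by simp

lemma homotopy_shift: "(\<And>n. h n \<in> Mor C (ob A n) (ob B (n + 1))) \<Longrightarrow> h (n - 1) \<in> Mor C (ob A (n - 1)) (ob B n)"
  for n :: int
  by (metis diff_add_cancel)

lemma null_homotopic_submodule:
  assumes A: "is_chain_complex C A" and B: "is_chain_complex C B"
  shows "submodule (null_homotopic C A B) S (Hom (Ch C) A B)"
proof -
  interpret Ch: S_category S "Ch C" by (rule Ch_S_category)
  interpret H: smodule S "Hom (Ch C) A B" using A B by (intro Ch.Hom_smodule) simp_all
  note AD = chain_complexD[OF A] and BD = chain_complexD[OF B] and dB = diff_Suc[OF B]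
  show ?thesis
  proof (rule H.submoduleI_smult)
    show "null_homotopic C A B \<subseteq> carrier (Hom (Ch C) A B)" unfolding null_homotopic_def by blast
    show "\<zero>\<^bsub>Hom (Ch C) A B\<^esub> \<in> null_homotopic C A B"
    proof (rule null_homotopicI[where h = "\<lambda>n. \<zero>\<^bsub>Hom C (ob A n) (ob B (n + 1))\<^esub>"])
      show "is_chain_map C A B \<zero>\<^bsub>Hom (Ch C) A B\<^esub>" using H.M.zero_closed by simp
    qed (use AD BD dB in \<open>simp_all add: Ch_zero\<close>)
  next
    fix f g assume "f \<in> null_homotopic C A B" "g \<in> null_homotopic C A B"
    then obtain h k where f: "is_chain_map C A B f" and h: "\<And>n. h n \<in> Mor C (ob A n) (ob B (n + 1))"
      "\<And>n. f n = Comp C (ob A n) (ob B (n + 1)) (ob B n) (diff B (n + 1)) (h n)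
      \<oplus>\<^bsub>Hom C (ob A n) (ob B n)\<^esub> Comp C (ob A n) (ob A (n - 1)) (ob B n) (h (n - 1)) (diff A n)"
      and g: "is_chain_map C A B g" and k: "\<And>n. k n \<in> Mor C (ob A n) (ob B (n + 1))"
      "\<And>n. g n = Comp C (ob A n) (ob B (n + 1)) (ob B n) (diff B (n + 1)) (k n)
      \<oplus>\<^bsub>Hom C (ob A n) (ob B n)\<^esub> Comp C (ob A n) (ob A (n - 1)) (ob B n) (k (n - 1)) (diff A n)"
      by (elim null_homotopicE) blast
    note hs = homotopy_shift[of h A B, OF h(1)] and ks = homotopy_shift[of k A B, OF k(1)]
    show "f \<oplus>\<^bsub>Hom (Ch C) A B\<^esub> g \<in> null_homotopic C A B"
    proof (rule null_homotopicI[where h = "\<lambda>n. h n \<oplus>\<^bsub>Hom C (ob A n) (ob B (n + 1))\<^esub> k n"])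
      show "is_chain_map C A B (f \<oplus>\<^bsub>Hom (Ch C) A B\<^esub> g)" using H.M.a_closed[of f g] f g by simp
      show "h n \<oplus>\<^bsub>Hom C (ob A n) (ob B (n + 1))\<^esub> k n \<in> Mor C (ob A n) (ob B (n + 1))" for n
        using AD(1) BD(1) h(1) k(1) by simp
      fix n
      interpret Hn: abelian_group "Hom C (ob A n) (ob B n)" by (rule Hom_abelian[OF AD(1) BD(1)])
      show "(f \<oplus>\<^bsub>Hom (Ch C) A B\<^esub> g) n = Comp C (ob A n) (ob B (n + 1)) (ob B n) (diff B (n + 1)) (h n \<oplus>\<^bsub>Hom C (ob A n) (ob B (n + 1))\<^esub> k n)
        \<oplus>\<^bsub>Hom C (ob A n) (ob B n)\<^esub> Comp C (ob A n) (ob A (n - 1)) (ob B n) (h (n - 1) \<oplus>\<^bsub>Hom C (ob A (n - 1)) (ob B (n - 1 + 1))\<^esub> k (n - 1)) (diff A n)"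
        unfolding Ch_add h(2)[of n] k(2)[of n] using AD(1,2) BD(1) dB h(1) k(1) hs ks
        by (simp add: Comp_add_left Comp_add_right Hn.a_ac)
    qed
  next
    fix s f assume s: "s \<in> carrier S" and "f \<in> null_homotopic C A B"
    then obtain h where f: "is_chain_map C A B f" and h: "\<And>n. h n \<in> Mor C (ob A n) (ob B (n + 1))"
      "\<And>n. f n = Comp C (ob A n) (ob B (n + 1)) (ob B n) (diff B (n + 1)) (h n)
      \<oplus>\<^bsub>Hom C (ob A n) (ob B n)\<^esub> Comp C (ob A n) (ob A (n - 1)) (ob B n) (h (n - 1)) (diff A n)"
      by (elim null_homotopicE) blast
    note hs = homotopy_shift[of h A B, OF h(1)]
    show "s \<odot>\<^bsub>Hom (Ch C) A B\<^esub> f \<in> null_homotopic C A B"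
    proof (rule null_homotopicI[where h = "\<lambda>n. s \<odot>\<^bsub>Hom C (ob A n) (ob B (n + 1))\<^esub> h n"])
      show "is_chain_map C A B (s \<odot>\<^bsub>Hom (Ch C) A B\<^esub> f)" using H.smult_closed[of s f] s f by simp
      show "s \<odot>\<^bsub>Hom C (ob A n) (ob B (n + 1))\<^esub> h n \<in> Mor C (ob A n) (ob B (n + 1))" for n
        using AD(1) BD(1) h(1) s by simp
      fix n
      interpret Hn: smodule S "Hom C (ob A n) (ob B n)" by (rule Hom_smodule[OF AD(1) BD(1)])
      have "(s \<odot>\<^bsub>Hom (Ch C) A B\<^esub> f) n = s \<odot>\<^bsub>Hom C (ob A n) (ob B n)\<^esub> f n" by (simp add: Ch_simps)
      then show "(s \<odot>\<^bsub>Hom (Ch C) A B\<^esub> f) n = Comp C (ob A n) (ob B (n + 1)) (ob B n) (diff B (n + 1)) (s \<odot>\<^bsub>Hom C (ob A n) (ob B (n + 1))\<^esub> h n)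
        \<oplus>\<^bsub>Hom C (ob A n) (ob B n)\<^esub> Comp C (ob A n) (ob A (n - 1)) (ob B n) (s \<odot>\<^bsub>Hom C (ob A (n - 1)) (ob B (n - 1 + 1))\<^esub> h (n - 1)) (diff A n)"
        unfolding h(2)[of n] using AD(1,2) BD(1) dB h(1) hs s
        by (simp add: Comp_smult_left Comp_smult_right Hn.smult_r_distr)
    qed
  qed
qed

lemma null_homotopic_Comp:
  assumes A: "is_chain_complex C A" and B: "is_chain_complex C B" and D: "is_chain_complex C D"
  shows "f \<in> null_homotopic C A B \<Longrightarrow> is_chain_map C B D g \<Longrightarrow> Comp (Ch C) A B D g f \<in> null_homotopic C A D"
    and "is_chain_map C A B f \<Longrightarrow> g \<in> null_homotopic C B D \<Longrightarrow> Comp (Ch C) A B D g f \<in> null_homotopic C A D"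
proof -
  interpret Ch: S_category S "Ch C" by (rule Ch_S_category)
  note AD = chain_complexD[OF A] and BD = chain_complexD[OF B] and DD = chain_complexD[OF D]
    and dB = diff_Suc[OF B] and dD = diff_Suc[OF D]
  have comp: "is_chain_map C A D (Comp (Ch C) A B D g f)" if "is_chain_map C A B f" "is_chain_map C B D g" for f g
    using Ch.Comp_closed[of A B D g f] A B D that by simp
  {
    assume "f \<in> null_homotopic C A B" and g: "is_chain_map C B D g"
    then obtain h where f: "is_chain_map C A B f" and h: "\<And>n. h n \<in> Mor C (ob A n) (ob B (n + 1))"
      "\<And>n. f n = Comp C (ob A n) (ob B (n + 1)) (ob B n) (diff B (n + 1)) (h n)
      \<oplus>\<^bsub>Hom C (ob A n) (ob B n)\<^esub> Comp C (ob A n) (ob A (n - 1)) (ob B n) (h (n - 1)) (diff A n)"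
      by (elim null_homotopicE) blast
    note hs = homotopy_shift[of h A B, OF h(1)] and gD = chain_mapD[OF g]
    show "Comp (Ch C) A B D g f \<in> null_homotopic C A D"
    proof (rule null_homotopicI[OF comp[OF f g], where h = "\<lambda>n. Comp C (ob A n) (ob B (n + 1)) (ob D (n + 1)) (g (n + 1)) (h n)"])
      show "Comp C (ob A n) (ob B (n + 1)) (ob D (n + 1)) (g (n + 1)) (h n) \<in> Mor C (ob A n) (ob D (n + 1))" for n
        using AD(1) BD(1) DD(1) gD(1) h(1) by simp
      fix n
      have dg: "Comp C (ob B (n + 1)) (ob D (n + 1)) (ob D n) (diff D (n + 1)) (g (n + 1))
          = Comp C (ob B (n + 1)) (ob B n) (ob D n) (g n) (diff B (n + 1))" using gD(2)[of "n + 1"] by simp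
      show "Comp (Ch C) A B D g f n = Comp C (ob A n) (ob D (n + 1)) (ob D n) (diff D (n + 1)) (Comp C (ob A n) (ob B (n + 1)) (ob D (n + 1)) (g (n + 1)) (h n))
        \<oplus>\<^bsub>Hom C (ob A n) (ob D n)\<^esub> Comp C (ob A n) (ob A (n - 1)) (ob D n) (Comp C (ob A (n - 1)) (ob B (n - 1 + 1)) (ob D (n - 1 + 1)) (g (n - 1 + 1)) (h (n - 1))) (diff A n)"
        unfolding Ch_Comp h(2)[of n] using AD(1,2) BD(1) DD(1) dB dD h(1) hs gD(1)
        by (simp add: Comp_add_right Comp_assoc Comp_reassoc[OF dg])
    qed
  next
    assume f: "is_chain_map C A B f" and "g \<in> null_homotopic C B D"
    then obtain h where g: "is_chain_map C B D g" and h: "\<And>n. h n \<in> Mor C (ob B n) (ob D (n + 1))"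
      "\<And>n. g n = Comp C (ob B n) (ob D (n + 1)) (ob D n) (diff D (n + 1)) (h n)
      \<oplus>\<^bsub>Hom C (ob B n) (ob D n)\<^esub> Comp C (ob B n) (ob B (n - 1)) (ob D n) (h (n - 1)) (diff B n)"
      by (elim null_homotopicE) blast
    note hs = homotopy_shift[of h B D, OF h(1)] and fD = chain_mapD[OF f]
    show "Comp (Ch C) A B D g f \<in> null_homotopic C A D"
    proof (rule null_homotopicI[OF comp[OF f g], where h = "\<lambda>n. Comp C (ob A n) (ob B n) (ob D (n + 1)) (h n) (f n)"])
      show "Comp C (ob A n) (ob B n) (ob D (n + 1)) (h n) (f n) \<in> Mor C (ob A n) (ob D (n + 1))" for n
        using AD(1) BD(1) DD(1) fD(1) h(1) by simp
      fix n
      show "Comp (Ch C) A B D g f n = Comp C (ob A n) (ob D (n + 1)) (ob D n) (diff D (n + 1)) (Comp C (ob A n) (ob B n) (ob D (n + 1)) (h n) (f n))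
        \<oplus>\<^bsub>Hom C (ob A n) (ob D n)\<^esub> Comp C (ob A n) (ob A (n - 1)) (ob D n) (Comp C (ob A (n - 1)) (ob B (n - 1)) (ob D (n - 1 + 1)) (h (n - 1)) (f (n - 1))) (diff A n)"
        unfolding Ch_Comp h(2)[of n] using AD(1,2) BD(1,2) DD(1) dD h(1) hs fD(1)
        by (simp add: Comp_add_left Comp_assoc fD(2))
    qed
  }
qed

end

locale hom_classes = S_category S C
  for S :: "('a, 'r) ring_scheme" (structure) and C :: "('o, 'a, 'm) linear_category" +
  fixes A B :: "('o, 'm) chain_complex"
  assumes A: "is_chain_complex C A" and B: "is_chain_complex C B"
begin

sublocale H: smodule S "Hom (Ch C) A B"
  using S_category.Hom_smodule[OF Ch_S_category] A B by simp

abbreviation "N \<equiv> null_homotopic C A B"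
abbreviation "cls \<equiv> homotopy_class C A B"

sublocale N: abelian_subgroup N "Hom (Ch C) A B"
  by (rule abelian_subgroupI3[OF additive_subgroupI[OF submodule.axioms(1)[OF null_homotopic_submodule[OF A B]]]
        H.M.abelian_group_axioms])

lemma Ho_carrier: "F \<in> Mor (Ho C) A B \<longleftrightarrow> (\<exists>f. is_chain_map C A B f \<and> F = cls f)"
  unfolding Ho_def quot_module_def homotopy_class_def A_RCOSETS_def' by auto

lemma cls_eq_iff:
  assumes f: "is_chain_map C A B f" and g: "is_chain_map C A B g"
  shows "cls f = cls g \<longleftrightarrow> f \<ominus>\<^bsub>Hom (Ch C) A B\<^esub> g \<in> N"
proof -
  have "f \<in> cls g \<longleftrightarrow> f \<ominus>\<^bsub>Hom (Ch C) A B\<^esub> g \<in> N"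
    unfolding homotopy_class_def a_minus_def using N.a_rcos_module[of g f] f g by simp
  moreover have "f \<in> cls f" unfolding homotopy_class_def using N.a_rcos_self[of f] f by simp
  moreover have "f \<in> cls g \<Longrightarrow> cls f = cls g"
    unfolding homotopy_class_def using N.a_repr_independence'[of f g] g by simp
  ultimately show ?thesis by blast
qed

lemma cls_self: "is_chain_map C A B f \<Longrightarrow> f \<in> cls f"
  unfolding homotopy_class_def using N.a_rcos_self[of f] by simp

lemma cls_mem: "f \<in> cls g \<Longrightarrow> is_chain_map C A B g \<Longrightarrow> is_chain_map C A B f \<and> cls f = cls g"
  unfolding homotopy_class_def using N.a_repr_independence'[of f g] N.a_elemrcos_carrier[of g f] by simp

lemma cls_zero: "\<zero>\<^bsub>Hom (Ho C) A B\<^esub> = cls \<zero>\<^bsub>Hom (Ch C) A B\<^esub>"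
proof -
  have "cls \<zero>\<^bsub>Hom (Ch C) A B\<^esub> = N" unfolding homotopy_class_def using N.a_rcos_const[OF N.zero_closed] .
  then show ?thesis by (simp add: Ho_def quot_module_def)
qed

lemma cls_add: "is_chain_map C A B f \<Longrightarrow> is_chain_map C A B g \<Longrightarrow>
    cls f \<oplus>\<^bsub>Hom (Ho C) A B\<^esub> cls g = cls (f \<oplus>\<^bsub>Hom (Ch C) A B\<^esub> g)"
  unfolding homotopy_class_def using N.a_rcos_sum[of f g] by (simp add: Ho_def quot_module_def)

lemma cls_smult:
  assumes s: "s \<in> carrier S" and f: "is_chain_map C A B f"
  shows "s \<odot>\<^bsub>Hom (Ho C) A B\<^esub> cls f = cls (s \<odot>\<^bsub>Hom (Ch C) A B\<^esub> f)"
proof -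
  have "cls (s \<odot>\<^bsub>Hom (Ch C) A B\<^esub> g) = cls (s \<odot>\<^bsub>Hom (Ch C) A B\<^esub> f)" if g: "g \<in> cls f" for g
  proof -
    have gm: "is_chain_map C A B g" and "cls g = cls f" using cls_mem[OF g f] by auto
    then have "g \<ominus>\<^bsub>Hom (Ch C) A B\<^esub> f \<in> N" using cls_eq_iff f by blast
    then have "s \<odot>\<^bsub>Hom (Ch C) A B\<^esub> (g \<ominus>\<^bsub>Hom (Ch C) A B\<^esub> f) \<in> N"
      using H.submodule_smult[OF null_homotopic_submodule[OF A B] s] by blast
    moreover have "s \<odot>\<^bsub>Hom (Ch C) A B\<^esub> (g \<ominus>\<^bsub>Hom (Ch C) A B\<^esub> f) = s \<odot>\<^bsub>Hom (Ch C) A B\<^esub> g \<ominus>\<^bsub>Hom (Ch C) A B\<^esub> s \<odot>\<^bsub>Hom (Ch C) A B\<^esub> f"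
      using H.smult_r_distr[OF s, of g "\<ominus>\<^bsub>Hom (Ch C) A B\<^esub> f"] H.smult_r_minus[OF s, of f] H.M.a_inv_closed[of f] f gm
      by (simp add: a_minus_def)
    ultimately show ?thesis using cls_eq_iff H.smult_closed[OF s, of f] H.smult_closed[OF s, of g] f gm by simp
  qed
  then have "(\<Union>g\<in>cls f. cls (s \<odot>\<^bsub>Hom (Ch C) A B\<^esub> g)) = cls (s \<odot>\<^bsub>Hom (Ch C) A B\<^esub> f)"
    using cls_self[OF f] by blast
  then show ?thesis by (simp add: Ho_def quot_module_def homotopy_class_def)
qed

end

context S_category
begin

lemma hom_classes: "is_chain_complex C A \<Longrightarrow> is_chain_complex C B \<Longrightarrow> hom_classes S C A B"
  by (intro hom_classes.intro hom_classes_axioms.intro S_category_axioms)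

lemma Ho_Obj [simp]: "A \<in> Obj (Ho C) \<longleftrightarrow> is_chain_complex C A"
  by (simp add: Ho_def)

lemma Ho_Ident: "Ident (Ho C) A = homotopy_class C A A (Ident (Ch C) A)"
  by (simp add: Ho_def homotopy_class_def)

lemma Ho_Comp:
  assumes A: "is_chain_complex C A" and B: "is_chain_complex C B" and D: "is_chain_complex C D"
    and f: "is_chain_map C A B f" and g: "is_chain_map C B D g"
  shows "Comp (Ho C) A B D (homotopy_class C B D g) (homotopy_class C A B f) = homotopy_class C A D (Comp (Ch C) A B D g f)"
proof -
  interpret Ch: S_category S "Ch C" by (rule Ch_S_category)
  interpret AB: hom_classes S C A B by (rule hom_classes[OF A B])
  interpret BD: hom_classes S C B D by (rule hom_classes[OF B D])
  interpret AD: hom_classes S C A D by (rule hom_classes[OF A D])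
  note O = A B D
  have comp: "is_chain_map C A D (Comp (Ch C) A B D g f)" if "is_chain_map C A B f" "is_chain_map C B D g" for f g
    using Ch.Comp_closed[of A B D g f] A B D that by simp
  have "AD.cls (Comp (Ch C) A B D g' f') = AD.cls (Comp (Ch C) A B D g f)" if "g' \<in> BD.cls g" "f' \<in> AB.cls f" for g' f'
  proof -
    have g': "is_chain_map C B D g'" "BD.cls g' = BD.cls g" and f': "is_chain_map C A B f'" "AB.cls f' = AB.cls f"
      using AB.cls_mem[OF that(2) f] BD.cls_mem[OF that(1) g] by auto
    have ng: "g' \<ominus>\<^bsub>Hom (Ch C) B D\<^esub> g \<in> BD.N" and nf: "f' \<ominus>\<^bsub>Hom (Ch C) A B\<^esub> f \<in> AB.N"
      using AB.cls_eq_iff[OF f'(1) f] BD.cls_eq_iff[OF g'(1) g] f'(2) g'(2) by auto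
    have "Comp (Ch C) A B D (g' \<ominus>\<^bsub>Hom (Ch C) B D\<^esub> g) f' \<in> AD.N" "Comp (Ch C) A B D g (f' \<ominus>\<^bsub>Hom (Ch C) A B\<^esub> f) \<in> AD.N"
      using null_homotopic_Comp[OF O] ng nf f' g by blast+
    then have "Comp (Ch C) A B D g' f' \<ominus>\<^bsub>Hom (Ch C) A D\<^esub> Comp (Ch C) A B D g f' \<in> AD.N"
      "Comp (Ch C) A B D g f' \<ominus>\<^bsub>Hom (Ch C) A D\<^esub> Comp (Ch C) A B D g f \<in> AD.N"
      using Ch.Comp_minus_left[of A B D g' g f'] Ch.Comp_minus_right[of A B D g f' f] O f f' g g' by simp_all
    then show ?thesis using AD.cls_eq_iff comp f f' g g' by metis
  qed
  then have "(\<Union>g'\<in>BD.cls g. \<Union>f'\<in>AB.cls f. AD.cls (Comp (Ch C) A B D g' f')) = AD.cls (Comp (Ch C) A B D g f)"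
    using AB.cls_self[OF f] BD.cls_self[OF g] by blast
  then show ?thesis by (simp add: Ho_def homotopy_class_def)
qed

lemma Ho_MorE:
  assumes "F \<in> Mor (Ho C) A B" "is_chain_complex C A" "is_chain_complex C B"
  obtains f where "is_chain_map C A B f" "F = homotopy_class C A B f"
  using hom_classes.Ho_carrier[OF hom_classes[OF assms(2,3)]] assms(1) by blast

lemma Ho_MorI: "is_chain_complex C A \<Longrightarrow> is_chain_complex C B \<Longrightarrow> is_chain_map C A B f \<Longrightarrow> homotopy_class C A B f \<in> Mor (Ho C) A B"
  using hom_classes.Ho_carrier[OF hom_classes] by blast

lemma Ho_S_category: "S_category S (Ho C)"
proof -
  interpret Ch: S_category S "Ch C" by (rule Ch_S_category)
  note add = hom_classes.cls_add[OF hom_classes] and smult = hom_classes.cls_smult[OF hom_classes]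
    and zero = hom_classes.cls_zero[OF hom_classes]
  have addm: "is_chain_map C A B (f \<oplus>\<^bsub>Hom (Ch C) A B\<^esub> g)"
    if "is_chain_complex C A" "is_chain_complex C B" "is_chain_map C A B f" "is_chain_map C A B g" for A B f g
    using Ch.Hom_add[of A B f g] that by simp
  have smultm: "is_chain_map C A B (s \<odot>\<^bsub>Hom (Ch C) A B\<^esub> f)"
    if "is_chain_complex C A" "is_chain_complex C B" "s \<in> carrier S" "is_chain_map C A B f" for A B s f
    using Ch.Hom_smult[of A B s f] that by simp
  have compm: "is_chain_map C A D (Comp (Ch C) A B D g f)"
    if "is_chain_complex C A" "is_chain_complex C B" "is_chain_complex C D" "is_chain_map C A B f" "is_chain_map C B D g" for A B D g f
    using Ch.Comp_closed[of A B D g f] that by simp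
  have identm: "is_chain_map C A A (Ident (Ch C) A)" if "is_chain_complex C A" for A
    using Ch.Ident_closed[of A] that by simp
  show ?thesis
  proof (intro S_category.intro S_category_axioms.intro)
    show "cring S" by (rule is_cring)
  next
    fix A B assume "A \<in> Obj (Ho C)" "B \<in> Obj (Ho C)"
    then have A: "is_chain_complex C A" and B: "is_chain_complex C B" by simp_all
    interpret H: smodule S "Hom (Ch C) A B" using A B by (intro Ch.Hom_smodule) simp_all
    have zm: "is_chain_map C A B \<zero>\<^bsub>Hom (Ch C) A B\<^esub>" using H.M.zero_closed by simp
    have ab: "abelian_group (Hom (Ho C) A B)"
    proof (rule abelian_groupI)
      show "\<zero>\<^bsub>Hom (Ho C) A B\<^esub> \<in> Mor (Ho C) A B" unfolding zero[OF A B] by (rule Ho_MorI[OF A B zm])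
    next
      fix F G assume F: "F \<in> Mor (Ho C) A B" and G: "G \<in> Mor (Ho C) A B"
      obtain f where f: "is_chain_map C A B f" "F = homotopy_class C A B f" by (rule Ho_MorE[OF F A B])
      obtain g where g: "is_chain_map C A B g" "G = homotopy_class C A B g" by (rule Ho_MorE[OF G A B])
      show "F \<oplus>\<^bsub>Hom (Ho C) A B\<^esub> G \<in> Mor (Ho C) A B"
        unfolding f g add[OF A B f(1) g(1)] by (rule Ho_MorI[OF A B addm[OF A B f(1) g(1)]])
      show "F \<oplus>\<^bsub>Hom (Ho C) A B\<^esub> G = G \<oplus>\<^bsub>Hom (Ho C) A B\<^esub> F"
        unfolding f g add[OF A B f(1) g(1)] add[OF A B g(1) f(1)] using H.M.a_comm[of f g] f g by simp
      show "\<zero>\<^bsub>Hom (Ho C) A B\<^esub> \<oplus>\<^bsub>Hom (Ho C) A B\<^esub> F = F"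
        unfolding zero[OF A B] f add[OF A B zm f(1)] using H.M.l_zero[of f] f by simp
      have nm: "is_chain_map C A B (\<ominus>\<^bsub>Hom (Ch C) A B\<^esub> f)" using H.M.a_inv_closed[of f] f by simp
      show "\<exists>Y\<in>Mor (Ho C) A B. Y \<oplus>\<^bsub>Hom (Ho C) A B\<^esub> F = \<zero>\<^bsub>Hom (Ho C) A B\<^esub>"
      proof (rule bexI[OF _ Ho_MorI[OF A B nm]])
        show "homotopy_class C A B (\<ominus>\<^bsub>Hom (Ch C) A B\<^esub> f) \<oplus>\<^bsub>Hom (Ho C) A B\<^esub> F = \<zero>\<^bsub>Hom (Ho C) A B\<^esub>"
          unfolding zero[OF A B] f add[OF A B nm f(1)] using H.M.l_neg[of f] f by simp
      qed
      fix K assume K: "K \<in> Mor (Ho C) A B"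
      obtain k where k: "is_chain_map C A B k" "K = homotopy_class C A B k" by (rule Ho_MorE[OF K A B])
      show "F \<oplus>\<^bsub>Hom (Ho C) A B\<^esub> G \<oplus>\<^bsub>Hom (Ho C) A B\<^esub> K = F \<oplus>\<^bsub>Hom (Ho C) A B\<^esub> (G \<oplus>\<^bsub>Hom (Ho C) A B\<^esub> K)"
        unfolding f g k using add[OF A B] addm[OF A B] H.M.a_assoc[of f g k] f g k by simp
    qed
    show "Module.module S (Hom (Ho C) A B)"
    proof (rule moduleI[OF is_cring ab])
      fix s t F G assume s: "s \<in> carrier S" and F: "F \<in> Mor (Ho C) A B"
      obtain f where f: "is_chain_map C A B f" "F = homotopy_class C A B f" by (rule Ho_MorE[OF F A B])
      show "s \<odot>\<^bsub>Hom (Ho C) A B\<^esub> F \<in> Mor (Ho C) A B"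
        unfolding f smult[OF A B s f(1)] by (rule Ho_MorI[OF A B smultm[OF A B s f(1)]])
      show "(s \<oplus> t) \<odot>\<^bsub>Hom (Ho C) A B\<^esub> F = s \<odot>\<^bsub>Hom (Ho C) A B\<^esub> F \<oplus>\<^bsub>Hom (Ho C) A B\<^esub> t \<odot>\<^bsub>Hom (Ho C) A B\<^esub> F"
        "(s \<otimes> t) \<odot>\<^bsub>Hom (Ho C) A B\<^esub> F = s \<odot>\<^bsub>Hom (Ho C) A B\<^esub> (t \<odot>\<^bsub>Hom (Ho C) A B\<^esub> F)" if t: "t \<in> carrier S"
        unfolding f using s t f(1) smult[OF A B] smultm[OF A B] add[OF A B] H.smult_l_distr[of s t f] H.smult_assoc1[of s t f]
        by simp_all
      show "s \<odot>\<^bsub>Hom (Ho C) A B\<^esub> (F \<oplus>\<^bsub>Hom (Ho C) A B\<^esub> G) = s \<odot>\<^bsub>Hom (Ho C) A B\<^esub> F \<oplus>\<^bsub>Hom (Ho C) A B\<^esub> s \<odot>\<^bsub>Hom (Ho C) A B\<^esub> G"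
        if G: "G \<in> Mor (Ho C) A B"
      proof -
        obtain g where g: "is_chain_map C A B g" "G = homotopy_class C A B g" by (rule Ho_MorE[OF G A B])
        show ?thesis unfolding f g
          using s f(1) g(1) smult[OF A B] smultm[OF A B] add[OF A B] addm[OF A B] H.smult_r_distr[of s f g] by simp
      qed
    next
      fix F assume F: "F \<in> Mor (Ho C) A B"
      obtain f where f: "is_chain_map C A B f" "F = homotopy_class C A B f" by (rule Ho_MorE[OF F A B])
      show "\<one> \<odot>\<^bsub>Hom (Ho C) A B\<^esub> F = F" unfolding f using smult[OF A B one_closed f(1)] H.smult_one[of f] f by simp
    qed
  next
    fix A assume "A \<in> Obj (Ho C)"
    then show "Ident (Ho C) A \<in> Mor (Ho C) A A" unfolding Ho_Ident by (intro Ho_MorI identm) auto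
  next
    fix A B D G F assume "A \<in> Obj (Ho C)" "B \<in> Obj (Ho C)" "D \<in> Obj (Ho C)"
      and G: "G \<in> Mor (Ho C) B D" and F: "F \<in> Mor (Ho C) A B"
    then have O: "is_chain_complex C A" "is_chain_complex C B" "is_chain_complex C D" by simp_all
    obtain f where f: "is_chain_map C A B f" "F = homotopy_class C A B f" by (rule Ho_MorE[OF F O(1,2)])
    obtain g where g: "is_chain_map C B D g" "G = homotopy_class C B D g" by (rule Ho_MorE[OF G O(2,3)])
    show "Comp (Ho C) A B D G F \<in> Mor (Ho C) A D"
      unfolding f g Ho_Comp[OF O f(1) g(1)] by (rule Ho_MorI[OF O(1,3) compm[OF O f(1) g(1)]])
    show "Comp (Ho C) A B D (s \<odot>\<^bsub>Hom (Ho C) B D\<^esub> G) F = s \<odot>\<^bsub>Hom (Ho C) A D\<^esub> Comp (Ho C) A B D G F"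
      "Comp (Ho C) A B D G (s \<odot>\<^bsub>Hom (Ho C) A B\<^esub> F) = s \<odot>\<^bsub>Hom (Ho C) A D\<^esub> Comp (Ho C) A B D G F"
      if s: "s \<in> carrier S" for s
      unfolding f g using s O f(1) g(1) smult smultm compm Ho_Comp
        Ch.Comp_smult_left[of A B D s g f] Ch.Comp_smult_right[of A B D s g f] by simp_all
    show "Comp (Ho C) A B D (G \<oplus>\<^bsub>Hom (Ho C) B D\<^esub> G') F = Comp (Ho C) A B D G F \<oplus>\<^bsub>Hom (Ho C) A D\<^esub> Comp (Ho C) A B D G' F"
      if G': "G' \<in> Mor (Ho C) B D" for G'
    proof -
      obtain g' where g': "is_chain_map C B D g'" "G' = homotopy_class C B D g'" by (rule Ho_MorE[OF G' O(2,3)])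
      show ?thesis unfolding f g g' using O f(1) g(1) g'(1) add addm compm Ho_Comp Ch.Comp_add_left[of A B D g g' f] by simp
    qed
    show "Comp (Ho C) A B D G (F \<oplus>\<^bsub>Hom (Ho C) A B\<^esub> F') = Comp (Ho C) A B D G F \<oplus>\<^bsub>Hom (Ho C) A D\<^esub> Comp (Ho C) A B D G F'"
      if F': "F' \<in> Mor (Ho C) A B" for F'
    proof -
      obtain f' where f': "is_chain_map C A B f'" "F' = homotopy_class C A B f'" by (rule Ho_MorE[OF F' O(1,2)])
      show ?thesis unfolding f g f' using O f(1) g(1) f'(1) add addm compm Ho_Comp Ch.Comp_add_right[of A B D g f f'] by simp
    qed
    show "Comp (Ho C) A B E (Comp (Ho C) B D E K G) F = Comp (Ho C) A D E K (Comp (Ho C) A B D G F)"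
      if "E \<in> Obj (Ho C)" and K: "K \<in> Mor (Ho C) D E" for E K
    proof -
      have E: "is_chain_complex C E" using that by simp
      obtain k where k: "is_chain_map C D E k" "K = homotopy_class C D E k" by (rule Ho_MorE[OF K O(3) E])
      show ?thesis unfolding f g k using O E f(1) g(1) k(1) compm Ho_Comp Ch.Comp_assoc[of A B D E k g f] by simp
    qed
  next
    fix A B F assume "A \<in> Obj (Ho C)" "B \<in> Obj (Ho C)" and F: "F \<in> Mor (Ho C) A B"
    then have O: "is_chain_complex C A" "is_chain_complex C B" by simp_all
    obtain f where f: "is_chain_map C A B f" "F = homotopy_class C A B f" by (rule Ho_MorE[OF F O])
    show "Comp (Ho C) A B B (Ident (Ho C) B) F = F" "Comp (Ho C) A A B F (Ident (Ho C) A) = F"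
      unfolding f Ho_Ident using O f(1) identm Ho_Comp Ch.Comp_Ident_left[of A B f] Ch.Comp_Ident_right[of A B f] by simp_all
  qed
qed

end

context S_category
begin

lemma invertible_cancel_right:
  assumes "X \<in> Obj C" "Y \<in> Obj C" "Z \<in> Obj C" "g \<in> Mor C Y Z" "invertible C X Y f" "invertible C X Z (Comp C X Y Z g f)"
  shows "invertible C Y Z g"
proof -
  obtain f' where f: "f \<in> Mor C X Y" "f' \<in> Mor C Y X" "Comp C Y X Y f f' = Ident C Y" "invertible C Y X f'"
    using assms(5) by (rule invertibleE)
  have "invertible C Y Z (Comp C Y X Z (Comp C X Y Z g f) f')"
    by (rule invertible_Comp[OF assms(2,1,3) assms(6) f(4)])
  then show ?thesis using assms(1-4) f by (simp add: Comp_assoc)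
qed

lemma is_chain_map_simps [simp]:
  "is_chain_complex C A \<Longrightarrow> is_chain_map C A A (Ident (Ch C) A)"
  "is_chain_complex C A \<Longrightarrow> is_chain_complex C B \<Longrightarrow> is_chain_map C A B \<zero>\<^bsub>Hom (Ch C) A B\<^esub>"
  "is_chain_complex C A \<Longrightarrow> is_chain_complex C B \<Longrightarrow> is_chain_complex C D \<Longrightarrow> is_chain_map C A B f \<Longrightarrow> is_chain_map C B D g
    \<Longrightarrow> is_chain_map C A D (Comp (Ch C) A B D g f)"
  "is_chain_complex C A \<Longrightarrow> is_chain_complex C B \<Longrightarrow> is_chain_map C A B f \<Longrightarrow> is_chain_map C A B f'
    \<Longrightarrow> is_chain_map C A B (f \<oplus>\<^bsub>Hom (Ch C) A B\<^esub> f')"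
  "is_chain_complex C A \<Longrightarrow> is_chain_complex C B \<Longrightarrow> is_chain_map C A B f \<Longrightarrow> is_chain_map C A B f'
    \<Longrightarrow> is_chain_map C A B (f \<ominus>\<^bsub>Hom (Ch C) A B\<^esub> f')"
  using S_category.Ident_closed[OF Ch_S_category, of A] S_category.Comp_closed[OF Ch_S_category, of A B D g f]
    S_category.Hom_zero[OF Ch_S_category, of A B] S_category.Hom_add[OF Ch_S_category, of A B f f']
    S_category.Hom_minus[OF Ch_S_category, of A B f f']
  by simp_all

lemma Ho_zero: "is_chain_complex C A \<Longrightarrow> is_chain_complex C B \<Longrightarrow>
    homotopy_class C A B \<zero>\<^bsub>Hom (Ch C) A B\<^esub> = \<zero>\<^bsub>Hom (Ho C) A B\<^esub>"
  using hom_classes.cls_zero[OF hom_classes] by metis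

lemma homotopy_class_eq_iff: "is_chain_complex C A \<Longrightarrow> is_chain_complex C B \<Longrightarrow> is_chain_map C A B f \<Longrightarrow> is_chain_map C A B g
    \<Longrightarrow> homotopy_class C A B f = homotopy_class C A B g \<longleftrightarrow> f \<ominus>\<^bsub>Hom (Ch C) A B\<^esub> g \<in> null_homotopic C A B"
  by (rule hom_classes.cls_eq_iff[OF hom_classes])

lemma Ho_add: "is_chain_complex C A \<Longrightarrow> is_chain_complex C B \<Longrightarrow> is_chain_map C A B f \<Longrightarrow> is_chain_map C A B g \<Longrightarrow>
    homotopy_class C A B f \<oplus>\<^bsub>Hom (Ho C) A B\<^esub> homotopy_class C A B g = homotopy_class C A B (f \<oplus>\<^bsub>Hom (Ch C) A B\<^esub> g)"
  by (rule hom_classes.cls_add[OF hom_classes])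

lemma Ho_minus:
  assumes A: "is_chain_complex C A" and B: "is_chain_complex C B" and f: "is_chain_map C A B f" and g: "is_chain_map C A B g"
  shows "homotopy_class C A B f \<ominus>\<^bsub>Hom (Ho C) A B\<^esub> homotopy_class C A B g = homotopy_class C A B (f \<ominus>\<^bsub>Hom (Ch C) A B\<^esub> g)"
proof -
  interpret H: smodule S "Hom (Ch C) A B" using S_category.Hom_smodule[OF Ch_S_category, of A B] A B by simp
  interpret K: smodule S "Hom (Ho C) A B" using S_category.Hom_smodule[OF Ho_S_category, of A B] A B by simp
  have "(f \<ominus>\<^bsub>Hom (Ch C) A B\<^esub> g) \<oplus>\<^bsub>Hom (Ch C) A B\<^esub> g = f"
    using H.M.a_assoc[of f "\<ominus>\<^bsub>Hom (Ch C) A B\<^esub> g" g] H.M.a_inv_closed[of g] H.M.l_neg[of g] H.M.r_zero[of f] f g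
    by (simp add: a_minus_def)
  then have "homotopy_class C A B (f \<ominus>\<^bsub>Hom (Ch C) A B\<^esub> g) \<oplus>\<^bsub>Hom (Ho C) A B\<^esub> homotopy_class C A B g = homotopy_class C A B f"
    using A B f g by (simp add: Ho_add)
  moreover have "homotopy_class C A B (f \<ominus>\<^bsub>Hom (Ch C) A B\<^esub> g) \<in> Mor (Ho C) A B" by (rule Ho_MorI) (use A B f g in simp_all)
  moreover have "y \<ominus>\<^bsub>Hom (Ho C) A B\<^esub> z = x" if "x \<oplus>\<^bsub>Hom (Ho C) A B\<^esub> z = y" "x \<in> Mor (Ho C) A B" "z \<in> Mor (Ho C) A B" for x y z
    using that K.M.a_assoc[of x z "\<ominus>\<^bsub>Hom (Ho C) A B\<^esub> z"] K.M.r_neg[of z] by (auto simp: a_minus_def)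
  ultimately show ?thesis using Ho_MorI[OF A B] A B f g by blast
qed

lemma Ho_biproduct:
  assumes "biproduct (Ch C) X Y A i j p q"
  shows "biproduct (Ho C) X Y A (homotopy_class C X A i) (homotopy_class C Y A j) (homotopy_class C A X p) (homotopy_class C A Y q)"
  using S_category.biproductD[OF Ch_S_category assms]
  unfolding biproduct_def by (simp add: Ho_MorI Ho_Comp Ho_Ident Ho_add Ho_zero)

lemma Ho_invertible:
  assumes A: "is_chain_complex C A" and B: "is_chain_complex C B" and "invertible (Ch C) A B f"
  shows "invertible (Ho C) A B (homotopy_class C A B f)"
proof -
  obtain g where "is_chain_map C A B f" "is_chain_map C B A g" "Comp (Ch C) A B A g f = Ident (Ch C) A"
    "Comp (Ch C) B A B f g = Ident (Ch C) B"
    using assms(3) unfolding invertible_def by auto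
  then show ?thesis unfolding invertible_def
    using A B by (auto intro!: bexI[of _ "homotopy_class C B A g"] simp: Ho_MorI Ho_Comp Ho_Ident)
qed

lemma Ho_zero_object: "zero_object (Ho C) X \<longleftrightarrow> is_chain_complex C X \<and> Ident (Ho C) X = \<zero>\<^bsub>Hom (Ho C) X X\<^esub>"
  by (simp add: zero_object_def)

lemma zero_object_Mor:
  assumes "zero_object C Z" "X \<in> Obj C"
  shows "f \<in> Mor C X Z \<Longrightarrow> f = \<zero>\<^bsub>Hom C X Z\<^esub>" "f \<in> Mor C Z X \<Longrightarrow> f = \<zero>\<^bsub>Hom C Z X\<^esub>"
  using Comp_Ident_left[of X Z f] Comp_Ident_right[of Z X f] assms unfolding zero_object_def by auto

end

context complete_locally_finite
begin

sublocale Ho: additive_category S "Ho C"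
proof (intro additive_category.intro Ho_S_category additive_category_axioms.intro)
  show "\<exists>Z. zero_object (Ho C) Z"
  proof -
    obtain Z where "zero_object (Ch C) Z" using Ch.zero_object_ex ..
    then have "zero_object (Ho C) Z" unfolding zero_object_def by (simp add: Ho_Ident Ho_zero)
    then show ?thesis ..
  qed
  show "\<exists>A i j p q. biproduct (Ho C) X Y A i j p q" if "X \<in> Obj (Ho C)" "Y \<in> Obj (Ho C)" for X Y
    using Ch.biproduct_ex[of X Y] Ho_biproduct that by (metis Ch_Obj Ho_Obj)
qed

text \<open>An object is zero in \<open>Ho C\<close> if and only if it is contractible. Null-homotopic endomorphisms of a
  local complex that is not contractible are not invertible, so units can be tested up to homotopy.\<close>

lemma Ho_invertible_local_iff:
  assumes X: "is_chain_complex C X" and loc: "local_ring (End (Ch C) X)" and nz: "\<not> zero_object (Ho C) X"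
    and a: "is_chain_map C X X a"
  shows "invertible (Ho C) X X (homotopy_class C X X a) \<longleftrightarrow> invertible (Ch C) X X a"
proof
  assume "invertible (Ho C) X X (homotopy_class C X X a)"
  then obtain b' where b': "b' \<in> Mor (Ho C) X X" "Comp (Ho C) X X X b' (homotopy_class C X X a) = Ident (Ho C) X"
    by (rule Ho.invertibleE)
  obtain b where b: "is_chain_map C X X b" "b' = homotopy_class C X X b" by (rule Ho_MorE[OF b'(1) X X])
  interpret E: ring "End (Ch C) X" using X by (intro Ch.End_ring) simp
  let ?d = "Ident (Ch C) X \<ominus>\<^bsub>Hom (Ch C) X X\<^esub> Comp (Ch C) X X X b a"
  have "homotopy_class C X X ?d = \<zero>\<^bsub>Hom (Ho C) X X\<^esub>"
    using b'(2) X a b Ho.minus_self[of X X "Ident (Ho C) X"]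
    by (simp add: Ho_Comp Ho_minus[symmetric] Ho_Ident[symmetric])
  moreover have "\<not> invertible (Ho C) X X \<zero>\<^bsub>Hom (Ho C) X X\<^esub>"
    using nz X unfolding invertible_def Ho_zero_object by auto
  ultimately have "\<not> invertible (Ch C) X X ?d" using Ho_invertible[OF X X] by metis
  moreover have "Comp (Ch C) X X X b a \<oplus>\<^bsub>End (Ch C) X\<^esub> ?d = \<one>\<^bsub>End (Ch C) X\<^esub>"
    using smodule.add_diff_cancel[OF smodule.intro[OF Ch.End_module], of X "Comp (Ch C) X X X b a" "Ident (Ch C) X"] X a b by simp
  ultimately have "invertible (Ch C) X X (Comp (Ch C) X X X b a)"
    using E.local_ring_add_unit[OF loc, of "Comp (Ch C) X X X b a" ?d] E.Units_one_closed X a b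
    by (simp add: Ch.Units_End_iff[symmetric])
  then show "invertible (Ch C) X X a"
    using Ch.retract_of_local_unit(1)[of X X a b] Ch.local_End_nonzero[OF _ loc] loc X a b by simp
qed (rule Ho_invertible[OF X X])

lemma Ho_local:
  assumes X: "is_chain_complex C X" and loc: "local_ring (End (Ch C) X)" and nz: "\<not> zero_object (Ho C) X"
  shows "local_ring (End (Ho C) X)"
proof -
  interpret K: ring "End (Ho C) X" using X by (intro Ho.End_ring) simp
  interpret E: ring "End (Ch C) X" using X by (intro Ch.End_ring) simp
  show ?thesis
  proof (rule K.local_ringI)
    show "\<one>\<^bsub>End (Ho C) X\<^esub> \<noteq> \<zero>\<^bsub>End (Ho C) X\<^esub>" using nz X by (simp add: Ho_zero_object)
    fix a' assume "a' \<in> carrier (End (Ho C) X)"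
    then have "a' \<in> Mor (Ho C) X X" by simp
    then obtain a where a: "is_chain_map C X X a" "a' = homotopy_class C X X a" by (rule Ho_MorE[OF _ X X])
    let ?d = "Ident (Ch C) X \<ominus>\<^bsub>Hom (Ch C) X X\<^esub> a"
    have "a \<oplus>\<^bsub>End (Ch C) X\<^esub> ?d = \<one>\<^bsub>End (Ch C) X\<^esub>"
      using smodule.add_diff_cancel[OF smodule.intro[OF Ch.End_module], of X a "Ident (Ch C) X"] X a by simp
    then have "invertible (Ch C) X X a \<or> invertible (Ch C) X X ?d"
      using E.local_ring_add_unit[OF loc, of a ?d] E.Units_one_closed X a by (simp add: Ch.Units_End_iff[symmetric])
    then show "a' \<in> Units (End (Ho C) X) \<or> \<one>\<^bsub>End (Ho C) X\<^esub> \<ominus>\<^bsub>End (Ho C) X\<^esub> a' \<in> Units (End (Ho C) X)"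
      using Ho_invertible[OF X X] X a by (auto simp: Ho.Units_End_iff Ho_Ident Ho_minus)
  qed
qed

end

context locally_finite_sum
begin

lemma null_homotopic_if_components:
  assumes B: "is_chain_complex C B" and f: "is_chain_map C A B f"
    and null: "\<And>i. i \<in> I \<Longrightarrow> Comp (Ch C) (X i) A B f (\<iota> i) \<in> null_homotopic C (X i) B"
  shows "f \<in> null_homotopic C A B"
proof -
  note AD = chain_complexD[OF A] and BD = chain_complexD[OF B] and dB = diff_Suc[OF B]
  have XD: "ob (X i) n \<in> Obj C" "diff (X i) n \<in> Mor C (ob (X i) n) (ob (X i) (n - 1))"
    "\<iota> i n \<in> Mor C (ob (X i) n) (ob A n)" if "i \<in> I" for i n
    using X[OF that] \<iota>[OF that] by (simp_all add: chain_complexD(1,2) chain_mapD(1))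
  have "\<exists>h. (\<forall>n. h n \<in> Mor C (ob (X i) n) (ob B (n + 1))) \<and>
    (\<forall>n. Comp C (ob (X i) n) (ob A n) (ob B n) (f n) (\<iota> i n) = Comp C (ob (X i) n) (ob B (n + 1)) (ob B n) (diff B (n + 1)) (h n)
      \<oplus>\<^bsub>Hom C (ob (X i) n) (ob B n)\<^esub> Comp C (ob (X i) n) (ob (X i) (n - 1)) (ob B n) (h (n - 1)) (diff (X i) n))" if "i \<in> I" for i
    using null[OF that] unfolding null_homotopic_def Ch_Comp by blast
  then obtain h where h: "\<And>i n. i \<in> I \<Longrightarrow> h i n \<in> Mor C (ob (X i) n) (ob B (n + 1))"
    "\<And>i n. i \<in> I \<Longrightarrow> Comp C (ob (X i) n) (ob A n) (ob B n) (f n) (\<iota> i n) = Comp C (ob (X i) n) (ob B (n + 1)) (ob B n) (diff B (n + 1)) (h i n)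
      \<oplus>\<^bsub>Hom C (ob (X i) n) (ob B n)\<^esub> Comp C (ob (X i) n) (ob (X i) (n - 1)) (ob B n) (h i (n - 1)) (diff (X i) n)"
    by metis
  have "\<exists>s. s \<in> Mor C (ob A n) (ob B (n + 1)) \<and> (\<forall>i\<in>I. Comp C (ob (X i) n) (ob A n) (ob B (n + 1)) s (\<iota> i n) = h i n)" for n
    using direct_sum_ex1[OF degreewise_direct_sum[of n] BD(1)[of "n + 1"], of "\<lambda>i. h i n"] h(1) by blast
  then obtain s where s: "\<And>n. s n \<in> Mor C (ob A n) (ob B (n + 1))"
    "\<And>n i. i \<in> I \<Longrightarrow> Comp C (ob (X i) n) (ob A n) (ob B (n + 1)) (s n) (\<iota> i n) = h i n" by metis
  have s': "s (n - 1) \<in> Mor C (ob A (n - 1)) (ob B n)" for n by (rule homotopy_shift[OF s(1)])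
  have si: "Comp C (ob (X i) (n - 1)) (ob A (n - 1)) (ob B n) (s (n - 1)) (\<iota> i (n - 1)) = h i (n - 1)" if "i \<in> I" for i n
    using s(2)[OF that, of "n - 1"] by simp
  show ?thesis
  proof (rule null_homotopicI[OF f s(1)])
    fix n
    show "f n = Comp C (ob A n) (ob B (n + 1)) (ob B n) (diff B (n + 1)) (s n)
      \<oplus>\<^bsub>Hom C (ob A n) (ob B n)\<^esub> Comp C (ob A n) (ob A (n - 1)) (ob B n) (s (n - 1)) (diff A n)" (is "_ = ?r")
    proof (rule direct_sum_eqI[OF degreewise_direct_sum BD(1) chain_mapD(1)[OF f]])
      show "?r \<in> Mor C (ob A n) (ob B n)" using AD(1,2) BD(1) dB s(1) s' by simp
      fix i assume i: "i \<in> I"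
      have "Comp C (ob (X i) n) (ob A n) (ob B n) (Comp C (ob A n) (ob A (n - 1)) (ob B n) (s (n - 1)) (diff A n)) (\<iota> i n)
        = Comp C (ob (X i) n) (ob (X i) (n - 1)) (ob B n) (h i (n - 1)) (diff (X i) n)"
        using AD(1,2) BD(1) s' XD[OF i] by (simp add: Comp_assoc chain_mapD(2)[OF \<iota>[OF i]] Comp_reassoc[OF si[OF i]])
      then show "Comp C (ob (X i) n) (ob A n) (ob B n) (f n) (\<iota> i n) = Comp C (ob (X i) n) (ob A n) (ob B n) ?r (\<iota> i n)"
        unfolding h(2)[OF i] using AD(1,2) BD(1) dB s(1) s' XD[OF i] by (simp add: Comp_add_left Comp_assoc s(2)[OF i])
    qed
  qed
qed

definition "I\<^sub>H = {i \<in> I. \<not> zero_object (Ho C) (X i)}"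

lemma homotopy_class_eqI:
  assumes B: "is_chain_complex C B" and f: "is_chain_map C A B f" and g: "is_chain_map C A B g"
    and eq: "\<And>i. i \<in> I\<^sub>H \<Longrightarrow> homotopy_class C (X i) B (Comp (Ch C) (X i) A B f (\<iota> i)) = homotopy_class C (X i) B (Comp (Ch C) (X i) A B g (\<iota> i))"
  shows "homotopy_class C A B f = homotopy_class C A B g"
  unfolding homotopy_class_eq_iff[OF A B f g]
proof (rule null_homotopic_if_components[OF B])
  show "is_chain_map C A B (f \<ominus>\<^bsub>Hom (Ch C) A B\<^esub> g)" using A B f g by simp
  fix i assume i: "i \<in> I"
  note Xi = X[OF i] \<iota>[OF i]
  have m: "is_chain_map C (X i) B (Comp (Ch C) (X i) A B f (\<iota> i))" "is_chain_map C (X i) B (Comp (Ch C) (X i) A B g (\<iota> i))"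
    using A B f g Xi by simp_all
  have "homotopy_class C (X i) B (Comp (Ch C) (X i) A B f (\<iota> i)) = homotopy_class C (X i) B (Comp (Ch C) (X i) A B g (\<iota> i))"
  proof (cases "i \<in> I\<^sub>H")
    case False
    then have "zero_object (Ho C) (X i)" using i unfolding I\<^sub>H_def by blast
    from Ho.zero_object_Mor(2)[OF this, of B] have "homotopy_class C (X i) B k = \<zero>\<^bsub>Hom (Ho C) (X i) B\<^esub>" if "is_chain_map C (X i) B k" for k
      using B Ho_MorI[OF Xi(1) B that] by simp
    then show ?thesis using m by metis
  qed (rule eq)
  then show "Comp (Ch C) (X i) A B (f \<ominus>\<^bsub>Hom (Ch C) A B\<^esub> g) (\<iota> i) \<in> null_homotopic C (X i) B"
    using homotopy_class_eq_iff[OF Xi(1) B m] A B f g Xi by (simp add: Ch.Comp_minus_left)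
qed

lemma Ho_sum: "direct_sum (Ho C) I\<^sub>H X A (\<lambda>i. homotopy_class C (X i) A (\<iota> i)) (\<lambda>i. homotopy_class C A (X i) (\<pi> i))"
proof (rule Ho.direct_sumI)
  have HI: "i \<in> I" if "i \<in> I\<^sub>H" for i using that unfolding I\<^sub>H_def by blast
  show "A \<in> Obj (Ho C)" using A by simp
  fix i assume i: "i \<in> I\<^sub>H"
  note Xi = X[OF HI[OF i]] \<iota>[OF HI[OF i]] \<pi>[OF HI[OF i]]
  show "X i \<in> Obj (Ho C)" using Xi by simp
  show "homotopy_class C (X i) A (\<iota> i) \<in> Mor (Ho C) (X i) A" "homotopy_class C A (X i) (\<pi> i) \<in> Mor (Ho C) A (X i)"
    using A Xi by (auto intro: Ho_MorI)
  fix j assume j: "j \<in> I\<^sub>H"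
  note Xj = X[OF HI[OF j]] \<iota>[OF HI[OF j]] \<pi>[OF HI[OF j]]
  show "Comp (Ho C) (X i) A (X j) (homotopy_class C A (X j) (\<pi> j)) (homotopy_class C (X i) A (\<iota> i))
    = (if i = j then Ident (Ho C) (X i) else \<zero>\<^bsub>Hom (Ho C) (X i) (X j)\<^esub>)"
    unfolding Ho_Comp[OF Xi(1) A Xj(1) Xi(2) Xj(3)] \<pi>\<iota>[OF HI[OF i] HI[OF j]] using Xi Xj by (simp add: Ho_Ident Ho_zero)
next
  have HI: "i \<in> I" if "i \<in> I\<^sub>H" for i using that unfolding I\<^sub>H_def by blast
  fix B assume "B \<in> Obj (Ho C)"
  then have B: "is_chain_complex C B" by simp
  {
    fix G assume G: "\<And>i. i \<in> I\<^sub>H \<Longrightarrow> G i \<in> Mor (Ho C) (X i) B"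
    have "\<exists>g. is_chain_map C (X i) B g \<and> (i \<in> I\<^sub>H \<longrightarrow> G i = homotopy_class C (X i) B g)" if "i \<in> I" for i
    proof (cases "i \<in> I\<^sub>H")
      case True
      show ?thesis by (rule Ho_MorE[OF G[OF True] X[OF that] B]) blast
    next
      case False
      have "is_chain_map C (X i) B \<zero>\<^bsub>Hom (Ch C) (X i) B\<^esub>" using X[OF that] B by simp
      then show ?thesis using False by blast
    qed
    then obtain g where g: "\<And>i. i \<in> I \<Longrightarrow> is_chain_map C (X i) B (g i)"
      "\<And>i. i \<in> I\<^sub>H \<Longrightarrow> G i = homotopy_class C (X i) B (g i)" using HI by metis
    obtain h where h: "is_chain_map C A B h" "\<And>i. i \<in> I \<Longrightarrow> Comp (Ch C) (X i) A B h (\<iota> i) = g i"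
      using Ch.direct_sum_ex1[OF Ch_sum, of B g] B g(1) by (auto simp: Ex1_def)
    show "\<exists>h\<in>Mor (Ho C) A B. \<forall>i\<in>I\<^sub>H. Comp (Ho C) (X i) A B h (homotopy_class C (X i) A (\<iota> i)) = G i"
    proof (intro bexI[of _ "homotopy_class C A B h"] ballI Ho_MorI A B h(1))
      fix i assume i: "i \<in> I\<^sub>H"
      show "Comp (Ho C) (X i) A B (homotopy_class C A B h) (homotopy_class C (X i) A (\<iota> i)) = G i"
        unfolding Ho_Comp[OF X[OF HI[OF i]] A B \<iota>[OF HI[OF i]] h(1)] h(2)[OF HI[OF i]] g(2)[OF i] ..
    qed
  next
    fix H H' assume H: "H \<in> Mor (Ho C) A B" and H': "H' \<in> Mor (Ho C) A B"
      and eq: "\<And>i. i \<in> I\<^sub>H \<Longrightarrow> Comp (Ho C) (X i) A B H (homotopy_class C (X i) A (\<iota> i)) = Comp (Ho C) (X i) A B H' (homotopy_class C (X i) A (\<iota> i))"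
    obtain h where h: "is_chain_map C A B h" "H = homotopy_class C A B h" by (rule Ho_MorE[OF H A B])
    obtain h' where h': "is_chain_map C A B h'" "H' = homotopy_class C A B h'" by (rule Ho_MorE[OF H' A B])
    show "H = H'" unfolding h(2) h'(2)
    proof (rule homotopy_class_eqI[OF B h(1) h'(1)])
      fix i assume i: "i \<in> I\<^sub>H"
      from eq[OF i] show "homotopy_class C (X i) B (Comp (Ch C) (X i) A B h (\<iota> i)) = homotopy_class C (X i) B (Comp (Ch C) (X i) A B h' (\<iota> i))"
        unfolding h(2) h'(2) using X[OF HI[OF i]] \<iota>[OF HI[OF i]] A B h(1) h'(1) by (simp add: Ho_Comp)
    qed
  }
qed

lemma Ho_complement:
  assumes "\<forall>i\<in>I. \<exists>Y j q. biproduct (Ch C) (X i) Y A (\<iota> i) j (\<pi> i) q" and "i \<in> I\<^sub>H"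
  shows "\<exists>Y j q. biproduct (Ho C) (X i) Y A (homotopy_class C (X i) A (\<iota> i)) j (homotopy_class C A (X i) (\<pi> i)) q"
proof -
  obtain Y j q where "biproduct (Ch C) (X i) Y A (\<iota> i) j (\<pi> i) q" using assms unfolding I\<^sub>H_def by blast
  from Ho_biproduct[OF this] show ?thesis by blast
qed

lemma Ho_summand:
  assumes "i \<in> I\<^sub>H"
  shows "is_chain_complex C (X i)" "local_ring (End (Ch C) (X i))" "\<not> zero_object (Ho C) (X i)" "local_ring (End (Ho C) (X i))"
  using assms X loc Ho_local unfolding I\<^sub>H_def by auto

lemma Ho_finite_multiplicities: "Ho.finite_multiplicities I\<^sub>H X"
  unfolding Ho.finite_multiplicities_def
proof (intro ballI impI)
  fix Z assume Z: "Z \<in> Obj (Ho C)"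
  show "finite {i \<in> I\<^sub>H. isomorphic (Ho C) (X i) Z}"
  proof (cases "\<exists>i\<in>I\<^sub>H. isomorphic (Ho C) (X i) Z")
    case True
    then obtain k where k: "k \<in> I\<^sub>H" "isomorphic (Ho C) (X k) Z" by blast
    note Xk = Ho_summand[OF k(1)]
    have "isomorphic (Ch C) (X i) (X k)" if i: "i \<in> I\<^sub>H" "isomorphic (Ho C) (X i) Z" for i
    proof -
      note Xi = Ho_summand[OF i(1)]
      have "isomorphic (Ho C) (X i) (X k)"
        using Ho.isomorphic_trans[OF _ Z _ i(2) Ho.isomorphic_sym[OF k(2)]] Xi Xk by simp
      then obtain F G where F: "F \<in> Mor (Ho C) (X i) (X k)" and G: "G \<in> Mor (Ho C) (X k) (X i)"
        and GF: "Comp (Ho C) (X i) (X k) (X i) G F = Ident (Ho C) (X i)"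
        unfolding isomorphic_def by (metis Ho.invertibleE)
      obtain f where f: "is_chain_map C (X i) (X k) f" "F = homotopy_class C (X i) (X k) f" by (rule Ho_MorE[OF F Xi(1) Xk(1)])
      obtain g where g: "is_chain_map C (X k) (X i) g" "G = homotopy_class C (X k) (X i) g" by (rule Ho_MorE[OF G Xk(1) Xi(1)])
      have gf: "is_chain_map C (X i) (X i) (Comp (Ch C) (X i) (X k) (X i) g f)" using Xi Xk f g by simp
      have "invertible (Ho C) (X i) (X i) (homotopy_class C (X i) (X i) (Comp (Ch C) (X i) (X k) (X i) g f))"
        using GF Xi Xk f g Ho.invertible_Ident[of "X i"] by (simp add: Ho_Comp)
      then have "invertible (Ch C) (X i) (X i) (Comp (Ch C) (X i) (X k) (X i) g f)"
        using Ho_invertible_local_iff[OF Xi(1-3) gf] by simp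
      then have "invertible (Ch C) (X i) (X k) f"
        using Ch.retract_of_local_unit(1)[of "X k" "X i" f g] Ch.local_End_nonzero[OF _ Xi(2)] Xi Xk f g by simp
      then show ?thesis unfolding isomorphic_def by blast
    qed
    then have "{i \<in> I\<^sub>H. isomorphic (Ho C) (X i) Z} \<subseteq> {i \<in> I. isomorphic (Ch C) (X i) (X k)}"
      unfolding I\<^sub>H_def by blast
    then show ?thesis
      using Ch_finite_multiplicities Xk unfolding Ch.finite_multiplicities_def by (meson Ch_Obj finite_subset)
  next
    case False
    then have "{i \<in> I\<^sub>H. isomorphic (Ho C) (X i) Z} = {}" by blast
    then show ?thesis by (simp only: finite.emptyI)
  qed
qed

end

context complete_locally_finite
begin

lemma Ho_local_representative:
  assumes Z: "is_chain_complex C Z" and loc: "local_ring (End (Ho C) Z)"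
  obtains W \<kappa> \<rho> where "is_chain_complex C W" "local_ring (End (Ch C) W)" "\<not> zero_object (Ho C) W"
    "is_chain_map C W Z \<kappa>" "is_chain_map C Z W \<rho>" "Comp (Ch C) W Z W \<rho> \<kappa> = Ident (Ch C) W"
    "invertible (Ho C) W Z (homotopy_class C W Z \<kappa>)" "invertible (Ho C) Z W (homotopy_class C Z W \<rho>)"
proof -
  obtain J :: "nat set" and W \<kappa> \<rho> F where s: "locally_finite_sum S \<mm> C J W Z \<kappa> \<rho> F"
    using locally_finite_sum_ex[OF Z] by (elim exE conjE) (rule that)
  interpret s: locally_finite_sum S \<mm> C J W Z \<kappa> \<rho> F by (rule s)
  have ZO: "Z \<in> Obj (Ho C)" using Z by simp
  have "s.I\<^sub>H \<noteq> {}"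
  proof
    assume "s.I\<^sub>H = {}"
    then have "Ident (Ho C) Z = \<zero>\<^bsub>Hom (Ho C) Z Z\<^esub>"
      by (intro Ho.direct_sum_eqI[OF s.Ho_sum ZO Ho.Ident_closed[OF ZO] Ho.Hom_zero[OF ZO ZO]]) simp
    then show False using Ho.local_End_nonzero[OF ZO loc] by simp
  qed
  then obtain j where j: "j \<in> s.I\<^sub>H" by blast
  then have jJ: "j \<in> J" unfolding s.I\<^sub>H_def by blast
  note Wj = s.Ho_summand[OF j] and \<kappa> = s.\<iota>[OF jJ] and \<rho> = s.\<pi>[OF jJ]
  have WO: "W j \<in> Obj (Ho C)" and nz: "Ident (Ho C) (W j) \<noteq> \<zero>\<^bsub>Hom (Ho C) (W j) (W j)\<^esub>"
    using Wj(1,3) by (simp_all add: Ho_zero_object)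
  have \<rho>\<kappa>: "Comp (Ch C) (W j) Z (W j) (\<rho> j) (\<kappa> j) = Ident (Ch C) (W j)" using s.\<pi>\<iota>[OF jJ jJ] by simp
  have Ho_\<rho>\<kappa>: "Comp (Ho C) (W j) Z (W j) (homotopy_class C Z (W j) (\<rho> j)) (homotopy_class C (W j) Z (\<kappa> j)) = Ident (Ho C) (W j)"
    using Wj(1) Z \<kappa> \<rho> \<rho>\<kappa> by (simp add: Ho_Comp Ho_Ident)
  note retract = Ho.retract_of_local[OF ZO loc WO nz Ho_MorI[OF Wj(1) Z \<kappa>] Ho_MorI[OF Z Wj(1) \<rho>] Ho_\<rho>\<kappa>]
  show ?thesis by (rule that[OF Wj(1-3) \<kappa> \<rho> \<rho>\<kappa> retract])
qed

end

context locally_finite_sum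
begin

lemma Ho_detecting: "Ho.detecting I\<^sub>H X A (\<lambda>i. homotopy_class C (X i) A (\<iota> i)) (\<lambda>i. homotopy_class C A (X i) (\<pi> i))"
  unfolding Ho.detecting_def
proof (intro ballI impI)
  fix Z a' b' assume ZO: "Z \<in> Obj (Ho C)" and lZ: "local_ring (End (Ho C) Z)" and a': "a' \<in> Mor (Ho C) Z A" and b': "b' \<in> Mor (Ho C) A Z"
    and ba: "Comp (Ho C) Z A Z b' a' = Ident (Ho C) Z"
  have Z: "is_chain_complex C Z" and AO: "A \<in> Obj (Ho C)" using ZO A by simp_all
  obtain a where a: "is_chain_map C Z A a" "a' = homotopy_class C Z A a" by (rule Ho_MorE[OF a' Z A])
  obtain b where b: "is_chain_map C A Z b" "b' = homotopy_class C A Z b" by (rule Ho_MorE[OF b' A Z])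
  obtain W \<kappa> \<rho> where W: "is_chain_complex C W" "local_ring (End (Ch C) W)" "\<not> zero_object (Ho C) W"
    and \<kappa>: "is_chain_map C W Z \<kappa>" "invertible (Ho C) W Z (homotopy_class C W Z \<kappa>)"
    and \<rho>: "is_chain_map C Z W \<rho>" "invertible (Ho C) Z W (homotopy_class C Z W \<rho>)"
    and \<rho>\<kappa>: "Comp (Ch C) W Z W \<rho> \<kappa> = Ident (Ch C) W" by (rule Ho_local_representative[OF Z lZ])
  note q = Ho_MorI Ho_Comp
  let ?a = "Comp (Ch C) W Z A a \<kappa>" and ?b = "Comp (Ch C) A Z W \<rho> b"
  let ?u = "Comp (Ch C) W A W ?b ?a"
  have m: "is_chain_map C W A ?a" "is_chain_map C A W ?b" "is_chain_map C W W ?u" using W Z A a b \<kappa> \<rho> by simp_all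
  have "homotopy_class C W W ?u
      = Comp (Ho C) W Z W (homotopy_class C Z W \<rho>) (Comp (Ho C) W Z Z (Comp (Ho C) Z A Z b' a') (homotopy_class C W Z \<kappa>))"
    using W Z A a b \<kappa> \<rho> by (simp add: Ho_Comp Ch.Comp_assoc)
  also have "\<dots> = Ident (Ho C) W"
    unfolding ba using W Z \<kappa> \<rho> \<rho>\<kappa> by (simp add: q Ho_Ident)
  finally have "invertible (Ho C) W W (homotopy_class C W W ?u)" using Ho.invertible_Ident[of W] W by simp
  then have "invertible (Ch C) W W ?u" using Ho_invertible_local_iff[OF W m(3)] by simp
  then obtain v where v: "v \<in> Mor (Ch C) W W" "Comp (Ch C) W W W ?u v = Ident (Ch C) W" "invertible (Ch C) W W v"
    by (metis Ch.invertibleE)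
  have WO: "W \<in> Obj (Ch C)" and vm: "is_chain_map C W W v" using W v by simp_all
  have av: "Comp (Ch C) W W A ?a v \<in> Mor (Ch C) W A" "?b \<in> Mor (Ch C) A W" using m A W vm by simp_all
  have "Comp (Ch C) W A W ?b (Comp (Ch C) W W A ?a v) = Ident (Ch C) W"
    using v(2) m A W vm by (simp add: Ch.Comp_assoc[of W W A W])
  then obtain i where i: "i \<in> I" and inv: "invertible (Ch C) W W (Comp (Ch C) W (X i) W
      (Comp (Ch C) (X i) A W ?b (\<iota> i)) (Comp (Ch C) W A (X i) (\<pi> i) (Comp (Ch C) W W A ?a v)))"
    by (rule Ch.detectingD[OF Ch_detecting WO W(2) av])
  note Xi = X[OF i] \<iota>[OF i] \<pi>[OF i]
  let ?t = "Comp (Ch C) Z (X i) Z (Comp (Ch C) (X i) A Z b (\<iota> i)) (Comp (Ch C) Z A (X i) (\<pi> i) a)"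
  let ?T = "homotopy_class C Z Z ?t"
  have tm: "is_chain_map C Z Z ?t" using Z A a b Xi by simp
  have "Comp (Ch C) W (X i) W (Comp (Ch C) (X i) A W ?b (\<iota> i)) (Comp (Ch C) W A (X i) (\<pi> i) (Comp (Ch C) W W A ?a v))
      = Comp (Ch C) W Z W \<rho> (Comp (Ch C) W Z Z ?t (Comp (Ch C) W W Z \<kappa> v))"
    using W Z A a b \<kappa> \<rho> Xi vm by (simp add: Ch.Comp_assoc)
  then have "invertible (Ho C) W W (homotopy_class C W W (Comp (Ch C) W Z W \<rho> (Comp (Ch C) W Z Z ?t (Comp (Ch C) W W Z \<kappa> v))))"
    using Ho_invertible[OF W(1) W(1) inv] by simp
  then have 1: "invertible (Ho C) W W (Comp (Ho C) W Z W (homotopy_class C Z W \<rho>)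
      (Comp (Ho C) W Z Z ?T (Comp (Ho C) W W Z (homotopy_class C W Z \<kappa>) (homotopy_class C W W v))))"
    using W Z \<kappa> \<rho> vm tm by (simp add: Ho_Comp del: is_chain_map_simps(3)) (simp add: Ho_Comp)
  have WH: "W \<in> Obj (Ho C)" using W by simp
  have T: "?T \<in> Mor (Ho C) Z Z" by (rule Ho_MorI[OF Z Z tm])
  have kv: "invertible (Ho C) W Z (Comp (Ho C) W W Z (homotopy_class C W Z \<kappa>) (homotopy_class C W W v))"
    by (rule Ho.invertible_Comp[OF WH WH ZO \<kappa>(2) Ho_invertible[OF W(1) W(1) v(3)]])
  have kv': "Comp (Ho C) W W Z (homotopy_class C W Z \<kappa>) (homotopy_class C W W v) \<in> Mor (Ho C) W Z" using kv unfolding invertible_def by blast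
  have "invertible (Ho C) W Z (Comp (Ho C) W Z Z ?T (Comp (Ho C) W W Z (homotopy_class C W Z \<kappa>) (homotopy_class C W W v)))"
    by (rule Ho.invertible_cancel_left[OF WH ZO WH Ho.Comp_closed[OF WH ZO ZO T kv'] \<rho>(2) 1])
  then have 2: "invertible (Ho C) Z Z ?T" by (rule Ho.invertible_cancel_right[OF WH ZO ZO T kv])
  have eq: "?T = Comp (Ho C) Z (X i) Z (Comp (Ho C) (X i) A Z b' (homotopy_class C (X i) A (\<iota> i))) (Comp (Ho C) Z A (X i) (homotopy_class C A (X i) (\<pi> i)) a')"
    using Z A a b Xi by (simp add: Ho_Comp)
  have "\<not> zero_object (Ho C) (X i)"
  proof
    assume z: "zero_object (Ho C) (X i)"
    have "Comp (Ho C) Z A (X i) (homotopy_class C A (X i) (\<pi> i)) a' = \<zero>\<^bsub>Hom (Ho C) Z (X i)\<^esub>"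
      by (rule Ho.zero_object_Mor(1)[OF z ZO]) (use Z A a' Xi in \<open>simp add: Ho_MorI\<close>)
    then have "?T = \<zero>\<^bsub>Hom (Ho C) Z Z\<^esub>" unfolding eq using Z A b' Xi by (simp add: Ho_MorI)
    then show False using 2 Ho.local_End_nonzero[OF ZO lZ] ZO unfolding invertible_def by auto
  qed
  then have "i \<in> I\<^sub>H" using i unfolding I\<^sub>H_def by blast
  then show "\<exists>i\<in>I\<^sub>H. invertible (Ho C) Z Z (Comp (Ho C) Z (X i) Z (Comp (Ho C) (X i) A Z b' (homotopy_class C (X i) A (\<iota> i)))
      (Comp (Ho C) Z A (X i) (homotopy_class C A (X i) (\<pi> i)) a'))"
    using 2 unfolding eq by blast
qed

end

context complete_locally_finite
begin

sublocale Ho: detecting_category S "Ho C"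
proof
  fix A assume "A \<in> Obj (Ho C)"
  then have A: "is_chain_complex C A" by simp
  obtain I :: "nat set" and X \<iota> \<pi> F where s: "locally_finite_sum S \<mm> C I X A \<iota> \<pi> F"
    and compl: "\<forall>i\<in>I. \<exists>Y j q. biproduct (Ch C) (X i) Y A (\<iota> i) j (\<pi> i) q"
    using locally_finite_sum_ex[OF A] by (elim exE conjE) (rule that)
  interpret s: locally_finite_sum S \<mm> C I X A \<iota> \<pi> F by (rule s)
  show "\<exists>(I::nat set) X \<iota> \<pi>. direct_sum (Ho C) I X A \<iota> \<pi> \<and>
    (\<forall>i\<in>I. local_ring (End (Ho C) (X i))) \<and> Ho.detecting I X A \<iota> \<pi> \<and> Ho.finite_multiplicities I X \<and>
    (\<forall>i\<in>I. \<exists>Y j q. biproduct (Ho C) (X i) Y A (\<iota> i) j (\<pi> i) q)"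
    by (intro exI[of _ s.I\<^sub>H] exI[of _ X] exI[of _ "\<lambda>i. homotopy_class C (X i) A (\<iota> i)"] exI[of _ "\<lambda>i. homotopy_class C A (X i) (\<pi> i)"]
        conjI ballI s.Ho_summand(4) s.Ho_sum s.Ho_detecting s.Ho_finite_multiplicities s.Ho_complement[OF compl])
qed

lemma Ho_radical_iff:
  assumes A: "is_chain_complex C A" and B: "is_chain_complex C B" and F: "F \<in> Mor (Ho C) A B"
  shows "F \<in> radical (Ho C) A B \<longleftrightarrow> (\<exists>f. is_chain_map C A B f \<and> F = homotopy_class C A B f \<and>
    (\<forall>g n. is_chain_map C B A g \<longrightarrow> nilp (ob B n) (Comp C (ob B n) (ob A n) (ob B n) (f n) (g n))))"
proof -
  have AH: "A \<in> Obj (Ho C)" and BH: "B \<in> Obj (Ho C)" using A B by simp_all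
  note rad = Ho.radical_iff[OF AH BH F]
  show ?thesis
  proof
    assume "\<exists>f. is_chain_map C A B f \<and> F = homotopy_class C A B f \<and>
      (\<forall>g n. is_chain_map C B A g \<longrightarrow> nilp (ob B n) (Comp C (ob B n) (ob A n) (ob B n) (f n) (g n)))"
    then obtain f where f: "is_chain_map C A B f" "F = homotopy_class C A B f"
      and nil: "\<And>g n. is_chain_map C B A g \<Longrightarrow> nilp (ob B n) (Comp C (ob B n) (ob A n) (ob B n) (f n) (g n))" by blast
    have "Ident (Ho C) Z = \<zero>\<^bsub>Hom (Ho C) Z Z\<^esub>"
      if Z: "Z \<in> Obj (Ho C)" and a': "a' \<in> Mor (Ho C) Z A" and b': "b' \<in> Mor (Ho C) B Z"
        and bfa: "Comp (Ho C) Z B Z b' (Comp (Ho C) Z A B F a') = Ident (Ho C) Z" for Z a' b'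
    proof (rule Ho.no_factor_if_invertible[OF AH BH Z F a' b' bfa])
      have ZC: "is_chain_complex C Z" using Z by simp
      obtain a where a: "is_chain_map C Z A a" "a' = homotopy_class C Z A a" by (rule Ho_MorE[OF a' ZC A])
      obtain b where b: "is_chain_map C B Z b" "b' = homotopy_class C B Z b" by (rule Ho_MorE[OF b' B ZC])
      have "is_chain_map C B A (Comp (Ch C) B Z A a b)" using A B ZC a b by simp
      then have "invertible (Ch C) B B (Ident (Ch C) B \<ominus>\<^bsub>Hom (Ch C) B B\<^esub> Comp (Ch C) B A B f (Comp (Ch C) B Z A a b))"
        using nilp_no_factor[OF A B f(1)] nil by blast
      from Ho_invertible[OF B B this]
      show "invertible (Ho C) B B (Ident (Ho C) B \<ominus>\<^bsub>Hom (Ho C) B B\<^esub> Comp (Ho C) B A B F (Comp (Ho C) B Z A a' b'))"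
        using A B ZC f a b by (simp add: Ho_Comp Ho_Ident Ho_minus)
    qed
    then show "F \<in> radical (Ho C) A B" unfolding rad using Ho.local_End_nonzero by blast
  next
    assume "F \<in> radical (Ho C) A B"
    then have no: "\<not> (\<exists>Z\<in>Obj (Ho C). local_ring (End (Ho C) Z) \<and> (\<exists>a\<in>Mor (Ho C) Z A. \<exists>b\<in>Mor (Ho C) B Z.
      Comp (Ho C) Z B Z b (Comp (Ho C) Z A B F a) = Ident (Ho C) Z))" unfolding rad .
    obtain f where f: "is_chain_map C A B f" "F = homotopy_class C A B f" by (rule Ho_MorE[OF F A B])
    obtain I :: "nat set" and X \<iota> \<pi> E where s: "locally_finite_sum S \<mm> C I X A \<iota> \<pi> E"
      using locally_finite_sum_ex[OF A] by (elim exE conjE) (rule that)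
    interpret s: locally_finite_sum S \<mm> C I X A \<iota> \<pi> E by (rule s)
    \<comment> \<open>a representative of \<open>F\<close> that vanishes on the contractible summands of \<open>A\<close>\<close>
    let ?k = "\<lambda>i. if i \<in> s.I\<^sub>H then Comp (Ch C) (X i) A B f (\<iota> i) else \<zero>\<^bsub>Hom (Ch C) (X i) B\<^esub>"
    have BO: "B \<in> Obj (Ch C)" and "\<forall>i\<in>I. ?k i \<in> Mor (Ch C) (X i) B" using A B f s.X s.\<iota> by simp_all
    from ex1_implies_ex[OF Ch.direct_sum_ex1[OF s.Ch_sum this]] obtain k
      where "k \<in> Mor (Ch C) A B \<and> (\<forall>i\<in>I. Comp (Ch C) (X i) A B k (\<iota> i) = ?k i)" ..
    then have k: "is_chain_map C A B k" "\<And>i. i \<in> I \<Longrightarrow> Comp (Ch C) (X i) A B k (\<iota> i) = ?k i" by simp_all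
    have Fk: "F = homotopy_class C A B k"
      unfolding f(2) by (rule s.homotopy_class_eqI[OF B f(1) k(1)]) (use k(2) in \<open>simp add: s.I\<^sub>H_def\<close>)
    have "nilp (ob B n) (Comp C (ob B n) (ob A n) (ob B n) (k n) (g n))" if g: "is_chain_map C B A g" for g n
    proof (rule ccontr)
      assume "\<not> nilp (ob B n) (Comp C (ob B n) (ob A n) (ob B n) (k n) (g n))"
      then obtain Z a b where Z: "is_chain_complex C Z" "local_ring (End (Ch C) Z)" and a: "is_chain_map C Z A a"
        and b: "is_chain_map C B Z b" and bka: "Comp (Ch C) Z B Z b (Comp (Ch C) Z A B k a) = Ident (Ch C) Z"
        by (rule not_nilp_factor[OF A B k(1) g])
      let ?b = "Comp (Ch C) A B Z b k"
      have ZO: "Z \<in> Obj (Ch C)" "a \<in> Mor (Ch C) Z A" "?b \<in> Mor (Ch C) A Z" using A B Z a b k by simp_all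
      note nz = Ch.local_End_nonzero[OF ZO(1) Z(2)]
      have "Comp (Ch C) Z A Z ?b a = Ident (Ch C) Z" using bka A B Z a b k by (simp add: Ch.Comp_assoc)
      then obtain i where i: "i \<in> I" and inv: "invertible (Ch C) Z Z
          (Comp (Ch C) Z (X i) Z (Comp (Ch C) (X i) A Z ?b (\<iota> i)) (Comp (Ch C) Z A (X i) (\<pi> i) a))"
        by (rule Ch.detectingD[OF s.Ch_detecting ZO(1) Z(2) ZO(2,3)])
      note Xi = s.X[OF i] s.\<iota>[OF i] s.\<pi>[OF i]
      have pa: "is_chain_map C Z (X i) (Comp (Ch C) Z A (X i) (\<pi> i) a)" using A Z a Xi by simp
      have iH: "i \<in> s.I\<^sub>H"
      proof (rule ccontr)
        assume "i \<notin> s.I\<^sub>H"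
        then have "Comp (Ch C) (X i) A B k (\<iota> i) = \<zero>\<^bsub>Hom (Ch C) (X i) B\<^esub>" using k(2)[OF i] by simp
        then have "Comp (Ch C) (X i) A Z ?b (\<iota> i) = \<zero>\<^bsub>Hom (Ch C) (X i) Z\<^esub>"
          using A B Z b k(1) Xi by (simp add: Ch.Comp_assoc)
        then show False using inv nz Z Xi pa unfolding invertible_def by auto
      qed
      have "invertible (Ch C) Z (X i) (Comp (Ch C) Z A (X i) (\<pi> i) a)"
        by (rule Ch.retract_of_local_unit(1)[OF _ s.loc[OF i] ZO(1) nz _ _ inv]) (use A B Z a b k(1) Xi in simp_all)
      then obtain c where c: "is_chain_map C (X i) Z c" "Comp (Ch C) (X i) Z (X i) (Comp (Ch C) Z A (X i) (\<pi> i) a) c = Ident (Ch C) (X i)"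
        unfolding invertible_def by auto
      have "\<not> zero_object (Ho C) Z"
      proof
        assume z: "zero_object (Ho C) Z"
        have "homotopy_class C (X i) Z c = \<zero>\<^bsub>Hom (Ho C) (X i) Z\<^esub>"
          by (rule Ho.zero_object_Mor(1)[OF z]) (use Ho_MorI[OF Xi(1) Z(1) c(1)] Xi in simp_all)
        then have "Ident (Ho C) (X i) = \<zero>\<^bsub>Hom (Ho C) (X i) (X i)\<^esub>"
          unfolding Ho_Ident c(2)[symmetric] Ho_Comp[OF Xi(1) Z(1) Xi(1) c(1) pa, symmetric]
          using Ho.Comp_zero_right[of "X i" Z "X i"] Ho_MorI[OF Z(1) Xi(1) pa] Xi Z by simp
        then show False using s.Ho_summand(1,3)[OF iH] by (simp add: Ho_zero_object)
      qed
      then have "local_ring (End (Ho C) Z)" by (rule Ho_local[OF Z])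
      moreover have "Comp (Ho C) Z B Z (homotopy_class C B Z b) (Comp (Ho C) Z A B F (homotopy_class C Z A a)) = Ident (Ho C) Z"
        unfolding Fk using A B Z a b k(1) bka by (simp add: Ho_Comp Ho_Ident)
      ultimately show False using no Ho_MorI[OF Z(1) A a] Ho_MorI[OF B Z(1) b] Z by (metis Ho_Obj)
    qed
    then show "\<exists>f. is_chain_map C A B f \<and> F = homotopy_class C A B f \<and>
      (\<forall>g n. is_chain_map C B A g \<longrightarrow> nilp (ob B n) (Comp C (ob B n) (ob A n) (ob B n) (f n) (g n)))"
      using Fk k(1) by blast
  qed
qed

end

theorem propositionA2:
  fixes S :: "('a, 'c) ring_scheme"
    and \<mm> :: "'a set"
    and C :: "('o, 'a, 'm) linear_category"
  assumes "complete_local_cring S \<mm>"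
    and "noetherian_ring S"
    and "locally_finite_category S C"
  shows "omega_local_category S (Ch C) \<and> omega_local_category S (Ho C) \<and>
    krull_schmidt TYPE('i) (Ch C) \<and> krull_schmidt TYPE('i) (Ho C) \<and>
    (\<forall>A\<in>Obj (Ch C). \<forall>B\<in>Obj (Ch C). \<forall>f\<in>Mor (Ch C) A B.
      (f \<in> radical (Ch C) A B \<longleftrightarrow>
        (\<forall>g\<in>Mor (Ch C) B A. \<forall>n.
          nilpotent_mod S \<mm> C (ob B n) (Comp C (ob B n) (ob A n) (ob B n) (f n) (g n)))) \<and>
      (f \<in> radical (Ch C) A B \<longleftrightarrow>
        (\<forall>g\<in>Mor (Ch C) B A. \<forall>n.
          nilpotent_mod S \<mm> C (ob A n) (Comp C (ob A n) (ob B n) (ob A n) (g n) (f n))))) \<and>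
    (\<forall>A\<in>Obj (Ho C). \<forall>B\<in>Obj (Ho C). \<forall>F\<in>Mor (Ho C) A B.
      (F \<in> radical (Ho C) A B \<longleftrightarrow>
        (\<exists>f\<in>F. \<forall>G\<in>Mor (Ho C) B A. \<forall>g\<in>G. \<forall>n.
          nilpotent_mod S \<mm> C (ob B n) (Comp C (ob B n) (ob A n) (ob B n) (f n) (g n)))) \<and>
      (F \<in> radical (Ho C) A B \<longleftrightarrow>
        (\<exists>f\<in>F. \<forall>G\<in>Mor (Ho C) B A. \<forall>g\<in>G. \<forall>n.
          nilpotent_mod S \<mm> C (ob A n) (Comp C (ob A n) (ob B n) (ob A n) (g n) (f n)))))"
proof -
  interpret S: complete_local_cring S \<mm> by fact
  interpret complete_locally_finite S \<mm> C
    by (intro complete_locally_finite.intro complete_noetherian.intro assms)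
  have omega: "omega_local_category S (Ch C)" "omega_local_category S (Ho C)"
    using Ch.detecting_decomposition Ho.detecting_decomposition
    by (intro omega_local_category.intro omega_local_category_axioms.intro Ch.additive_category_axioms Ho.additive_category_axioms; meson)+
  have swap: "nilpotent_mod S \<mm> C (ob B n) (Comp C (ob B n) (ob A n) (ob B n) (f n) (g n)) \<longleftrightarrow>
      nilpotent_mod S \<mm> C (ob A n) (Comp C (ob A n) (ob B n) (ob A n) (g n) (f n))"
    if "is_chain_complex C A" "is_chain_complex C B" "is_chain_map C A B f" "is_chain_map C B A g" for A B f g n
    using nilp_swap[of "ob A n" "ob B n" "f n" "g n"] nilp_swap[of "ob B n" "ob A n" "g n" "f n"] that
    by (auto simp: chain_complexD(1) chain_mapD(1))
  have Ch: "(f \<in> radical (Ch C) A B \<longleftrightarrow> (\<forall>g\<in>Mor (Ch C) B A. \<forall>n.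
        nilpotent_mod S \<mm> C (ob B n) (Comp C (ob B n) (ob A n) (ob B n) (f n) (g n)))) \<and>
      (f \<in> radical (Ch C) A B \<longleftrightarrow> (\<forall>g\<in>Mor (Ch C) B A. \<forall>n.
        nilpotent_mod S \<mm> C (ob A n) (Comp C (ob A n) (ob B n) (ob A n) (g n) (f n))))"
    if "A \<in> Obj (Ch C)" "B \<in> Obj (Ch C)" "f \<in> Mor (Ch C) A B" for A B f
    using Ch_radical_iff[of A B f] swap[of A B f] that by (simp add: Ball_def)
  have Ho: "(F \<in> radical (Ho C) A B \<longleftrightarrow> (\<exists>f\<in>F. \<forall>G\<in>Mor (Ho C) B A. \<forall>g\<in>G. \<forall>n.
        nilpotent_mod S \<mm> C (ob B n) (Comp C (ob B n) (ob A n) (ob B n) (f n) (g n)))) \<and>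
      (F \<in> radical (Ho C) A B \<longleftrightarrow> (\<exists>f\<in>F. \<forall>G\<in>Mor (Ho C) B A. \<forall>g\<in>G. \<forall>n.
        nilpotent_mod S \<mm> C (ob A n) (Comp C (ob A n) (ob B n) (ob A n) (g n) (f n))))"
    if "A \<in> Obj (Ho C)" "B \<in> Obj (Ho C)" and F: "F \<in> Mor (Ho C) A B" for A B F
  proof -
    have A: "is_chain_complex C A" and B: "is_chain_complex C B" using that by simp_all
    interpret AB: hom_classes S C A B by (rule hom_classes[OF A B])
    interpret BA: hom_classes S C B A by (rule hom_classes[OF B A])
    have rep: "f \<in> F \<longleftrightarrow> is_chain_map C A B f \<and> F = AB.cls f" for f
      using F AB.cls_mem[of f] AB.cls_self[of f] unfolding AB.Ho_carrier by auto
    have all: "(\<forall>G\<in>Mor (Ho C) B A. \<forall>g\<in>G. P g) \<longleftrightarrow> (\<forall>g. is_chain_map C B A g \<longrightarrow> P g)" for P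
    proof (intro iffI ballI allI impI)
      fix g assume P: "\<forall>G\<in>Mor (Ho C) B A. \<forall>g\<in>G. P g" and g: "is_chain_map C B A g"
      show "P g" by (rule bspec[OF bspec[OF P Ho_MorI[OF B A g]] BA.cls_self[OF g]])
    next
      fix G g assume P: "\<forall>g. is_chain_map C B A g \<longrightarrow> P g" and G: "G \<in> Mor (Ho C) B A" and g: "g \<in> G"
      obtain g' where "is_chain_map C B A g'" "G = BA.cls g'" by (rule Ho_MorE[OF G B A])
      then have "is_chain_map C B A g" using BA.cls_mem[of g g'] g by simp
      then show "P g" using P by simp
    qed
    show ?thesis
      unfolding all Ho_radical_iff[OF A B F] Bex_def rep using swap[OF A B] by (intro conjI) (metis (no_types, lifting))+
  qed
  show ?thesis
    by (intro conjI ballI omega Ch.krull_schmidt Ho.krull_schmidt Ch[THEN conjunct1] Ch[THEN conjunct2] Ho[THEN conjunct1] Ho[THEN conjunct2])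
qed

end
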